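(* Let $U\subseteq R_{2,1}$ be a basepoint free four-dimensional subspace. Then the (reduced) codimension one singular locus of $X_U$ is as follows, according to the numerical type of $I_U$: (Type 1) a twisted cubic curve; (Type 2) the union $C\cup L_1$ of a smooth plane conic $C$ and a line $L_1$; (Type 3) a line $L_1$; (Type 4) a line $L_1$; (Type 5a) a union of three lines $L_1\cup L_2\cup L_3$; (Type 5b) a union of two lines $L_1\cup L_2$; (Type 6) empty.
   Context: $k$ is an algebraically closed field and $R=k[s,t,u,v]$ is bigraded with $s,t$ of degree $(1,0)$ and $u,v$ of degree $(0,1)$; $R_{m,n}$ is the graded piece of bidegree $(m,n)$. $U=\mathrm{Span}\{p_0,p_1,p_2,p_3\}\subseteq R_{2,1}=H^0(\mathcal{O}_{\mathbb{P}^1\times\mathbb{P}^1}(2,1))$ is a four-dimensional subspace and $I_U=\langle p_0,p_1,p_2,p_3\rangle\subset R$. $U$ is basepoint free if the $p_i$ have no common zero on $\mathbb{P}^1\times\mathbb{P}^1$, i.e. $\sqrt{I_U}=\langle s,t\rangle\cap\langle u,v\rangle$. In that case $\phi_U=(p_0:p_1:p_2:p_3):\mathbb{P}^1\times\mathbb{P}^1\to\mathbb{P}^3$ is a regular map, and $X_U=\phi_U(\mathbb{P}^1\times\mathbb{P}^1)\subseteq\mathbb{P}^3$ is its image surface (with reduced structure). The (reduced) codimension one singular locus of $X_U$ is the union of the one-dimensional irreducible components of the singular locus of $X_U$, taken with reduced structure. Numerical types: $I_U$ is of (numerical) Type $n$ if its bigraded minimal free resolution has the form $0\leftarrow I_U\leftarrow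 F_1\leftarrow F_2\leftarrow F_3\leftarrow F_4\leftarrow 0$ with $F_1=R(-2,-1)^4$ and: Type 1: $F_2=R(-2,-4)\oplus R(-3,-2)^4\oplus R(-4,-1)^2$, $F_3=R(-3,-4)^2\oplus R(-4,-2)^3$, $F_4=R(-4,-4)$. Type 2: $F_2=R(-2,-3)\oplus R(-3,-2)^4\oplus R(-4,-1)^2$, $F_3=R(-3,-3)^2\oplus R(-4,-2)^3$, $F_4=R(-4,-3)$. Type 3: $F_2=R(-2,-4)\oplus R(-3,-1)\oplus R(-3,-2)^2\oplus R(-3,-3)\oplus R(-4,-2)\oplus R(-5,-1)$, $F_3=R(-3,-4)^2\oplus R(-4,-3)^2\oplus R(-5,-2)^2$, $F_4=R(-4,-4)\oplus R(-5,-3)$. Type 4: $F_2=R(-2,-3)\oplus R(-3,-1)\oplus R(-3,-2)^2\oplus R(-4,-2)\oplus R(-5,-1)$, $F_3=R(-3,-3)\oplus R(-4,-3)\oplus R(-5,-2)^2$, $F_4=R(-5,-3)$. Type 5: $F_2=R(-2,-2)\oplus R(-3,-2)^2\oplus R(-4,-1)^2$, $F_3=R(-4,-2)^2$, $F_4=0$. Type 5 splits into Type 5a, where $I_U$ has exactly two embedded primes, and Type 5b, where $I_U$ has exactly one embedded prime (these embedded primes have the form $\langle s,t,l\rangle$ with $l\in R_{0,1}$). Type 6: $F_2=R(-2,-2)^2\oplus R(-4,-1)^2$, $F_3=R(-4,-2)$, $F_4=0$. *)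

theory Defs
  imports
    "HOL-Analysis.Analysis"
    "HOL-Computational_Algebra.Polynomial"
    "HOL-Library.Poly_Mapping"
    "HOL-Library.Product_Plus"
begin

section \<open>Multivariate polynomials\<close>

type_synonym ('v, 'k) mpoly = "('v \<Rightarrow>\<^sub>0 nat) \<Rightarrow>\<^sub>0 'k"

definition scale_mpoly :: "'k::field \<Rightarrow> ('v, 'k) mpoly \<Rightarrow> ('v, 'k) mpoly" where
  "scale_mpoly c f = Poly_Mapping.single 0 c * f"

global_interpretation mp: vector_space "scale_mpoly :: 'k::field \<Rightarrow> ('v, 'k) mpoly \<Rightarrow> _"
proof
  fix a b :: 'k and f g :: "('v, 'k) mpoly"
  show "scale_mpoly a (f + g) = scale_mpoly a f + scale_mpoly a g"
    by (simp add: scale_mpoly_def algebra_simps)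
  show "scale_mpoly (a + b) f = scale_mpoly a f + scale_mpoly b f"
    by (simp add: scale_mpoly_def single_add algebra_simps)
  show "scale_mpoly a (scale_mpoly b f) = scale_mpoly (a * b) f"
    by (simp add: scale_mpoly_def mult.assoc[symmetric] mult_single)
  show "scale_mpoly 1 f = f"
    by (simp add: scale_mpoly_def)
qed

text \<open>
  A commutative ring as a module over itself: \<open>ideal.subspace\<close> are the ideals and
  \<open>ideal.span S\<close> is the ideal generated by \<open>S\<close>.
\<close>

global_interpretation ideal: module "(*) :: 'r::comm_ring_1 \<Rightarrow> 'r \<Rightarrow> 'r"
  by standard (simp_all add: algebra_simps)

definition eval_mpoly :: "('v \<Rightarrow> 'k::field) \<Rightarrow> ('v, 'k) mpoly \<Rightarrow> 'k" where
  "eval_mpoly x f =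
     (\<Sum>m\<in>Poly_Mapping.keys f. Poly_Mapping.lookup f m *
        (\<Prod>v\<in>Poly_Mapping.keys m. x v ^ Poly_Mapping.lookup m v))"

definition partial_deriv :: "'v \<Rightarrow> ('v, 'k::field) mpoly \<Rightarrow> ('v, 'k) mpoly" where
  "partial_deriv v f =
     (\<Sum>m\<in>Poly_Mapping.keys f.
        Poly_Mapping.single (m - Poly_Mapping.single v 1)
          (of_nat (Poly_Mapping.lookup m v) * Poly_Mapping.lookup f m))"

definition homogeneous :: "nat \<Rightarrow> ('v, 'k::field) mpoly \<Rightarrow> bool" where
  "homogeneous d f \<longleftrightarrow>
     (\<forall>m\<in>Poly_Mapping.keys f. (\<Sum>v\<in>Poly_Mapping.keys m. Poly_Mapping.lookup m v) = d)"


section \<open>The bigraded ring \<open>R = k[s,t,u,v]\<close>\<close>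

datatype bvar = Var_s | Var_t | Var_u | Var_v

type_synonym 'k bipoly = "(bvar, 'k) mpoly"

definition bidegree :: "(bvar \<Rightarrow>\<^sub>0 nat) \<Rightarrow> nat \<times> nat" where
  "bidegree m = (Poly_Mapping.lookup m Var_s + Poly_Mapping.lookup m Var_t,
                 Poly_Mapping.lookup m Var_u + Poly_Mapping.lookup m Var_v)"

definition bigraded_piece :: "nat \<Rightarrow> nat \<Rightarrow> 'k::field bipoly set" where
  "bigraded_piece a b = {f. \<forall>m\<in>Poly_Mapping.keys f. bidegree m = (a, b)}"

definition bicoords :: "'k^2 \<Rightarrow> 'k^2 \<Rightarrow> bvar \<Rightarrow> 'k" where
  "bicoords a b w = (case w of Var_s \<Rightarrow> a $ 1 | Var_t \<Rightarrow> a $ 2 | Var_u \<Rightarrow> b $ 1 | Var_v \<Rightarrow> b $ 2)"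

definition basepoint_free :: "(4 \<Rightarrow> 'k::field bipoly) \<Rightarrow> bool" where
  "basepoint_free p \<longleftrightarrow>
     (\<forall>a b. a \<noteq> 0 \<longrightarrow> b \<noteq> 0 \<longrightarrow> (\<exists>i. eval_mpoly (bicoords a b) (p i) \<noteq> 0))"


section \<open>Bigraded minimal free resolutions\<close>

text \<open>
  A bigraded free module \<open>R(-a\<^sub>1,-b\<^sub>1) \<oplus> \<dots> \<oplus> R(-a\<^sub>n,-b\<^sub>n)\<close> is encoded by the list
  \<open>[(a\<^sub>1,b\<^sub>1), \<dots>, (a\<^sub>n,b\<^sub>n)]\<close> of the bidegrees of its basis elements. A list \<open>Fs\<close> of such lists
  encodes \<open>F\<^sub>1, \<dots>, F\<^sub>l\<close>; we add \<open>F\<^sub>0 = R\<close> and \<open>F\<^sub>i = 0\<close> for \<open>i > l\<close>.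
\<close>

definition res_module :: "(nat \<times> nat) list list \<Rightarrow> nat \<Rightarrow> (nat \<times> nat) list" where
  "res_module Fs i =
     (case i of 0 \<Rightarrow> [(0, 0)] | Suc j \<Rightarrow> if j < length Fs then Fs ! j else [])"

definition res_rank :: "(nat \<times> nat) list list \<Rightarrow> nat \<Rightarrow> nat" where
  "res_rank Fs i = length (res_module Fs i)"

text \<open>The elements of \<open>R\<^sup>n\<close>, as families extended by zero.\<close>

definition free_vecs :: "nat \<Rightarrow> (nat \<Rightarrow> 'r::comm_ring_1) set" where
  "free_vecs n = {x. \<forall>i\<ge>n. x i = 0}"

definition mat_apply ::
  "nat \<Rightarrow> nat \<Rightarrow> (nat \<Rightarrow> nat \<Rightarrow> 'r::comm_ring_1) \<Rightarrow> (nat \<Rightarrow> 'r) \<Rightarrow> nat \<Rightarrow> 'r" where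
  "mat_apply m n A x = (\<lambda>i. if i < m then \<Sum>j<n. A i j * x j else 0)"

text \<open>
  \<open>d i\<close> is the matrix of \<open>F\<^sub>i\<^sub>+\<^sub>1 \<rightarrow> F\<^sub>i\<close>; \<open>d 0\<close> is the row of generators \<open>F\<^sub>1 \<rightarrow> R\<close> with image \<open>I\<close>.
  The conditions say that the maps preserve bidegrees, that \<open>0 \<leftarrow> I \<leftarrow> F\<^sub>1 \<leftarrow> F\<^sub>2 \<leftarrow> \<dots>\<close> is
  exact, and that it is minimal: the matrices of \<open>F\<^sub>i\<^sub>+\<^sub>1 \<rightarrow> F\<^sub>i\<close>, \<open>i \<ge> 1\<close>, have all entries in
  \<open>\<langle>s,t,u,v\<rangle>\<close>.
\<close>

definition is_minimal_free_resolution ::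
  "'k::field bipoly set \<Rightarrow> (nat \<times> nat) list list \<Rightarrow> (nat \<Rightarrow> nat \<Rightarrow> nat \<Rightarrow> 'k bipoly) \<Rightarrow> bool" where
  "is_minimal_free_resolution I Fs d \<longleftrightarrow>
     (\<forall>i. \<forall>r<res_rank Fs i. \<forall>c<res_rank Fs (Suc i). \<forall>m\<in>Poly_Mapping.keys (d i r c).
        bidegree m + res_module Fs i ! r = res_module Fs (Suc i) ! c) \<and>
     (\<lambda>x. mat_apply (res_rank Fs 0) (res_rank Fs 1) (d 0) x 0) ` free_vecs (res_rank Fs 1) = I \<and>
     (\<forall>i. {x \<in> free_vecs (res_rank Fs (Suc i)).
             mat_apply (res_rank Fs i) (res_rank Fs (Suc i)) (d i) x = (\<lambda>_. 0)} =
          mat_apply (res_rank Fs (Suc i)) (res_rank Fs (Suc (Suc i))) (d (Suc i)) `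
             free_vecs (res_rank Fs (Suc (Suc i)))) \<and>
     (\<forall>i\<ge>1. \<forall>r<res_rank Fs i. \<forall>c<res_rank Fs (Suc i). Poly_Mapping.lookup (d i r c) 0 = 0)"

datatype numerical_type = Type1 | Type2 | Type3 | Type4 | Type5 | Type6

fun resolution_shape :: "numerical_type \<Rightarrow> (nat \<times> nat) list list" where
  "resolution_shape Type1 =
     [replicate 4 (2,1),
      [(2,4)] @ replicate 4 (3,2) @ replicate 2 (4,1),
      replicate 2 (3,4) @ replicate 3 (4,2),
      [(4,4)]]"
| "resolution_shape Type2 =
     [replicate 4 (2,1),
      [(2,3)] @ replicate 4 (3,2) @ replicate 2 (4,1),
      replicate 2 (3,3) @ replicate 3 (4,2),
      [(4,3)]]"
| "resolution_shape Type3 =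
     [replicate 4 (2,1),
      [(2,4), (3,1)] @ replicate 2 (3,2) @ [(3,3), (4,2), (5,1)],
      replicate 2 (3,4) @ replicate 2 (4,3) @ replicate 2 (5,2),
      [(4,4), (5,3)]]"
| "resolution_shape Type4 =
     [replicate 4 (2,1),
      [(2,3), (3,1)] @ replicate 2 (3,2) @ [(4,2), (5,1)],
      [(3,3), (4,3)] @ replicate 2 (5,2),
      [(5,3)]]"
| "resolution_shape Type5 =
     [replicate 4 (2,1),
      [(2,2)] @ replicate 2 (3,2) @ replicate 2 (4,1),
      replicate 2 (4,2),
      []]"
| "resolution_shape Type6 =
     [replicate 4 (2,1),
      replicate 2 (2,2) @ replicate 2 (4,1),
      [(4,2)],
      []]"

definition has_type :: "'k::field bipoly set \<Rightarrow> numerical_type \<Rightarrow> bool" where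
  "has_type I \<tau> \<longleftrightarrow> (\<exists>d. is_minimal_free_resolution I (resolution_shape \<tau>) d)"

definition prime_ideal :: "'r::comm_ring_1 set \<Rightarrow> bool" where
  "prime_ideal P \<longleftrightarrow>
     ideal.subspace P \<and> 1 \<notin> P \<and> (\<forall>a b. a * b \<in> P \<longrightarrow> a \<in> P \<or> b \<in> P)"

text \<open>Associated and embedded primes of an ideal \<open>I\<close> are those of the module \<open>R/I\<close>.\<close>

definition associated_primes :: "'r::comm_ring_1 set \<Rightarrow> 'r set set" where
  "associated_primes I = {P. prime_ideal P \<and> (\<exists>f. P = {g. g * f \<in> I})}"

definition embedded_primes :: "'r::comm_ring_1 set \<Rightarrow> 'r set set" where
  "embedded_primes I = {P \<in> associated_primes I. \<exists>Q\<in>associated_primes I. Q \<subset> P}"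

definition has_type_5a :: "'k::field bipoly set \<Rightarrow> bool" where
  "has_type_5a I \<longleftrightarrow> has_type I Type5 \<and> card (embedded_primes I) = 2"

definition has_type_5b :: "'k::field bipoly set \<Rightarrow> bool" where
  "has_type_5b I \<longleftrightarrow> has_type I Type5 \<and> card (embedded_primes I) = 1"


section \<open>Closed subsets of \<open>P\<^sup>3\<close>\<close>

text \<open>
  Subsets of \<open>P\<^sup>3\<close> are represented by their sets of homogeneous coordinate vectors, i.e. by
  subsets of \<open>k\<^sup>4 - {0}\<close> closed under nonzero scalars. Over an algebraically closed field
  reduced closed subschemes are the same as closed sets of (closed) points.
\<close>

type_synonym 'k poly3 = "(4, 'k) mpoly"

definition proj_closed :: "('k::field^4) set \<Rightarrow> bool" where
  "proj_closed Z \<longleftrightarrow>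
     (\<exists>S :: 'k poly3 set. (\<forall>F\<in>S. \<exists>d. homogeneous d F) \<and>
        Z = {x. x \<noteq> 0 \<and> (\<forall>F\<in>S. eval_mpoly (($) x) F = 0)})"

definition proj_irreducible :: "('k::field^4) set \<Rightarrow> bool" where
  "proj_irreducible Z \<longleftrightarrow> proj_closed Z \<and> Z \<noteq> {} \<and>
     (\<forall>A B. proj_closed A \<longrightarrow> proj_closed B \<longrightarrow> Z = A \<union> B \<longrightarrow> Z = A \<or> Z = B)"

definition irreducible_components :: "('k::field^4) set \<Rightarrow> ('k^4) set set" where
  "irreducible_components Z =
     {Y. proj_irreducible Y \<and> Y \<subseteq> Z \<and>
         (\<forall>Y'. proj_irreducible Y' \<longrightarrow> Y \<subseteq> Y' \<longrightarrow> Y' \<subseteq> Z \<longrightarrow> Y' = Y)}"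

text \<open>Krull dimension, with the (irrelevant) convention that the empty set has dimension 0.\<close>

definition proj_dim :: "('k::field^4) set \<Rightarrow> enat" where
  "proj_dim Z = Sup {enat n | n. \<exists>Y :: nat \<Rightarrow> ('k^4) set.
     (\<forall>i\<le>n. proj_irreducible (Y i) \<and> Y i \<subseteq> Z) \<and> (\<forall>i<n. Y i \<subset> Y (Suc i))}"

definition local_dim :: "('k::field^4) set \<Rightarrow> 'k^4 \<Rightarrow> enat" where
  "local_dim Z x = Sup {proj_dim Y | Y. Y \<in> irreducible_components Z \<and> x \<in> Y}"

text \<open>
  The cone over the embedded projective tangent space of \<open>Z\<close> (with reduced structure) at \<open>x\<close>.
  It is a linear subspace of \<open>k\<^sup>4\<close>, of dimension one more than the Zariski tangent space.
\<close>

definition affine_tangent_space :: "('k::field^4) set \<Rightarrow> 'k^4 \<Rightarrow> ('k^4) set" where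
  "affine_tangent_space Z x =
     {w. \<forall>F :: 'k poly3. (\<exists>d. homogeneous d F) \<longrightarrow> (\<forall>z\<in>Z. eval_mpoly (($) z) F = 0) \<longrightarrow>
        (\<Sum>i\<in>UNIV. eval_mpoly (($) x) (partial_deriv i F) * w $ i) = 0}"

definition singular_locus :: "('k::field^4) set \<Rightarrow> ('k^4) set" where
  "singular_locus Z =
     {x \<in> Z. enat (vec.dim (affine_tangent_space Z x)) \<noteq> local_dim Z x + 1}"

definition codim1_singular_locus :: "('k::field^4) set \<Rightarrow> ('k^4) set" where
  "codim1_singular_locus X =
     \<Union> {Y \<in> irreducible_components (singular_locus X). proj_dim Y = 1}"

definition image_surface :: "(4 \<Rightarrow> 'k::field bipoly) \<Rightarrow> ('k^4) set" where
  "image_surface p =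
     {c *s (\<chi> i. eval_mpoly (bicoords a b) (p i)) | c a b. c \<noteq> 0 \<and> a \<noteq> 0 \<and> b \<noteq> 0}"


section \<open>Curves in \<open>P\<^sup>3\<close>\<close>

definition is_line :: "('k::field^4) set \<Rightarrow> bool" where
  "is_line L \<longleftrightarrow> (\<exists>W. vec.subspace W \<and> vec.dim W = 2 \<and> L = W - {0})"

text \<open>
  A smooth conic in the plane \<open>W\<close>: the zero set of a quadratic form on \<open>W\<close> whose differential
  (restricted to \<open>W\<close>) vanishes at no point of it.
\<close>

definition is_smooth_plane_conic :: "('k::field^4) set \<Rightarrow> bool" where
  "is_smooth_plane_conic C \<longleftrightarrow>
     (\<exists>W (F :: 'k poly3). vec.subspace W \<and> vec.dim W = 3 \<and> homogeneous 2 F \<and>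
        C = {x \<in> W. x \<noteq> 0 \<and> eval_mpoly (($) x) F = 0} \<and>
        (\<forall>x\<in>C. \<exists>w\<in>W. (\<Sum>i\<in>UNIV. eval_mpoly (($) x) (partial_deriv i F) * w $ i) \<noteq> 0))"

text \<open>The images of the standard rational normal curve under projective automorphisms.\<close>

definition is_twisted_cubic :: "('k::field^4) set \<Rightarrow> bool" where
  "is_twisted_cubic C \<longleftrightarrow>
     (\<exists>A :: 'k^4^4. invertible A \<and>
        C = {c *s (A *v vector [a^3, a^2 * b, a * b^2, b^3]) | c a b. c \<noteq> 0 \<and> (a \<noteq> 0 \<or> b \<noteq> 0)})"

end

theory Submission
  imports Defs "HOL-Library.Function_Algebras"
begin

text \<open>
  The minimal resolution enters only through the first syzygies of bidegree (0,1), (0,2) and (1,0). They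
  bring \<open>U\<close> into a normal form by linear changes of basis and of \<open>u, v\<close>, whose image surface has an
  explicit equation \<open>G\<close>. The tangent space of the surface at each point is the kernel of the
  differential of \<open>G\<close>; since the surface is too small to carry four independent forms, this holds in every
  characteristic and without knowing that \<open>G\<close> generates the ideal of the surface. So the singular
  locus is the zero set of the gradient of \<open>G\<close>, a union of explicitly parametrized curves.
  In Type 5 the number of lines and the number of embedded primes are both governed by the roots of the
  discriminant, a binary quadratic form in \<open>u, v\<close>, of the normal form.
\<close>

text \<open>Dimension is controlled by counting. A surface parametrized in bidegree (2,1) carries at
  most (2d + 1)(d + 1) independent forms of degree d, which is quadratic growth, while a chain of n
  + 1 irreducible sets produces about d^n of them. This bounds \<open>proj_dim\<close>, and it also
  prevents the polar of \<open>G\<close> from dominating a plane, which is what ties tangent spaces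
  to the gradient. Most equations have one origin. Three independent binary quadratic forms trace a
  smooth conic. In the normal forms with one (0,1) syzygy and with a (0,3) syzygy, quadratic
  expressions in the coordinates recover the point of the conic, and substitution gives a quartic;
  in the (0,2) case that point is defined only over a quadratic extension, and a norm takes its
  place. Type 1 has no small syzygy to start from: 25 unknowns against 24 equations supply one of
  bidegree (0,3). In characteristic 2 the gradient of a smooth conic has a zero off the conic, so
  the equation is carried along with its gradient. For Type 5 inequalities suffice: two simple roots
  give two embedded primes, a double root at most one.\<close>

type_synonym 'a quad = "'a \<times> 'a \<times> 'a \<times> 'a"

abbreviation "lookup \<equiv> Poly_Mapping.lookup"
abbreviation "keys \<equiv> Poly_Mapping.keys"
abbreviation "single \<equiv> Poly_Mapping.single"

abbreviation nz :: "'a::zero \<Rightarrow> 'a \<Rightarrow> bool" where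
  "nz a b \<equiv> a \<noteq> 0 \<or> b \<noteq> 0"

text \<open>Reassociates ordinary products and makes the simplifier loop with \<open>algebra_simps\<close>.\<close>

declare ideal.scale_scale [simp del]

section \<open>Polynomials over an infinite field\<close>

lemma infinite_alg_closed: "infinite (UNIV :: 'k::alg_closed_field set)"
proof
 assume fin: "finite (UNIV :: 'k set)"
 define P :: "'k poly" where "P = 1 + (\<Prod>a\<in>UNIV. [:-a, 1:])"
 have deg: "degree (\<Prod>a\<in>(UNIV::'k set). [:-a, 1:]) = card (UNIV :: 'k set)"
  by (subst degree_prod_eq_sum_degree) auto
 have "card (UNIV :: 'k set) > 0" using fin by (simp add: card_gt_0_iff)
 hence "degree P > 0" unfolding P_def by (subst degree_add_eq_right) (simp_all add: deg)
 then obtain x where "poly P x = 0" using alg_closed_imp_poly_has_root by blast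
 moreover have "(\<Prod>a\<in>(UNIV::'k set). x - a) = 0" using fin by (subst prod_zero_iff) auto
 ultimately show False by (simp add: P_def poly_prod)
qed

lemma poly_zeroI:
 assumes "!!t. t \<notin> E ==> poly P t = 0" and "finite E"
 shows "(P :: 'k::alg_closed_field poly) = 0"
proof (rule ccontr)
 assume "P ~= 0"
 hence "finite (E \<union> {t. poly P t = 0})" using poly_roots_finite assms(2) by blast
 moreover have "E \<union> {t. poly P t = 0} = UNIV" using assms(1) by auto
 ultimately show False using infinite_alg_closed by metis
qed

lemma poly_fun_eqI: "(!!t. poly P t = poly Q t) ==> P = (Q :: 'k::alg_closed_field poly)"
 using poly_zeroI[of "{}" "P - Q"] by simp

lemma avoid_roots:
 fixes P :: "'k::alg_closed_field poly"
 assumes "P ~= 0" "finite E"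
 obtains t where "t \<notin> E" "poly P t ~= 0" using poly_zeroI[of E P] assms by blast

lemma ex_root_quadratic:
 fixes a b c :: "'k::alg_closed_field"
 shows "\<exists>s t. nz s t & a * s^2 + b * s * t + c * t^2 = 0"
proof (cases "a = 0")
 case True
 thus ?thesis by (intro exI[of _ 1] exI[of _ 0]) simp
next
 case False
 have "degree [:c, b, a:] > 0" using False by simp
 then obtain x where "poly [:c, b, a:] x = 0" using alg_closed_imp_poly_has_root by blast
 hence "c + x * (b + x * a) = 0" by simp
 hence "a * x^2 + b * x + c = 0" by algebra
 thus ?thesis by (intro exI[of _ x] exI[of _ 1]) simp
qed

lemma ex_root_cubic:
 fixes a b c d :: "'k::alg_closed_field"
 shows "\<exists>s t. nz s t & a * s^3 + b * s^2 * t + c * s * t^2 + d * t^3 = 0"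
proof (cases "a = 0")
 case True
 thus ?thesis by (intro exI[of _ 1] exI[of _ 0]) simp
next
 case False
 have "degree [:d, c, b, a:] > 0" using False by simp
 then obtain x where "poly [:d, c, b, a:] x = 0" using alg_closed_imp_poly_has_root by blast
 hence "d + x * (c + x * (b + x * a)) = 0" by simp
 hence "a * x^3 + b * x^2 + c * x + d = 0" by algebra
 thus ?thesis by (intro exI[of _ x] exI[of _ 1]) simp
qed

text \<open>Induction on the degree, splitting off one root from \<open>g\<close> and
  \<open>r\<close>; simplicity keeps the other roots of \<open>g\<close> away from it. The
  contrapositive is what matters later: if \<open>G\<close> fails to divide \<open>F\<close> along a
  line although \<open>F\<close> vanishes wherever \<open>G\<close> does, then \<open>G\<close> has
  a multiple root on that line.\<close>

lemma dvd_of_common_simple_roots: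
 fixes g r :: "'k::alg_closed_field poly"
 assumes "g ~= 0"
  and "!!a. poly g a = 0 ==> poly (pderiv g) a ~= 0"
  and "!!a. poly g a = 0 ==> poly r a = 0"
 shows "g dvd r" using assms
proof (induction "degree g" arbitrary: g r)
 case 0
 then obtain c where "g = [:c:]" by (metis degree_eq_zeroE)
 thus ?case using 0 by (simp add: const_poly_dvd_iff dvd_field_iff)
next
 case (Suc n)
 have "degree g > 0" using Suc.hyps(2) by simp
 then obtain a where a: "poly g a = 0" using alg_closed_imp_poly_has_root by blast
 then obtain g1 where g1: "g = [:-a, 1:] * g1" by (metis poly_eq_0_iff_dvd dvdE)
 from a Suc.prems(3) obtain r1 where r1: "r = [:-a, 1:] * r1" by (metis poly_eq_0_iff_dvd dvdE)
 have g1nz: "g1 ~= 0" using g1 Suc.prems by auto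
 have der: "pderiv g = g1 + [:-a, 1:] * pderiv g1"
  unfolding g1 by (subst pderiv_mult) (simp add: pderiv_pCons)
 have "poly g1 a ~= 0" using Suc.prems(2)[OF a] der by simp
 hence ne: "b ~= a" if "poly g1 b = 0" for b using that by auto
 have "degree g = Suc (degree g1)" unfolding g1 using g1nz by (subst degree_mult_eq) auto
 hence "g1 dvd r1" using Suc.hyps(2) g1nz
 proof (intro Suc.hyps(1))
  fix b assume b: "poly g1 b = 0"
  have "poly (pderiv g) b ~= 0" by (rule Suc.prems(2)) (use b g1 in simp)
  thus "poly (pderiv g1) b ~= 0" using der b by simp
  have "poly r b = 0" by (rule Suc.prems(3)) (use b g1 in simp)
  thus "poly r1 b = 0" using r1 ne[OF b] by simp
 qed auto
 thus ?case unfolding g1 r1 by (rule mult_dvd_mono[OF dvd_refl])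
qed


section \<open>Evaluation of multivariate polynomials\<close>

text \<open>The coefficient map \<open>h\<close> lets one construction serve for evaluation in the
  field, for restriction to paths and planes with values in \<open>'k poly\<close> and
  \<open>'k poly poly\<close>, and for substitution into the bigraded ring.\<close>

definition mp_hom :: "('k::field => 'r::comm_ring_1) => ('v => 'r) => ('v, 'k) mpoly => 'r" where
 "mp_hom h x f =
  (\<Sum>m\<in>keys f. h (lookup f m) *
    (\<Prod>v\<in>keys m. x v ^ lookup m v))"

lemma eval_mpoly_eq_hom: "eval_mpoly x f = mp_hom (%c. c) x f"
 by (simp add: eval_mpoly_def mp_hom_def)

definition mon_eval :: "('v => 'r::comm_ring_1) => ('v \<Rightarrow>\<^sub>0 nat) => 'r" where
 "mon_eval x m = (\<Prod>v\<in>keys m. x v ^ lookup m v)"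

lemma mon_eval_superset:
 assumes "finite A" "keys m \<subseteq> A"
 shows "mon_eval x m = (\<Prod>v\<in>A. x v ^ lookup m v)" unfolding mon_eval_def using assms
 by (intro prod.mono_neutral_left) (auto simp: in_keys_iff)

lemma mon_eval_add: "mon_eval x (m + n) = mon_eval x m * mon_eval x n"
proof -
 let ?A = "keys m \<union> keys n"
 have "mon_eval x (m + n) = (\<Prod>v\<in>?A. x v ^ lookup (m + n) v)"
  using Poly_Mapping.keys_add[of m n] by (intro mon_eval_superset) auto
 also have "\<dots> = (\<Prod>v\<in>?A. x v ^ lookup m v) * (\<Prod>v\<in>?A. x v ^ lookup n v)"
  by (simp add: lookup_add power_add prod.distrib)
 also have "\<dots> = mon_eval x m * mon_eval x n" by (simp add: mon_eval_superset[of ?A])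
 finally show ?thesis .
qed

lemma mon_eval_0 [simp]: "mon_eval x 0 = 1" by (simp add: mon_eval_def)

lemma mon_eval_single [simp]: "mon_eval x (single v n) = x v ^ n"
 by (cases "n = 0") (auto simp: mon_eval_def)

lemma mpoly_eq_sum_single:
 "f = (\<Sum>m\<in>keys f. single m (lookup f m))" by (rule poly_mapping_eqI)
  (auto simp: lookup_sum lookup_single when_def sum.delta in_keys_iff)

locale coeff_hom =
 fixes h :: "'k::field => 'r::comm_ring_1"
 assumes h_add: "h (a + b) = h a + h b" and h_mult: "h (a * b) = h a * h b" and h_one: "h 1 = 1"
begin

lemma h_zero [simp]: "h 0 = 0" using h_add[of 0 0] by simp

lemma mp_hom_superset:
 assumes "finite A" "keys f \<subseteq> A"
 shows "mp_hom h x f = (\<Sum>m\<in>A. h (lookup f m) * mon_eval x m)"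
 unfolding mp_hom_def mon_eval_def using assms
 by (intro sum.mono_neutral_left) (auto simp: in_keys_iff)

lemma mp_hom_add: "mp_hom h x (f + g) = mp_hom h x f + mp_hom h x g"
proof -
 let ?A = "keys f \<union> keys g"
 have "mp_hom h x (f + g) = (\<Sum>m\<in>?A. h (lookup (f + g) m) * mon_eval x m)"
  using Poly_Mapping.keys_add[of f g] by (intro mp_hom_superset) auto
 also have "\<dots> = mp_hom h x f + mp_hom h x g"
  by (simp add: mp_hom_superset[of ?A] lookup_add h_add algebra_simps sum.distrib)
 finally show ?thesis .
qed

lemma mp_hom_0 [simp]: "mp_hom h x 0 = 0" by (simp add: mp_hom_def)

lemma mp_hom_sum: "mp_hom h x (\<Sum>i\<in>A. f i) = (\<Sum>i\<in>A. mp_hom h x (f i))"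
 by (induction A rule: infinite_finite_induct) (auto simp: mp_hom_add)

lemma mp_hom_single: "mp_hom h x (single m c) = h c * mon_eval x m"
 by (cases "c = 0") (auto simp: mp_hom_def mon_eval_def)

lemma mp_hom_mult: "mp_hom h x (f * g) = mp_hom h x f * mp_hom h x g"
proof -
 have "f * g = (\<Sum>m\<in>keys f. \<Sum>n\<in>keys g.
     single m (lookup f m) * single n (lookup g n))"
  by (subst mpoly_eq_sum_single[of f], subst mpoly_eq_sum_single[of g])
   (simp only: sum_product)
 also have "mp_hom h x \<dots> = (\<Sum>m\<in>keys f. \<Sum>n\<in>keys g.
   (h (lookup f m) * mon_eval x m) * (h (lookup g n) * mon_eval x n))"
  by (simp only: mp_hom_sum mult_single mp_hom_single h_mult mon_eval_add mult_ac)
 also have "\<dots> = mp_hom h x f * mp_hom h x g" by (simp only: mp_hom_def mon_eval_def sum_product)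
 finally show ?thesis .
qed

lemma mp_hom_1 [simp]: "mp_hom h x 1 = 1" using mp_hom_single[of x 0 1] by (simp add: h_one)

lemma mp_hom_uminus: "mp_hom h x (- f) = - mp_hom h x f"
 using mp_hom_add[of x f "- f"] by (simp add: eq_neg_iff_add_eq_0 add.commute)

lemma mp_hom_diff: "mp_hom h x (f - g) = mp_hom h x f - mp_hom h x g"
 using mp_hom_add[of x f "- g"] by (simp add: mp_hom_uminus)

lemma mp_hom_power: "mp_hom h x (f ^ n) = mp_hom h x f ^ n"
 by (induction n) (auto simp: mp_hom_mult)

end

lemma coeff_hom_id: "coeff_hom (%c::'k::field. c)" by unfold_locales auto

lemmas eval_mpoly_add = coeff_hom.mp_hom_add[OF coeff_hom_id, folded eval_mpoly_eq_hom]
 and eval_mpoly_sum = coeff_hom.mp_hom_sum[OF coeff_hom_id, folded eval_mpoly_eq_hom]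
 and eval_mpoly_mult = coeff_hom.mp_hom_mult[OF coeff_hom_id, folded eval_mpoly_eq_hom]
 and eval_mpoly_single = coeff_hom.mp_hom_single[OF coeff_hom_id, folded eval_mpoly_eq_hom]

lemma mp_hom_finite:
 fixes x :: "'v::finite => 'r::comm_ring_1"
 shows "mp_hom h x f =
  (\<Sum>m\<in>keys f. h (lookup f m) * (\<Prod>v\<in>UNIV. x v ^ lookup m v))"
 unfolding mp_hom_def by (simp flip: mon_eval_def add: mon_eval_superset[of UNIV])

lemma poly_mp_hom:
 "poly (mp_hom (%c. [:h c:]) X f) t = mp_hom h (%v. poly (X v) t) f"
 by (simp add: mp_hom_def poly_sum poly_prod)


section \<open>Homogeneous polynomial functions\<close>

text \<open>Polynomial functions replace polynomials, so that linear changes of coordinates and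
  parametrizations act by plain composition.\<close>

definition hpoly :: "nat => ('k::field^4 => 'k) => bool" where
 "hpoly d f \<longleftrightarrow> (\<exists>F. homogeneous d F & f = (%x. eval_mpoly (($) x) F))"

definition mdeg :: "('v \<Rightarrow>\<^sub>0 nat) => nat" where
 "mdeg m = (\<Sum>v\<in>keys m. lookup m v)"

lemma mdeg_superset:
 assumes "finite A" "keys m \<subseteq> A"
 shows "mdeg m = (\<Sum>v\<in>A. lookup m v)" unfolding mdeg_def using assms
 by (intro sum.mono_neutral_left) (auto simp: in_keys_iff)

lemma mdeg_add: "mdeg (m + n) = mdeg m + mdeg n"
proof -
 let ?A = "keys m \<union> keys n"
 have "mdeg (m + n) = (\<Sum>v\<in>?A. lookup (m + n) v)"
  using Poly_Mapping.keys_add[of m n] by (intro mdeg_superset) auto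
 thus ?thesis by (simp add: mdeg_superset[of ?A] lookup_add sum.distrib)
qed

lemma homogeneous_altdef: "homogeneous d f \<longleftrightarrow> (\<forall>m\<in>keys f. mdeg m = d)"
 by (simp add: homogeneous_def mdeg_def)

lemma hpoly_eval: "homogeneous d F ==> hpoly d (%x. eval_mpoly (($) x) F)" by (auto simp: hpoly_def)

lemma hpoly_0: "hpoly d (%x. 0)"
 unfolding hpoly_def by (rule exI[of _ 0]) (auto simp: homogeneous_def eval_mpoly_def)

lemma hpoly_add:
 assumes "hpoly d f" "hpoly d g"
 shows "hpoly d (%x. f x + g x)"
proof -
 obtain F where "homogeneous d F" "f = (%x. eval_mpoly (($) x) F)"
  using assms(1) unfolding hpoly_def by blast
 moreover obtain G where "homogeneous d G" "g = (%x. eval_mpoly (($) x) G)"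
  using assms(2) unfolding hpoly_def by blast
 ultimately show ?thesis unfolding hpoly_def using Poly_Mapping.keys_add[of F G]
  by (intro exI[of _ "F + G"]) (force simp: eval_mpoly_add homogeneous_altdef)
qed

lemma hpoly_mult:
 assumes "hpoly d f" "hpoly e g"
 shows "hpoly (d + e) (%x. f x * g x)"
proof -
 obtain F where F: "homogeneous d F" "f = (%x. eval_mpoly (($) x) F)"
  using assms(1) unfolding hpoly_def by blast
 moreover obtain G where G: "homogeneous e G" "g = (%x. eval_mpoly (($) x) G)"
  using assms(2) unfolding hpoly_def by blast
 moreover from F(1) G(1) have "homogeneous (d + e) (F * G)"
  using Poly_Mapping.keys_mult[of F G] unfolding homogeneous_altdef by (force simp: mdeg_add)
 ultimately show ?thesis unfolding hpoly_def
  by (intro exI[of _ "F * G"]) (simp add: eval_mpoly_mult)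
qed

lemma hpoly_const: "hpoly 0 (%x. c)" unfolding hpoly_def by (rule exI[of _ "single 0 c"])
  (auto simp: homogeneous_altdef mdeg_def eval_mpoly_single)

lemma hpoly_coord: "hpoly 1 (%x. x $ i)" unfolding hpoly_def
 by (rule exI[of _ "single (single i 1) 1"])
  (auto simp: homogeneous_altdef mdeg_def eval_mpoly_single)

lemma hpoly_smult: "hpoly d f ==> hpoly d (%x. c * f x)"
 using hpoly_mult[OF hpoly_const, of d f c] by simp

lemma hpoly_uminus: "hpoly d f ==> hpoly d (%x. - f x)" using hpoly_smult[of d f "-1"] by simp

lemma hpoly_diff: "hpoly d f ==> hpoly d g ==> hpoly d (%x. f x - g x)"
 using hpoly_add[OF _ hpoly_uminus, of d f g] by simp

lemma hpoly_sum: "(!!i. i \<in> A ==> hpoly d (f i)) ==> hpoly d (%x. \<Sum>i\<in>A. f i x)"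
 by (induction A rule: infinite_finite_induct) (auto intro: hpoly_0 hpoly_add)

lemma hpoly_power: "hpoly d f ==> hpoly (d * n) (%x. f x ^ n)"
 by (induction n) (auto intro: hpoly_mult hpoly_const)

lemma hpoly_prod: "finite A ==> (!!i. i \<in> A ==> hpoly (d i) (f i)) ==> hpoly (\<Sum>i\<in>A. d i) (%x. \<Prod>i\<in>A. f i x)"
 by (induction A rule: finite_induct) (auto intro: hpoly_mult hpoly_const)

lemma hpoly_linear_subst:
 assumes "hpoly d f"
 shows "hpoly d (%x. f (A *v x))"
proof -
 obtain F where F: "homogeneous d F" "f = (%x. eval_mpoly (($) x) F)"
  using assms unfolding hpoly_def by blast
 have lin: "hpoly 1 (%x. (A *v x) $ i)" for i
  unfolding matrix_vector_mult_def by (simp del: One_nat_def) (intro hpoly_sum hpoly_smult hpoly_coord)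
 have "hpoly d (%x. \<Prod>v\<in>keys m. (A *v x) $ v ^ lookup m v)"
  if "m \<in> keys F" for m
 proof -
  have "hpoly (\<Sum>v\<in>keys m. 1 * lookup m v)
   (%x. \<Prod>v\<in>keys m. (A *v x) $ v ^ lookup m v)" by (intro hpoly_prod hpoly_power lin) auto
  thus ?thesis using F(1) that by (simp add: homogeneous_def)
 qed
 thus ?thesis unfolding F(2) eval_mpoly_def by (intro hpoly_sum hpoly_smult)
qed

lemma hpoly_scale:
 assumes "hpoly d f"
 shows "f (c *s x) = c ^ d * f x"
proof -
 obtain F where F: "homogeneous d F" "f = (%x. eval_mpoly (($) x) F)"
  using assms unfolding hpoly_def by blast
 show ?thesis unfolding F(2) eval_mpoly_def using F(1)
  by (auto simp: homogeneous_def power_mult_distrib prod.distrib sum_distrib_left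
    simp flip: power_sum intro!: sum.cong)
qed

lemma hpoly_cong_degree: "hpoly d f ==> d = e ==> hpoly e f" by simp

lemma vec_nth_Abs: "($) (\<chi> i. g i) = g" by (rule ext) simp

text \<open>The regularity used throughout: restriction to any polynomial path is a univariate
  polynomial. Derivatives and zero-product arguments then reduce to one variable, where values
  determine the polynomial.\<close>

definition path_poly :: "('k::field^'n => 'k) => bool" where
 "path_poly f \<longleftrightarrow> (\<forall>X :: 'n => 'k poly. \<exists>P. \<forall>t. poly P t = f (\<chi> i. poly (X i) t))"

lemma path_poly_hpoly:
 assumes "hpoly d f"
 shows "path_poly f"
proof -
 obtain F where F: "f = (%x. eval_mpoly (($) x) F)" using assms unfolding hpoly_def by blast
 have "poly (mp_hom (%c. [:c:]) X F) t = f (\<chi> i. poly (X i) t)" for X t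
  by (simp add: F poly_mp_hom eval_mpoly_eq_hom vec_nth_Abs)
 thus ?thesis unfolding path_poly_def by blast
qed

lemma sum_const_poly: "(\<Sum>i\<in>A. [:c i:]) = [:\<Sum>i\<in>A. c i:]"
 by (induction A rule: infinite_finite_induct) auto

lemma coeff_mult_degree_bound:
 assumes "degree p \<le> m" "degree q \<le> n"
 shows "coeff (p * q) (m + n) = coeff p m * coeff q n"
proof -
 have "coeff p i * coeff q (m + n - i) = 0" if "i \<le> m + n" "i ~= m" for i
  using that assms by (cases "i < m") (auto simp: coeff_eq_0)
 hence "coeff (p * q) (m + n) = (\<Sum>i\<in>{m}. coeff p i * coeff q (m + n - i))"
  unfolding coeff_mult by (intro sum.mono_neutral_right) auto
 thus ?thesis by simp
qed

text \<open>
 The expansion of \<open>f (x + eps w + tau e)\<close>: the outer variable is \<open>tau\<close>, the inner one \<open>eps\<close>.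
\<close>

lemma hpoly_plane:
 assumes "hpoly d f"
 obtains P :: "'k::alg_closed_field poly poly" where
  "!!tau eps. poly (poly P [:tau:]) eps = f (x + eps *s w + tau *s e)"
  "degree P \<le> d" "coeff P d = [:f e:]"
proof -
 obtain F where F: "homogeneous d F" "f = (%x. eval_mpoly (($) x) F)"
  using assms unfolding hpoly_def by blast
 define X :: "4 => 'k poly poly" where "X = (%i. [:[:x $ i, w $ i:], [:e $ i:]:])"
 define P where "P = mp_hom (%c. [:[:c:]:]) X F"
 have ev: "poly (poly P [:tau:]) eps = f (x + eps *s w + tau *s e)" for tau eps
 proof -
  have "(%v. poly (poly (X v) [:tau:]) eps) = ($) (x + eps *s w + tau *s e)"
   by (rule ext) (simp add: X_def algebra_simps)
  thus ?thesis by (simp add: P_def poly_mp_hom F(2) eval_mpoly_eq_hom)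
 qed
 \<comment> \<open>In the outer variable each coordinate is linear with constant leading coefficient
   \<open>e $ i\<close>. Hence the coefficient of tau^d in the whole form is the constant
   \<open>f e\<close>.\<close>
 have lin: "degree (X i ^ n) \<le> n & coeff (X i ^ n) n = [:e $ i ^ n:]" for i n
 proof (induction n)
  case (Suc n)
  have "degree (X i) \<le> 1" by (simp add: X_def)
  moreover have "coeff (X i) 1 = [:e $ i:]" by (simp add: X_def)
  moreover have "coeff (X i * X i ^ n) (1 + n) = coeff (X i) 1 * coeff (X i ^ n) n"
   using Suc \<open>degree (X i) \<le> 1\<close> by (intro coeff_mult_degree_bound) auto
  ultimately show ?case using Suc degree_mult_le[of "X i" "X i ^ n"] by auto
 qed auto
 have pr: "degree (\<Prod>v\<in>A. X v ^ m v) \<le> (\<Sum>v\<in>A. m v) &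
  coeff (\<Prod>v\<in>A. X v ^ m v) (\<Sum>v\<in>A. m v) = [:\<Prod>v\<in>A. e $ v ^ m v:]" if "finite A" for A m using that
 proof (induction A rule: finite_induct)
  case (insert a A)
  have "coeff (X a ^ m a * (\<Prod>v\<in>A. X v ^ m v)) (m a + (\<Sum>v\<in>A. m v)) =
   coeff (X a ^ m a) (m a) * coeff (\<Prod>v\<in>A. X v ^ m v) (\<Sum>v\<in>A. m v)"
   using insert lin by (intro coeff_mult_degree_bound) auto
  thus ?case using insert lin[of a "m a"] degree_mult_le[of "X a ^ m a" "\<Prod>v\<in>A. X v ^ m v"] by auto
 qed auto
 have "degree P \<le> d" unfolding P_def mp_hom_def
 proof (intro degree_sum_le)
  fix m assume "m \<in> keys F"
  hence "(\<Sum>v\<in>keys m. lookup m v) = d" using F(1) by (auto simp: homogeneous_def)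
  thus "degree ([:[:lookup F m:]:] *
    (\<Prod>v\<in>keys m. X v ^ lookup m v)) \<le> d" using pr[of "keys m" "lookup m"]
   by (intro order_trans[OF degree_mult_le]) auto
 qed auto
 moreover have "coeff P d = [:f e:]"
 proof -
  have "coeff P d = (\<Sum>m\<in>keys F. [:lookup F m:] *
    [:\<Prod>v\<in>keys m. e $ v ^ lookup m v:])" unfolding P_def mp_hom_def coeff_sum
  proof (intro sum.cong refl)
   fix m assume "m \<in> keys F"
   hence "(\<Sum>v\<in>keys m. lookup m v) = d" using F(1) by (auto simp: homogeneous_def)
   thus "coeff ([:[:lookup F m:]:] *
      (\<Prod>v\<in>keys m. X v ^ lookup m v)) d =
     [:lookup F m:] *
      [:\<Prod>v\<in>keys m. e $ v ^ lookup m v:]" using pr[of "keys m" "lookup m"] by auto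
  qed
  also have "\<dots> = [:f e:]" by (simp add: F(2) eval_mpoly_def sum_const_poly mult.commute)
  finally show ?thesis .
 qed
 ultimately show ?thesis using that ev by blast
qed

section \<open>Directional derivatives\<close>

text \<open>The linear coefficient of \<open>f\<close> along the line through \<open>x\<close> in
  direction \<open>w\<close>. The choice is unambiguous because polynomials over an infinite field
  are determined by their values, and the definition makes sense in every characteristic.\<close>

definition ddir :: "('k::field^'n => 'k) => 'k^'n => 'k^'n => 'k" where
 "ddir f x w = poly (pderiv (SOME P. \<forall>t. poly P t = f (x + t *s w))) 0"

lemma ddirI:
 fixes f :: "'k::alg_closed_field^'n => 'k"
 assumes "!!t. poly P t = f (x + t *s w)"
 shows "ddir f x w = poly (pderiv P) 0"
proof -
 have "(SOME P. \<forall>t. poly P t = f (x + t *s w)) = P"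
 proof (rule some_equality)
  fix Q assume "\<forall>t. poly Q t = f (x + t *s w)"
  thus "Q = P" using assms by (intro poly_fun_eqI) auto
 qed (use assms in auto)
 thus ?thesis by (simp add: ddir_def)
qed

lemma path_poly_line:
 assumes "path_poly f"
 obtains P where "!!t. poly P t = f (x + t *s w)"
proof -
 obtain P where P: "!!t. poly P t = f (\<chi> i. poly [:x $ i, w $ i:] t)"
  using assms unfolding path_poly_def by (metis (no_types))
 moreover have "(\<chi> i. poly [:x $ i, w $ i:] t) = x + t *s w" for t by (simp add: vec_eq_iff)
 ultimately show ?thesis using that by auto
qed

lemma path_poly_add [simp]: "path_poly f ==> path_poly g ==> path_poly (%x. f x + g x)"
 unfolding path_poly_def by (metis poly_add)

lemma path_poly_mult [simp]: "path_poly f ==> path_poly g ==> path_poly (%x. f x * g x)"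
 unfolding path_poly_def by (metis poly_mult)

lemma path_poly_const [simp]: "path_poly (%x. c)"
 unfolding path_poly_def by (intro allI exI[of _ "[:c:]"]) simp

lemma path_poly_coord [simp]: "path_poly (%x. x $ i)" unfolding path_poly_def by auto

lemma path_poly_uminus [simp]: "path_poly f ==> path_poly (%x. - f x)"
 unfolding path_poly_def by (metis poly_minus)

lemma path_poly_diff [simp]: "path_poly f ==> path_poly g ==> path_poly (%x. f x - g x)"
 unfolding path_poly_def by (metis poly_diff)

lemma path_poly_power [simp]: "path_poly f ==> path_poly (%x. f x ^ n)"
 unfolding path_poly_def by (metis poly_power)

lemma path_poly_sum: "(!!i. i \<in> A ==> path_poly (f i)) ==> path_poly (%x. \<Sum>i\<in>A. f i x)"
 by (induction A rule: infinite_finite_induct) auto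

context
 fixes f g :: "'k::alg_closed_field^'n => 'k"
 assumes f: "path_poly f" and g: "path_poly g"
begin

lemma ddir_add: "ddir (%x. f x + g x) x w = ddir f x w + ddir g x w"
proof -
 obtain P where P: "!!t. poly P t = f (x + t *s w)" using path_poly_line[OF f, of x w] by blast
 obtain Q where Q: "!!t. poly Q t = g (x + t *s w)" using path_poly_line[OF g, of x w] by blast
 show ?thesis using ddirI[of "P + Q" "%x. f x + g x" x w] ddirI[of P f x w] ddirI[of Q g x w]
  by (simp add: P Q pderiv_add)
qed

lemma ddir_diff: "ddir (%x. f x - g x) x w = ddir f x w - ddir g x w"
proof -
 obtain P where P: "!!t. poly P t = f (x + t *s w)" using path_poly_line[OF f, of x w] by blast
 obtain Q where Q: "!!t. poly Q t = g (x + t *s w)" using path_poly_line[OF g, of x w] by blast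
 show ?thesis using ddirI[of "P - Q" "%x. f x - g x" x w] ddirI[of P f x w] ddirI[of Q g x w]
  by (simp add: P Q pderiv_diff)
qed

lemma ddir_mult: "ddir (%x. f x * g x) x w = f x * ddir g x w + ddir f x w * g x"
proof -
 obtain P where P: "!!t. poly P t = f (x + t *s w)" using path_poly_line[OF f, of x w] by blast
 obtain Q where Q: "!!t. poly Q t = g (x + t *s w)" using path_poly_line[OF g, of x w] by blast
 show ?thesis using ddirI[of "P * Q" "%x. f x * g x" x w] ddirI[of P f x w] ddirI[of Q g x w]
   P[of 0] Q[of 0] by (simp add: P Q pderiv_mult mult.commute)
qed

end

lemma ddir_const: "ddir (%x. c) x w = (0 :: 'k::alg_closed_field)"
 using ddirI[of "[:c:]" "%x. c" x w] by simp

lemma ddir_coord: "ddir (%x. x $ i) x w = (w $ i :: 'k::alg_closed_field)"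
 using ddirI[of "[:x $ i, w $ i:]" "%x. x $ i" x w] by (simp add: pderiv_pCons)

lemma ddir_uminus: "path_poly f ==> ddir (%x. - f x) x w = - ddir f x (w :: 'k::alg_closed_field^'n)"
 using ddir_diff[of "%x. 0" f x w] by (simp add: ddir_const)

lemma ddir_linear_subst: "ddir (%x. f (A *v x)) x w = ddir f (A *v x) (A *v w)"
 by (simp add: ddir_def matrix_vector_right_distrib vector_scalar_commute)

lemma pderiv_sum: "pderiv (\<Sum>i\<in>A. f i) = (\<Sum>i\<in>A. pderiv (f i))"
 by (induction A rule: infinite_finite_induct) (auto simp: pderiv_add)

text \<open>Both sides are the linear coefficient of \<open>F\<close> at \<open>x + t w\<close>,
  expanded monomial by monomial with the product rule. This connects the formal derivatives of the
  tangent space to derivatives of functions.\<close>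

lemma ddir_partial:
 fixes x w :: "'k::alg_closed_field^'n"
 shows "(\<Sum>i\<in>UNIV. eval_mpoly (($) x) (partial_deriv i F) * w $ i) =
  ddir (%x. eval_mpoly (($) x) F) x w"
proof -
 define X where "X = (%i. [:x $ i, w $ i:])"
 define P where "P = mp_hom (%c. [:c:]) X F"
 have "poly P t = eval_mpoly (($) (x + t *s w)) F" for t
 proof -
  have "(%v. poly (X v) t) = ($) (x + t *s w)" by (rule ext) (simp add: X_def)
  thus ?thesis by (simp add: P_def poly_mp_hom eval_mpoly_eq_hom)
 qed
 hence "ddir (%x. eval_mpoly (($) x) F) x w = poly (pderiv P) 0" by (rule ddirI)
 also have "\<dots> = (\<Sum>m\<in>keys F. lookup F m *
   (\<Sum>i\<in>UNIV. (\<Prod>j\<in>UNIV - {i}. x $ j ^ lookup m j) *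
    (of_nat (lookup m i) * x $ i ^ (lookup m i - 1) * w $ i)))"
 proof -
  have const: "[:c:] * Q = smult c Q" for c :: 'k and Q by simp
  have der: "poly (pderiv (X i ^ n)) 0 = of_nat n * x $ i ^ (n - 1) * w $ i" for i n
  proof -
   have "pderiv (X i) = [:w $ i:]" "poly (X i) 0 = x $ i" by (simp_all add: X_def pderiv_pCons)
   thus ?thesis by (simp only: pderiv_power poly_mult poly_smult poly_power) simp
  qed
  have val: "poly (X i ^ n) 0 = x $ i ^ n" for i n by (simp add: X_def)
  show ?thesis
   unfolding P_def mp_hom_finite const pderiv_sum pderiv_smult pderiv_prod poly_sum poly_smult
    poly_mult poly_prod der val ..
 qed
 also have "\<dots> = (\<Sum>i\<in>UNIV. \<Sum>m\<in>keys F. lookup F m *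
   ((\<Prod>j\<in>UNIV - {i}. x $ j ^ lookup m j) *
    (of_nat (lookup m i) * x $ i ^ (lookup m i - 1) * w $ i)))"
  unfolding sum_distrib_left by (rule sum.swap)
 also have "\<dots> = (\<Sum>i\<in>UNIV. eval_mpoly (($) x) (partial_deriv i F) * w $ i)"
 proof (intro sum.cong refl)
  fix i :: 'n
  have mon: "mon_eval (($) x) (m - single i 1) =
   (\<Prod>j\<in>UNIV - {i}. x $ j ^ lookup m j) * x $ i ^ (lookup m i - 1)" for m
  proof -
   have "mon_eval (($) x) (m - single i 1) =
    (\<Prod>j\<in>UNIV. x $ j ^ lookup (m - single i 1) j)" by (rule mon_eval_superset) auto
   also have "\<dots> = x $ i ^ (lookup m i - 1) *
     (\<Prod>j\<in>UNIV - {i}. x $ j ^ lookup (m - single i 1) j)"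
    by (subst prod.remove[of UNIV i]) (auto simp: lookup_minus)
   also have "(\<Prod>j\<in>UNIV - {i}. x $ j ^ lookup (m - single i 1) j) =
     (\<Prod>j\<in>UNIV - {i}. x $ j ^ lookup m j)"
    by (intro prod.cong) (auto simp: lookup_minus lookup_single when_def)
   finally show ?thesis by (simp only: mult.commute)
  qed
  show "(\<Sum>m\<in>keys F. lookup F m *
   ((\<Prod>j\<in>UNIV - {i}. x $ j ^ lookup m j) *
    (of_nat (lookup m i) * x $ i ^ (lookup m i - 1) * w $ i))) =
   eval_mpoly (($) x) (partial_deriv i F) * w $ i"
   unfolding partial_deriv_def eval_mpoly_sum eval_mpoly_single mon sum_distrib_right
  proof (intro sum.cong refl)
   have ac: "a * (p * (n * y * z)) = n * a * (p * y) * z" for a p n y z :: 'k by algebra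
   show "lookup F m * ((\<Prod>j\<in>UNIV - {i}. x $ j ^ lookup m j) *
     (of_nat (lookup m i) * x $ i ^ (lookup m i - 1) * w $ i)) =
    of_nat (lookup m i) * lookup F m *
     ((\<Prod>j\<in>UNIV - {i}. x $ j ^ lookup m j) *
      x $ i ^ (lookup m i - 1)) * w $ i" for m by (rule ac)
  qed
 qed
 finally show ?thesis ..
qed

lemma homogeneous_partial_deriv:
 assumes "homogeneous d F"
 shows "homogeneous (d - 1) (partial_deriv i F)" unfolding homogeneous_altdef
proof
 fix n assume "n \<in> keys (partial_deriv i F)"
 then obtain m where m: "m \<in> keys F"
  "n \<in> keys (single (m - single i 1)
     (of_nat (lookup m i) * lookup F m))"
  unfolding partial_deriv_def using Poly_Mapping.keys_sum by fastforce
 hence n: "n = m - single i 1" and pos: "lookup m i ~= 0"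
  by (cases "lookup m i = 0"; force split: if_splits)+
 have "m = n + single i 1"
  using pos by (intro poly_mapping_eqI) (auto simp: n lookup_add lookup_minus lookup_single when_def)
 hence "mdeg m = mdeg n + 1" by (simp add: mdeg_add) (simp add: mdeg_def)
 thus "mdeg n = d - 1" using assms m(1) by (auto simp: homogeneous_altdef)
qed

lemma hpoly_ddir:
 fixes f :: "'k::alg_closed_field^4 => 'k"
 assumes "hpoly d f"
 shows "hpoly (d - 1) (%x. ddir f x w)"
proof -
 obtain F where F: "homogeneous d F" "f = (%x. eval_mpoly (($) x) F)"
  using assms unfolding hpoly_def by blast
 have "hpoly (d - 1) (%x. \<Sum>i\<in>UNIV. w $ i * eval_mpoly (($) x) (partial_deriv i F))"
  by (intro hpoly_sum hpoly_smult hpoly_eval homogeneous_partial_deriv F)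
 thus ?thesis unfolding F(2) ddir_partial[symmetric] by (simp add: mult.commute)
qed

lemma ddir_linear:
 fixes f :: "'k::alg_closed_field^4 => 'k"
 assumes "hpoly d f"
 obtains c where "!!w. ddir f x w = (\<Sum>i\<in>UNIV. c i * w $ i)"
proof -
 obtain F where F: "f = (%x. eval_mpoly (($) x) F)" using assms unfolding hpoly_def by blast
 show ?thesis
  by (rule that[of "%i. eval_mpoly (($) x) (partial_deriv i F)"]) (simp add: F ddir_partial)
qed

lemma affine_tangent_space_altdef:
 fixes x :: "'k::alg_closed_field^4"
 shows "affine_tangent_space Z x =
  {w. \<forall>d f. hpoly d f --> (\<forall>z\<in>Z. f z = 0) --> ddir f x w = 0}"
 unfolding affine_tangent_space_def ddir_partial hpoly_def by blast


section \<open>Closed and irreducible sets\<close>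

lemma proj_closed_altdef:
 "proj_closed Z \<longleftrightarrow> (\<exists>S. (\<forall>f\<in>S. \<exists>d. hpoly d f) & Z = {x. x ~= 0 & (\<forall>f\<in>S. f x = 0)})"
 (is "_ \<longleftrightarrow> ?R")
proof
 assume "proj_closed Z"
 then obtain S :: "'a poly3 set" where S: "\<forall>F\<in>S. \<exists>d. homogeneous d F"
  "Z = {x. x ~= 0 & (\<forall>F\<in>S. eval_mpoly (($) x) F = 0)}" unfolding proj_closed_def by blast
 show ?R
 proof (intro exI[of _ "(%F x. eval_mpoly (($) x) F) ` S"] conjI ballI)
  fix f assume "f \<in> (%F x. eval_mpoly (($) x) F) ` S"
  then obtain F where "F \<in> S" "f = (%x. eval_mpoly (($) x) F)" by blast
  thus "\<exists>d. hpoly d f" using S(1) hpoly_eval by blast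
 qed (simp add: S(2))
next
 assume ?R
 then obtain S where S: "\<forall>f\<in>S. \<exists>d. hpoly d f" "Z = {x. x ~= 0 & (\<forall>f\<in>S. f x = 0)}" by blast
 show "proj_closed Z" unfolding proj_closed_def
  by (rule exI[of _ "{F. (\<exists>d. homogeneous d F) & (%x. eval_mpoly (($) x) F) \<in> S}"])
   (use S in \<open>fastforce simp: hpoly_def\<close>)
qed

lemma proj_closed_zero_set:
 "(!!f. f \<in> S ==> \<exists>d. hpoly d f) ==> proj_closed {x. x ~= 0 & (\<forall>f\<in>S. f x = 0)}"
 unfolding proj_closed_altdef by blast

lemma proj_closed_hypersurface: "hpoly d f ==> proj_closed {x. x ~= 0 & f x = 0}"
 using proj_closed_zero_set[of "{f}"] by auto

lemma proj_closed_Int: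
 assumes "proj_closed A" "proj_closed B"
 shows "proj_closed (A \<inter> B)"
proof -
 obtain S where S: "\<forall>f\<in>S. \<exists>d. hpoly d f" "A = {x. x ~= 0 & (\<forall>f\<in>S. f x = 0)}"
  using assms(1) unfolding proj_closed_altdef by blast
 obtain T where T: "\<forall>f\<in>T. \<exists>d. hpoly d f" "B = {x. x ~= 0 & (\<forall>f\<in>T. f x = 0)}"
  using assms(2) unfolding proj_closed_altdef by blast
 show ?thesis unfolding proj_closed_altdef by (rule exI[of _ "S \<union> T"]) (use S T in auto)
qed

lemma proj_closed_separate:
 assumes "proj_closed A" "x \<notin> A" "x ~= 0"
 obtains d f where "hpoly d f" "!!y. y \<in> A ==> f y = 0" "f x ~= 0"
 using assms unfolding proj_closed_altdef by blast

lemma proj_closed_nonzero: "proj_closed A ==> x \<in> A ==> x ~= 0" unfolding proj_closed_altdef by blast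

text \<open>A segment between two parameters may run through the excluded points s = t = 0 or u = v
  = 0, or make the scalar factor vanish, so finitely many parameters are allowed to leave
  \<open>Z\<close>.\<close>

definition poly_connected :: "('k::field^4) set => bool" where
 "poly_connected Z \<longleftrightarrow> (\<forall>x\<in>Z. \<forall>y\<in>Z. \<exists>X. (\<chi> i. poly (X i) 0) = x & (\<chi> i. poly (X i) 1) = y &
  finite {t. (\<chi> i. poly (X i) t) \<notin> Z})"

text \<open>On a path from a point with \<open>f\<close> nonzero to one with \<open>g\<close>
  nonzero, both restrict to nonzero univariate polynomials, whose product would have to vanish
  almost everywhere.\<close>

lemma poly_connected_zero_product:
 fixes Z :: "('k::alg_closed_field^4) set"
 assumes "poly_connected Z" "path_poly f" "path_poly g" "!!x. x \<in> Z ==> f x * g x = 0"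
 shows "(\<forall>x\<in>Z. f x = 0) | (\<forall>x\<in>Z. g x = 0)"
proof (rule ccontr)
 assume "\<not> ?thesis"
 then obtain x y where xy: "x \<in> Z" "f x ~= 0" "y \<in> Z" "g y ~= 0" by blast
 then obtain X where X: "(\<chi> i. poly (X i) 0) = x" "(\<chi> i. poly (X i) 1) = y"
  "finite {t. (\<chi> i. poly (X i) t) \<notin> Z}" using assms(1) unfolding poly_connected_def by blast
 obtain P where P: "!!t. poly P t = f (\<chi> i. poly (X i) t)"
  using assms(2) unfolding path_poly_def by blast
 obtain Q where Q: "!!t. poly Q t = g (\<chi> i. poly (X i) t)"
  using assms(3) unfolding path_poly_def by blast
 have "P * Q = 0"
 proof (rule poly_zeroI)
  fix t assume "t \<notin> {t. (\<chi> i. poly (X i) t) \<notin> Z}"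
  thus "poly (P * Q) t = 0" using assms(4) by (simp add: P Q)
 qed (rule X(3))
 moreover have "poly P 0 ~= 0" "poly Q 1 ~= 0" using xy X P Q by auto
 ultimately show False by auto
qed

lemma proj_irreducibleI:
 fixes Z :: "('k::alg_closed_field^4) set"
 assumes "proj_closed Z" "Z ~= {}" "poly_connected Z"
 shows "proj_irreducible Z" unfolding proj_irreducible_def
proof (intro conjI allI impI assms(1,2))
 fix A B assume AB: "proj_closed A" "proj_closed B" "Z = A \<union> B"
 show "Z = A | Z = B"
 proof (rule ccontr)
  assume "\<not> ?thesis"
  then obtain x y where xy: "x \<in> Z" "x \<notin> A" "y \<in> Z" "y \<notin> B" using AB by blast
  hence nz: "x ~= 0" "y ~= 0" using assms(1) proj_closed_nonzero by blast+
  obtain d f where f: "hpoly d f" "!!y. y \<in> A ==> f y = 0" "f x ~= 0"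
   using proj_closed_separate[OF AB(1) xy(2) nz(1)] by blast
  obtain e g where g: "hpoly e g" "!!z. z \<in> B ==> g z = 0" "g y ~= 0"
   using proj_closed_separate[OF AB(2) xy(4) nz(2)] by blast
  have "(\<forall>x\<in>Z. f x = 0) | (\<forall>x\<in>Z. g x = 0)"
   by (rule poly_connected_zero_product[OF assms(3) path_poly_hpoly[OF f(1)] path_poly_hpoly[OF g(1)]])
    (use AB f g in auto)
  thus False using xy f g by blast
 qed
qed

lemma proj_irreducible_zero_product:
 assumes "proj_irreducible Z" "hpoly d f" "hpoly e g" "!!x. x \<in> Z ==> f x * g x = 0"
 shows "(\<forall>x\<in>Z. f x = 0) | (\<forall>x\<in>Z. g x = 0)"
proof -
 have cl: "proj_closed Z" using assms(1) unfolding proj_irreducible_def by blast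
 have "proj_closed (Z \<inter> {x. x ~= 0 & f x = 0})" "proj_closed (Z \<inter> {x. x ~= 0 & g x = 0})"
  by (intro proj_closed_Int cl proj_closed_hypersurface[OF assms(2)]
    proj_closed_hypersurface[OF assms(3)])+
 moreover have "Z = (Z \<inter> {x. x ~= 0 & f x = 0}) \<union> (Z \<inter> {x. x ~= 0 & g x = 0})"
  using assms(4) proj_closed_nonzero[OF cl] by auto
 ultimately have "Z = Z \<inter> {x. x ~= 0 & f x = 0} | Z = Z \<inter> {x. x ~= 0 & g x = 0}"
  using assms(1) unfolding proj_irreducible_def by blast
 thus ?thesis by blast
qed

lemma proj_irreducible_subset_Un:
 assumes "proj_irreducible Z" "proj_closed A" "proj_closed B" "Z \<subseteq> A \<union> B"
 shows "Z \<subseteq> A | Z \<subseteq> B"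
proof -
 have "proj_closed Z" using assms(1) by (simp add: proj_irreducible_def)
 hence "proj_closed (Z \<inter> A)" "proj_closed (Z \<inter> B)" using assms(2,3) by (auto intro: proj_closed_Int)
 moreover have "Z = (Z \<inter> A) \<union> (Z \<inter> B)" using assms(4) by auto
 ultimately show ?thesis using assms(1) unfolding proj_irreducible_def by blast
qed

lemma proj_closed_Un:
 assumes "proj_closed A" "proj_closed B"
 shows "proj_closed (A \<union> B)"
proof -
 obtain S where S: "\<forall>f\<in>S. \<exists>d. hpoly d f" "A = {x. x ~= 0 & (\<forall>f\<in>S. f x = 0)}"
  using assms(1) unfolding proj_closed_altdef by blast
 obtain T where T: "\<forall>f\<in>T. \<exists>d. hpoly d f" "B = {x. x ~= 0 & (\<forall>f\<in>T. f x = 0)}"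
  using assms(2) unfolding proj_closed_altdef by blast
 show ?thesis unfolding proj_closed_altdef
 proof (intro exI[of _ "(%(f, g) x. f x * g x) ` (S \<times> T)"] conjI ballI)
  fix h assume "h \<in> (%(f, g) x. f x * g x) ` (S \<times> T)"
  then obtain f g where "f \<in> S" "g \<in> T" "h = (%x. f x * g x)" by auto
  thus "\<exists>d. hpoly d h" using S(1) T(1) hpoly_mult by blast
 next
  show "A \<union> B = {x. x ~= 0 & (\<forall>h\<in>(%(f, g) x. f x * g x) ` (S \<times> T). h x = 0)}"
   unfolding S(2) T(2) by auto
 qed
qed

lemma proj_closed_empty: "proj_closed {}"
 using proj_closed_hypersurface[OF hpoly_const[of 1]] by simp

lemma proj_closed_Union_finite: "finite \<Y> ==> (!!Y. Y \<in> \<Y> ==> proj_closed Y) ==> proj_closed (\<Union>\<Y>)"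
 by (induction \<Y> rule: finite_induct) (auto intro: proj_closed_Un proj_closed_empty)

lemma proj_irreducible_subset_Union:
 assumes "finite \<Y>" "!!Y. Y \<in> \<Y> ==> proj_closed Y" "proj_irreducible Z" "Z \<subseteq> \<Union>\<Y>"
 shows "\<exists>Y\<in>\<Y>. Z \<subseteq> Y" using assms
proof (induction \<Y> rule: finite_induct)
 case empty
 thus ?case by (auto simp: proj_irreducible_def)
next
 case (insert Y \<Y>)
 have "Z \<subseteq> Y | Z \<subseteq> \<Union>\<Y>"
  using insert by (intro proj_irreducible_subset_Un proj_closed_Union_finite) auto
 thus ?case using insert by blast
qed

lemma proj_irreducible_point:
 fixes x :: "'k::alg_closed_field^4"
 assumes "x ~= 0"
 shows "proj_irreducible {c *s x | c. c ~= 0}"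
proof (rule proj_irreducibleI)
 obtain i where i: "x $ i ~= 0" using assms by (auto simp: vec_eq_iff)
 have eq: "{c *s x | c. c ~= 0} =
  {y. y ~= 0 & (\<forall>f\<in>range (%j y. x $ i * y $ j - x $ j * y $ i). f y = 0)}"
 proof (intro equalityI subsetI)
  fix y assume "y \<in> {y. y ~= 0 & (\<forall>f\<in>range (%j y. x $ i * y $ j - x $ j * y $ i). f y = 0)}"
  hence y: "y ~= 0" "!!j. x $ i * y $ j = x $ j * y $ i" by auto
  have "y = (y $ i / x $ i) *s x" using i y(2) by (simp add: vec_eq_iff field_simps)
  moreover from this have "y $ i / x $ i ~= 0" using y(1) by auto
  ultimately show "y \<in> {c *s x | c. c ~= 0}" by blast
 qed (use assms in \<open>auto simp: vec_eq_iff\<close>)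
 show "proj_closed {c *s x | c. c ~= 0}" unfolding eq
  by (intro proj_closed_zero_set) (auto intro!: exI[of _ 1] hpoly_diff hpoly_smult hpoly_coord simp del: One_nat_def)
 show "{c *s x | c. c ~= 0} ~= {}" by (auto intro: exI[of _ 1])
 show "poly_connected {c *s x | c. c ~= 0}" unfolding poly_connected_def
 proof (intro ballI)
  fix y z assume "y \<in> {c *s x | c. c ~= 0}" "z \<in> {c *s x | c. c ~= 0}"
  then obtain a b where ab: "a ~= 0" "b ~= 0" "y = a *s x" "z = b *s x" by blast
  define X where "X = (%i. [:a, b - a:] * [:x $ i:])"
  have "(\<chi> i. poly (X i) t) = poly [:a, b - a:] t *s x" for t by (simp add: X_def vec_eq_iff)
  moreover from this have "{t. (\<chi> i. poly (X i) t) \<notin> {c *s x | c. c ~= 0}} \<subseteq> {t. poly [:a, b - a:] t = 0}"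
   by (auto; blast)
  moreover have "finite {t. poly [:a, b - a:] t = 0}" using ab by (intro poly_roots_finite) simp
  ultimately show "\<exists>X. (\<chi> i. poly (X i) 0) = y & (\<chi> i. poly (X i) 1) = z &
    finite {t. (\<chi> i. poly (X i) t) \<notin> {c *s x | c. c ~= 0}}"
   using ab by (intro exI[of _ X]) (auto intro: finite_subset)
 qed
qed

section \<open>Parametrized sets\<close>

interpretation fun_space: vector_space "%(c :: 'k::field) f (x :: 'a). c * f x"
proof
 fix a b :: 'k and f g :: "'a => 'k"
 show "(%x. a * (f + g) x) = (%x. a * f x) + (%x. a * g x)" by (rule ext) (simp add: distrib_left)
 show "(%x. (a + b) * f x) = (%x. a * f x) + (%x. b * f x)" by (rule ext) (simp add: distrib_right)
 show "(%x. a * (b * f x)) = (%x. a * b * f x)" by (rule ext) (simp add: mult.assoc)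
 show "(%x. 1 * f x) = f" by (rule ext) simp
qed

definition bmon :: "nat => nat => nat \<times> nat => 'k quad => 'k::field" where
 "bmon a b = (%(i, j) (s, t, u, v). s ^ i * t ^ (a - i) * u ^ j * v ^ (b - j))"

text \<open>Membership in the span of (a + 1)(b + 1) monomial functions; the bound on the dimension
  is read off from this spanning set.\<close>

definition bform :: "nat => nat => ('k quad => 'k::field) => bool" where
 "bform a b f \<longleftrightarrow> f \<in> fun_space.span (bmon a b ` ({..a} \<times> {..b}))"

lemma bform_add: "bform a b f ==> bform a b g ==> bform a b (%x. f x + g x)"
 unfolding bform_def using fun_space.span_add[of f _ g] by (simp add: plus_fun_def)

lemma bform_smult: "bform a b f ==> bform a b (%x. c * f x)"
 unfolding bform_def by (rule fun_space.span_scale)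

lemma bform_0: "bform a b (%x. 0)"
 unfolding bform_def using fun_space.span_zero by (simp add: zero_fun_def)

lemma bform_sum: "(!!i. i \<in> A ==> bform a b (f i)) ==> bform a b (%x. \<Sum>i\<in>A. f i x)"
 by (induction A rule: infinite_finite_induct) (auto intro: bform_0 bform_add)

lemma bform_bmon: "i \<le> a ==> j \<le> b ==> bform a b (bmon a b (i, j))"
 unfolding bform_def by (rule fun_space.span_base) auto

lemma bform_induct [consumes 1, case_names zero step]:
 assumes "bform a b f" "P (%x. 0)"
  "!!c i j g. i \<le> a ==> j \<le> b ==> P g ==> P (%x. c * bmon a b (i, j) x + g x)"
 shows "P f" using assms(1) unfolding bform_def
proof (induction rule: fun_space.span_induct_alt)
 case base
 thus ?case using assms(2) by (simp add: zero_fun_def)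
next
 case (step c x y)
 then obtain i j where "i \<le> a" "j \<le> b" "x = bmon a b (i, j)" by auto
 thus ?case using assms(3)[of i j y c] step by (simp add: plus_fun_def)
qed

lemma bmon_mult:
 assumes "i \<le> a" "j \<le> b" "i' \<le> a'" "j' \<le> b'"
 shows "bmon a b (i, j) x * bmon a' b' (i', j') x = bmon (a + a') (b + b') (i + i', j + j') x"
proof -
 have "a + a' - (i + i') = (a - i) + (a' - i')" "b + b' - (j + j') = (b - j) + (b' - j')"
  using assms by auto
 thus ?thesis by (cases x) (simp add: bmon_def power_add)
qed

lemma bform_mult:
 assumes "bform a b f" "bform a' b' g"
 shows "bform (a + a') (b + b') (%x. f x * g x)" using assms(1)
proof (induction rule: bform_induct)
 case zero
 thus ?case by (simp add: bform_0)
next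
 case (step c i j f)
 have "bform (a + a') (b + b') (%x. bmon a b (i, j) x * g x)" using assms(2)
 proof (induction rule: bform_induct)
  case zero
  thus ?case by (simp add: bform_0)
 next
  case (step c' i' j' g)
  have "bform (a + a') (b + b') (%x. c' * bmon (a + a') (b + b') (i + i', j + j') x +
    bmon a b (i, j) x * g x)"
   using step \<open>i \<le> a\<close> \<open>j \<le> b\<close> by (intro bform_add bform_smult bform_bmon) auto
  moreover have "c' * bmon (a + a') (b + b') (i + i', j + j') x + bmon a b (i, j) x * g x =
   bmon a b (i, j) x * (c' * bmon a' b' (i', j') x + g x)" for x
   using bmon_mult[of i a j b i' a' j' b' x] step \<open>i \<le> a\<close> \<open>j \<le> b\<close> by (simp add: algebra_simps)
  ultimately show ?case by simp
 qed
 hence "bform (a + a') (b + b') (%x. c * (bmon a b (i, j) x * g x) + f x * g x)"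
  using step by (intro bform_add bform_smult)
 thus ?case by (simp add: ring_distribs mult.assoc)
qed

lemma bform_1: "bform 0 0 (%x. 1)"
 using bform_bmon[of 0 0 0 0] by (simp add: bmon_def case_prod_unfold)

lemma bform_power: "bform a b f ==> bform (a * n) (b * n) (%x. f x ^ n)"
 by (induction n) (auto intro: bform_1 bform_mult)

lemma bform_prod:
 "finite A ==> (!!i. i \<in> A ==> bform (a * d i) (b * d i) (f i)) ==>
  bform (a * (\<Sum>i\<in>A. d i)) (b * (\<Sum>i\<in>A. d i)) (%x. \<Prod>i\<in>A. f i x)"
 by (induction A rule: finite_induct) (auto intro: bform_1 bform_mult simp: ring_distribs)

lemma bform_hpoly:
 assumes "!!i. bform a b (%x. Phi x $ i)" "hpoly d f"
 shows "bform (a * d) (b * d) (%x. f (Phi x))"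
proof -
 obtain F where F: "homogeneous d F" "f = (%x. eval_mpoly (($) x) F)"
  using assms(2) unfolding hpoly_def by blast
 have "bform (a * d) (b * d) (%x. \<Prod>v\<in>keys m. Phi x $ v ^ lookup m v)"
  if "m \<in> keys F" for m
 proof -
  have "d = (\<Sum>v\<in>keys m. lookup m v)" using F(1) that by (auto simp: homogeneous_def)
  thus ?thesis by (simp only:) (intro bform_prod bform_power assms(1) finite_keys)
 qed
 thus ?thesis unfolding F(2) eval_mpoly_def by (intro bform_sum bform_smult)
qed

lemma bform_path:
 assumes "bform a b f"
 shows "\<exists>P. \<forall>tau. poly P tau = f (poly S tau, poly T tau, poly U tau, poly V tau)" using assms
proof (induction rule: bform_induct)
 case zero
 show ?case by (intro exI[of _ 0]) simp
next
 case (step c i j g)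
 then obtain P where "!!tau. poly P tau = g (poly S tau, poly T tau, poly U tau, poly V tau)" by blast
 thus ?case
  by (intro exI[of _ "[:c:] * (S ^ i * T ^ (a - i) * U ^ j * V ^ (b - j)) + P"]) (simp add: bmon_def)
qed

definition param_dom :: "('k::field quad) set" where
 "param_dom = {(s, t, u, v). nz s t & nz u v}"

definition surf :: "('k quad => 'k::field^4) => ('k^4) set" where
 "surf Phi = {c *s Phi x | c x. c ~= 0 & x \<in> param_dom}"

lemma surfI: "c ~= 0 ==> nz s t ==> nz u v ==> c *s Phi (s, t, u, v) \<in> surf Phi"
 unfolding surf_def param_dom_def by blast

lemma surfE:
 assumes "x \<in> surf Phi"
 obtains c s t u v where "c ~= 0" "nz s t" "nz u v" "x = c *s Phi (s, t, u, v)"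
 using assms unfolding surf_def param_dom_def by blast

lemma surf_nonempty: "surf Phi ~= {}" using surfI[of 1 1 0 1 0 Phi] by auto

lemma finite_linear_roots:
 fixes a b :: "'k::alg_closed_field"
 shows "a ~= 0 ==> finite {t. poly [:a, b:] t = 0}" by (intro poly_roots_finite) simp

text \<open>All five quantities, the scalar and the four parameters, are interpolated linearly. At
  parameter 0 the excluded conditions fail, so each of them cuts out only finitely many
  roots.\<close>

lemma poly_connected_surf:
 fixes Phi :: "'k quad => 'k::alg_closed_field^4"
 assumes "!!i. bform a b (%x. Phi x $ i)"
 shows "poly_connected (surf Phi)" unfolding poly_connected_def
proof (intro ballI)
 fix x y assume "x \<in> surf Phi" "y \<in> surf Phi"
 then obtain c s t u v c' s' t' u' v' where
  x: "c ~= 0" "nz s t" "nz u v" "x = c *s Phi (s, t, u, v)" and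
  y: "c' ~= 0" "nz s' t'" "nz u' v'" "y = c' *s Phi (s', t', u', v')" by (metis surfE)
 define L where "L = (%a b :: 'k. [:a, b - a:])"
 have "\<exists>P. \<forall>tau. poly P tau = Phi (poly (L s s') tau, poly (L t t') tau, poly (L u u') tau, poly (L v v') tau) $ i" for i
  using bform_path[OF assms] .
 then obtain P where P: "!!i tau. poly (P i) tau =
   Phi (poly (L s s') tau, poly (L t t') tau, poly (L u u') tau, poly (L v v') tau) $ i" by metis
 define X where "X = (%i. L c c' * P i)"
 have X: "(\<chi> i. poly (X i) tau) = poly (L c c') tau *s
   Phi (poly (L s s') tau, poly (L t t') tau, poly (L u u') tau, poly (L v v') tau)" for tau
  by (simp add: X_def P vec_eq_iff)
 define Z where "Z = (%a a' :: 'k. {tau. poly (L a a') tau = 0})"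
 have fin: "finite (Z a a')" if "a ~= 0" for a a'
  using finite_linear_roots[OF that] by (simp add: Z_def L_def)
 have "{tau. (\<chi> i. poly (X i) tau) \<notin> surf Phi} \<subseteq> Z c c' \<union> (Z s s' \<inter> Z t t') \<union> (Z u u' \<inter> Z v v')"
  unfolding X Z_def using surfI by blast
 moreover have "finite (Z c c' \<union> (Z s s' \<inter> Z t t') \<union> (Z u u' \<inter> Z v v'))" using x fin by auto
 ultimately have "finite {tau. (\<chi> i. poly (X i) tau) \<notin> surf Phi}" by (rule finite_subset)
 moreover have "(\<chi> i. poly (X i) 0) = x" "(\<chi> i. poly (X i) 1) = y"
  unfolding X by (simp_all add: L_def x y)
 ultimately show "\<exists>X. (\<chi> i. poly (X i) 0) = x & (\<chi> i. poly (X i) 1) = y &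
   finite {tau. (\<chi> i. poly (X i) tau) \<notin> surf Phi}" by blast
qed

lemma proj_irreducible_surf:
 fixes Phi :: "'k quad => 'k::alg_closed_field^4"
 assumes "!!i. bform a b (%x. Phi x $ i)" "proj_closed (surf Phi)"
 shows "proj_irreducible (surf Phi)"
 using assms by (intro proj_irreducibleI surf_nonempty poly_connected_surf)


section \<open>Dimension by counting independent forms\<close>

definition indep_on :: "'a set => 'b set => ('b => 'a => 'k::field) => bool" where
 "indep_on Z A g \<longleftrightarrow>
  (\<forall>tha. (\<forall>x\<in>Z. (\<Sum>a\<in>A. tha a * g a x) = 0) --> (\<forall>a\<in>A. tha a = 0))"

lemma sum_fun_at: "(\<Sum>i\<in>A. f i) x = (\<Sum>i\<in>A. f i x :: 'k::comm_monoid_add)"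
 by (induction A rule: infinite_finite_induct) auto

lemma indep_on_card_le:
 fixes g :: "'b => 'a => 'k::field"
 assumes "indep_on UNIV A g" "finite A" "!!a. a \<in> A ==> g a \<in> fun_space.span B" "finite B"
 shows "card A \<le> card B"
proof -
 have inj: "inj_on g A"
 proof (rule inj_onI, rule ccontr)
  fix a b assume ab: "a \<in> A" "b \<in> A" "g a = g b" "a ~= b"
  define tha where "tha = (%c. if c = a then 1 else if c = b then - 1 else 0 :: 'k)"
  have "(\<Sum>c\<in>A. tha c * g c x) = 0" for x
  proof -
   have "(\<Sum>c\<in>A. tha c * g c x) = (\<Sum>c\<in>{a, b}. tha c * g c x)"
    using ab assms(2) by (intro sum.mono_neutral_right) (auto simp: tha_def)
   thus ?thesis using ab by (simp add: tha_def)
  qed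
  hence "tha a = 0" using assms(1) ab unfolding indep_on_def by blast
  thus False by (simp add: tha_def)
 qed
 have "fun_space.independent (g ` A)" unfolding fun_space.independent_explicit_module
 proof (intro allI impI)
  fix T u f assume T: "finite T" "T \<subseteq> g ` A" "(\<Sum>f\<in>T. (%x. u f * f x)) = 0" "f \<in> T"
  define tha where "tha = (%a. if g a \<in> T then u (g a) else 0)"
  have "(\<Sum>a\<in>A. tha a * g a x) = 0" for x
  proof -
   have "(\<Sum>a\<in>A. tha a * g a x) = (\<Sum>f\<in>g ` A. (if f \<in> T then u f else 0) * f x)"
    by (subst sum.reindex[OF inj]) (simp add: tha_def)
   also have "\<dots> = (\<Sum>f\<in>T. u f * f x)" using T assms(2) by (intro sum.mono_neutral_cong_right) auto
   also have "\<dots> = (\<Sum>f\<in>T. (%x. u f * f x)) x" by (simp add: sum_fun_at)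
   finally show ?thesis using T(3) by simp
  qed
  hence "\<forall>a\<in>A. tha a = 0" using assms(1) unfolding indep_on_def by blast
  moreover obtain a where "a \<in> A" "f = g a" using T by blast
  ultimately show "u f = 0" using T(4) by (auto simp: tha_def)
 qed
 hence "card (g ` A) \<le> card B" using fun_space.independent_span_bound[OF assms(4)] assms(3) by blast
 thus ?thesis using card_image[OF inj] by simp
qed

text \<open>Pulling back along \<open>Phi\<close> keeps forms independent, by homogeneity, and lands
  in the span of the monomials of bidegree (a d, b d).\<close>

lemma indep_on_surf_card_le:
 fixes Phi :: "'k quad => 'k::alg_closed_field^4"
 assumes "!!i. bform a b (%x. Phi x $ i)" "!!c. c \<in> A ==> hpoly d (g c)" "finite A"
  "indep_on (surf Phi) A g"
 shows "card A \<le> (a * d + 1) * (b * d + 1)"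
proof -
 have "indep_on UNIV A (%c x. g c (Phi x))" unfolding indep_on_def
 proof (intro allI impI)
  fix tha assume *: "\<forall>x\<in>UNIV. (\<Sum>c\<in>A. tha c * g c (Phi x)) = 0"
  have "(\<Sum>c\<in>A. tha c * g c y) = 0" if "y \<in> surf Phi" for y
  proof -
   obtain r x where "y = r *s Phi x" using \<open>y \<in> surf Phi\<close> by (auto simp: surf_def)
   hence "(\<Sum>c\<in>A. tha c * g c y) = r ^ d * (\<Sum>c\<in>A. tha c * g c (Phi x))" unfolding sum_distrib_left
    by (intro sum.cong) (auto simp: hpoly_scale[OF assms(2)] mult.left_commute)
   thus ?thesis using * by simp
  qed
  thus "\<forall>c\<in>A. tha c = 0" using assms(4) unfolding indep_on_def by blast
 qed
 moreover have "(%x. g c (Phi x)) \<in> fun_space.span (bmon (a * d) (b * d) ` ({..a * d} \<times> {..b * d}))"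
  if "c \<in> A" for c using bform_hpoly[OF assms(1) assms(2)[OF that]] unfolding bform_def .
 ultimately have "card A \<le> card (bmon (a * d) (b * d) ` ({..a * d} \<times> {..b * d}) ::
   ('k quad => 'k) set)" using assms(3) by (intro indep_on_card_le) auto
 also have "\<dots> \<le> card ({..a * d} \<times> {..b * d})" by (intro card_image_le) auto
 finally show ?thesis by simp
qed

text \<open>\<open>f\<close> vanishes on \<open>Z'\<close> but is no zero divisor on
  \<open>Z\<close>. In a relation between the products, the lowest occurring power of
  \<open>f\<close> can be cancelled; restriction to \<open>Z'\<close> then kills all higher powers
  and leaves a relation between the \<open>g a\<close>. Powers of \<open>l\<close> equalize the
  degrees, and the extra factor \<open>l x ^ j\<close> is carried along so that the independence
  statement reproduces itself.\<close>

lemma indep_on_step: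
 assumes irr: "!!h d. hpoly d h ==> (\<forall>x\<in>Z. f x * h x = 0) ==> (\<forall>x\<in>Z. h x = 0)"
  and "Z' \<subseteq> Z" and f0: "!!x. x \<in> Z' ==> f x = 0"
  and f: "hpoly e f" and l: "hpoly e l" and g: "!!a. a \<in> A ==> hpoly d (g a)"
  and ind: "!!j. indep_on Z' A (%a x. l x ^ j * g a x)" and "finite A"
 shows "indep_on Z ({..<N} \<times> A) (%(k, a) x. l x ^ j * (l x ^ (N - k) * f x ^ k * g a x))"
 unfolding indep_on_def
proof (intro allI impI)
 fix tha assume "\<forall>x\<in>Z. (\<Sum>c\<in>{..<N} \<times> A. tha c * (case c of (k, a) =>
   %x. l x ^ j * (l x ^ (N - k) * f x ^ k * g a x)) x) = 0"
 define h where "h = (%k x. l x ^ (j + (N - k)) * (\<Sum>a\<in>A. tha (k, a) * g a x))"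
 have *: "(\<Sum>k<N. f x ^ k * h k x) = 0" if "x \<in> Z" for x
 proof -
  have "0 = (\<Sum>c\<in>{..<N} \<times> A. tha c * (case c of (k, a) =>
   %x. l x ^ j * (l x ^ (N - k) * f x ^ k * g a x)) x)" using \<open>\<forall>x\<in>Z. _\<close> that by simp
  also have "\<dots> = (\<Sum>k<N. \<Sum>a\<in>A. tha (k, a) * (l x ^ j * (l x ^ (N - k) * f x ^ k * g a x)))"
   by (simp add: sum.cartesian_product case_prod_unfold)
  also have "\<dots> = (\<Sum>k<N. f x ^ k * h k x)"
  proof (intro sum.cong refl)
   fix k
   have ac: "th * (p * (q * r * s)) = r * (p * q * (th * s))" for th p q r s :: 'a by algebra
   show "(\<Sum>a\<in>A. tha (k, a) * (l x ^ j * (l x ^ (N - k) * f x ^ k * g a x))) = f x ^ k * h k x"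
    unfolding h_def sum_distrib_left power_add by (intro sum.cong refl ac)
  qed
  finally show ?thesis ..
 qed
 have cancel: "\<forall>x\<in>Z. h x = 0" if "\<forall>x\<in>Z. f x ^ n * h x = 0" "hpoly D h" for n D h using that(1)
 proof (induction n)
  case (Suc m)
  have "hpoly (e * m + D) (%x. f x ^ m * h x)" using that(2) by (intro hpoly_mult hpoly_power f)
  moreover have "\<forall>x\<in>Z. f x * (f x ^ m * h x) = 0"
   using Suc.prems by (simp only: power_Suc mult.assoc)
  ultimately show ?case using irr Suc.IH by blast
 qed simp
 have zero: "tha (k, a) = 0" if "k < N" "a \<in> A" for k a using that
 proof (induction k arbitrary: a rule: less_induct)
  case (less k0)
  have h0: "h k x = 0" if "k < k0" for k x unfolding h_def using less that by simp
  define h' where "h' = (%x. \<Sum>k\<in>{k0..<N}. f x ^ (k - k0) * h k x)"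
  have "f x ^ k0 * h' x = 0" if "x \<in> Z" for x
  proof -
   have "0 = (\<Sum>k<N. f x ^ k * h k x)" using *[OF that] by simp
   also have "\<dots> = (\<Sum>k\<in>{k0..<N}. f x ^ k * h k x)" using h0 by (intro sum.mono_neutral_right) auto
   also have "\<dots> = f x ^ k0 * h' x" unfolding h'_def sum_distrib_left
    by (intro sum.cong refl) (simp add: mult.assoc[symmetric] flip: power_add)
   finally show ?thesis ..
  qed
  moreover have hp: "hpoly (e * (j + N - k0) + d) h'" unfolding h'_def
  proof (intro hpoly_sum)
   fix k assume k: "k \<in> {k0..<N}"
   have "hpoly (e * (k - k0) + (e * (j + (N - k)) + d)) (%x. f x ^ (k - k0) * h k x)"
    unfolding h_def by (intro hpoly_mult hpoly_power hpoly_sum hpoly_smult f l g)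
   moreover have "e * (k - k0) + (e * (j + (N - k)) + d) = e * ((k - k0) + (j + (N - k))) + d"
    by (simp add: ring_distribs)
   moreover have "(k - k0) + (j + (N - k)) = j + N - k0" using k by auto
   ultimately show "hpoly (e * (j + N - k0) + d) (%x. f x ^ (k - k0) * h k x)" by simp
  qed
  ultimately have "\<forall>x\<in>Z. h' x = 0" using cancel by blast
  \<comment> \<open>After cancelling f^k0, only the term k = k0 survives on \<open>Z'\<close>, all
    others containing a positive power of \<open>f\<close>.\<close>
  have "l x ^ (j + (N - k0)) * (\<Sum>a\<in>A. tha (k0, a) * g a x) = 0" if "x \<in> Z'" for x
  proof -
   have "0 = h' x" using \<open>\<forall>x\<in>Z. h' x = 0\<close> that assms(2) by auto
   also have "\<dots> = (\<Sum>k\<in>{k0}. f x ^ (k - k0) * h k x)" unfolding h'_def using less.prems f0[OF that]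
    by (intro sum.mono_neutral_right) (auto simp: power_0_left)
   finally show ?thesis by (simp add: h_def)
  qed
  hence "\<forall>x\<in>Z'. (\<Sum>a\<in>A. tha (k0, a) * (l x ^ (j + (N - k0)) * g a x)) = 0"
   by (simp add: sum_distrib_left mult.left_commute)
  thus ?case using ind[of "j + (N - k0)"] less.prems
   unfolding indep_on_def by (elim allE[of _ "%a. tha (k0, a)"]) blast
 qed
 show "\<forall>c\<in>{..<N} \<times> A. tha c = 0" using zero by auto
qed

lemma hpoly_step:
 assumes "hpoly e f" "hpoly e l" "hpoly d g" "k \<le> N"
 shows "hpoly (e * N + d) (%x. l x ^ (N - k) * f x ^ k * g x)"
proof -
 have "hpoly (e * (N - k) + e * k + d) (%x. l x ^ (N - k) * f x ^ k * g x)"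
  using assms by (intro hpoly_mult hpoly_power)
 moreover have "e * (N - k) + e * k = e * N" using assms(4) by (simp flip: add_mult_distrib2)
 ultimately show ?thesis by simp
qed

lemma indep_on_reindex:
 assumes "inj_on h A" "indep_on Z A (%a. g (h a))"
 shows "indep_on Z (h ` A) g" unfolding indep_on_def
proof (intro allI impI)
 fix tha assume "\<forall>x\<in>Z. (\<Sum>b\<in>h ` A. tha b * g b x) = 0"
 hence "\<forall>x\<in>Z. (\<Sum>a\<in>A. tha (h a) * g (h a) x) = 0" by (simp add: sum.reindex[OF assms(1)])
 thus "\<forall>b\<in>h ` A. tha b = 0"
  using assms(2) unfolding indep_on_def by (auto dest: spec[of _ "%a. tha (h a)"])
qed

lemma indep_on_mono: "indep_on Z A g ==> Z \<subseteq> Z' ==> indep_on Z' A g" unfolding indep_on_def by blast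

section \<open>Chains of irreducible sets and the growth of independent forms\<close>

lemma proj_irreducible_separate:
 assumes "proj_irreducible Y" "proj_irreducible Z" "Y \<subset> Z"
 obtains e f where "e > 0" "hpoly e f" "!!x. x \<in> Y ==> f x = 0" "\<exists>x\<in>Z. f x ~= 0"
proof -
 have cl: "proj_closed Y" "proj_closed Z" "Y ~= {}"
  using assms(1,2) by (auto simp: proj_irreducible_def)
 obtain z where z: "z \<in> Z" "z \<notin> Y" using assms(3) by blast
 obtain e f where f: "hpoly e f" "!!x. x \<in> Y ==> f x = 0" "f z ~= 0"
  using proj_closed_separate[OF cl(1) z(2)] proj_closed_nonzero[OF cl(2) z(1)] by blast
 have "e > 0"
 proof (rule ccontr)
  assume "\<not> e > 0"
  hence const: "f x = f 0" for x using hpoly_scale[OF f(1), of 0 x] by simp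
  obtain y where "y \<in> Y" using cl(3) by blast
  thus False using f(2)[of y] f(3) const[of y] const[of z] by simp
 qed
 thus ?thesis using that f z by blast
qed

text \<open>Each inclusion of the chain multiplies the number of independent forms by
  \<open>N\<close>, through \<open>indep_on_step\<close>. The forms separating consecutive members
  are raised to powers of the common degree \<open>E\<close>, and \<open>l\<close> is the
  \<open>E\<close>-th power of a coordinate that does not vanish at a point of \<open>Y 0\<close>.
  The index lists record the exponents chosen at each stage.\<close>

lemma chain_family:
 fixes Y :: "nat => ('k::alg_closed_field^4) set"
 assumes irr: "!!i. i \<le> n ==> proj_irreducible (Y i)" and sub: "!!i. i < n ==> Y i \<subset> Y (Suc i)"
 obtains E where "!!N. \<exists>(A :: nat list set) g. finite A & card A = N ^ n &
  (\<forall>a\<in>A. hpoly (n * (E * N)) (g a)) & indep_on (Y n) A g"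
proof -
 have "\<exists>e f. e > 0 & hpoly e f & (\<forall>x\<in>Y i. f x = 0) & (\<exists>x\<in>Y (Suc i). f x ~= 0)" if "i < n" for i
  using proj_irreducible_separate[of "Y i" "Y (Suc i)"] irr[of i] irr[of "Suc i"] sub[OF that] that
  by (metis Suc_leI less_imp_le)
 then obtain e f where f: "!!i. i < n ==> e i > 0 & hpoly (e i) (f i) &
   (\<forall>x\<in>Y i. f i x = 0) & (\<exists>x\<in>Y (Suc i). f i x ~= 0)" by metis
 define E where "E = (\<Prod>i<n. e i)"
 have dvd: "e i dvd E" if "i < n" for i unfolding E_def using that by (intro dvd_prodI) auto
 have Epos: "E > 0" unfolding E_def using f by (intro prod_pos) auto
 define F where "F = (%i x. f i x ^ (E div e i))"
 have F: "hpoly E (F i)" "!!x. x \<in> Y i ==> F i x = 0" "\<exists>x\<in>Y (Suc i). F i x ~= 0" if "i < n" for i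
 proof -
  have "E div e i > 0" using f[OF that] dvd[OF that] Epos by (auto simp: div_greater_zero_iff dvd_imp_le)
  thus "!!x. x \<in> Y i ==> F i x = 0" using f[OF that] by (simp add: F_def)
  obtain x where "x \<in> Y (Suc i)" "f i x ~= 0" using f[OF \<open>i < n\<close>] by blast
  thus "\<exists>x\<in>Y (Suc i). F i x ~= 0" by (intro bexI[of _ x]) (simp_all add: F_def)
  have "hpoly (e i * (E div e i)) (F i)"
   unfolding F_def using f[OF that] by (intro hpoly_power) auto
  thus "hpoly E (F i)" using dvd[OF that] by simp
 qed
 obtain y0 where y0: "y0 \<in> Y 0" using irr[of 0] by (auto simp: proj_irreducible_def)
 have "y0 ~= 0" using irr[of 0] y0 proj_closed_nonzero by (auto simp: proj_irreducible_def)
 then obtain i0 where i0: "y0 $ i0 ~= 0" by (auto simp: vec_eq_iff)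
 define l where "l = (%x :: 'k^4. (x $ i0) ^ E)"
 have l: "hpoly E l" unfolding l_def using hpoly_power[OF hpoly_coord[of i0], of E] by simp
 have "\<exists>(A :: nat list set) g. finite A & card A = N ^ m & (\<forall>a\<in>A. hpoly (m * (E * N)) (g a)) &
   (\<forall>j. indep_on (Y m) A (%a x. l x ^ j * g a x))" if "m \<le> n" for m N using that
 proof (induction m)
  case 0
  have "indep_on (Y 0) {[]} (%a x. l x ^ j * 1)" for j
   unfolding indep_on_def using y0 i0 by (auto simp: l_def)
  thus ?case by (intro exI[of _ "{[]}"] exI[of _ "%a x. 1"]) (auto intro: hpoly_const)
 next
  case (Suc m)
  then obtain A :: "nat list set" and g where A: "finite A" "card A = N ^ m"
   "!!a. a \<in> A ==> hpoly (m * (E * N)) (g a)"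
   "!!j. indep_on (Y m) A (%a x. l x ^ j * g a x)" by auto
  have m: "m < n" using Suc by simp
  define h where "h = (%(k :: nat, a). k # a)"
  define g' where "g' = (%b x. l x ^ (N - hd b) * F m x ^ (hd b) * g (tl b) x)"
  have inj: "inj_on h ({..<N} \<times> A)" by (auto simp: inj_on_def h_def)
  have "indep_on (Y (Suc m)) (h ` ({..<N} \<times> A)) (%b x. l x ^ j * g' b x)" for j
  proof (rule indep_on_reindex[OF inj])
   have "indep_on (Y (Suc m)) ({..<N} \<times> A)
     (%(k, a) x. l x ^ j * (l x ^ (N - k) * F m x ^ k * g a x))"
   proof (rule indep_on_step[OF _ _ F(2)[OF m] F(1)[OF m] l A(3) A(4) A(1)])
    fix d q assume q: "hpoly d q" "\<forall>x\<in>Y (Suc m). F m x * q x = 0"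
    thus "\<forall>x\<in>Y (Suc m). q x = 0"
     using proj_irreducible_zero_product[OF irr F(1)[OF m] q(1), of "Suc m"] F(3)[OF m] m by auto
   qed (use sub[OF m] in auto)
   thus "indep_on (Y (Suc m)) ({..<N} \<times> A) (%a x. l x ^ j * g' (h a) x)"
    by (simp add: g'_def h_def case_prod_unfold)
  qed
  moreover have "hpoly (Suc m * (E * N)) (g' b)" if "b \<in> h ` ({..<N} \<times> A)" for b
  proof -
   obtain k a where "k < N" "a \<in> A" "b = k # a" using \<open>b \<in> _\<close> by (auto simp: h_def)
   thus ?thesis unfolding g'_def using hpoly_step[OF F(1)[OF m] l A(3), of a k N] by simp
  qed
  moreover have "card (h ` ({..<N} \<times> A)) = N ^ Suc m"
   using inj A by (simp add: card_image card_cartesian_product)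
  ultimately show ?case using A(1) by (intro exI[of _ "h ` ({..<N} \<times> A)"] exI[of _ g']) auto
 qed
 hence "\<exists>(A :: nat list set) g. finite A & card A = N ^ n &
   (\<forall>a\<in>A. hpoly (n * (E * N)) (g a)) & (\<forall>j. indep_on (Y n) A (%a x. l x ^ j * g a x))" for N
  by blast
 moreover have "indep_on (Y n) A g" if "\<forall>j. indep_on (Y n) A (%a x. l x ^ j * g a x)"
  for A :: "nat list set" and g using spec[OF that, of 0] by simp
 ultimately have "\<exists>(A :: nat list set) g. finite A & card A = N ^ n &
  (\<forall>a\<in>A. hpoly (n * (E * N)) (g a)) & indep_on (Y n) A g" for N by meson
 thus ?thesis by (rule that)
qed

lemma cubic_exceeds_product:
 fixes a b :: nat
 assumes "!!N. N ^ n \<le> (a * N + 1) * (b * N + 1)"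
 shows "n \<le> 2" "b = 0 ==> n \<le> 1"
proof -
 have lin: "a * N + 1 \<le> N * (a + 1)" if "N \<ge> 1" for a N :: nat
  using that by (simp add: algebra_simps)
 \<comment> \<open>Just larger than the coefficient (a + 1)(b + 1) of N^2 in the estimate that
   follows, which makes N^3 win.\<close>
 define N where "N = (a + 1) * (b + 1) + 1"
 have N: "N \<ge> 1" by (simp add: N_def)
 have "N ^ n \<le> (N * (a + 1)) * (N * (b + 1))"
  using assms[of N] lin[OF N, of a] lin[OF N, of b] by (meson le_trans mult_le_mono)
 also have "\<dots> = N ^ 2 * ((a + 1) * (b + 1))" by (simp only: power2_eq_square ac_simps)
 also have "\<dots> < N ^ 3" by (simp add: N_def power3_eq_cube power2_eq_square)
 finally show "n \<le> 2" using N power_increasing[of 3 n N] by (cases "n \<le> 2") auto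
 assume b: "b = 0"
 define N where "N = a + 2"
 have "N ^ n \<le> a * N + 1" using assms[of N] b by simp
 also have "\<dots> < N ^ 2" by (simp add: N_def power2_eq_square)
 finally show "n \<le> 1" using power_increasing[of 2 n N] by (cases "n \<le> 1") (auto simp: N_def)
qed

lemma chain_length_surf:
 fixes Phi :: "'k quad => 'k::alg_closed_field^4"
 assumes "!!i. bform a b (%x. Phi x $ i)"
  and "!!i. i \<le> n ==> proj_irreducible (Y i)" "!!i. i < n ==> Y i \<subset> Y (Suc i)" "Y n \<subseteq> surf Phi"
 shows "n \<le> 2" "b = 0 ==> n \<le> 1"
proof -
 obtain E where E: "!!N. \<exists>(A :: nat list set) g. finite A & card A = N ^ n &
  (\<forall>a\<in>A. hpoly (n * (E * N)) (g a)) & indep_on (Y n) A g"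
  using chain_family[of n Y, OF assms(2,3)] by blast
 have bound: "N ^ n \<le> (a * n * E * N + 1) * (b * n * E * N + 1)" for N
 proof -
  obtain A :: "nat list set" and g where "finite A & card A = N ^ n &
    (\<forall>a\<in>A. hpoly (n * (E * N)) (g a)) & indep_on (Y n) A g" using E[of N] by (elim exE)
  hence A: "finite A" "card A = N ^ n" "!!a. a \<in> A ==> hpoly (n * (E * N)) (g a)"
   "indep_on (Y n) A g" by blast+
  have "card A \<le> (a * (n * (E * N)) + 1) * (b * (n * (E * N)) + 1)"
   by (rule indep_on_surf_card_le[OF assms(1) A(3) A(1) indep_on_mono[OF A(4) assms(4)]])
  thus ?thesis by (simp add: A(2) mult.assoc)
 qed
 show "n \<le> 2" by (rule cubic_exceeds_product(1)[OF bound])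
 show "n \<le> 1" if "b = 0" by (rule cubic_exceeds_product(2)[OF bound]) (simp add: that)
qed

section \<open>Dimensions of parametrized curves and surfaces\<close>

lemma proj_dim_geI:
 assumes "!!i. i \<le> n ==> proj_irreducible (Y i)" "!!i. i < n ==> Y i \<subset> Y (Suc i)" "Y n \<subseteq> Z"
 shows "enat n \<le> proj_dim Z"
proof -
 have "Y i \<subseteq> Y n" if "i \<le> n" for i using that
 proof (induction rule: inc_induct)
  case (step m)
  thus ?case using assms(2)[of m] by auto
 qed simp
 thus ?thesis unfolding proj_dim_def using assms by (intro Sup_upper) blast
qed

lemma proj_dim_leI:
 assumes "!!n Y. (!!i. i \<le> n ==> proj_irreducible (Y i)) ==> (!!i. i < n ==> Y i \<subset> Y (Suc i)) ==>
  Y n \<subseteq> Z ==> n \<le> k"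
 shows "proj_dim Z \<le> enat k" unfolding proj_dim_def
proof (intro Sup_least)
 fix d assume "d \<in> {enat n |n. \<exists>Y. (\<forall>i\<le>n. proj_irreducible (Y i) & Y i \<subseteq> Z) & (\<forall>i<n. Y i \<subset> Y (Suc i))}"
 then obtain n Y where "d = enat n" "\<forall>i\<le>n. proj_irreducible (Y i) & Y i \<subseteq> Z" "\<forall>i<n. Y i \<subset> Y (Suc i)"
  by blast
 thus "d \<le> enat k" using assms[of n Y] by simp
qed

lemma proj_dim_gtE:
 assumes "enat k < proj_dim Z"
 obtains n Y where "n > k" "!!i. i \<le> n ==> proj_irreducible (Y i) & Y i \<subseteq> Z"
  "!!i. i < n ==> Y i \<subset> Y (Suc i)"
proof -
 obtain d where "enat k < d"
  "d \<in> {enat n |n. \<exists>Y. (\<forall>i\<le>n. proj_irreducible (Y i) & Y i \<subseteq> Z) & (\<forall>i<n. Y i \<subset> Y (Suc i))}"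
  using assms unfolding proj_dim_def less_Sup_iff by blast
 then obtain n Y where "enat k < enat n" "\<forall>i\<le>n. proj_irreducible (Y i) & Y i \<subseteq> Z"
  "\<forall>i<n. Y i \<subset> Y (Suc i)" by blast
 thus ?thesis using that[of n Y] by simp
qed

text \<open>The points \<open>x\<close> and \<open>y\<close> differ in projective space, so the
  point of \<open>x\<close> is a proper irreducible subset. Bidegree (a, 0) gives only linear growth
  and excludes longer chains.\<close>

lemma proj_dim_curve:
 fixes Phi :: "'k quad => 'k::alg_closed_field^4"
 assumes bf: "!!i. bform a 0 (%x. Phi x $ i)" and cl: "proj_closed (surf Phi)"
  and "x \<in> surf Phi" "y \<in> surf Phi" "!!c. y ~= c *s x"
 shows "proj_irreducible (surf Phi)" "proj_dim (surf Phi) = 1"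
proof -
 show irr: "proj_irreducible (surf Phi)" by (rule proj_irreducible_surf[OF bf cl])
 have "x ~= 0" using proj_closed_nonzero[OF cl] assms(3) by blast
 hence pt: "proj_irreducible {c *s x | c. c ~= 0}" by (rule proj_irreducible_point)
 define Y where "Y = (%i :: nat. if i = 0 then {c *s x | c. c ~= 0} else surf Phi)"
 have "{c *s x | c. c ~= 0} \<subset> surf Phi"
 proof -
  have "c *s x \<in> surf Phi" if "c ~= 0" for c
  proof -
   obtain r z where "r ~= 0" "z \<in> param_dom" "x = r *s Phi z"
    using assms(3) unfolding surf_def by blast
   thus ?thesis unfolding surf_def using that
    by (intro CollectI exI[of _ "c * r"] exI[of _ z]) (simp add: vector_smult_assoc)
  qed
  hence "{c *s x | c. c ~= 0} \<subseteq> surf Phi" by blast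
  moreover have "y \<notin> {c *s x | c. c ~= 0}" using assms(5) by blast
  ultimately show ?thesis using assms(4) by blast
 qed
 hence "enat 1 \<le> proj_dim (surf Phi)"
  using pt irr by (intro proj_dim_geI[of 1 Y]) (auto simp: Y_def)
 moreover have "proj_dim (surf Phi) \<le> enat 1"
  using chain_length_surf(2)[OF bf] by (intro proj_dim_leI) auto
 ultimately show "proj_dim (surf Phi) = 1" by (simp add: one_enat_def)
qed

text \<open>The lower bound comes from a chain in the curve \<open>C\<close>, continued by
  \<open>C\<close> and by the surface; the upper bound is the count of forms.\<close>

lemma proj_dim_surface:
 fixes Phi :: "'k quad => 'k::alg_closed_field^4"
 assumes bf: "!!i. bform a b (%x. Phi x $ i)" and cl: "proj_closed (surf Phi)"
  and C: "proj_irreducible C" "proj_dim C = 1" "C \<subset> surf Phi"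
 shows "proj_dim (surf Phi) = 2"
proof -
 have irr: "proj_irreducible (surf Phi)" by (rule proj_irreducible_surf[OF bf cl])
 have "enat 0 < proj_dim C" using C(2) by (simp add: enat_0)
 then obtain n Y where Y: "n > 0" "!!i. i \<le> n ==> proj_irreducible (Y i) & Y i \<subseteq> C"
  "!!i. i < n ==> Y i \<subset> Y (Suc i)" by (rule proj_dim_gtE) blast
 define Y' where "Y' = (%i :: nat. if i = 0 then Y 0 else if i = 1 then C else surf Phi)"
 have "Y 0 \<subset> C" using Y(2)[of 1] Y(3)[of 0] Y(1) by auto
 hence "enat 2 \<le> proj_dim (surf Phi)"
  using irr C Y(2)[of 0] by (intro proj_dim_geI[of 2 Y']) (auto simp: Y'_def less_Suc_eq numeral_2_eq_2)
 moreover have "proj_dim (surf Phi) \<le> enat 2"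
  using chain_length_surf(1)[OF bf] by (intro proj_dim_leI) auto
 ultimately show ?thesis by (simp add: numeral_eq_enat)
qed


section \<open>Components of a union of curves\<close>

text \<open>An irreducible subset of a finite union of closed sets lies in one of them. Two
  different nested curves would give a chain of length two inside a set of dimension one.\<close>

lemma irreducible_components_curves:
 assumes fin: "finite \<Y>" and irr: "!!Y. Y \<in> \<Y> ==> proj_irreducible Y"
  and dim: "!!Y. Y \<in> \<Y> ==> proj_dim Y = 1"
 shows "irreducible_components (\<Union>\<Y>) = \<Y>"
proof -
 have cl: "!!Y. Y \<in> \<Y> ==> proj_closed Y" using irr by (auto simp: proj_irreducible_def)
 have eq: "Y = Y'" if Y: "Y \<in> \<Y>" "Y' \<in> \<Y>" "Y \<subseteq> Y'" for Y Y'
 proof (rule ccontr)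
  assume "Y ~= Y'"
  have "enat 0 < proj_dim Y" using dim[OF Y(1)] by (simp add: enat_0)
  then obtain n C where C: "n > 0" "!!i. i \<le> n ==> proj_irreducible (C i) & C i \<subseteq> Y"
   "!!i. i < n ==> C i \<subset> C (Suc i)" by (rule proj_dim_gtE) blast
  define D where "D = (%i :: nat. if i = 0 then C 0 else if i = 1 then Y else Y')"
  have "C 0 \<subset> Y" using C(2)[of 1] C(3)[of 0] C(1) by auto
  hence "enat 2 \<le> proj_dim Y'" using irr Y C(2)[of 0] \<open>Y ~= Y'\<close>
   by (intro proj_dim_geI[of 2 D]) (auto simp: D_def less_Suc_eq numeral_2_eq_2)
  thus False using dim[OF Y(2)] by (simp add: one_enat_def)
 qed
 show ?thesis
 proof (intro equalityI subsetI)
  fix Z assume "Z \<in> irreducible_components (\<Union>\<Y>)"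
  hence Z: "proj_irreducible Z" "Z \<subseteq> \<Union>\<Y>"
   "!!Y'. proj_irreducible Y' ==> Z \<subseteq> Y' ==> Y' \<subseteq> \<Union>\<Y> ==> Y' = Z" by (auto simp: irreducible_components_def)
  obtain Y where "Y \<in> \<Y>" "Z \<subseteq> Y" using proj_irreducible_subset_Union[OF fin cl Z(1,2)] by blast
  thus "Z \<in> \<Y>" using Z(3)[of Y] irr by blast
 next
  fix Y assume Y: "Y \<in> \<Y>"
  show "Y \<in> irreducible_components (\<Union>\<Y>)" unfolding irreducible_components_def
  proof (intro CollectI conjI allI impI)
   fix Y' assume Y': "proj_irreducible Y'" "Y \<subseteq> Y'" "Y' \<subseteq> \<Union>\<Y>"
   obtain Y2 where "Y2 \<in> \<Y>" "Y' \<subseteq> Y2"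
    using proj_irreducible_subset_Union[OF fin cl Y'(1,3)] by blast
   thus "Y' = Y" using eq[OF Y, of Y2] Y'(2) by blast
  qed (use Y irr in auto)
 qed
qed

lemma codim1_singular_locus_curves:
 assumes "finite \<Y>" "!!Y. Y \<in> \<Y> ==> proj_irreducible Y" "!!Y. Y \<in> \<Y> ==> proj_dim Y = 1"
  and "singular_locus X = \<Union>\<Y>"
 shows "codim1_singular_locus X = \<Union>\<Y>"
proof -
 have "irreducible_components (singular_locus X) = \<Y>"
  unfolding assms(4) by (rule irreducible_components_curves[OF assms(1-3)])
 thus ?thesis unfolding codim1_singular_locus_def using assms(3) by auto
qed

lemma local_dim_irreducible:
 assumes "proj_irreducible X" "x \<in> X"
 shows "local_dim X x = proj_dim X"
proof -
 have "irreducible_components X = {X}" using assms(1) unfolding irreducible_components_def by blast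
 hence "{proj_dim Y | Y. Y \<in> irreducible_components X & x \<in> Y} = {proj_dim X}"
  using assms(2) by auto
 thus ?thesis by (simp add: local_dim_def)
qed

section \<open>The singular locus of a parametrized hypersurface\<close>

lemma poly_map_poly_eval: "poly (map_poly (%c. poly c eps) P) tau = poly (poly P [:tau:]) eps"
 by (induction P) (simp_all add: map_poly_pCons)

lemma bivariate_zero:
 fixes tha :: "nat \<times> nat => 'k::alg_closed_field"
 assumes "!!a b. (\<Sum>(i, j)\<in>{..<N} \<times> {..<N}. tha (i, j) * (a ^ i * b ^ j)) = 0"
  and "i < N" "j < N"
 shows "tha (i, j) = 0"
proof -
 have zero: "c k = 0" if "!!a. (\<Sum>k<N. c k * a ^ k) = 0" "k < N" for c :: "nat => 'k" and k
 proof -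
  have "(\<Sum>k<N. monom (c k) k) = 0"
   using that(1) by (intro poly_fun_eqI) (simp add: poly_sum poly_monom)
  hence "coeff (\<Sum>k<N. monom (c k) k) k = 0" by simp
  thus ?thesis using that(2) by (simp add: coeff_sum)
 qed
 have "(\<Sum>i<N. (\<Sum>j<N. tha (i, j) * b ^ j) * a ^ i) = 0" for a b
 proof -
  have "(\<Sum>i<N. (\<Sum>j<N. tha (i, j) * b ^ j) * a ^ i) = (\<Sum>(i, j)\<in>{..<N} \<times> {..<N}. tha (i, j) * (a ^ i * b ^ j))"
   by (simp add: sum.cartesian_product[symmetric] sum_distrib_left mult_ac)
  thus ?thesis using assms(1) by simp
 qed
 hence "(\<Sum>j<N. tha (i, j) * b ^ j) = 0" for b using zero[of "%i. \<Sum>j<N. tha (i, j) * b ^ j"] assms(2) by blast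
 thus ?thesis using zero[of "%j. tha (i, j)"] assms(3) by blast
qed

text \<open>The leading coefficient of \<open>G\<close> in tau is the constant \<open>G e\<close>.
  So pseudo-division multiplies \<open>F\<close> only by a nonzero scalar, and no specialization of
  eps lowers the degree of \<open>G\<close>.\<close>

lemma pseudo_division_plane:
 fixes F G :: "'k::alg_closed_field^4 => 'k"
 assumes "hpoly d G" "hpoly d' F" "G e ~= 0"
 shows "\<exists>(c :: 'k) P Q q r. c ~= 0 &
  (\<forall>tau eps. poly (poly P [:tau:]) eps = G (x + eps *s w + tau *s e)) &
  (\<forall>tau eps. poly (poly Q [:tau:]) eps = F (x + eps *s w + tau *s e)) &
  smult [:c:] Q = P * q + r &
  (\<forall>eps. degree (map_poly (%c. poly c eps) P) = d & map_poly (%c. poly c eps) P ~= 0) &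
  (\<forall>i\<ge>d. coeff r i = 0)"
proof -
 obtain P where P: "!!tau eps. poly (poly P [:tau:]) eps = G (x + eps *s w + tau *s e)"
  "degree P \<le> d" "coeff P d = [:G e:]" using hpoly_plane[OF assms(1)] by blast
 obtain Q where Q: "!!tau eps. poly (poly Q [:tau:]) eps = F (x + eps *s w + tau *s e)"
  using hpoly_plane[OF assms(2)] by blast
 have deg: "degree P = d" using P(2,3) assms(3) by (intro antisym le_degree) auto
 have "P ~= 0" using P(3) assms(3) by auto
 obtain q r where qr: "pseudo_divmod Q P = (q, r)" by fastforce
 define k where "k = Suc (degree Q) - degree P"
 have div: "smult (coeff P (degree P) ^ k) Q = P * q + r" "r = 0 | degree r < degree P"
  using pseudo_divmod[OF \<open>P ~= 0\<close> qr] by (auto simp: k_def)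
 have "coeff P (degree P) ^ k = [:G e ^ k:]" by (simp add: deg P(3) poly_const_pow)
 moreover have "degree (map_poly (%c. poly c eps) P) = d & map_poly (%c. poly c eps) P ~= 0" for eps
 proof -
  have c: "coeff (map_poly (%c. poly c eps) P) d = G e" by (simp add: coeff_map_poly P(3))
  hence "d \<le> degree (map_poly (%c. poly c eps) P)" using assms(3) by (intro le_degree) simp
  moreover have "degree (map_poly (%c. poly c eps) P) \<le> degree P"
   by (intro degree_le) (auto simp: coeff_map_poly coeff_eq_0)
  ultimately show ?thesis using deg c assms(3) by auto
 qed
 moreover have "coeff r i = 0" if "i \<ge> d" for i using div(2) deg that by (auto intro: coeff_eq_0)
 ultimately show ?thesis using assms(3) P Q div(1)
  by (intro exI[of _ "G e ^ k"] exI[of _ P] exI[of _ Q] exI[of _ q] exI[of _ r]) simp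
qed

lemma dim_linear_kernel:
 fixes c :: "4 => 'k::field"
 assumes "(\<Sum>i\<in>UNIV. c i * v $ i) ~= 0"
 shows "vec.subspace {w. (\<Sum>i\<in>UNIV. c i * w $ i) = 0}" "vec.dim {w. (\<Sum>i\<in>UNIV. c i * w $ i) = 0} = 3"
proof -
 define f where "f w = (\<Sum>i\<in>UNIV. c i * w $ i)" for w
 have v: "f v ~= 0" using assms by (simp add: f_def)
 define K where "K = {w. f w = 0}"
 have add: "f (u + w) = f u + f w" for u w by (simp add: f_def algebra_simps sum.distrib)
 have scale: "f (r *s w) = r * f w" for r w by (simp add: f_def sum_distrib_left mult.left_commute)
 have sub: "vec.subspace K"
  unfolding vec.subspace_def K_def by (auto simp: add scale) (simp add: f_def)
 have "v \<notin> vec.span K" using v sub by (auto simp: vec.span_eq_iff[THEN iffD2] K_def)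
 hence "vec.dim (insert v K) = vec.dim K + 1" by (simp add: vec.dim_insert)
 moreover have "w \<in> vec.span (insert v K)" for w
 proof -
  have "f (w - (f w / f v) *s v) = 0"
   using add[of "w - (f w / f v) *s v" "(f w / f v) *s v"] v by (simp add: scale)
  thus ?thesis unfolding vec.span_insert K_def by (blast intro: vec.span_base)
 qed
 hence "vec.span (insert v K) = UNIV" by blast
 hence "vec.dim (insert v K) = 4"
  using vec.dim_span[of "insert v K"] by (simp only: vec_dim_card) simp
 ultimately have "vec.dim K = 3" by simp
 thus "vec.subspace {w. (\<Sum>i\<in>UNIV. c i * w $ i) = 0}" "vec.dim {w. (\<Sum>i\<in>UNIV. c i * w $ i) = 0} = 3"
  using sub by (simp_all only: K_def f_def)
qed

section \<open>Tangent spaces by division along parallel lines\<close>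

locale param_hypersurface =
 fixes Phi :: "'k quad => 'k::alg_closed_field^4" and a b d :: nat and G
 assumes bf: "!!i. bform a b (%x. Phi x $ i)" and G: "hpoly d G"
  and X: "surf Phi = {x. x ~= 0 & G x = 0}"
begin

lemma irreducible: "proj_irreducible (surf Phi)"
 by (rule proj_irreducible_surf[OF bf]) (simp only: X proj_closed_hypersurface[OF G])

text \<open>
 If \<open>G\<close> had a repeated zero on the line \<open>y + ke\<close> for all \<open>y\<close> outside a proper closed set, the polar
 \<open>{x \<in> X. dG\<^sub>x(e) = 0}\<close> would dominate the plane of lines in direction \<open>e\<close> and carry three
 algebraically independent forms. Together with \<open>dG(e)\<close> these would be four on the surface \<open>X\<close>.
\<close>

lemma polar_not_dominant:
 assumes e: "e ~= 0" and x1: "x1 \<in> surf Phi" "ddir G x1 e ~= 0"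
  and dom: "!!y. \<exists>rho. rho ~= 0 & (\<forall>eps. poly rho eps ~= 0 -->
   (\<exists>tau. G (y0 + eps *s (y - y0) + tau *s e) = 0 & ddir G (y0 + eps *s (y - y0) + tau *s e) e = 0))"
 shows False
proof -
 obtain i0 where i0: "e $ i0 ~= 0" using e by (auto simp: vec_eq_iff)
 have "\<exists>i1 i2 i3 :: 4. distinct [i0, i1, i2, i3]"
 proof -
  consider "i0 = 1" | "i0 = 2" | "i0 = 3" | "i0 = 4" using exhaust_4[of i0] by blast
  thus ?thesis
  proof cases
   case 1 thus ?thesis by (intro exI[of _ 2] exI[of _ 3] exI[of _ 4]) simp
  next
   case 2 thus ?thesis by (intro exI[of _ 1] exI[of _ 3] exI[of _ 4]) simp
  next
   case 3 thus ?thesis by (intro exI[of _ 1] exI[of _ 2] exI[of _ 4]) simp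
  next
   case 4 thus ?thesis by (intro exI[of _ 1] exI[of _ 2] exI[of _ 3]) simp
  qed
 qed
 then obtain i1 i2 i3 :: 4 where ne: "distinct [i0, i1, i2, i3]" by blast
 \<comment> \<open>These linear forms vanish at \<open>e\<close>, hence are constant on lines of
   direction \<open>e\<close>. Three of them are coordinates on the space of such lines.\<close>
 define lam where "lam = (%i (x :: 'k^4). x $ i * e $ i0 - x $ i0 * e $ i)"
 have lam_h: "hpoly 1 (lam i)" for i
  using hpoly_diff[OF hpoly_smult[OF hpoly_coord] hpoly_smult[OF hpoly_coord], of "e $ i0" i "e $ i" i0]
  by (simp add: lam_def mult.commute)
 have lam_e: "lam i (y + tau *s e) = lam i y" for i y tau by (simp add: lam_def algebra_simps)
 define l where "l = (%x. lam i3 x ^ (d - 1))"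
 have l: "hpoly (d - 1) l" unfolding l_def using hpoly_power[OF lam_h[of i3], of "d - 1"] by simp
 \<comment> \<open>There will be N^3 forms of degree (d + 1) N, while the surface carries at most
   N^2 (a (d + 1) + 1)(b (d + 1) + 1); the choice of \<open>N\<close> exceeds the last two
   factors.\<close>
 define N where "N = (a * (d + 1) + 1) * (b * (d + 1) + 1) + 1"
 have N: "N \<ge> 1" by (simp add: N_def)
 define g where "g = (%(i, j) x. lam i1 x ^ i * lam i2 x ^ j * lam i3 x ^ (2 * N - i - j))"
 let ?A = "{..<N} \<times> {..<N}"
 let ?P = "{x \<in> surf Phi. ddir G x e = 0}"
 have g: "hpoly (2 * N) (g c)" if c: "c \<in> ?A" for c
 proof -
  obtain i j where ij: "c = (i, j)" "i < N" "j < N" using c by auto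
  have "hpoly (1 * i + 1 * j + 1 * (2 * N - i - j)) (g c)"
   unfolding g_def ij by simp (intro hpoly_mult hpoly_power[of 1, simplified] lam_h[simplified])
  thus ?thesis using ij by simp
 qed
 have "indep_on ?P ?A (%c x. l x ^ m * g c x)" for m unfolding indep_on_def
 proof (intro allI impI)
  fix tha assume *: "\<forall>x\<in>?P. (\<Sum>c\<in>?A. tha c * (l x ^ m * g c x)) = 0"
  define Psi where "Psi = (%x. \<Sum>c\<in>?A. tha c * (l x ^ m * g c x))"
  have Psi_e: "Psi (y + tau *s e) = Psi y" for y tau
   by (simp add: Psi_def l_def g_def lam_e case_prod_unfold)
  have "Psi 0 = 0" unfolding Psi_def by (intro sum.neutral) (auto simp: g_def lam_def zero_power)
  have path: "path_poly Psi" unfolding Psi_def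
   by (intro path_poly_sum path_poly_mult path_poly_const path_poly_power)
    (use g l path_poly_hpoly in blast)+
  \<comment> \<open>\<open>Psi\<close> depends only on the line in direction \<open>e\<close>, and
    by \<open>dom\<close> almost every line over the segment from \<open>y0\<close> to
    \<open>y\<close> meets the polar or passes through 0. So \<open>Psi\<close> vanishes along the
    segment.\<close>
  have zero: "Psi y = 0" for y
  proof -
   obtain rho where rho: "rho ~= 0" "!!eps. poly rho eps ~= 0 ==>
   (\<exists>tau. G (y0 + eps *s (y - y0) + tau *s e) = 0 & ddir G (y0 + eps *s (y - y0) + tau *s e) e = 0)"
    using dom by blast
   obtain P where P: "!!eps. poly P eps = Psi (y0 + eps *s (y - y0))"
    using path_poly_line[OF path, of y0 "y - y0"] by blast
   have "P = 0"
   proof (rule poly_zeroI)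
    fix eps assume "eps \<notin> {eps. poly rho eps = 0}"
    then obtain tau where tau: "G (y0 + eps *s (y - y0) + tau *s e) = 0"
     "ddir G (y0 + eps *s (y - y0) + tau *s e) e = 0" using rho(2) by blast
    hence "Psi (y0 + eps *s (y - y0) + tau *s e) = 0" using * \<open>Psi 0 = 0\<close>
     by (cases "y0 + eps *s (y - y0) + tau *s e = 0") (auto simp: X Psi_def)
    thus "poly P eps = 0" by (simp add: P Psi_e)
   qed (use rho(1) poly_roots_finite in blast)
   hence "Psi (y0 + 1 *s (y - y0)) = 0" using P[of 1] by simp
   thus ?thesis by simp
  qed
  have "(\<Sum>(i, j)\<in>?A. tha (i, j) * (al ^ i * bet ^ j)) = 0" for al bet
  proof -
   define y :: "'k^4" where "y = (\<chi> i. if i = i1 then al / e $ i0 else if i = i2 then bet / e $ i0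
    else if i = i3 then 1 / e $ i0 else 0)"
   have "lam i1 y = al" "lam i2 y = bet" "lam i3 y = 1" using ne i0 by (auto simp: lam_def y_def)
   thus ?thesis using zero[of y] by (simp add: Psi_def g_def l_def case_prod_unfold)
  qed
  thus "\<forall>c\<in>?A. tha c = 0" using bivariate_zero[of tha N] by auto
 qed
 \<comment> \<open>The derivative in direction \<open>e\<close> is the additional form: it vanishes
   on the polar, but not at \<open>x1\<close> and hence is no zero divisor on the irreducible
   surface.\<close>
 hence "indep_on (surf Phi) ({..<N} \<times> ?A)
   (%(k, c) x. l x ^ 0 * (l x ^ (N - k) * ddir G x e ^ k * g c x))"
 proof (intro indep_on_step[where Z' = ?P, OF _ _ _ hpoly_ddir[OF G] l g])
  fix h d' assume "hpoly d' h" "\<forall>x\<in>surf Phi. ddir G x e * h x = 0"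
  thus "\<forall>x\<in>surf Phi. h x = 0"
   using proj_irreducible_zero_product[OF irreducible hpoly_ddir[OF G, of e], of d' h] x1 by blast
 qed auto
 moreover have "hpoly ((d - 1) * N + 2 * N) (case kc of (k, c) =>
   %x. l x ^ 0 * (l x ^ (N - k) * ddir G x e ^ k * g c x))" if "kc \<in> {..<N} \<times> ?A" for kc
  using hpoly_step[OF hpoly_ddir[OF G, of e] l g, of "snd kc" "fst kc" N] that
  by (auto simp: case_prod_unfold)
 ultimately have "card ({..<N} \<times> ?A) \<le>
   (a * ((d - 1) * N + 2 * N) + 1) * (b * ((d - 1) * N + 2 * N) + 1)"
  by (intro indep_on_surf_card_le[OF bf]) auto
 hence bound: "N * (N * N) \<le> (a * ((d - 1) * N + 2 * N) + 1) * (b * ((d - 1) * N + 2 * N) + 1)"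
  by (simp add: card_cartesian_product)
 have "d \<ge> 1"
 proof (rule ccontr)
  assume "\<not> d \<ge> 1"
  hence "d = 0" by simp
  hence "G x = G 0" for x using hpoly_scale[OF G, of 0 x] by simp
  hence "G = (%x. G 0)" by blast
  thus False using x1(2) ddir_const[of "G 0" x1 e] by metis
 qed
 hence eq: "(d - 1) * N + 2 * N = (d + 1) * N" by (simp add: algebra_simps)
 have lin: "c * ((d + 1) * N) + 1 \<le> N * (c * (d + 1) + 1)" for c
  using N by (simp add: algebra_simps)
 have "N * (N * N) \<le> (N * (a * (d + 1) + 1)) * (N * (b * (d + 1) + 1))"
  using bound mult_le_mono[OF lin[of a] lin[of b]] unfolding eq by (rule le_trans)
 also have "\<dots> = N * N * ((a * (d + 1) + 1) * (b * (d + 1) + 1))" by (simp only: ac_simps)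
 also have "\<dots> < N * N * N"
 proof (rule mult_strict_left_mono)
  show "(a * (d + 1) + 1) * (b * (d + 1) + 1) < N" unfolding N_def by (rule less_add_one)
  show "0 < N * N" using N by simp
 qed
 finally show False by simp
qed

text \<open>For every form \<open>F\<close> vanishing on the surface, \<open>G\<close> divides
  \<open>F\<close> on each line of direction \<open>e\<close>. Therefore the pseudo-remainder on the
  plane spanned at \<open>x\<close> by \<open>w\<close> and \<open>e\<close> vanishes identically,
  so there \<open>F\<close> is up to a scalar a polynomial multiple of \<open>G\<close>, and dG(w) =
  0 implies dF(w) = 0.\<close>

lemma tangent_space:
 assumes x1: "x1 \<in> surf Phi" "ddir G x1 w1 ~= 0" and x: "x \<in> surf Phi"
 shows "affine_tangent_space (surf Phi) x = {w. ddir G x w = 0}"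
proof -
 \<comment> \<open>One direction serves two purposes: \<open>G e ~= 0\<close> fixes the degree of
   \<open>G\<close> on all parallel lines, and the second condition makes the polar a proper subset.
   Along \<open>y + t w1\<close> both say that a nonzero polynomial in t does not vanish.\<close>
 obtain e where e: "G e ~= 0" "ddir G x1 e ~= 0"
 proof -
  obtain y where y: "G y ~= 0"
  proof -
   have "G ~= (%x. 0)" using x1(2) ddir_const[of 0 x1 w1] by metis
   thus ?thesis using that by blast
  qed
  obtain P where P: "!!t. poly P t = G (y + t *s w1)"
   using path_poly_line[OF path_poly_hpoly[OF G], of y w1] by blast
  obtain c where c: "!!w. ddir G x1 w = (\<Sum>i\<in>UNIV. c i * w $ i)"
   using ddir_linear[OF G, of x1] by blast
  have lin: "ddir G x1 (y + t *s w1) = poly [:ddir G x1 y, ddir G x1 w1:] t" for t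
   by (simp add: c algebra_simps sum.distrib sum_distrib_left)
  have "P ~= 0" using P[of 0] y by auto
  hence "P * [:ddir G x1 y, ddir G x1 w1:] ~= 0" using x1(2) by (intro no_zero_divisors) auto
  then obtain t where "poly (P * [:ddir G x1 y, ddir G x1 w1:]) t ~= 0"
   using avoid_roots[of _ "{}"] by blast
  hence "poly P t ~= 0" "poly [:ddir G x1 y, ddir G x1 w1:] t ~= 0" unfolding poly_mult by auto
  thus ?thesis using that[of "y + t *s w1"] P[of t] lin[of t] by simp
 qed
 have "e ~= 0"
 proof
  assume "e = 0"
  hence "ddir G x1 e = poly (pderiv [:G x1:]) 0" by (intro ddirI) simp
  thus False using e by simp
 qed
 \<comment> \<open>If divisibility failed on one line, a coefficient of the pseudo-remainder would
   be nonzero there, hence at almost all eps for every \<open>y\<close>. On those lines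
   \<open>G\<close> has a double root, which is a point of the polar; this contradicts
   \<open>polar_not_dominant\<close>.\<close>
 have dvd: "P dvd Q" if F: "hpoly d' F" "!!z. z \<in> surf Phi ==> F z = 0"
  and PQ: "!!tau. poly P tau = G (y0 + tau *s e)" "!!tau. poly Q tau = F (y0 + tau *s e)" for d' F y0 P Q
 proof (rule ccontr)
  assume ndvd: "\<not> P dvd Q"
  have Fz: "F z = 0" if "G z = 0" for z
  proof (cases "z = 0")
   case True
   thus ?thesis using hpoly_scale[OF F(1), of 0 x1] F(2)[OF x1(1)] by simp
  qed (use F(2) that X in auto)
  have "\<exists>rho. rho ~= 0 & (\<forall>eps. poly rho eps ~= 0 -->
   (\<exists>tau. G (y0 + eps *s (y - y0) + tau *s e) = 0 & ddir G (y0 + eps *s (y - y0) + tau *s e) e = 0))" for y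
  proof -
   obtain c :: 'k and PP QQ q r :: "'k poly poly" where div: "c ~= 0"
    "!!tau eps. poly (poly PP [:tau:]) eps = G (y0 + eps *s (y - y0) + tau *s e)"
    "!!tau eps. poly (poly QQ [:tau:]) eps = F (y0 + eps *s (y - y0) + tau *s e)"
    "smult [:c:] QQ = PP * q + r"
    "!!eps. degree (map_poly (%c. poly c eps) PP) = d & map_poly (%c. poly c eps) PP ~= 0"
    "!!i. i \<ge> d ==> coeff r i = 0" using pseudo_division_plane[OF G F(1) e(1), of y0 "y - y0"] by blast
   define sp where "sp = (%eps. map_poly (%c. poly c eps) :: 'k poly poly => 'k poly)"
   have sp: "poly (sp eps R) tau = poly (poly R [:tau:]) eps" for R tau eps
    unfolding sp_def by (rule poly_map_poly_eval)
   have eq: "smult c (sp eps QQ) = sp eps PP * sp eps q + sp eps r" for eps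
   proof (rule poly_fun_eqI)
    fix tau
    have "poly (poly (smult [:c:] QQ) [:tau:]) eps = poly (poly (PP * q + r) [:tau:]) eps"
     using div(4) by simp
    thus "poly (smult c (sp eps QQ)) tau = poly (sp eps PP * sp eps q + sp eps r) tau"
     by (simp add: sp)
   qed
   have "P = sp 0 PP" "Q = sp 0 QQ" by (rule poly_fun_eqI; simp add: sp div PQ)+
   hence "sp 0 r ~= 0"
    using ndvd eq[of 0] div(1) by (metis add.right_neutral dvd_smult_cancel dvd_triv_left)
   then obtain i where i: "poly (coeff r i) 0 ~= 0" by (auto simp: sp_def poly_eq_iff coeff_map_poly)
   show ?thesis
   proof (intro exI[of _ "coeff r i"] conjI allI impI)
    fix eps assume "poly (coeff r i) eps ~= 0"
    hence nz: "coeff (sp eps r) i ~= 0" by (simp add: sp_def coeff_map_poly)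
    have "\<not> sp eps PP dvd sp eps QQ"
    proof
     assume "sp eps PP dvd sp eps QQ"
     hence "sp eps PP dvd smult c (sp eps QQ) - sp eps PP * sp eps q" by (intro dvd_diff dvd_smult) auto
     hence "sp eps PP dvd sp eps r" by (simp add: eq)
     moreover have "sp eps r ~= 0" using nz by auto
     ultimately have "d \<le> degree (sp eps r)" using div(5) by (metis dvd_imp_degree_le sp_def)
     hence "coeff (sp eps r) (degree (sp eps r)) = 0"
      using div(6) by (simp add: sp_def coeff_map_poly)
     thus False using \<open>sp eps r ~= 0\<close> by simp
    qed
    then obtain tau where tau: "poly (sp eps PP) tau = 0" "poly (pderiv (sp eps PP)) tau = 0"
    proof -
     have "\<exists>tau. poly (sp eps PP) tau = 0 & poly (pderiv (sp eps PP)) tau = 0"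
     proof (rule ccontr)
      assume "\<not> ?thesis"
      moreover have "sp eps PP ~= 0" using div(5)[of eps] by (simp add: sp_def)
      ultimately have "sp eps PP dvd sp eps QQ"
       using Fz by (intro dvd_of_common_simple_roots) (auto simp: sp div)
      thus False using \<open>\<not> sp eps PP dvd sp eps QQ\<close> by blast
     qed
     thus ?thesis using that by blast
    qed
    let ?z = "y0 + eps *s (y - y0) + tau *s e"
    have "ddir G ?z e = poly (pderiv (pcompose (sp eps PP) [:tau, 1:])) 0"
     by (rule ddirI) (simp add: poly_pcompose sp div algebra_simps)
    also have "\<dots> = 0" using tau(2) by (simp add: pderiv_pcompose pderiv_pCons poly_pcompose)
    finally show "\<exists>tau. G (y0 + eps *s (y - y0) + tau *s e) = 0 &
      ddir G (y0 + eps *s (y - y0) + tau *s e) e = 0" using tau(1) by (auto simp: sp div)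
   qed (use i in auto)
  qed
  thus False by (rule polar_not_dominant[OF \<open>e ~= 0\<close> x1(1) e(2)])
 qed
 show ?thesis unfolding affine_tangent_space_altdef
 proof (intro equalityI subsetI CollectI allI impI)
  fix w assume "w \<in> {w. \<forall>d f. hpoly d f --> (\<forall>z\<in>surf Phi. f z = 0) --> ddir f x w = 0}"
  thus "ddir G x w = 0" using G X by blast
 next
  fix w d' F assume "w \<in> {w. ddir G x w = 0}" and F: "hpoly d' F" "\<forall>z\<in>surf Phi. F z = 0"
  hence w: "ddir G x w = 0" by simp
  obtain c :: 'k and PP QQ q r :: "'k poly poly" where div: "c ~= 0"
   "!!tau eps. poly (poly PP [:tau:]) eps = G (x + eps *s w + tau *s e)"
   "!!tau eps. poly (poly QQ [:tau:]) eps = F (x + eps *s w + tau *s e)"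
   "smult [:c:] QQ = PP * q + r"
   "!!eps. degree (map_poly (%c. poly c eps) PP) = d & map_poly (%c. poly c eps) PP ~= 0"
   "!!i. i \<ge> d ==> coeff r i = 0" using pseudo_division_plane[OF G F(1) e(1), of x w] by blast
  define sp where "sp = (%eps. map_poly (%c. poly c eps) :: 'k poly poly => 'k poly)"
  have sp: "poly (sp eps R) tau = poly (poly R [:tau:]) eps" for R tau eps
   unfolding sp_def by (rule poly_map_poly_eval)
  have "sp eps r = 0" for eps
  proof (rule ccontr)
   assume nz: "sp eps r ~= 0"
   have "sp eps PP dvd sp eps QQ"
    by (rule dvd[of d' F "sp eps PP" "x + eps *s w"]) (use F in \<open>auto simp: sp div\<close>)
   hence "sp eps PP dvd smult c (sp eps QQ) - sp eps PP * sp eps q" by (intro dvd_diff dvd_smult) auto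
   also have "smult c (sp eps QQ) - sp eps PP * sp eps q = sp eps r"
   proof (rule poly_fun_eqI)
    fix tau
    have "poly (poly (smult [:c:] QQ) [:tau:]) eps = poly (poly (PP * q + r) [:tau:]) eps"
     using div(4) by simp
    thus "poly (smult c (sp eps QQ) - sp eps PP * sp eps q) tau = poly (sp eps r) tau"
     by (simp add: sp)
   qed
   finally have "d \<le> degree (sp eps r)" using div(5) nz by (metis dvd_imp_degree_le sp_def)
   hence "coeff (sp eps r) (degree (sp eps r)) = 0"
    using div(6) by (simp add: sp_def coeff_map_poly)
   thus False using nz by simp
  qed
  hence r0: "poly (poly r [:0:]) eps = 0" for eps using sp[of eps r 0] by simp
  obtain P1 Q1 q1 where eq: "P1 = poly PP [:0:]" "Q1 = poly QQ [:0:]" "q1 = poly q [:0:]" by blast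
  have "smult c Q1 = P1 * q1"
  proof (rule poly_fun_eqI)
   fix eps
   have "poly (poly (smult [:c:] QQ) [:0:]) eps = poly (poly (PP * q + r) [:0:]) eps"
    using div(4) by simp
   thus "poly (smult c Q1) eps = poly (P1 * q1) eps" using r0[of eps] by (simp add: eq)
  qed
  \<comment> \<open>Differentiate c F = G q in eps at 0; the term with the derivative of q drops out
    because \<open>G x = 0\<close>.\<close>
  hence "smult c (pderiv Q1) = P1 * pderiv q1 + q1 * pderiv P1" by (metis pderiv_mult pderiv_smult)
  hence "c * poly (pderiv Q1) 0 = poly P1 0 * poly (pderiv q1) 0 + poly q1 0 * poly (pderiv P1) 0"
   by (metis poly_add poly_mult poly_smult)
  moreover have "ddir F x w = poly (pderiv Q1) 0" "ddir G x w = poly (pderiv P1) 0"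
   by (rule ddirI; use div(2,3)[of 0] in \<open>simp add: eq\<close>)+
  moreover have "poly P1 0 = 0" using div(2)[of 0 0] x X by (simp add: eq)
  ultimately show "ddir F x w = 0" using w div(1) by simp
 qed
qed

theorem singular_locus:
 assumes x1: "x1 \<in> surf Phi" "ddir G x1 w1 ~= 0" and dim: "proj_dim (surf Phi) = 2"
 shows "singular_locus (surf Phi) = {x \<in> surf Phi. \<forall>w. ddir G x w = 0}"
proof -
 have "enat (vec.dim (affine_tangent_space (surf Phi) x)) ~= local_dim (surf Phi) x + 1 \<longleftrightarrow>
   (\<forall>w. ddir G x w = 0)" if x: "x \<in> surf Phi" for x
 proof -
  have loc: "local_dim (surf Phi) x + 1 = enat 3"
   unfolding local_dim_irreducible[OF irreducible x] dim by (simp add: numeral_eq_enat one_enat_def)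
  have T: "affine_tangent_space (surf Phi) x = {w. ddir G x w = 0}" by (rule tangent_space[OF x1 x])
  show ?thesis
  proof (cases "\<forall>w. ddir G x w = 0")
   case True
   hence "{w. ddir G x w = 0} = UNIV" by auto
   hence "vec.dim {w. ddir G x w = 0} = 4" by (simp only: vec_dim_card) simp
   thus ?thesis unfolding T loc using True by simp
  next
   case False
   then obtain v where v: "ddir G x v ~= 0" by blast
   obtain c where c: "!!w. ddir G x w = (\<Sum>i\<in>UNIV. c i * w $ i)"
    using ddir_linear[OF G, of x] by blast
   have "vec.dim {w. ddir G x w = 0} = 3" using dim_linear_kernel(2)[of c v] v unfolding c by blast
   thus ?thesis unfolding T loc using v by auto
  qed
 qed
 thus ?thesis unfolding singular_locus_def by blast
qed

end

section \<open>Projective automorphisms\<close>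

text \<open>Naming the inverse makes transport statements symmetric, so that one inclusion or
  inequality yields the other by exchanging the matrices.\<close>

definition inverse_pair :: "'k::field^4^4 => 'k^4^4 => bool" where
 "inverse_pair A B \<longleftrightarrow> A ** B = mat 1 & B ** A = mat 1"

lemma inverse_pair_sym: "inverse_pair A B ==> inverse_pair B A" by (simp add: inverse_pair_def)

lemma inverse_pair_apply [simp]:
 assumes "inverse_pair A B"
 shows "A *v (B *v x) = x" "B *v (A *v x) = x"
 using assms by (simp_all add: inverse_pair_def matrix_vector_mul_assoc matrix_vector_mul_lid)

lemma inverse_pair_image:
 assumes "inverse_pair A B"
 shows "(*v) A ` ((*v) B ` Z) = Z" using assms by (simp add: image_image)

lemma inverse_pair_inj: "inverse_pair A B ==> inj ((*v) A)" by (metis injI inverse_pair_apply(2))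

lemma inverse_pair_mem: "inverse_pair A B ==> x \<in> (*v) A ` Z \<longleftrightarrow> B *v x \<in> Z"
 using inverse_pair_apply[of A B] by (auto intro!: image_eqI[of x _ "B *v x"])

lemma matrix_vector_eq_0: "inverse_pair A B ==> A *v x = 0 \<longleftrightarrow> x = 0"
 by (metis inverse_pair_apply(2) matrix_vector_mult_0_right)

context
 fixes A B :: "'k::alg_closed_field^4^4"
 assumes AB: "inverse_pair A B"
begin

lemma proj_closed_image:
 assumes "proj_closed Z"
 shows "proj_closed ((*v) A ` Z)"
proof -
 obtain S where S: "\<forall>f\<in>S. \<exists>d. hpoly d f" "Z = {x. x ~= 0 & (\<forall>f\<in>S. f x = 0)}"
  using assms unfolding proj_closed_altdef by blast
 have eq: "(*v) A ` Z = {x. x ~= 0 & (\<forall>f\<in>(%f x. f (B *v x)) ` S. f x = 0)}"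
 proof (rule set_eqI)
  fix x
  show "x \<in> (*v) A ` Z \<longleftrightarrow> x \<in> {x. x ~= 0 & (\<forall>f\<in>(%f x. f (B *v x)) ` S. f x = 0)}"
   unfolding inverse_pair_mem[OF AB] S(2)
   using matrix_vector_eq_0[OF inverse_pair_sym[OF AB], of x] by simp
 qed
 have ex: "\<exists>d. hpoly d f" if f: "f \<in> (%f x. f (B *v x)) ` S" for f
 proof -
  obtain h where h: "h \<in> S" "f = (%x. h (B *v x))" using f by auto
  obtain d where "hpoly d h" using S(1) h(1) by (elim ballE exE) auto
  thus ?thesis unfolding h(2) by (intro exI[of _ d] hpoly_linear_subst)
 qed
 show ?thesis unfolding eq by (rule proj_closed_zero_set[OF ex])
qed

end

lemma proj_irreducible_image:
 fixes A B :: "'k::alg_closed_field^4^4"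
 assumes AB: "inverse_pair A B" and Z: "proj_irreducible Z"
 shows "proj_irreducible ((*v) A ` Z)" unfolding proj_irreducible_def
proof (intro conjI allI impI)
 show "proj_closed ((*v) A ` Z)" "(*v) A ` Z ~= {}"
  using Z proj_closed_image[OF AB] by (auto simp: proj_irreducible_def)
 fix C D assume CD: "proj_closed C" "proj_closed D" "(*v) A ` Z = C \<union> D"
 note BA = inverse_pair_sym[OF AB]
 have "Z = (*v) B ` C \<union> (*v) B ` D"
  using CD(3) inverse_pair_image[OF BA, of Z] by (simp flip: image_Un)
 hence "Z = (*v) B ` C | Z = (*v) B ` D"
  using Z proj_closed_image[OF BA] CD(1,2) unfolding proj_irreducible_def by blast
 thus "(*v) A ` Z = C | (*v) A ` Z = D" using inverse_pair_image[OF AB] by metis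
qed

lemma proj_dim_image:
 fixes A B :: "'k::alg_closed_field^4^4"
 assumes AB: "inverse_pair A B"
 shows "proj_dim ((*v) A ` Z) = proj_dim Z"
proof -
 have le: "proj_dim Z \<le> proj_dim ((*v) A ` Z)" if AB: "inverse_pair A B" for A B :: "'k^4^4" and Z
  unfolding proj_dim_def[of Z]
 proof (intro Sup_least)
  fix d assume "d \<in> {enat n |n. \<exists>Y. (\<forall>i\<le>n. proj_irreducible (Y i) & Y i \<subseteq> Z) & (\<forall>i<n. Y i \<subset> Y (Suc i))}"
  then obtain n Y where Y: "d = enat n" "\<forall>i\<le>n. proj_irreducible (Y i) & Y i \<subseteq> Z"
   "\<forall>i<n. Y i \<subset> Y (Suc i)" by blast
  show "d \<le> proj_dim ((*v) A ` Z)"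
   unfolding Y(1) using Y(2,3) proj_irreducible_image[OF AB] inverse_pair_inj[OF AB]
   by (intro proj_dim_geI[of n "%i. (*v) A ` Y i"]) (auto simp: inj_image_subset_iff psubset_eq inj_image_eq_iff)
 qed
 show ?thesis using le[OF AB, of Z] le[OF inverse_pair_sym[OF AB], of "(*v) A ` Z"]
  by (simp add: inverse_pair_image[OF inverse_pair_sym[OF AB]])
qed

lemma irreducible_components_image:
 fixes A B :: "'k::alg_closed_field^4^4"
 assumes AB: "inverse_pair A B"
 shows "irreducible_components ((*v) A ` Z) = (`) ((*v) A) ` irreducible_components Z"
proof -
 have sub: "(*v) A ` Y \<in> irreducible_components ((*v) A ` Z)"
  if AB: "inverse_pair A B" and Y: "Y \<in> irreducible_components Z" for A B :: "'k^4^4" and Y Z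
  unfolding irreducible_components_def
 proof (intro CollectI conjI allI impI)
  note BA = inverse_pair_sym[OF AB]
  fix Y' assume Y': "proj_irreducible Y'" "(*v) A ` Y \<subseteq> Y'" "Y' \<subseteq> (*v) A ` Z"
  have "Y \<subseteq> (*v) B ` Y'" "(*v) B ` Y' \<subseteq> Z"
   using image_mono[OF Y'(2), of "(*v) B"] image_mono[OF Y'(3), of "(*v) B"]
   by (simp_all add: inverse_pair_image[OF BA])
  hence "(*v) B ` Y' = Y"
   using Y proj_irreducible_image[OF BA Y'(1)] unfolding irreducible_components_def by blast
  thus "Y' = (*v) A ` Y" using inverse_pair_image[OF AB] by metis
 qed (use Y proj_irreducible_image[OF AB] in \<open>auto simp: irreducible_components_def\<close>)
 show ?thesis
 proof (intro equalityI subsetI)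
  fix Y assume "Y \<in> irreducible_components ((*v) A ` Z)"
  hence "(*v) B ` Y \<in> irreducible_components ((*v) B ` ((*v) A ` Z))"
   by (rule sub[OF inverse_pair_sym[OF AB]])
  thus "Y \<in> (`) ((*v) A) ` irreducible_components Z"
   using inverse_pair_image[OF AB, of Y] inverse_pair_image[OF inverse_pair_sym[OF AB], of Z]
   by (metis image_eqI)
 qed (use sub[OF AB] in blast)
qed

lemma local_dim_image:
 fixes A B :: "'k::alg_closed_field^4^4"
 assumes AB: "inverse_pair A B"
 shows "local_dim ((*v) A ` Z) (A *v x) = local_dim Z x"
proof -
 have "{proj_dim Y |Y. Y \<in> (`) ((*v) A) ` irreducible_components Z & A *v x \<in> Y} =
   {proj_dim ((*v) A ` Y) |Y. Y \<in> irreducible_components Z & A *v x \<in> (*v) A ` Y}" by blast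
 also have "\<dots> = {proj_dim Y |Y. Y \<in> irreducible_components Z & x \<in> Y}"
  by (simp only: inj_image_mem_iff[OF inverse_pair_inj[OF AB]] proj_dim_image[OF AB])
 finally have "{proj_dim Y |Y. Y \<in> (`) ((*v) A) ` irreducible_components Z & A *v x \<in> Y} =
   {proj_dim Y |Y. Y \<in> irreducible_components Z & x \<in> Y}" .
 thus ?thesis unfolding local_dim_def irreducible_components_image[OF AB] by simp
qed

lemma affine_tangent_space_image:
 fixes A B :: "'k::alg_closed_field^4^4"
 assumes AB: "inverse_pair A B"
 shows "affine_tangent_space ((*v) A ` Z) (A *v x) = (*v) A ` affine_tangent_space Z x"
proof -
 have sub: "(*v) A ` affine_tangent_space Z x \<subseteq> affine_tangent_space ((*v) A ` Z) (A *v x)"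
  if AB: "inverse_pair A B" for A B :: "'k^4^4" and Z x
 proof (intro image_subsetI)
  fix w assume w: "w \<in> affine_tangent_space Z x"
  show "A *v w \<in> affine_tangent_space ((*v) A ` Z) (A *v x)" unfolding affine_tangent_space_altdef
  proof (intro CollectI allI impI)
   fix d f assume f: "hpoly d f" "\<forall>z\<in>(*v) A ` Z. f z = 0"
   have "hpoly d (%x. f (A *v x))" by (rule hpoly_linear_subst[OF f(1)])
   hence "ddir (%x. f (A *v x)) x w = 0" using w f(2) unfolding affine_tangent_space_altdef by blast
   thus "ddir f (A *v x) (A *v w) = 0" by (simp add: ddir_linear_subst)
  qed
 qed
 have "(*v) B ` affine_tangent_space ((*v) A ` Z) (A *v x) \<subseteq> affine_tangent_space Z x"
  using sub[OF inverse_pair_sym[OF AB], of "(*v) A ` Z" "A *v x"]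
  by (simp add: inverse_pair_image[OF inverse_pair_sym[OF AB]] inverse_pair_apply[OF AB])
 hence "(*v) A ` ((*v) B ` affine_tangent_space ((*v) A ` Z) (A *v x)) \<subseteq> (*v) A ` affine_tangent_space Z x"
  by (rule image_mono)
 thus ?thesis using sub[OF AB] by (simp add: inverse_pair_image[OF AB] subset_antisym)
qed

lemma vec_dim_image:
 fixes A B :: "'k::field^4^4"
 assumes AB: "inverse_pair A B"
 shows "vec.dim ((*v) A ` W) = vec.dim W"
 using vec.dim_image_eq[OF matrix_vector_mul_linear_gen, of A W] inverse_pair_inj[OF AB]
 by (simp add: inj_on_subset)

lemma singular_locus_image:
 fixes A B :: "'k::alg_closed_field^4^4"
 assumes AB: "inverse_pair A B"
 shows "singular_locus ((*v) A ` Z) = (*v) A ` singular_locus Z" unfolding singular_locus_def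
 by (auto simp: affine_tangent_space_image[OF AB] vec_dim_image[OF AB] local_dim_image[OF AB])

lemma codim1_singular_locus_image:
 fixes A B :: "'k::alg_closed_field^4^4"
 assumes AB: "inverse_pair A B"
 shows "codim1_singular_locus ((*v) A ` Z) = (*v) A ` codim1_singular_locus Z"
proof -
 have "{Y \<in> (`) ((*v) A) ` irreducible_components (singular_locus Z). proj_dim Y = 1} =
   (`) ((*v) A) ` {Y \<in> irreducible_components (singular_locus Z). proj_dim Y = 1}"
  using proj_dim_image[OF AB] by auto
 thus ?thesis
  unfolding codim1_singular_locus_def singular_locus_image[OF AB] irreducible_components_image[OF AB]
  by (simp only:) blast
qed

text \<open>The two existence hypotheses allow a simultaneous change of parameters, as when
  \<open>u, v\<close> undergo a linear change.\<close>

lemma surf_reparam: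
 assumes AB: "inverse_pair A B"
  and "!!s t u v. (s, t, u, v) \<in> param_dom ==>
   \<exists>x\<in>param_dom. Phi (s, t, u, v) = A *v Psi x"
  and "!!s t u v. (s, t, u, v) \<in> param_dom ==>
   \<exists>x\<in>param_dom. Phi x = A *v Psi (s, t, u, v)"
 shows "surf Phi = (*v) A ` surf Psi"
proof (intro equalityI subsetI)
 fix y assume "y \<in> surf Phi"
 then obtain c s t u v where y: "c ~= 0" "(s, t, u, v) \<in> param_dom" "y = c *s Phi (s, t, u, v)"
  unfolding surf_def by auto
 then obtain x where "x \<in> param_dom" "Phi (s, t, u, v) = A *v Psi x" using assms(2) by blast
 hence "y = A *v (c *s Psi x)" "c *s Psi x \<in> surf Psi"
  using y(1,3) unfolding surf_def by (simp_all only: vector_scalar_commute) blast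
 thus "y \<in> (*v) A ` surf Psi" by blast
next
 fix y assume "y \<in> (*v) A ` surf Psi"
 then obtain c s t u v where y: "c ~= 0" "(s, t, u, v) \<in> param_dom" "y = A *v (c *s Psi (s, t, u, v))"
  unfolding surf_def by auto
 then obtain x where x: "x \<in> param_dom" "Phi x = A *v Psi (s, t, u, v)" using assms(3) by blast
 have "y = c *s Phi x" using y x by (simp add: vector_scalar_commute)
 thus "y \<in> surf Phi" using x y(1) unfolding surf_def by blast
qed


section \<open>Lines, conics and twisted cubics\<close>

lemma is_line_image:
 assumes AB: "inverse_pair A B" and "is_line L"
 shows "is_line ((*v) A ` L)"
proof -
 obtain W where W: "vec.subspace W" "vec.dim W = 2" "L = W - {0}"
  using assms(2) unfolding is_line_def by blast
 have "vec.subspace ((*v) A ` W)" by (rule vec.subspace_image[OF W(1)])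
 moreover have "(*v) A ` L = (*v) A ` W - {0}"
  using W(3) matrix_vector_eq_0[OF AB] by (auto simp: image_iff)
 ultimately show ?thesis unfolding is_line_def using W(2) vec_dim_image[OF AB] by metis
qed

lemma is_smooth_plane_conicI:
 fixes C :: "('k::alg_closed_field^4) set"
 assumes "vec.subspace W" "vec.dim W = 3" "hpoly 2 f" "C = {x \<in> W. x ~= 0 & f x = 0}"
  "!!x. x \<in> C ==> \<exists>w\<in>W. ddir f x w ~= 0"
 shows "is_smooth_plane_conic C"
proof -
 obtain F where F: "homogeneous 2 F" "f = (%x. eval_mpoly (($) x) F)"
  using assms(3) unfolding hpoly_def by blast
 show ?thesis unfolding is_smooth_plane_conic_def
  by (intro exI[of _ W] exI[of _ F] conjI assms(1,2) F(1))
   (use assms(4,5) in \<open>auto simp: F(2) ddir_partial\<close>)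
qed

lemma is_smooth_plane_conic_image:
 fixes C :: "('k::alg_closed_field^4) set"
 assumes AB: "inverse_pair A B" and "is_smooth_plane_conic C"
 shows "is_smooth_plane_conic ((*v) A ` C)"
proof -
 note BA = inverse_pair_sym[OF AB]
 obtain W and F :: "'k poly3" where W: "vec.subspace W" "vec.dim W = 3" "homogeneous 2 F"
  "C = {x \<in> W. x ~= 0 & eval_mpoly (($) x) F = 0}"
  "\<forall>x\<in>C. \<exists>w\<in>W. ddir (%x. eval_mpoly (($) x) F) x w ~= 0"
  using assms(2) unfolding is_smooth_plane_conic_def ddir_partial by blast
 define f where "f = (%x. eval_mpoly (($) x) F)"
 show ?thesis
 proof (rule is_smooth_plane_conicI)
  show "vec.subspace ((*v) A ` W)" by (rule vec.subspace_image[OF W(1)])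
  show "vec.dim ((*v) A ` W) = 3" using W(2) vec_dim_image[OF AB] by simp
  show "hpoly 2 (%x. f (B *v x))" unfolding f_def by (intro hpoly_linear_subst hpoly_eval W(3))
  show "(*v) A ` C = {x \<in> (*v) A ` W. x ~= 0 & f (B *v x) = 0}"
  proof (rule set_eqI)
   fix x
   show "x \<in> (*v) A ` C \<longleftrightarrow> x \<in> {x \<in> (*v) A ` W. x ~= 0 & f (B *v x) = 0}"
    unfolding mem_Collect_eq inverse_pair_mem[OF AB] W(4)
    using matrix_vector_eq_0[OF BA, of x] by (simp add: f_def)
  qed
  fix x assume "x \<in> (*v) A ` C"
  then obtain w where w: "w \<in> W" "ddir f (B *v x) w ~= 0"
   using W(5) unfolding inverse_pair_mem[OF AB] f_def by blast
  show "\<exists>w\<in>(*v) A ` W. ddir (%x. f (B *v x)) x w ~= 0"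
   using w by (intro bexI[of _ "A *v w"] imageI) (simp_all add: ddir_linear_subst inverse_pair_apply[OF AB])
 qed
qed

lemma is_twisted_cubicI:
 assumes "C = {c *s vector [a^3, a^2 * b, a * b^2, b^3] | c a b. c ~= 0 & nz a b}"
 shows "is_twisted_cubic C"
 unfolding is_twisted_cubic_def assms by (intro exI[of _ "mat 1"]) (auto simp: invertible_def)

lemma is_twisted_cubic_image:
 assumes AB: "inverse_pair A B" and C: "is_twisted_cubic C"
 shows "is_twisted_cubic ((*v) A ` C)"
proof -
 obtain M :: "'a^4^4" where M: "invertible M"
  "C = {c *s (M *v vector [a^3, a^2 * b, a * b^2, b^3]) | c a b. c ~= 0 & nz a b}"
  using C unfolding is_twisted_cubic_def by blast
 have eq: "A *v (c *s (M *v w)) = c *s ((A ** M) *v w)" for c w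
  by (simp add: vector_scalar_commute matrix_vector_mul_assoc)
 have "invertible (A ** M)"
  using invertible_mult[OF _ M(1)] AB unfolding inverse_pair_def invertible_def by blast
 moreover have "(*v) A ` C = {c *s ((A ** M) *v vector [a^3, a^2 * b, a * b^2, b^3]) | c a b. c ~= 0 & nz a b}"
 proof (intro equalityI subsetI)
  fix x assume "x \<in> (*v) A ` C"
  then obtain c a b where "c ~= 0" "nz a b" "x = A *v (c *s (M *v vector [a^3, a^2 * b, a * b^2, b^3]))"
   unfolding M(2) by blast
  thus "x \<in> {c *s ((A ** M) *v vector [a^3, a^2 * b, a * b^2, b^3]) | c a b. c ~= 0 & nz a b}"
   unfolding eq by blast
 next
  fix x assume "x \<in> {c *s ((A ** M) *v vector [a^3, a^2 * b, a * b^2, b^3]) | c a b. c ~= 0 & nz a b}"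
  then obtain c a b where "c ~= 0" "nz a b" "x = A *v (c *s (M *v vector [a^3, a^2 * b, a * b^2, b^3]))"
   unfolding eq by blast
  thus "x \<in> (*v) A ` C" unfolding M(2) by blast
 qed
 ultimately show ?thesis unfolding is_twisted_cubic_def by blast
qed

section \<open>Irreducibility and dimension of explicit curves\<close>

lemma bform_coords:
 "bform 1 0 (%(s, t, u, v). s :: 'k::field)" "bform 1 0 (%(s, t, u, v). t :: 'k)"
 "bform 0 1 (%(s, t, u, v). u :: 'k)" "bform 0 1 (%(s, t, u, v). v :: 'k)"
 using bform_bmon[of 1 1 0 0] bform_bmon[of 0 1 0 0] bform_bmon[of 0 0 1 1] bform_bmon[of 0 0 0 1]
 by (simp_all add: bmon_def)

text \<open>A curve is a \<open>surf\<close> whose parametrization ignores u and v; its bidegree (d,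
  0) is what bounds the dimension by one.\<close>

lemma curve_irreducible:
 fixes gam :: "'k => 'k => 'k::alg_closed_field^4"
 assumes "!!i. bform d 0 (%(s, t, u, v). gam s t $ i)"
  and C: "C = {c *s gam s t | c s t. c ~= 0 & nz s t}" and "proj_closed C"
  and "!!c. gam 0 1 ~= c *s gam 1 0"
 shows "proj_irreducible C" "proj_dim C = 1"
proof -
 define Phi where "Phi = (%(s, t, u :: 'k, v :: 'k). gam s t)"
 have bf: "bform d 0 (%x. Phi x $ i)" for i
  using assms(1)[of i] by (simp add: Phi_def case_prod_unfold)
 have eq: "surf Phi = C" unfolding C surf_def param_dom_def Phi_def by (auto; metis one_neq_zero)
 have mem: "gam 1 0 \<in> surf Phi" "gam 0 1 \<in> surf Phi" unfolding eq C
  by (rule CollectI, rule exI[of _ 1], rule exI[of _ 1], rule exI[of _ 0], simp,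
    rule CollectI, rule exI[of _ 1], rule exI[of _ 0], rule exI[of _ 1], simp)
 show "proj_irreducible C" "proj_dim C = 1"
  using proj_dim_curve[OF bf _ mem assms(4)] assms(3) unfolding eq by auto
qed

lemma is_lineI:
 fixes v w :: "'k::alg_closed_field^4"
 assumes ind: "!!a b. a *s v + b *s w = 0 ==> a = 0 & b = 0"
  and L: "L = {a *s v + b *s w | a b. a ~= 0 | b ~= 0}"
 shows "is_line L"
proof -
 have ne: "v ~= w" using ind[of 1 "-1"] by auto
 have "w ~= 0" using ind[of 0 1] by auto
 moreover have "v \<notin> vec.span {w}"
 proof
  assume "v \<in> vec.span {w}"
  then obtain c where "v = c *s w" by (auto simp: vec.span_singleton)
  thus False using ind[of 1 "- c"] by simp
 qed
 ultimately have "vec.independent {v, w}" by (simp add: vec.independent_insert ne)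
 hence "vec.dim (vec.span {v, w}) = 2"
  using ne vec.dim_span_eq_card_independent[of "{v, w}"] by simp
 moreover have sp: "x \<in> vec.span {v, w} \<longleftrightarrow> (\<exists>a b. x = a *s v + b *s w)" for x
 proof
  assume "x \<in> vec.span {v, w}"
  then obtain a b where "x - a *s v = b *s w" by (auto simp: vec.span_insert vec.span_singleton)
  hence "x = a *s v + b *s w" by (simp add: algebra_simps)
  thus "\<exists>a b. x = a *s v + b *s w" by blast
 next
  assume "\<exists>a b. x = a *s v + b *s w"
  moreover have "v \<in> vec.span {v, w}" "w \<in> vec.span {v, w}" by (simp_all add: vec.span_base)
  ultimately show "x \<in> vec.span {v, w}"
   by (auto simp del: vec.span_add_eq vec.span_add_eq2 intro: vec.span_add vec.span_scale)
 qed
 hence "L = vec.span {v, w} - {0}"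
 proof (intro equalityI subsetI)
  fix x assume "x \<in> L"
  then obtain a b where "x = a *s v + b *s w" "nz a b" unfolding L by blast
  thus "x \<in> vec.span {v, w} - {0}" using ind[of a b] sp by auto
 next
  fix x assume x: "x \<in> vec.span {v, w} - {0}"
  then obtain a b where ab: "x = a *s v + b *s w" using sp by blast
  hence "nz a b" using x by auto
  thus "x \<in> L" using ab unfolding L by blast
 qed
 ultimately show ?thesis unfolding is_line_def by blast
qed

lemma line_irreducible:
 fixes v w :: "'k::alg_closed_field^4"
 assumes ind: "!!a b. a *s v + b *s w = 0 ==> a = 0 & b = 0"
  and L: "L = {a *s v + b *s w | a b. a ~= 0 | b ~= 0}" and "proj_closed L"
 shows "proj_irreducible L" "proj_dim L = 1"
proof -
 define gam where "gam = (%a b. a *s v + b *s w)"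
 have "bform 1 0 (%(s, t, u, v). gam s t $ i)" for i
  using bform_add[OF bform_smult[OF bform_coords(1), of "v $ i"] bform_smult[OF bform_coords(2), of "w $ i"]]
  by (simp add: gam_def case_prod_unfold mult.commute)
 moreover have "L = {c *s gam s t | c s t. c ~= 0 & nz s t}"
 proof -
  have "c *s gam s t = gam (c * s) (c * t)" for c s t by (simp add: gam_def vec_eq_iff algebra_simps)
  moreover have "gam s t = 1 *s gam s t" for s t by simp
  moreover have Lg: "L = {gam a b |a b. a ~= 0 | b ~= 0}" unfolding L gam_def ..
  ultimately show ?thesis
  proof (intro equalityI subsetI)
   fix x assume "x \<in> L"
   with Lg obtain a b where "nz a b" "x = 1 *s gam a b" by auto
   thus "x \<in> {c *s gam s t | c s t. c ~= 0 & nz s t}" using one_neq_zero by blast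
  next
   fix x assume "x \<in> {c *s gam s t | c s t. c ~= 0 & nz s t}"
   then obtain c s t where "c * s ~= 0 | c * t ~= 0" "x = c *s gam s t" by auto
   thus "x \<in> L" unfolding Lg using \<open>!!c s t. c *s gam s t = gam (c * s) (c * t)\<close> by blast
  qed
 qed
 moreover have "gam 0 1 ~= c *s gam 1 0" for c using ind[of "- c" 1] by (auto simp: gam_def)
 ultimately show "proj_irreducible L" "proj_dim L = 1"
  using curve_irreducible[of 1 gam L] assms(3) by blast+
qed

section \<open>Quadratic and linear forms\<close>

lemma vector_4 [simp]:
 "(vector [x, y, z, w] :: 'a::zero^4) $ 1 = x" "(vector [x, y, z, w] :: 'a^4) $ 2 = y"
 "(vector [x, y, z, w] :: 'a^4) $ 3 = z" "(vector [x, y, z, w] :: 'a^4) $ 4 = w"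
 by (simp_all add: vector_def)

lemma vec4_eq_iff: "x = y \<longleftrightarrow> x $ 1 = y $ 1 & x $ 2 = y $ 2 & x $ 3 = y $ 3 & x $ 4 = (y $ 4 :: 'a)"
 for x y :: "'a^4" by (simp add: vec_eq_iff forall_4)

definition qf :: "'k::field^3 => 'k => 'k => 'k" where
 "qf a s t = a $ 1 * (s * s) + a $ 2 * (s * t) + a $ 3 * (t * t)"

definition lf :: "'k::field^2 => 'k => 'k => 'k" where
 "lf a s t = a $ 1 * s + a $ 2 * t"

lemma bform_vars:
 "bform 1 0 (fst :: 'k quad => 'k::field)" "bform 1 0 (%x. fst (snd x) :: 'k)"
 "bform 0 1 (%x. fst (snd (snd x)) :: 'k)" "bform 0 1 (%x. snd (snd (snd x)) :: 'k)"
 using bform_coords[where ?'k = 'k] by (simp_all add: case_prod_unfold)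

lemma bform_lf: "bform 1 0 (%x. lf a (fst x) (fst (snd x)))" "bform 0 1 (%x. lf a (fst (snd (snd x))) (snd (snd (snd x))))"
 unfolding lf_def by (intro bform_add bform_smult bform_vars)+

lemma bform_qf: "bform 2 0 (%x. qf a (fst x) (fst (snd x)))"
proof -
 have "bform (1 + 1) (0 + 0) (%x. qf a (fst x) (fst (snd x)))"
  unfolding qf_def by (intro bform_add bform_smult bform_mult bform_vars)
 thus ?thesis by (simp add: numeral_2_eq_2)
qed

lemma bform_qf_mult:
 "bform 0 1 l ==> bform 2 1 (%x. qf a (fst x) (fst (snd x)) * l x)"
 using bform_mult[OF bform_qf, of 0 1 l] by simp

lemma path_poly_qf [simp]: "path_poly f ==> path_poly g ==> path_poly (%x. qf a (f x) (g x))"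
 by (simp add: qf_def)

lemma path_poly_lf [simp]: "path_poly f ==> path_poly g ==> path_poly (%x. lf a (f x) (g x))"
 by (simp add: lf_def)

lemmas ddir_simps = ddir_add ddir_diff ddir_mult ddir_const ddir_coord ddir_uminus

lemma hpoly_qf: "hpoly d f ==> hpoly d g ==> hpoly (2 * d) (%x. qf a (f x) (g x))"
proof -
 assume "hpoly d f" "hpoly d g"
 hence "hpoly (d + d) (%x. qf a (f x) (g x))"
  unfolding qf_def by (intro hpoly_add hpoly_smult hpoly_mult)
 thus ?thesis by (simp add: mult_2)
qed

lemma hpoly_lf: "hpoly d f ==> hpoly d g ==> hpoly d (%x. lf a (f x) (g x))"
 unfolding lf_def by (intro hpoly_add hpoly_smult)

lemma qf_root: "\<exists>s t. nz s t & qf a s t = (0 :: 'k::alg_closed_field)"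
 using ex_root_quadratic[of "a $ 1" "a $ 2" "a $ 3"]
 by (simp add: qf_def power2_eq_square mult.assoc)

lemma qf_linear: "qf (x *s a + y *s b) s t = x * qf a s t + y * qf b s t"
 by (simp add: qf_def algebra_simps)

lemma proportional_pair:
 fixes a b p q :: "'k::field"
 assumes "nz a b" "nz p q" "b * p = a * q"
 obtains c where "c ~= 0" "c * p = a" "c * q = b"
proof (cases "p = 0")
 case True
 hence "a = 0" "q ~= 0" "b ~= 0" using assms by auto
 thus ?thesis using that[of "b / q"] True by simp
next
 case False
 have "a ~= 0" using assms False by auto
 thus ?thesis using that[of "a / p"] False assms(3) by (simp add: field_simps)
qed

lemma singular_linear_pair:
 fixes a b c d :: "'k::field"
 assumes "a * d = b * c"
 obtains u v where "nz u v" "a * u + b * v = 0" "c * u + d * v = 0"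
proof (cases "a = 0 & b = 0")
 case True
 show ?thesis
 proof (cases "c = 0 & d = 0")
  case True
  thus ?thesis using that[of 1 0] \<open>a = 0 & b = 0\<close> by simp
 next
  case False
  thus ?thesis using that[of d "- c"] True by (auto simp: algebra_simps)
 qed
next
 case False
 thus ?thesis using that[of b "- a"] assms by (auto simp: algebra_simps)
qed


section \<open>Two syzygies of bidegree (0,1)\<close>

text \<open>Here \<open>U\<close> is spanned by q1 u, q1 v, q2 u, q2 v, so the map is (q1 : q2) on
  the first factor followed by the Segre embedding, with image a smooth quadric.\<close>

locale quadric_form =
 fixes q1 q2 :: "'k::alg_closed_field^3"
 assumes coprime: "!!s t. qf q1 s t = 0 ==> qf q2 s t = 0 ==> s = 0 & t = 0"
begin

definition Phi :: "'k quad => 'k^4" where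
 "Phi = (%(s, t, u, v). vector [qf q1 s t * u, qf q1 s t * v, qf q2 s t * u, qf q2 s t * v])"

definition G :: "'k^4 => 'k" where
 "G x = x $ 1 * x $ 4 - x $ 2 * x $ 3"

lemma bform_Phi: "bform 2 1 (%x. Phi x $ i)"
proof -
 have "\<forall>i. bform 2 1 (%x. Phi x $ i)"
  unfolding forall_4 Phi_def case_prod_unfold by (auto simp del: One_nat_def intro: bform_qf_mult bform_vars)
 thus ?thesis by blast
qed

lemma surf_Phi: "surf Phi = {x. x ~= 0 & G x = 0}"
proof (intro equalityI subsetI)
 fix x assume "x \<in> surf Phi"
 then obtain c s t u v where x: "c ~= 0" "nz s t" "nz u v" "x = c *s Phi (s, t, u, v)"
  by (rule surfE)
 have "qf q1 s t ~= 0 | qf q2 s t ~= 0" using coprime x(2) by blast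
 thus "x \<in> {x. x ~= 0 & G x = 0}" using x by (auto simp: Phi_def G_def vec4_eq_iff)
next
 fix x assume "x \<in> {x. x ~= 0 & G x = 0}"
 hence x: "x ~= 0" "x $ 1 * x $ 4 = x $ 2 * x $ 3" by (auto simp: G_def)
 obtain a b u v where ab: "nz a b" "nz u v"
  "x $ 1 = a * u" "x $ 2 = a * v" "x $ 3 = b * u" "x $ 4 = b * v"
 proof (cases "x $ 1 = 0 & x $ 2 = 0")
  case True
  thus ?thesis using that[of 0 1 "x $ 3" "x $ 4"] x(1) by (simp add: vec4_eq_iff)
 next
  case False
  show ?thesis
  proof (cases "x $ 1 = 0")
   case True
   thus ?thesis using that[of 1 "x $ 4 / x $ 2" "x $ 1" "x $ 2"] False x(2) by simp
  next
   case False
   thus ?thesis using that[of 1 "x $ 3 / x $ 1" "x $ 1" "x $ 2"] x(2) by (simp add: field_simps)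
  qed
 qed
 \<comment> \<open>A point of the quadric is a pair of points (a : b) and (u : v). A parameter over
   (a : b) is a root of the pencil member b q1 - a q2.\<close>
 obtain s t where st: "nz s t" "qf (b *s q1 + (- a) *s q2) s t = 0" using qf_root by blast
 hence "b * qf q1 s t = a * qf q2 s t" unfolding qf_linear by simp
 moreover have "qf q1 s t ~= 0 | qf q2 s t ~= 0" using coprime st(1) by blast
 ultimately obtain c where c: "c ~= 0" "c * qf q1 s t = a" "c * qf q2 s t = b"
  using proportional_pair ab(1) by metis
 have "x = c *s Phi (s, t, u, v)" using ab c by (auto simp: Phi_def vec4_eq_iff)
 thus "x \<in> surf Phi" using surfI[OF c(1) st(1) ab(2)] by simp
qed

lemma hpoly_G: "hpoly 2 G"
 using hpoly_diff[OF hpoly_mult[OF hpoly_coord hpoly_coord] hpoly_mult[OF hpoly_coord hpoly_coord], of 1 4 2 3]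
 by (simp add: G_def[abs_def] numeral_2_eq_2)

sublocale param_hypersurface Phi 2 1 2 G by unfold_locales (rule bform_Phi hpoly_G surf_Phi)+

lemma ddir_G: "ddir G x w = x $ 1 * w $ 4 + w $ 1 * x $ 4 - (x $ 2 * w $ 3 + w $ 2 * x $ 3)"
 by (simp add: G_def[abs_def] ddir_simps)

theorem codim1: "codim1_singular_locus (surf Phi) = {}"
proof -
 define a b where "a = qf q1 1 0" and "b = qf q2 1 0"
 have ab: "nz a b" using coprime[of 1 0] by (auto simp: a_def b_def)
 define L where "L = {x :: 'k^4. x ~= 0 & b * x $ 1 - a * x $ 3 = 0} \<inter> {x. x ~= 0 & b * x $ 2 - a * x $ 4 = 0}"
 have cl: "proj_closed L" unfolding L_def
  by (intro proj_closed_Int; rule proj_closed_hypersurface[of 1]; intro hpoly_diff hpoly_smult hpoly_coord)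
 have L: "L = {s *s vector [a, 0, b, 0] + t *s vector [0, a, 0, b] | s t. s ~= 0 | t ~= 0}"
 proof (intro equalityI subsetI)
  fix x assume "x \<in> L"
  hence x: "x ~= 0" "b * x $ 1 = a * x $ 3" "b * x $ 2 = a * x $ 4" by (auto simp: L_def)
  define s where "s = (if a ~= 0 then x $ 1 / a else x $ 3 / b)"
  define t where "t = (if a ~= 0 then x $ 2 / a else x $ 4 / b)"
  have eq: "x = s *s vector [a, 0, b, 0] + t *s vector [0, a, 0, b]"
   using ab x(2,3) by (auto simp: vec4_eq_iff s_def t_def field_simps)
  moreover have "nz s t" using x(1) eq by auto
  ultimately show "x \<in> {s *s vector [a, 0, b, 0] + t *s vector [0, a, 0, b] | s t. s ~= 0 | t ~= 0}"
   by blast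
 qed (use ab in \<open>auto simp: L_def vec4_eq_iff\<close>)
 have ind: "s = 0 & t = 0" if "s *s vector [a, 0, b, 0] + t *s vector [0, a, 0, b] = (0 :: 'k^4)" for s t
  using that ab by (auto simp: vec4_eq_iff)
 note irr = line_irreducible[OF ind L cl]
 have "L \<subset> surf Phi"
 proof
  show "L \<subseteq> surf Phi" unfolding surf_Phi L using ind by (auto simp: G_def)
  define x :: "'k^4" where "x = (if a = 0 then vector [1, 0, 0, 0] else vector [0, 0, 1, 0])"
  have "x \<in> surf Phi" "x \<notin> L" using ab by (auto simp: surf_Phi G_def L_def x_def vec4_eq_iff)
  thus "L ~= surf Phi" by blast
 qed
 hence dim: "proj_dim (surf Phi) = 2" using proj_dim_surface[OF bf _ irr] irreducible
  by (simp add: proj_irreducible_def)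
 have no_sing: "\<exists>w. ddir G x w ~= 0" if "x ~= 0" for x
 proof -
  have "ddir G x (axis 1 1) = x $ 4" "ddir G x (axis 2 1) = - x $ 3" "ddir G x (axis 3 1) = - x $ 2"
   "ddir G x (axis 4 1) = x $ 1" by (simp_all add: ddir_G axis_def)
  thus ?thesis using that unfolding vec4_eq_iff by (metis neg_equal_0_iff_equal zero_index)
 qed
 obtain x1 where x1: "x1 \<in> surf Phi" using surf_nonempty by blast
 then obtain w1 where "ddir G x1 w1 ~= 0" using no_sing surf_Phi by blast
 hence "singular_locus (surf Phi) = {x \<in> surf Phi. \<forall>w. ddir G x w = 0}"
  using singular_locus[OF x1 _ dim] by blast
 also have "\<dots> = \<Union>{}" using no_sing by (auto simp: surf_Phi)
 finally have "codim1_singular_locus (surf Phi) = \<Union>{}" by (intro codim1_singular_locus_curves) auto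
 thus ?thesis by simp
qed

end


section \<open>A syzygy of bidegree (1,0)\<close>

text \<open>The augmented 3 by 3 matrix is singular and the coefficient matrix has rank two.
  Cramer's rule for a nonzero minor solves two equations, and the determinant gives the
  third.\<close>

lemma rank_two_solve:
 fixes a1 a2 a3 b1 b2 b3 w1 w2 w3 :: "'k::field"
 assumes det: "w1 * (a2 * b3 - a3 * b2) - w2 * (a1 * b3 - a3 * b1) + w3 * (a1 * b2 - a2 * b1) = 0"
  and rank: "!!u v. a1 * u + b1 * v = 0 ==> a2 * u + b2 * v = 0 ==> a3 * u + b3 * v = 0 ==> u = 0 & v = 0"
 shows "\<exists>u v. a1 * u + b1 * v = w1 & a2 * u + b2 * v = w2 & a3 * u + b3 * v = w3"
proof -
 have cramer: "\<exists>u v. p * u + q * v = x & r * u + s * v = y & e * u + f * v = z"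
  if ne: "p * s - r * q ~= 0" and
   "x * (r * f - e * s) - y * (p * f - e * q) + z * (p * s - r * q) = 0" for p q r s e f x y z :: 'k
 proof (intro exI conjI)
  let ?D = "p * s - r * q"
  let ?u = "(x * s - y * q) / ?D" and ?v = "(p * y - r * x) / ?D"
  show "p * ?u + q * ?v = x" "r * ?u + s * ?v = y"
   using ne by (simp_all add: divide_simps) (simp_all add: algebra_simps)
  show "e * ?u + f * ?v = z" using that by (simp add: divide_simps) (simp add: algebra_simps)
 qed
 consider "a1 * b2 - a2 * b1 ~= 0" | "a1 * b3 - a3 * b1 ~= 0" | "a2 * b3 - a3 * b2 ~= 0" |
  "a1 * b2 = a2 * b1" "a1 * b3 = a3 * b1" "a2 * b3 = a3 * b2" by force
 thus ?thesis
 proof cases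
  case 1
  thus ?thesis using cramer[of a1 b2 a2 b1 w1 b3 a3 w2 w3] det by blast
 next
  case 2
  moreover have "w1 * (a3 * b2 - a2 * b3) - w3 * (a1 * b2 - a2 * b1) + w2 * (a1 * b3 - a3 * b1) = 0"
   using det by (simp add: algebra_simps)
  ultimately show ?thesis using cramer[of a1 b3 a3 b1 w1 b2 a2 w3 w2] by blast
 next
  case 3
  moreover have "w2 * (a3 * b1 - a1 * b3) - w3 * (a2 * b1 - a1 * b2) + w1 * (a2 * b3 - a3 * b2) = 0"
   using det by (simp add: algebra_simps)
  ultimately show ?thesis using cramer[of a2 b3 a3 b2 w2 b1 a1 w3 w1] by blast
 next
  case 4
  have False
  proof (cases "a1 = 0 & b1 = 0")
   case True
   obtain u v where "nz u v" "a2 * u + b2 * v = 0" "a3 * u + b3 * v = 0"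
    using singular_linear_pair[of a2 b3 b2 a3] 4(3) by (metis mult.commute)
   thus False using rank[of u v] True by simp
  next
   case False
   moreover have "a2 * b1 + b2 * (- a1) = 0" "a3 * b1 + b3 * (- a1) = 0"
    using 4(1,2) by (simp_all add: algebra_simps)
   ultimately show False using rank[of b1 "- a1"] by (simp add: algebra_simps)
  qed
  thus ?thesis ..
 qed
qed

text \<open>The form g = g1 u + g2 v of bidegree (1,1) makes s g and t g elements of
  \<open>U\<close>; two further forms complete the basis.\<close>

locale linear_syzygy_form =
 fixes g1 g2 :: "'k::alg_closed_field^2" and a2 b2 a3 b3 :: "'k^3"
 assumes g_nz: "nz g1 g2"
  and bpf: "!!s t u v. lf g1 s t * u + lf g2 s t * v = 0 ==> qf a2 s t * u + qf b2 s t * v = 0 ==>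
    qf a3 s t * u + qf b3 s t * v = 0 ==> (s = 0 & t = 0) | (u = 0 & v = 0)"
begin

definition Phi :: "'k quad => 'k^4" where
 "Phi = (%(s, t, u, v). vector [s * (lf g1 s t * u + lf g2 s t * v), t * (lf g1 s t * u + lf g2 s t * v),
  qf a2 s t * u + qf b2 s t * v, qf a3 s t * u + qf b3 s t * v])"

text \<open>\<open>q4\<close>, \<open>c3\<close>, \<open>c2\<close> are the maximal minors of the 3
  by 2 matrix of coefficients of u, v in g and in the two further forms. A triple (w, y, z) of
  values is attained over (s : t) exactly when w q4 - y c3 + z c2 = 0, and \<open>G\<close> is this
  condition with (s, t) = (x1, x2) and w = 1.\<close>

definition q4 where "q4 s t = qf a2 s t * qf b3 s t - qf a3 s t * qf b2 s t"
definition c3 where "c3 s t = lf g1 s t * qf b3 s t - qf a3 s t * lf g2 s t"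
definition c2 where "c2 s t = lf g1 s t * qf b2 s t - qf a2 s t * lf g2 s t"

definition G :: "'k^4 => 'k" where
 "G x = q4 (x $ 1) (x $ 2) - x $ 3 * c3 (x $ 1) (x $ 2) + x $ 4 * c2 (x $ 1) (x $ 2)"

lemma bform_Phi: "bform 2 1 (%x. Phi x $ i)"
proof -
 have g: "bform 1 1 (%x. lf g1 (fst x) (fst (snd x)) * fst (snd (snd x)) +
   lf g2 (fst x) (fst (snd x)) * snd (snd (snd x)))"
  using bform_add[OF bform_mult[OF bform_lf(1)[of g1] bform_vars(3)] bform_mult[OF bform_lf(1)[of g2] bform_vars(4)]]
  by simp
 have "bform 2 1 (%x. f x * (lf g1 (fst x) (fst (snd x)) * fst (snd (snd x)) +
   lf g2 (fst x) (fst (snd x)) * snd (snd (snd x))))" if "bform 1 0 f" for f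
  using bform_mult[OF that g] by (simp add: numeral_2_eq_2)
 moreover have "bform 2 1 (%x. qf a (fst x) (fst (snd x)) * fst (snd (snd x)) +
   qf b (fst x) (fst (snd x)) * snd (snd (snd x)))" for a b
  by (intro bform_add bform_qf_mult bform_vars)
 ultimately have "\<forall>i. bform 2 1 (%x. Phi x $ i)"
  unfolding forall_4 Phi_def case_prod_unfold vector_4 by (intro conjI) (simp_all only: bform_vars)
 thus ?thesis by blast
qed

lemma q4_scale: "q4 (w * s) (w * t) = w * w * w * w * q4 s t"
 by (simp add: q4_def qf_def algebra_simps)

lemma c3_scale: "c3 (w * s) (w * t) = w * w * w * c3 s t"
 by (simp add: c3_def qf_def lf_def algebra_simps)

lemma c2_scale: "c2 (w * s) (w * t) = w * w * w * c2 s t"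
 by (simp add: c2_def qf_def lf_def algebra_simps)

lemma solve:
 assumes "nz s t" "w * q4 s t - y * c3 s t + z * c2 s t = 0"
 shows "\<exists>u v. lf g1 s t * u + lf g2 s t * v = w & qf a2 s t * u + qf b2 s t * v = y &
  qf a3 s t * u + qf b3 s t * v = z"
 by (rule rank_two_solve) (use assms bpf in \<open>auto simp: q4_def c3_def c2_def\<close>)

lemma surf_Phi: "surf Phi = {x. x ~= 0 & G x = 0}"
proof (intro equalityI subsetI)
 fix x assume "x \<in> surf Phi"
 then obtain c s t u v where x: "c ~= 0" "nz s t" "nz u v" "x = c *s Phi (s, t, u, v)"
  by (rule surfE)
 define w where "w = lf g1 s t * u + lf g2 s t * v"
 define y where "y = qf a2 s t * u + qf b2 s t * v"
 define z where "z = qf a3 s t * u + qf b3 s t * v"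
 have eq: "Phi (s, t, u, v) = vector [w * s, w * t, y, z]"
  by (simp add: Phi_def w_def y_def z_def mult.commute)
 have "w * q4 s t - y * c3 s t + z * c2 s t = 0"
  by (simp add: w_def y_def z_def q4_def c3_def c2_def algebra_simps)
 moreover have "G (vector [w * s, w * t, y, z]) = w * w * w * (w * q4 s t - y * c3 s t + z * c2 s t)"
  by (simp add: G_def q4_scale c3_scale c2_scale) algebra
 moreover have "G x = c * c * c * c * G (vector [w * s, w * t, y, z])"
  by (simp add: x(4) eq G_def q4_scale c3_scale c2_scale) algebra
 moreover have "vector [w * s, w * t, y, z] ~= (0 :: 'k^4)"
  using bpf[of s t u v] x(2,3) by (auto simp: vec4_eq_iff w_def y_def z_def)
 ultimately show "x \<in> {x. x ~= 0 & G x = 0}" using x(1,4) eq by simp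
next
 fix x assume "x \<in> {x. x ~= 0 & G x = 0}"
 hence x: "x ~= 0" "G x = 0" by auto
 show "x \<in> surf Phi"
 proof (cases "x $ 1 = 0 & x $ 2 = 0")
  case False
  then obtain u v where uv: "lf g1 (x $ 1) (x $ 2) * u + lf g2 (x $ 1) (x $ 2) * v = 1"
   "qf a2 (x $ 1) (x $ 2) * u + qf b2 (x $ 1) (x $ 2) * v = x $ 3"
   "qf a3 (x $ 1) (x $ 2) * u + qf b3 (x $ 1) (x $ 2) * v = x $ 4"
   using solve[of "x $ 1" "x $ 2" 1 "x $ 3" "x $ 4"] x(2) unfolding G_def by auto
  hence "x = 1 *s Phi (x $ 1, x $ 2, u, v)" by (simp add: Phi_def vec4_eq_iff)
  moreover have "nz u v" using uv(1) by auto
  moreover have "x $ 1 ~= 0 | x $ 2 ~= 0" using False by blast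
  ultimately show ?thesis using surfI[OF one_neq_zero] by metis
 next
  case True
  \<comment> \<open>On the line x1 = x2 = 0 the form g must take the value 0. The solvability
    condition is then a binary cubic in (s, t) with these coefficients, and any root of it provides
    a parameter.\<close>
  define C where "C = (%i k. x $ 4 * (g1 $ i * b2 $ k - g2 $ i * a2 $ k) - x $ 3 * (g1 $ i * b3 $ k - g2 $ i * a3 $ k))"
  obtain s t where st: "nz s t"
   "C 1 1 * s^3 + (C 1 2 + C 2 1) * s^2 * t + (C 1 3 + C 2 2) * s * t^2 + C 2 3 * t^3 = 0"
   using ex_root_cubic[of "C 1 1" "C 1 2 + C 2 1" "C 1 3 + C 2 2" "C 2 3"] by blast
  have "0 * q4 s t - x $ 3 * c3 s t + x $ 4 * c2 s t =
   C 1 1 * s^3 + (C 1 2 + C 2 1) * s^2 * t + (C 1 3 + C 2 2) * s * t^2 + C 2 3 * t^3"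
   unfolding C_def c3_def c2_def qf_def lf_def by algebra
  then obtain u v where uv: "lf g1 s t * u + lf g2 s t * v = 0"
   "qf a2 s t * u + qf b2 s t * v = x $ 3" "qf a3 s t * u + qf b3 s t * v = x $ 4"
   using solve[OF st(1), of 0 "x $ 3" "x $ 4"] st(2) by auto
  have "x = 1 *s Phi (s, t, u, v)" using uv True by (simp add: Phi_def vec4_eq_iff)
  moreover have "nz u v" using uv x(1) True by (auto simp: vec4_eq_iff)
  ultimately show ?thesis using surfI[OF one_neq_zero] st(1) by metis
 qed
qed

lemma hpoly_G: "hpoly 4 G"
proof -
 have "hpoly (2 * 1 + 2 * 1) (%x. q4 (x $ 1) (x $ 2))"
  unfolding q4_def by (intro hpoly_diff hpoly_mult hpoly_qf hpoly_coord)
 moreover have cub: "hpoly (1 + 2 * 1) (%x. lf g (x $ 1) (x $ 2) * qf b (x $ 1) (x $ 2) -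
   qf a (x $ 1) (x $ 2) * lf g' (x $ 1) (x $ 2))" for g g' :: "'k^2" and a b
 proof (rule hpoly_diff)
  show "hpoly (1 + 2 * 1) (%x. lf g (x $ 1) (x $ 2) * qf b (x $ 1) (x $ 2))"
   by (intro hpoly_mult hpoly_qf hpoly_lf hpoly_coord)
  have "hpoly (2 * 1 + 1) (%x. qf a (x $ 1) (x $ 2) * lf g' (x $ 1) (x $ 2))"
   by (intro hpoly_mult hpoly_qf hpoly_lf hpoly_coord)
  thus "hpoly (1 + 2 * 1) (%x. qf a (x $ 1) (x $ 2) * lf g' (x $ 1) (x $ 2))"
   by (rule hpoly_cong_degree) simp
 qed
 have c: "hpoly (1 + 2 * 1) (%x. c3 (x $ 1) (x $ 2))" "hpoly (1 + 2 * 1) (%x. c2 (x $ 1) (x $ 2))"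
  unfolding c3_def c2_def by (rule cub)+
 have "hpoly 4 (%x. x $ 3 * c3 (x $ 1) (x $ 2))" "hpoly 4 (%x. x $ 4 * c2 (x $ 1) (x $ 2))"
  by (rule hpoly_cong_degree[OF hpoly_mult[OF hpoly_coord c(1)]], simp)
   (rule hpoly_cong_degree[OF hpoly_mult[OF hpoly_coord c(2)]], simp)
 ultimately show ?thesis unfolding G_def[abs_def] by (intro hpoly_add hpoly_diff) simp_all
qed

sublocale param_hypersurface Phi 2 1 4 G by unfold_locales (rule bform_Phi hpoly_G surf_Phi)+

lemma path_poly_parts [simp]:
 "path_poly (%x. q4 (x $ 1) (x $ 2))" "path_poly (%x. c3 (x $ 1) (x $ 2))" "path_poly (%x. c2 (x $ 1) (x $ 2))"
 by (simp_all add: q4_def c3_def c2_def)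

lemma ddir_parts:
 assumes "(w $ 1 = 0 & w $ 2 = 0) | (x $ 1 = 0 & x $ 2 = 0)"
 shows "ddir (%x. q4 (x $ 1) (x $ 2)) x w = 0" "ddir (%x. c3 (x $ 1) (x $ 2)) x w = 0"
  "ddir (%x. c2 (x $ 1) (x $ 2)) x w = 0"
 using assms by (auto simp: q4_def c3_def c2_def qf_def lf_def ddir_simps)

text \<open>Every term of \<open>G\<close> has order at least three in (x1, x2), which makes the
  whole line singular. At another singular point all three minors would vanish, so the coefficient
  matrix would have rank below two, against base point freeness.\<close>

theorem codim1:
 "codim1_singular_locus (surf Phi) = {x. x ~= 0 & x $ 1 = 0} \<inter> {x. x ~= 0 & x $ 2 = 0}"
 "is_line (codim1_singular_locus (surf Phi))"
proof -
 define L :: "('k^4) set" where "L = {x. x ~= 0 & x $ 1 = 0} \<inter> {x. x ~= 0 & x $ 2 = 0}"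
 have cl: "proj_closed L"
  unfolding L_def by (intro proj_closed_Int proj_closed_hypersurface[OF hpoly_coord])
 have L: "L = {s *s vector [0, 0, 1, 0] + t *s vector [0, 0, 0, 1] | s t. s ~= 0 | t ~= 0}"
 proof (intro equalityI subsetI)
  fix x assume "x \<in> L"
  hence "x = x $ 3 *s vector [0, 0, 1, 0] + x $ 4 *s vector [0, 0, 0, 1]" "x $ 3 ~= 0 | x $ 4 ~= 0"
   by (auto simp: L_def vec4_eq_iff)
  thus "x \<in> {s *s vector [0, 0, 1, 0] + t *s vector [0, 0, 0, 1] | s t. s ~= 0 | t ~= 0}" by blast
 qed (auto simp: L_def vec4_eq_iff)
 have ind: "s = 0 & t = 0" if "s *s vector [0, 0, 1, 0] + t *s vector [0, 0, 0, 1] = (0 :: 'k^4)" for s t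
  using that by (auto simp: vec4_eq_iff)
 note irr = line_irreducible[OF ind L cl]
 have smooth: "\<exists>w. ddir G x w ~= 0" if x: "x \<in> surf Phi" "x \<notin> L" for x
 proof (rule ccontr)
  assume "\<not> ?thesis"
  hence "ddir G x (axis 3 1) = 0" "ddir G x (axis 4 1) = 0" by auto
  hence c: "c3 (x $ 1) (x $ 2) = 0" "c2 (x $ 1) (x $ 2) = 0"
   by (simp_all add: G_def[abs_def] ddir_simps ddir_parts axis_def)
  moreover have "G x = 0" using x(1) surf_Phi by simp
  ultimately have q: "q4 (x $ 1) (x $ 2) = 0" by (simp add: G_def)
  have nz: "x $ 1 ~= 0 | x $ 2 ~= 0" using x surf_Phi by (auto simp: L_def)
  obtain u v u' v' where "lf g1 (x $ 1) (x $ 2) * u + lf g2 (x $ 1) (x $ 2) * v = 0"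
   "qf a2 (x $ 1) (x $ 2) * u + qf b2 (x $ 1) (x $ 2) * v = 1"
   "qf a3 (x $ 1) (x $ 2) * u + qf b3 (x $ 1) (x $ 2) * v = 0"
   "lf g1 (x $ 1) (x $ 2) * u' + lf g2 (x $ 1) (x $ 2) * v' = 0"
   "qf a2 (x $ 1) (x $ 2) * u' + qf b2 (x $ 1) (x $ 2) * v' = 0"
   "qf a3 (x $ 1) (x $ 2) * u' + qf b3 (x $ 1) (x $ 2) * v' = 1"
   using solve[OF nz, of 0 1 0] solve[OF nz, of 0 0 1] c q by auto
  hence "(qf a2 (x $ 1) (x $ 2) * qf b3 (x $ 1) (x $ 2) - qf a3 (x $ 1) (x $ 2) * qf b2 (x $ 1) (x $ 2)) *
    (u * v' - u' * v) = 1" by algebra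
  thus False using q by (simp add: q4_def)
 qed
 have LG: "ddir G x w = 0" "G x = 0" if "x \<in> L" for x w
  using that by (auto simp: L_def G_def[abs_def] ddir_simps ddir_parts q4_def c3_def c2_def qf_def lf_def)
 obtain x1 where x1: "x1 \<in> surf Phi" "x1 \<notin> L"
 proof -
  obtain s t u v where "nz s t" "nz u v" "lf g1 s t * u + lf g2 s t * v ~= 0"
  proof -
   have "\<exists>s t. nz s t & lf g s t ~= 0" if "g ~= 0" for g :: "'k^2"
   proof -
    have "g $ 1 ~= 0 | g $ 2 ~= 0" using that by (auto simp: vec_eq_iff forall_2)
    hence "lf g 1 0 ~= 0 | lf g 0 1 ~= 0" by (simp add: lf_def)
    thus ?thesis using one_neq_zero by blast
   qed
   thus ?thesis using g_nz that[of _ _ 1 0] that[of _ _ 0 1] by (metis add_0 add.right_neutral mult_1_right mult_zero_right one_neq_zero)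
  qed
  thus ?thesis using that[of "1 *s Phi (s, t, u, v)"] surfI[OF one_neq_zero, of s t u v Phi]
   by (auto simp: L_def Phi_def)
 qed
 have "L \<subset> surf Phi" using x1 LG by (auto simp: surf_Phi L_def)
 hence dim: "proj_dim (surf Phi) = 2"
  using proj_dim_surface[OF bf _ irr] irreducible by (simp add: proj_irreducible_def)
 obtain w1 where "ddir G x1 w1 ~= 0" using smooth x1 by blast
 hence "singular_locus (surf Phi) = {x \<in> surf Phi. \<forall>w. ddir G x w = 0}"
  using singular_locus[OF x1(1) _ dim] by blast
 also have "\<dots> = \<Union>{L}" using smooth LG(1) \<open>L \<subset> surf Phi\<close> by blast
 finally have "codim1_singular_locus (surf Phi) = \<Union>{L}"
  using irr by (intro codim1_singular_locus_curves) auto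
 thus "codim1_singular_locus (surf Phi) = {x. x ~= 0 & x $ 1 = 0} \<inter> {x. x ~= 0 & x $ 2 = 0}"
  "is_line (codim1_singular_locus (surf Phi))" using is_lineI[OF ind L] by (simp_all add: L_def)
qed

end

section \<open>Plane conics\<close>

definition indep3 :: "'k::field^3 => 'k^3 => 'k^3 => bool" where
 "indep3 x y z \<longleftrightarrow> (\<forall>a b c. a *s x + b *s y + c *s z = 0 --> a = 0 & b = 0 & c = 0)"

definition conic :: "(nat => 'k::field) => 'k => 'k => 'k => 'k" where
 "conic k a b c = k 1 * (a * a) + k 2 * (b * b) + k 3 * (c * c) + k 4 * (b * c) + k 5 * (a * c) + k 6 * (a * b)"

definition conic_a :: "(nat => 'k::field) => 'k => 'k => 'k => 'k" where
 "conic_a k a b c = 2 * k 1 * a + k 5 * c + k 6 * b"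

definition conic_b :: "(nat => 'k::field) => 'k => 'k => 'k => 'k" where
 "conic_b k a b c = 2 * k 2 * b + k 4 * c + k 6 * a"

definition conic_c :: "(nat => 'k::field) => 'k => 'k => 'k => 'k" where
 "conic_c k a b c = 2 * k 3 * c + k 4 * b + k 5 * a"

lemma conic_scale: "conic k (r * a) (r * b) (r * c) = r * r * conic k a b c"
 unfolding conic_def by algebra

text \<open>The conic traced by (x : y : z), as an affine cone: scalars are squares and are absorbed
  into (s, t). The smoothness clause assumes the equation besides the gradient, because in
  characteristic 2 the gradient also vanishes at a point off the conic.\<close>

definition conic_through :: "'k::field^3 => 'k^3 => 'k^3 => (nat => 'k) => bool" where
 "conic_through x y z k \<longleftrightarrow>
  (\<forall>s t. conic k (qf x s t) (qf y s t) (qf z s t) = 0) &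
  (\<forall>a b c. conic k a b c = 0 --> (\<exists>s t. a = qf x s t & b = qf y s t & c = qf z s t)) &
  (\<forall>a b c. conic k a b c = 0 --> conic_a k a b c = 0 --> conic_b k a b c = 0 -->
    conic_c k a b c = 0 --> a = 0 & b = 0 & c = 0)"

lemma vec3_eq_iff: "x = y \<longleftrightarrow> x $ 1 = y $ 1 & x $ 2 = y $ 2 & x $ 3 = (y $ 3 :: 'a)"
 for x y :: "'a^3" by (simp add: vec_eq_iff forall_3)

lemma indep3_inverse:
 fixes x y z :: "'k::field^3"
 assumes "indep3 x y z"
 obtains N :: "'k^3^3" where "vector [x, y, z] ** N = mat 1" "N ** vector [x, y, z] = mat 1"
proof -
 define M :: "'k^3^3" where "M = vector [x, y, z]"
 have "\<exists>N. M ** N = mat 1" unfolding matrix_right_invertible_independent_rows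
  using assms by (simp add: sum_3 row_def M_def indep3_def forall_3 vec_nth_inverse)
 then obtain N where "M ** N = mat 1" by blast
 moreover from this have "N ** M = mat 1" by (simp add: matrix_left_right_inverse)
 ultimately show ?thesis using that by (simp add: M_def)
qed

text \<open>The triple (s^2, st, t^2) lies on n2^2 = n1 n3. The inverse of the matrix with rows
  \<open>x\<close>, \<open>y\<close>, \<open>z\<close> pulls this equation back, and
  \<open>k\<close> lists the resulting coefficients.\<close>

lemma conic_exists:
 fixes x y z :: "'k::alg_closed_field^3"
 assumes "indep3 x y z"
 obtains k where "conic_through x y z k"
proof -
 obtain N :: "'k^3^3" where N: "vector [x, y, z] ** N = mat 1" "N ** vector [x, y, z] = mat 1"
  using indep3_inverse[OF assms] .
 define M :: "'k^3^3" where "M = vector [x, y, z]"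
 define n where "n = (%a b c i. N $ i $ 1 * a + N $ i $ 2 * b + N $ i $ 3 * c)"
 have n: "n a b c i = (N *v vector [a, b, c]) $ i" for a b c i
  by (simp add: n_def matrix_vector_mult_def sum_3)
 have Mq: "M *v vector [s * s, s * t, t * t] = vector [qf x s t, qf y s t, qf z s t]" for s t
  by (simp add: M_def matrix_vector_mult_def sum_3 vec3_eq_iff qf_def)
 have nq: "n (qf x s t) (qf y s t) (qf z s t) = ($) (vector [s * s, s * t, t * t])" for s t
 proof
  fix i
  have "N *v vector [qf x s t, qf y s t, qf z s t] = vector [s * s, s * t, t * t]"
   unfolding Mq[symmetric] matrix_vector_mul_assoc using N(2) by (simp add: M_def)
  thus "n (qf x s t) (qf y s t) (qf z s t) i = (vector [s * s, s * t, t * t] :: 'k^3) $ i"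
   by (simp add: n)
 qed
 have inv: "M *v vector [n a b c 1, n a b c 2, n a b c 3] = vector [a, b, c]" for a b c
 proof -
  have "vector [n a b c 1, n a b c 2, n a b c 3] = N *v vector [a, b, c]"
   unfolding vec3_eq_iff by (simp add: n)
  thus ?thesis using N(1) by (simp add: matrix_vector_mul_assoc M_def)
 qed
 define k where "k = (%m :: nat. let P = (%i j. 2 * N $ 2 $ i * N $ 2 $ j - N $ 1 $ i * N $ 3 $ j - N $ 1 $ j * N $ 3 $ i);
   Q = (%i. N $ 2 $ i * N $ 2 $ i - N $ 1 $ i * N $ 3 $ i) in
   if m = 1 then Q 1 else if m = 2 then Q 2 else if m = 3 then Q 3
   else if m = 4 then P 2 3 else if m = 5 then P 1 3 else P 1 2)"
 have kn: "conic k a b c = n a b c 2 * n a b c 2 - n a b c 1 * n a b c 3" for a b c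
  by (simp add: conic_def k_def n_def Let_def) algebra
 have "conic_through x y z k" unfolding conic_through_def
 proof (intro conjI allI impI)
  show "conic k (qf x s t) (qf y s t) (qf z s t) = 0" for s t unfolding kn nq by simp
  show "\<exists>s t. a = qf x s t & b = qf y s t & c = qf z s t" if "conic k a b c = 0" for a b c
  proof -
   obtain s t where st: "s^2 = n a b c 1" "t^2 = n a b c 3"
    using nth_root_exists[of 2] by (metis zero_less_numeral)
   have "(n a b c 2 - s * t) * (n a b c 2 + s * t) = 0" using that st unfolding kn by algebra
   then obtain t' where "t'^2 = n a b c 3" "s * t' = n a b c 2"
    using st(2) by (cases "n a b c 2 = s * t") (auto simp: add_eq_0_iff intro: that[of "- t"])
   hence "vector [n a b c 1, n a b c 2, n a b c 3] = (vector [s * s, s * t', t' * t'] :: 'k^3)"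
    using st(1) by (simp add: power2_eq_square)
   hence "vector [a, b, c] = (vector [qf x s t', qf y s t', qf z s t'] :: 'k^3)"
    using inv[of a b c] Mq[of s t'] by simp
   thus ?thesis unfolding vec3_eq_iff by auto
  qed
  fix a b c
  assume *: "conic k a b c = 0" "conic_a k a b c = 0" "conic_b k a b c = 0" "conic_c k a b c = 0"
  \<comment> \<open>The gradient of n2^2 - n1 n3 in the coordinates n; \<open>g v* N\<close> is the
    gradient in \<open>a\<close>, \<open>b\<close>, \<open>c\<close>. In characteristic 2 it says
    nothing about n2, which the equation itself then kills.\<close>
  define g :: "'k^3" where "g = vector [- n a b c 3, 2 * n a b c 2, - n a b c 1]"
  have "(\<Sum>i\<in>UNIV. g $ i * N $ i $ j) = 0" for j
  proof -
   have "\<forall>j. (\<Sum>i\<in>UNIV. g $ i * N $ i $ j) = 0" using *(2-4) unfolding forall_3 sum_3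
    by (simp add: g_def n_def conic_a_def conic_b_def conic_c_def k_def Let_def algebra_simps)
   thus ?thesis by blast
  qed
  hence "g v* N = 0" by (simp add: vector_matrix_mult_def vec_eq_iff mult.commute)
  hence "(g v* N) v* M = 0" by (simp add: vec_eq_iff vector_matrix_mult_def)
  hence "g v* (N ** M) = 0" by (simp add: vector_matrix_mul_assoc)
  hence "g = 0" using N(2) by (simp add: M_def)
  hence n0: "n a b c 1 = 0" "n a b c 3 = 0" unfolding vec3_eq_iff by (auto simp: g_def)
  hence "n a b c 2 = 0" using *(1) by (simp add: kn)
  hence "vector [n a b c 1, n a b c 2, n a b c 3] = (0 :: 'k^3)" using n0 by (simp add: vec3_eq_iff)
  hence "(0 :: 'k^3) = vector [a, b, c]" using inv[of a b c] by simp
  thus "a = 0" "b = 0" "c = 0" unfolding vec3_eq_iff by auto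
 qed
 thus ?thesis using that by blast
qed

lemma indep3_span:
 assumes "indep3 x y z"
 shows "\<exists>a b c. r = a *s x + b *s y + c *s z"
proof -
 obtain N :: "'a^3^3" where N: "vector [x, y, z] ** N = mat 1" "N ** vector [x, y, z] = mat 1"
  using indep3_inverse[OF assms] .
 define w where "w = r v* N"
 have "w v* vector [x, y, z] = r" using N(2) by (simp add: vector_matrix_mul_assoc w_def)
 moreover have "w v* vector [x, y, z] = w $ 1 *s x + w $ 2 *s y + w $ 3 *s z"
  by (simp add: vector_matrix_mult_def vec_eq_iff sum_3 mult.commute)
 ultimately show ?thesis by metis
qed

lemma indep3_complete:
 assumes "q ~= (0 :: 'k::field^3)"
 obtains y z where "indep3 q y z"
proof -
 consider "q $ 1 ~= 0" | "q $ 2 ~= 0" | "q $ 3 ~= 0" using assms by (auto simp: vec3_eq_iff)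
 thus ?thesis
 proof cases
  case 1
  thus ?thesis by (intro that[of "vector [0, 1, 0]" "vector [0, 0, 1]"]) (auto simp: indep3_def vec3_eq_iff)
 next
  case 2
  thus ?thesis by (intro that[of "vector [1, 0, 0]" "vector [0, 0, 1]"]) (auto simp: indep3_def vec3_eq_iff)
 next
  case 3
  thus ?thesis by (intro that[of "vector [1, 0, 0]" "vector [0, 1, 0]"]) (auto simp: indep3_def vec3_eq_iff)
 qed
qed


lemma qf_nonzero:
 assumes "q ~= (0 :: 'k::field^3)"
 obtains s t where "nz s t" "qf q s t ~= 0"
proof -
 have "qf q 1 0 ~= 0 | qf q 0 1 ~= 0 | qf q 1 1 ~= 0" using assms by (auto simp: qf_def vec3_eq_iff)
 thus ?thesis using that[of 1 0] that[of 0 1] that[of 1 1] by auto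
qed

lemma indep3_no_common_zero:
 assumes "indep3 x y z" "qf x s t = 0" "qf y s t = 0" "qf z s t = 0"
 shows "s = 0 & t = 0"
proof -
 have qf: "qf r s t = 0" for r
 proof -
  obtain a b c where "r = a *s x + b *s y + c *s z" using indep3_span[OF assms(1)] by blast
  hence "qf r s t = a * qf x s t + b * qf y s t + c * qf z s t" by (simp add: qf_def algebra_simps)
  thus ?thesis using assms(2-4) by simp
 qed
 show ?thesis using qf[of "vector [1, 0, 0]"] qf[of "vector [0, 0, 1]"] by (simp add: qf_def)
qed


section \<open>One syzygy of bidegree (0,1)\<close>

text \<open>The (0,1) syzygy contributes q u and q v; modulo these, the other two basis elements
  involve only \<open>y\<close> and \<open>z\<close>, with coefficients linear in u and v.\<close>

locale pencil_form =
 fixes q y z :: "'k::alg_closed_field^3" and l1 l2 l3 l4 :: "'k^2" and k :: "nat => 'k"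
 assumes conic: "conic_through q y z k" and q_nz: "q ~= 0"
  and bpf: "!!s t u v. qf q s t * u = 0 ==> qf q s t * v = 0 ==>
    qf y s t * lf l1 u v + qf z s t * lf l2 u v = 0 ==>
    qf y s t * lf l3 u v + qf z s t * lf l4 u v = 0 ==> (s = 0 & t = 0) | (u = 0 & v = 0)"
begin

definition Phi :: "'k quad => 'k^4" where
 "Phi = (%(s, t, u, v). vector [qf q s t * u, qf q s t * v,
  qf y s t * lf l1 u v + qf z s t * lf l2 u v, qf y s t * lf l3 u v + qf z s t * lf l4 u v])"

text \<open>Cramer's rule for the system y l1 + z l2 = x3 q, y l3 + z l4 = x4 q at (u, v) = (x1,
  x2): on the surface (disc, Yf, Zf) is proportional to (q, y, z). Thus \<open>G\<close> requires
  that this point lie on the conic.\<close>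

definition disc where "disc u v = lf l1 u v * lf l4 u v - lf l2 u v * lf l3 u v"
definition Yf :: "'k^4 => 'k" where "Yf x = x $ 3 * lf l4 (x $ 1) (x $ 2) - x $ 4 * lf l2 (x $ 1) (x $ 2)"
definition Zf :: "'k^4 => 'k" where "Zf x = x $ 4 * lf l1 (x $ 1) (x $ 2) - x $ 3 * lf l3 (x $ 1) (x $ 2)"
definition G :: "'k^4 => 'k" where "G x = conic k (disc (x $ 1) (x $ 2)) (Yf x) (Zf x)"

lemma bform_Phi: "bform 2 1 (%x. Phi x $ i)"
proof -
 have "\<forall>i. bform 2 1 (%x. Phi x $ i)" unfolding forall_4 Phi_def case_prod_unfold vector_4
  by (intro conjI bform_add bform_qf_mult bform_vars bform_lf)
 thus ?thesis by blast
qed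

lemma hpoly_G: "hpoly 4 G"
proof -
 have "hpoly (1 + 1) (%x. disc (x $ 1) (x $ 2))" "hpoly (1 + 1) Yf" "hpoly (1 + 1) Zf"
  unfolding disc_def Yf_def[abs_def] Zf_def[abs_def]
  by (intro hpoly_diff hpoly_mult hpoly_lf hpoly_coord)+
 hence "hpoly ((1 + 1) + (1 + 1)) G"
  unfolding G_def[abs_def] conic_def by (intro hpoly_add hpoly_smult hpoly_mult)
 thus ?thesis by (rule hpoly_cong_degree) simp
qed

lemma on_surface:
 assumes "x = c *s Phi (s, t, u, v)"
 shows "G x = 0"
proof -
 let ?r = "c * c * qf q s t * disc u v"
 have l: "lf l (c * (qf q s t * u)) (c * (qf q s t * v)) = c * qf q s t * lf l u v" for l
  unfolding lf_def by algebra
 have "disc (x $ 1) (x $ 2) = ?r * qf q s t" "Yf x = ?r * qf y s t" "Zf x = ?r * qf z s t"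
  unfolding Yf_def Zf_def disc_def assms Phi_def by (simp_all add: l) algebra+
 thus ?thesis unfolding G_def using conic conic_scale[of k ?r] by (simp add: conic_through_def)
qed

text \<open>The conic point (0, Yf, Zf) comes from some (s, t) with q = 0, and by Cramer's rule the
  other two basis elements vanish there as well. Base point freeness leaves s = t = 0.\<close>

lemma on_discriminant:
 assumes "G x = 0" "x ~= 0" "disc (x $ 1) (x $ 2) = 0"
 shows "Yf x = 0" "Zf x = 0"
proof -
 have "Yf x = 0 & Zf x = 0"
 proof (cases "x $ 1 = 0 & x $ 2 = 0")
  case True
  thus ?thesis by (simp add: Yf_def Zf_def lf_def)
 next
  case False
  obtain s t where st: "0 = qf q s t" "Yf x = qf y s t" "Zf x = qf z s t"
   using assms(1,3) conic unfolding G_def conic_through_def by metis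
  have "qf y s t * lf l1 (x $ 1) (x $ 2) + qf z s t * lf l2 (x $ 1) (x $ 2) = 0"
   "qf y s t * lf l3 (x $ 1) (x $ 2) + qf z s t * lf l4 (x $ 1) (x $ 2) = 0"
   using assms(3) unfolding st(2,3)[symmetric] Yf_def Zf_def disc_def by algebra+
  hence "s = 0 & t = 0" using bpf[of s t "x $ 1" "x $ 2"] st(1) False by auto
  thus ?thesis using st by (simp add: qf_def)
 qed
 thus "Yf x = 0" "Zf x = 0" by auto
qed

lemma surf_Phi: "surf Phi = {x. x ~= 0 & G x = 0}"
proof (intro equalityI subsetI)
 fix x assume "x \<in> surf Phi"
 then obtain c s t u v where x: "c ~= 0" "nz s t" "nz u v" "x = c *s Phi (s, t, u, v)"
  by (rule surfE)
 have "x ~= 0" using bpf[of s t u v] x by (auto simp: Phi_def vec4_eq_iff)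
 thus "x \<in> {x. x ~= 0 & G x = 0}" using on_surface[OF x(4)] by simp
next
 fix x assume "x \<in> {x. x ~= 0 & G x = 0}"
 hence x: "x ~= 0" "G x = 0" by auto
 let ?L = "%l. lf l (x $ 1) (x $ 2)"
 show "x \<in> surf Phi"
 proof (cases "x $ 1 = 0 & x $ 2 = 0")
  case True
  obtain s t where st: "nz s t" "qf q s t = 0" using qf_root by blast
  define m where "m = (%(l :: 'k^2) (l' :: 'k^2) i. qf y s t * l $ i + qf z s t * l' $ i)"
  have m: "m l l' 1 * u + m l l' 2 * v = qf y s t * lf l u v + qf z s t * lf l' u v"
   for l l' :: "'k^2" and u v unfolding m_def lf_def by algebra
  have "\<exists>u v. 0 * u + 0 * v = (0 :: 'k) & m l1 l2 1 * u + m l1 l2 2 * v = x $ 3 &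
    m l3 l4 1 * u + m l3 l4 2 * v = x $ 4"
  proof (rule rank_two_solve)
   fix u v assume "m l1 l2 1 * u + m l1 l2 2 * v = 0" "m l3 l4 1 * u + m l3 l4 2 * v = 0"
   thus "u = 0 & v = 0" using bpf[of s t u v] st unfolding m by auto
  qed simp
  then obtain u v where "qf y s t * lf l1 u v + qf z s t * lf l2 u v = x $ 3"
   "qf y s t * lf l3 u v + qf z s t * lf l4 u v = x $ 4" unfolding m by blast
  hence eq: "x = 1 *s Phi (s, t, u, v)" using True st(2) by (simp add: Phi_def vec4_eq_iff)
  moreover have "nz u v" using x(1) eq by (auto simp: Phi_def vec4_eq_iff lf_def)
  ultimately show ?thesis using surfI[OF one_neq_zero st(1)] by metis
 next
  case nz: False
  hence nz': "x $ 1 ~= 0 | x $ 2 ~= 0" by blast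
  show ?thesis
  proof (cases "disc (x $ 1) (x $ 2) = 0")
   case False
   let ?D = "disc (x $ 1) (x $ 2)"
   obtain s t where st: "?D = qf q s t" "Yf x = qf y s t" "Zf x = qf z s t"
    using x(2) conic unfolding G_def conic_through_def by metis
   have "Yf x * ?L l1 + Zf x * ?L l2 = ?D * x $ 3" "Yf x * ?L l3 + Zf x * ?L l4 = ?D * x $ 4"
    unfolding Yf_def Zf_def disc_def by algebra+
   hence "x = inverse ?D *s Phi (s, t, x $ 1, x $ 2)"
    using False by (simp add: Phi_def vec4_eq_iff st[symmetric] field_simps)
   moreover have "nz s t" using False st(1) by (auto simp: qf_def)
   ultimately show ?thesis using surfI[of "inverse ?D" s t "x $ 1" "x $ 2" Phi] False nz' by simp
  next
   case True
   have YZ: "x $ 3 * ?L l4 = x $ 4 * ?L l2" "x $ 4 * ?L l1 = x $ 3 * ?L l3"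
    using on_discriminant[OF x(2,1) True] by (simp_all add: Yf_def Zf_def)
   have D: "?L l1 * ?L l4 = ?L l2 * ?L l3" using True by (simp add: disc_def)
   \<comment> \<open>The matrix of linear forms is singular here. \<open>sel\<close> is its first
     row if that is nonzero, else the second, together with the matching coordinate; the parameter
     (s : t) is a root of the binary quadratic form obtained from this one equation.\<close>
   define sel where "sel = (if ?L l1 ~= 0 | ?L l2 ~= 0 then (?L l1, ?L l2, x $ 3) else (?L l3, ?L l4, x $ 4))"
   obtain r1 r2 p where r: "sel = (r1, r2, p)" by (cases sel)
   obtain s t where st: "nz s t" "qf (1 *s (r1 *s y + r2 *s z) + (- p) *s q) s t = 0"
    using qf_root by blast
   hence root: "r1 * qf y s t + r2 * qf z s t = p * qf q s t" unfolding qf_linear by simp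
   have eqs: "qf y s t * ?L l1 + qf z s t * ?L l2 = x $ 3 * qf q s t &
     qf y s t * ?L l3 + qf z s t * ?L l4 = x $ 4 * qf q s t"
   proof (cases "?L l1 ~= 0 | ?L l2 ~= 0")
    case True
    hence "r1 = ?L l1" "r2 = ?L l2" "p = x $ 3" using r by (auto simp: sel_def)
    hence e: "qf y s t * ?L l1 + qf z s t * ?L l2 = x $ 3 * qf q s t" using root by (simp add: mult.commute)
    have "?L l1 * (qf y s t * ?L l3 + qf z s t * ?L l4) = ?L l1 * (x $ 4 * qf q s t)"
     "?L l2 * (qf y s t * ?L l3 + qf z s t * ?L l4) = ?L l2 * (x $ 4 * qf q s t)"
     using e YZ D by algebra+
    thus ?thesis using e True by auto
   next
    case False
    hence "r1 = ?L l3" "r2 = ?L l4" "p = x $ 4" using r by (auto simp: sel_def)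
    hence e: "qf y s t * ?L l3 + qf z s t * ?L l4 = x $ 4 * qf q s t" using root by (simp add: mult.commute)
    have "x $ 3 * qf q s t = 0"
    proof (rule ccontr)
     assume "x $ 3 * qf q s t ~= 0"
     hence "?L l3 = 0" "?L l4 = 0" using YZ False by auto
     hence "!!s t. qf q s t = 0 ==> s = 0 & t = 0" using bpf[of _ _ "x $ 1" "x $ 2"] False nz' by auto
     thus False using qf_root[of q] by blast
    qed
    thus ?thesis using e False by simp
   qed
   have Q: "qf q s t ~= 0" using eqs bpf[of s t "x $ 1" "x $ 2"] st(1) nz' by auto
   have "x = inverse (qf q s t) *s Phi (s, t, x $ 1, x $ 2)"
    using eqs Q by (simp add: Phi_def vec4_eq_iff field_simps)
   thus ?thesis using surfI[of "inverse (qf q s t)" s t "x $ 1" "x $ 2" Phi] Q nz' st(1) by simp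
  qed
 qed
qed

sublocale param_hypersurface Phi 2 1 4 G by unfold_locales (rule bform_Phi hpoly_G surf_Phi)+

lemma path_poly_parts [simp]:
 "path_poly (%x. disc (x $ 1) (x $ 2))" "path_poly Yf" "path_poly Zf"
 unfolding disc_def Yf_def[abs_def] Zf_def[abs_def] by simp_all

lemma ddir_G:
 "ddir G x w =
  conic_a k (disc (x $ 1) (x $ 2)) (Yf x) (Zf x) * ddir (%x. disc (x $ 1) (x $ 2)) x w +
  conic_b k (disc (x $ 1) (x $ 2)) (Yf x) (Zf x) * ddir Yf x w +
  conic_c k (disc (x $ 1) (x $ 2)) (Yf x) (Zf x) * ddir Zf x w"
 unfolding G_def[abs_def] conic_def conic_a_def conic_b_def conic_c_def
 by (simp add: ddir_simps) algebra

text \<open>If \<open>disc\<close> is nonzero, the derivatives in x3 and x4 force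
  \<open>conic_b\<close> and \<open>conic_c\<close> to vanish, and Euler's relation then
  \<open>conic_a\<close>; this contradicts smoothness of the conic. If it is zero, the point of the
  conic is (0, 0, 0) and all derivatives vanish.\<close>

lemma ddir_G_zero_iff:
 assumes "x \<in> surf Phi"
 shows "(\<forall>w. ddir G x w = 0) \<longleftrightarrow> disc (x $ 1) (x $ 2) = 0"
proof
 have x: "x ~= 0" "G x = 0" using assms surf_Phi by auto
 {
  assume "disc (x $ 1) (x $ 2) = 0"
  thus "\<forall>w. ddir G x w = 0"
   using on_discriminant[OF x(2,1)] by (simp add: ddir_G conic_a_def conic_b_def conic_c_def)
 }
 assume zero: "\<forall>w. ddir G x w = 0"
 let ?D = "disc (x $ 1) (x $ 2)" and ?L = "%l. lf l (x $ 1) (x $ 2)"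
 let ?a = "conic_a k ?D (Yf x) (Zf x)" and ?b = "conic_b k ?D (Yf x) (Zf x)" and ?c = "conic_c k ?D (Yf x) (Zf x)"
 have d0: "ddir (%x. disc (x $ 1) (x $ 2)) x (axis i 1) = 0" if "i = 3 | i = 4" for i
  using that by (auto simp: disc_def lf_def ddir_simps axis_def)
 have "ddir Yf x (axis 3 1) = ?L l4" "ddir Yf x (axis 4 1) = - ?L l2"
  "ddir Zf x (axis 3 1) = - ?L l3" "ddir Zf x (axis 4 1) = ?L l1"
  by (simp_all add: Yf_def[abs_def] Zf_def[abs_def] lf_def ddir_simps axis_def)
 hence "?b * ?L l4 = ?c * ?L l3" "?c * ?L l1 = ?b * ?L l2"
  using zero[rule_format, of "axis 3 1"] zero[rule_format, of "axis 4 1"] by (simp_all add: ddir_G d0)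
 hence "?b * ?D = 0" "?c * ?D = 0" unfolding disc_def by algebra+
 moreover have "?D * ?a + Yf x * ?b + Zf x * ?c = 2 * conic k ?D (Yf x) (Zf x)"
  unfolding conic_def conic_a_def conic_b_def conic_c_def by algebra
 moreover have "conic k ?D (Yf x) (Zf x) = 0" using x(2) by (simp add: G_def)
 ultimately show "?D = 0"
  using conic unfolding conic_through_def by (metis add.right_neutral mult_eq_0_iff mult_zero_right)
qed

definition L0 :: "('k^4) set" where
 "L0 = {x. x ~= 0 & x $ 1 = 0} \<inter> {x. x ~= 0 & x $ 2 = 0}"

text \<open>The image of the fibre (u : v) = (a : b) over a root of \<open>disc\<close>, which
  collapses onto a line. Both conditions on x3 and x4 are imposed since either may degenerate to 0 =
  0.\<close>

definition Lr :: "'k \<times> 'k => ('k^4) set" where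
 "Lr = (%(a, b). {x. x ~= 0 & b * x $ 1 - a * x $ 2 = 0} \<inter>
  {x. x ~= 0 & lf l4 a b * x $ 3 - lf l2 a b * x $ 4 = 0} \<inter>
  {x. x ~= 0 & lf l1 a b * x $ 4 - lf l3 a b * x $ 3 = 0})"

lemma line_L0: "is_line L0" "proj_irreducible L0" "proj_dim L0 = 1"
proof -
 have cl: "proj_closed L0"
  unfolding L0_def by (intro proj_closed_Int proj_closed_hypersurface[OF hpoly_coord])
 have L: "L0 = {s *s vector [0, 0, 1, 0] + t *s vector [0, 0, 0, 1] | s t. s ~= 0 | t ~= 0}"
 proof (intro equalityI subsetI)
  fix x assume "x \<in> L0"
  hence "x = x $ 3 *s vector [0, 0, 1, 0] + x $ 4 *s vector [0, 0, 0, 1]" "x $ 3 ~= 0 | x $ 4 ~= 0"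
   by (auto simp: L0_def vec4_eq_iff)
  thus "x \<in> {s *s vector [0, 0, 1, 0] + t *s vector [0, 0, 0, 1] | s t. s ~= 0 | t ~= 0}" by blast
 qed (auto simp: L0_def vec4_eq_iff)
 have ind: "s = 0 & t = 0" if "s *s vector [0, 0, 1, 0] + t *s vector [0, 0, 0, 1] = (0 :: 'k^4)" for s t
  using that by (auto simp: vec4_eq_iff)
 show "is_line L0" "proj_irreducible L0" "proj_dim L0 = 1"
  using line_irreducible[OF ind L cl] is_lineI[OF ind L] by blast+
qed

lemma line_Lr:
 assumes ab: "nz a b" "disc a b = 0"
 shows "is_line (Lr (a, b))" "proj_irreducible (Lr (a, b))" "proj_dim (Lr (a, b)) = 1"
  "\<exists>e f. vector [a, b, e, f] \<in> Lr (a, b)"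
proof -
 have cl: "proj_closed (Lr (a, b))" unfolding Lr_def prod.case
  by (intro proj_closed_Int; rule proj_closed_hypersurface[of 1]; intro hpoly_diff hpoly_smult hpoly_coord)
 have D: "lf l1 a b * lf l4 a b = lf l2 a b * lf l3 a b" using ab(2) by (simp add: disc_def)
 obtain s t where st: "nz s t" "qf q s t = 0" using qf_root by blast
 have nz: "lf l1 a b ~= 0 | lf l2 a b ~= 0 | lf l3 a b ~= 0 | lf l4 a b ~= 0"
  using bpf[of s t a b] st ab(1) by auto
 \<comment> \<open>(e, f) is a nonzero column of the matrix of linear forms at (a, b), which has
   rank one.\<close>
 define e where "e = (if lf l1 a b ~= 0 | lf l3 a b ~= 0 then lf l1 a b else lf l2 a b)"
 define f where "f = (if lf l1 a b ~= 0 | lf l3 a b ~= 0 then lf l3 a b else lf l4 a b)"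
 have ef: "nz e f" "lf l4 a b * e = lf l2 a b * f" "lf l1 a b * f = lf l3 a b * e"
  using nz D by (auto simp: e_def f_def mult.commute split: if_splits)
 have ind: "s = 0 & t = 0" if "s *s vector [a, b, 0, 0] + t *s vector [0, 0, e, f] = (0 :: 'k^4)" for s t
  using that ab(1) ef(1) by (auto simp: vec4_eq_iff)
 have L: "Lr (a, b) = {s *s vector [a, b, 0, 0] + t *s vector [0, 0, e, f] | s t. s ~= 0 | t ~= 0}"
 proof (intro equalityI subsetI)
  fix x assume "x \<in> Lr (a, b)"
  hence x: "x ~= 0" "b * x $ 1 = a * x $ 2" "lf l4 a b * x $ 3 = lf l2 a b * x $ 4"
   "lf l1 a b * x $ 4 = lf l3 a b * x $ 3" by (auto simp: Lr_def)
  define s where "s = (if a ~= 0 then x $ 1 / a else x $ 2 / b)"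
  define t where "t = (if e ~= 0 then x $ 3 / e else x $ 4 / f)"
  have s: "x $ 1 = s * a" "x $ 2 = s * b" using ab(1) x(2) by (auto simp: s_def field_simps)
  have "f * x $ 3 = e * x $ 4"
  proof -
   have "lf l1 a b * (f * x $ 3) = lf l1 a b * (e * x $ 4)" "lf l2 a b * (f * x $ 3) = lf l2 a b * (e * x $ 4)"
    "lf l3 a b * (f * x $ 3) = lf l3 a b * (e * x $ 4)" "lf l4 a b * (f * x $ 3) = lf l4 a b * (e * x $ 4)"
    using ef(2,3) x(3,4) by algebra+
   thus ?thesis using nz by auto
  qed
  hence t: "x $ 3 = t * e" "x $ 4 = t * f" using ef(1) by (auto simp: t_def field_simps)
  have eq: "x = s *s vector [a, b, 0, 0] + t *s vector [0, 0, e, f]"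
   using s t by (simp add: vec4_eq_iff)
  moreover have "nz s t" using x(1) eq by auto
  ultimately show "x \<in> {s *s vector [a, b, 0, 0] + t *s vector [0, 0, e, f] | s t. s ~= 0 | t ~= 0}"
   by blast
 next
  fix x :: "'k^4" assume "x \<in> {s *s vector [a, b, 0, 0] + t *s vector [0, 0, e, f] | s t. s ~= 0 | t ~= 0}"
  then obtain s t where st: "x = s *s vector [a, b, 0, 0] + t *s vector [0, 0, e, f]" "nz s t"
   by blast
  have "x ~= 0" using st ind[of s t] by metis
  thus "x \<in> Lr (a, b)" using st ef(2,3) by (simp add: Lr_def mult.left_commute)
 qed
 show "is_line (Lr (a, b))" "proj_irreducible (Lr (a, b))" "proj_dim (Lr (a, b)) = 1"
  using line_irreducible[OF ind L cl] is_lineI[OF ind L] by blast+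
 have "vector [a, b, 0, 0] = 1 *s vector [a, b, 0, 0] + 0 *s vector [0, 0, e, f :: 'k]" by simp
 hence "vector [a, b, 0, 0] \<in> Lr (a, b)" unfolding L using one_neq_zero by blast
 thus "\<exists>e f. vector [a, b, e, f] \<in> Lr (a, b)" by blast
qed

theorem codim1:
 assumes R: "finite R" "!!a b. (a, b) \<in> R ==> nz a b"
  and roots: "!!u v. nz u v ==> disc u v = 0 \<longleftrightarrow> (\<exists>(a, b)\<in>R. b * u = a * v)"
  and nz: "disc u0 v0 ~= 0"
 shows "codim1_singular_locus (surf Phi) = L0 \<union> \<Union> (Lr ` R)"
proof -
 have root: "disc a b = 0" if "(a, b) \<in> R" for a b
 proof -
  have "\<exists>(a', b')\<in>R. b' * a = a' * b" using that by (intro bexI[of _ "(a, b)"]) auto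
  thus ?thesis using roots[of a b] R(2)[OF that] by blast
 qed
 obtain s t where st: "nz s t" "qf q s t ~= 0" using qf_nonzero[OF q_nz] .
 have uv0: "nz u0 v0" using nz by (auto simp: disc_def lf_def)
 define x1 where "x1 = 1 *s Phi (s, t, u0, v0)"
 have x1: "x1 \<in> surf Phi" unfolding x1_def by (rule surfI[OF one_neq_zero st(1) uv0])
 have "disc (x1 $ 1) (x1 $ 2) = qf q s t * qf q s t * disc u0 v0"
  unfolding x1_def Phi_def disc_def lf_def by simp algebra
 hence x1d: "disc (x1 $ 1) (x1 $ 2) ~= 0" using st(2) nz by simp
 then obtain w1 where w1: "ddir G x1 w1 ~= 0" using ddir_G_zero_iff[OF x1] by blast
 have L0: "x \<in> surf Phi" if "x \<in> L0" for x
  using that by (auto simp: surf_Phi L0_def G_def disc_def Yf_def Zf_def lf_def conic_def)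
 have "x1 \<notin> L0" using x1d by (auto simp: L0_def disc_def lf_def)
 hence "L0 \<subset> surf Phi" using L0 x1 by blast
 hence dim: "proj_dim (surf Phi) = 2"
  using proj_dim_surface[OF bf _ line_L0(2,3)] irreducible by (simp add: proj_irreducible_def)
 have "singular_locus (surf Phi) = {x \<in> surf Phi. \<forall>w. ddir G x w = 0}"
  by (rule singular_locus[OF x1 w1 dim])
 also have "\<dots> = {x \<in> surf Phi. disc (x $ 1) (x $ 2) = 0}" using ddir_G_zero_iff by blast
 also have "\<dots> = \<Union> (insert L0 (Lr ` R))"
 proof (intro equalityI subsetI)
  fix x assume "x \<in> {x \<in> surf Phi. disc (x $ 1) (x $ 2) = 0}"
  hence x: "x ~= 0" "G x = 0" "disc (x $ 1) (x $ 2) = 0" by (auto simp: surf_Phi)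
  note YZ = on_discriminant[OF x(2,1,3)]
  show "x \<in> \<Union> (insert L0 (Lr ` R))"
  proof (cases "x $ 1 = 0 & x $ 2 = 0")
   case True
   thus ?thesis using x(1) by (auto simp: L0_def)
  next
   case False
   then obtain a b where ab: "(a, b) \<in> R" "b * x $ 1 = a * x $ 2"
    using roots[of "x $ 1" "x $ 2"] x(3) by blast
   obtain r where r: "r ~= 0" "r * a = x $ 1" "r * b = x $ 2"
    using proportional_pair[of "x $ 1" "x $ 2" a b] False R(2)[OF ab(1)] ab(2) by (metis mult.commute)
   have lr: "lf l (x $ 1) (x $ 2) = r * lf l a b" for l
    unfolding r(2,3)[symmetric] lf_def by algebra
   have "r * (lf l4 a b * x $ 3 - lf l2 a b * x $ 4) = 0" "r * (lf l1 a b * x $ 4 - lf l3 a b * x $ 3) = 0"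
    using YZ unfolding Yf_def Zf_def lr by algebra+
   hence "x \<in> Lr (a, b)" using x(1) ab(2) r(1) by (simp add: Lr_def)
   thus ?thesis using ab(1) by blast
  qed
 next
  fix x assume "x \<in> \<Union> (insert L0 (Lr ` R))"
  then consider "x \<in> L0" | a b where "(a, b) \<in> R" "x \<in> Lr (a, b)" by auto
  thus "x \<in> {x \<in> surf Phi. disc (x $ 1) (x $ 2) = 0}"
  proof cases
   case 1
   thus ?thesis using L0[OF 1] by (auto simp: L0_def disc_def lf_def)
  next
   case 2
   hence x: "x ~= 0" "b * x $ 1 = a * x $ 2" "lf l4 a b * x $ 3 = lf l2 a b * x $ 4"
    "lf l1 a b * x $ 4 = lf l3 a b * x $ 3" by (auto simp: Lr_def)
   define r where "r = (if a ~= 0 then x $ 1 / a else x $ 2 / b)"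
   have r: "x $ 1 = r * a" "x $ 2 = r * b" using R(2)[OF 2(1)] x(2) by (auto simp: r_def field_simps)
   have lr: "lf l (x $ 1) (x $ 2) = r * lf l a b" for l unfolding r lf_def by algebra
   have "disc (x $ 1) (x $ 2) = r * r * disc a b" unfolding disc_def lr by algebra
   hence D: "disc (x $ 1) (x $ 2) = 0" using root[OF 2(1)] by simp
   have "Yf x = 0" "Zf x = 0" using x(3,4) unfolding Yf_def Zf_def lr by algebra+
   thus ?thesis using D x(1) by (simp add: surf_Phi G_def conic_def)
  qed
 qed
 finally have "codim1_singular_locus (surf Phi) = \<Union> (insert L0 (Lr ` R))"
  using R line_L0 line_Lr root by (intro codim1_singular_locus_curves) auto
 thus ?thesis by simp
qed

lemma L0_neq_Lr:
 assumes "nz a b" "disc a b = 0"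
 shows "L0 ~= Lr (a, b)"
proof -
 obtain e f where "vector [a, b, e, f] \<in> Lr (a, b)" using line_Lr(4)[OF assms] by blast
 moreover have "vector [a, b, e, f] \<notin> L0" using assms(1) by (simp add: L0_def)
 ultimately show ?thesis by metis
qed

lemma Lr_neq_Lr:
 assumes "nz a b" "disc a b = 0" "b * c ~= a * d"
 shows "Lr (a, b) ~= Lr (c, d)"
proof -
 obtain e f where "vector [a, b, e, f] \<in> Lr (a, b)" using line_Lr(4)[OF assms(1,2)] by blast
 moreover have "vector [a, b, e, f] \<notin> Lr (c, d)" using assms(3) by (simp add: Lr_def mult.commute)
 ultimately show ?thesis by metis
qed

end

section \<open>A syzygy of bidegree (0,2)\<close>

text \<open>\<open>k 2 ~= 0\<close> keeps (0, 1, 0) off the conic, so that \<open>x\<close> and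
  \<open>z\<close> have no common root; \<open>k 3 ~= 0\<close> does the same for (0, 0, 1), hence
  for \<open>x\<close> and \<open>y\<close>.\<close>

locale conic_line_form =
 fixes x y z :: "'k::alg_closed_field^3" and k :: "nat => 'k"
 assumes ind: "indep3 x y z" and conic: "conic_through x y z k" and k2: "k 2 ~= 0" and k3: "k 3 ~= 0"
begin

definition Phi :: "'k quad => 'k^4" where
 "Phi = (%(s, t, u, v). vector [qf x s t * u + qf z s t * v, qf z s t * u, qf x s t * v, qf y s t * v])"

definition M :: "'k^4 => 'k" where
 "M w = k 3 * w $ 1 + k 5 * w $ 3 + k 4 * w $ 4"

definition E :: "'k^4 => 'k" where
 "E w = k 1 * (w $ 3 * w $ 3) + k 6 * (w $ 3 * w $ 4) + k 2 * (w $ 4 * w $ 4) - k 3 * (w $ 2 * w $ 3)"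

definition G :: "'k^4 => 'k" where
 "G w = E w * E w + w $ 1 * (E w * M w) + (w $ 2 * w $ 3) * (M w * M w)"

text \<open>
 \<open>G\<close> is the norm of \<open>conic k w\<^sub>3 w\<^sub>4 tau\<close> over the quadratic extension generated by a root
 \<open>tau\<close> of \<open>tau\<^sup>2 - w\<^sub>1 tau + w\<^sub>2 w\<^sub>3\<close>, and \<open>E + tau M\<close> is that conic with \<open>tau\<^sup>2\<close> eliminated.
\<close>

lemma G_factor:
 assumes "a + b = w $ 1" "a * b = w $ 2 * w $ 3"
 shows "G w = (E w + a * M w) * (E w + b * M w)" unfolding G_def assms[symmetric] by algebra

lemma conic_eq:
 assumes "a + b = w $ 1" "a * b = w $ 2 * w $ 3"
 shows "conic k (w $ 3) (w $ 4) a = E w + a * M w"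
 unfolding E_def M_def conic_def assms[symmetric] by algebra

lemma roots:
 fixes w :: "'k^4"
 obtains a b where "a + b = w $ 1" "a * b = w $ 2 * w $ 3"
proof -
 have "degree [:w $ 2 * w $ 3, - w $ 1, 1:] > 0" by simp
 then obtain a where "poly [:w $ 2 * w $ 3, - w $ 1, 1:] a = 0"
  using alg_closed_imp_poly_has_root by blast
 hence "w $ 2 * w $ 3 + a * (- w $ 1 + a) = 0" by simp
 hence "a * (w $ 1 - a) = w $ 2 * w $ 3" by algebra
 thus ?thesis using that[of a "w $ 1 - a"] by simp
qed

lemma conic_b_axis: "conic k 0 b 0 = 0 ==> b = 0" using k2 by (simp add: conic_def)

lemma xz_coprime:
 assumes "qf x s t = 0" "qf z s t = 0"
 shows "s = 0 & t = 0"
proof -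
 have "conic k (qf x s t) (qf y s t) (qf z s t) = 0" using conic by (simp add: conic_through_def)
 hence "qf y s t = 0" using assms conic_b_axis by simp
 thus ?thesis using indep3_no_common_zero[OF ind] assms by blast
qed

lemma bform_Phi: "bform 2 1 (%p. Phi p $ i)"
proof -
 have "\<forall>i. bform 2 1 (%p. Phi p $ i)" unfolding forall_4 Phi_def case_prod_unfold vector_4
  by (intro conjI bform_add bform_qf_mult bform_vars)
 thus ?thesis by blast
qed

lemma hpoly_M: "hpoly 1 M" unfolding M_def[abs_def] by (intro hpoly_add hpoly_smult hpoly_coord)

lemma hpoly_E: "hpoly 2 E"
proof -
 have "hpoly (1 + 1) E"
  unfolding E_def[abs_def] by (intro hpoly_add hpoly_diff hpoly_smult hpoly_mult hpoly_coord)
 thus ?thesis by (rule hpoly_cong_degree) simp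
qed

lemma hpoly_G: "hpoly 4 G"
proof -
 have "hpoly 4 (%w. E w * E w)" "hpoly 4 (%w. w $ 1 * (E w * M w))"
  "hpoly 4 (%w. (w $ 2 * w $ 3) * (M w * M w))"
  by (rule hpoly_cong_degree[OF hpoly_mult[OF hpoly_E hpoly_E]], simp)
   (rule hpoly_cong_degree[OF hpoly_mult[OF hpoly_coord hpoly_mult[OF hpoly_E hpoly_M]]], simp,
    rule hpoly_cong_degree[OF hpoly_mult[OF hpoly_mult[OF hpoly_coord hpoly_coord] hpoly_mult[OF hpoly_M hpoly_M]]], simp)
 thus ?thesis unfolding G_def[abs_def] by (intro hpoly_add)
qed

lemma on_surface: "G (Phi (s, t, u, v)) = 0"
proof -
 \<comment> \<open>On the surface the roots of tau^2 - w1 tau + w2 w3 are z v and x u. For the first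
   of them the conic takes v^2 times its value at (x, y, z), which is zero.\<close>
 let ?w = "Phi (s, t, u, v)" and ?a = "qf z s t * v" and ?b = "qf x s t * u"
 have ab: "?a + ?b = ?w $ 1" "?a * ?b = ?w $ 2 * ?w $ 3" by (simp_all add: Phi_def)
 have "conic k (?w $ 3) (?w $ 4) ?a = v * v * conic k (qf x s t) (qf y s t) (qf z s t)"
  unfolding conic_scale[symmetric] by (simp add: Phi_def mult.commute)
 moreover have "conic k (qf x s t) (qf y s t) (qf z s t) = 0"
  using conic by (simp add: conic_through_def)
 ultimately have "E ?w + ?a * M ?w = 0" by (simp only: conic_eq[OF ab] mult_zero_right)
 thus ?thesis by (simp only: G_factor[OF ab] mult_zero_left)
qed

lemma surf_Phi: "surf Phi = {w. w ~= 0 & G w = 0}"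
proof (intro equalityI subsetI)
 fix w assume "w \<in> surf Phi"
 then obtain c s t u v where w: "c ~= 0" "nz s t" "nz u v" "w = c *s Phi (s, t, u, v)"
  by (rule surfE)
 have "Phi (s, t, u, v) ~= 0"
  using indep3_no_common_zero[OF ind, of s t] xz_coprime[of s t] w(2,3) by (auto simp: Phi_def vec4_eq_iff)
 hence "w ~= 0" using w(1,4) by simp
 moreover have "G w = 0" unfolding w(4) hpoly_scale[OF hpoly_G] on_surface by simp
 ultimately show "w \<in> {w. w ~= 0 & G w = 0}" by simp
next
 fix w assume "w \<in> {w. w ~= 0 & G w = 0}"
 hence w: "w ~= 0" "G w = 0" by auto
 obtain a b where ab: "a + b = w $ 1" "a * b = w $ 2 * w $ 3" "E w + a * M w = 0"
 proof -
  obtain a b where ab: "a + b = w $ 1" "a * b = w $ 2 * w $ 3" using roots .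
  have "E w + a * M w = 0 | E w + b * M w = 0" using w(2) G_factor[OF ab] by simp
  thus ?thesis using that[of a b] that[of b a] ab by (auto simp: ac_simps)
 qed
 have K: "conic k (w $ 3) (w $ 4) a = 0" using conic_eq[OF ab(1,2)] ab(3) by simp
 show "w \<in> surf Phi"
 proof (cases "w $ 3 = 0 & a = 0")
  \<comment> \<open>These points come from v = 0; they form the line \<open>L\<close>.\<close>
  case True
  hence w34: "w $ 3 = 0" "w $ 4 = 0" using K conic_b_axis by auto
  hence w12: "w $ 1 ~= 0 | w $ 2 ~= 0" using w(1) by (auto simp: vec4_eq_iff)
  obtain s t where st: "nz s t" "qf (w $ 2 *s x + (- w $ 1) *s z) s t = 0" using qf_root by blast
  hence eq: "w $ 2 * qf x s t = w $ 1 * qf z s t" unfolding qf_linear by simp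
  have ne: "qf x s t ~= 0 | qf z s t ~= 0" using xz_coprime st(1) by blast
  obtain u where u: "u ~= 0" "u * qf x s t = w $ 1" "u * qf z s t = w $ 2"
   using proportional_pair[OF w12 ne eq] .
  hence "w = 1 *s Phi (s, t, u, 0)" using w34 by (simp add: Phi_def vec4_eq_iff mult.commute)
  thus ?thesis using surfI[OF one_neq_zero st(1), of u 0 Phi] u(1) by simp
 next
  case False
  obtain s t where st: "w $ 3 = qf x s t" "w $ 4 = qf y s t" "a = qf z s t"
   using K conic unfolding conic_through_def by metis
  have "\<exists>u. w $ 3 * u = b & a * u = w $ 2"
  proof (cases "w $ 3 = 0")
   case True
   hence "a ~= 0" "b = 0" using False ab(2) by auto
   thus ?thesis using True by (intro exI[of _ "w $ 2 / a"]) simp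
  next
   case False
   thus ?thesis using ab(2) by (intro exI[of _ "b / w $ 3"]) (simp add: field_simps)
  qed
  then obtain u where "w $ 3 * u = b" "a * u = w $ 2" by blast
  hence "w = 1 *s Phi (s, t, u, 1)" using ab(1) st by (simp add: Phi_def vec4_eq_iff add.commute)
  moreover have "nz s t" using False st by (auto simp: qf_def)
  ultimately show ?thesis using surfI[OF one_neq_zero, of s t u 1 Phi] by simp
 qed
qed

sublocale param_hypersurface Phi 2 1 4 G by unfold_locales (rule bform_Phi hpoly_G surf_Phi)+

lemma path_poly_parts [simp]: "path_poly M" "path_poly E"
 using path_poly_hpoly hpoly_M hpoly_E by blast+

lemma ddir_M: "ddir M w d = k 3 * d $ 1 + k 5 * d $ 3 + k 4 * d $ 4"
 unfolding M_def[abs_def] by (simp add: ddir_simps)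

lemma ddir_E:
 "ddir E w d = (2 * k 1 * w $ 3 + k 6 * w $ 4 - k 3 * w $ 2) * d $ 3 +
  (2 * k 2 * w $ 4 + k 6 * w $ 3) * d $ 4 - k 3 * w $ 3 * d $ 2"
 unfolding E_def[abs_def] by (simp add: ddir_simps) algebra

lemma ddir_G:
 "ddir G w d = (2 * E w + w $ 1 * M w) * ddir E w d + (w $ 1 * E w + 2 * (w $ 2 * w $ 3) * M w) * ddir M w d +
  E w * M w * d $ 1 + M w * M w * (w $ 2 * d $ 3 + d $ 2 * w $ 3)"
 unfolding G_def[abs_def] by (simp add: ddir_simps) algebra

definition C :: "('k^4) set" where "C = {w. w ~= 0 & M w = 0} \<inter> {w. w ~= 0 & E w = 0}"
definition L :: "('k^4) set" where "L = {w. w ~= 0 & w $ 3 = 0} \<inter> {w. w ~= 0 & w $ 4 = 0}"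

text \<open>With E = - a M the gradient is divisible by M. Off M = 0 the four partial derivatives
  either make (w3, w4, a) a singular point of the conic or give a = w3 = 0; both end with w3 = w4 =
  0.\<close>

lemma ddir_G_zero_iff:
 assumes "w \<in> surf Phi"
 shows "(\<forall>d. ddir G w d = 0) \<longleftrightarrow> w \<in> C \<union> L"
proof
 assume "w \<in> C \<union> L"
 thus "\<forall>d. ddir G w d = 0"
  by (auto simp: ddir_G C_def L_def) (auto simp: ddir_E ddir_M E_def M_def algebra_simps)
next
 assume zero: "\<forall>d. ddir G w d = 0"
 have w: "w ~= 0" "G w = 0" using assms surf_Phi by auto
 obtain a b where ab: "a + b = w $ 1" "a * b = w $ 2 * w $ 3" "E w = - a * M w"
 proof -
  obtain a b where ab: "a + b = w $ 1" "a * b = w $ 2 * w $ 3" using roots .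
  have "E w + a * M w = 0 | E w + b * M w = 0" using w(2) G_factor[OF ab] by simp
  thus ?thesis using that[of a b] that[of b a] ab by (auto simp: ac_simps eq_neg_iff_add_eq_0)
 qed
 have K: "conic k (w $ 3) (w $ 4) a = 0" using conic_eq[OF ab(1,2)] ab(3) by simp
 show "w \<in> C \<union> L"
 proof (cases "M w = 0")
  case True
  thus ?thesis using ab(3) w(1) by (simp add: C_def)
 next
  case False
  have expand: "ddir G w d = M w * ((b - a) * ddir E w d + a * (b - a) * ddir M w d - a * M w * d $ 1 +
    M w * (w $ 2 * d $ 3 + d $ 2 * w $ 3))" for d
   unfolding ddir_G ab(3) ab(1,2)[symmetric] by algebra
  have e: "(b - a) * ddir E w d + a * (b - a) * ddir M w d - a * M w * d $ 1 +
    M w * (w $ 2 * d $ 3 + d $ 2 * w $ 3) = 0" for d using zero expand[of d] False by simp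
  have e1: "a * ((b - a) * k 3 - M w) = 0" using e[of "axis 1 1"]
   by (simp add: ddir_E ddir_M axis_def algebra_simps)
  have e2: "w $ 3 * (M w - (b - a) * k 3) = 0" using e[of "axis 2 1"]
   by (simp add: ddir_E ddir_M axis_def algebra_simps)
  have e4: "(b - a) * conic_b k (w $ 3) (w $ 4) a = 0" using e[of "axis 4 1"]
   by (simp add: ddir_E ddir_M axis_def conic_b_def algebra_simps)
  have e3: "(b - a) * (conic_a k (w $ 3) (w $ 4) a - k 3 * w $ 2) + M w * w $ 2 = 0" using e[of "axis 3 1"]
   by (simp add: ddir_E ddir_M axis_def conic_a_def algebra_simps)
  have "w $ 3 = 0 & w $ 4 = 0"
  proof (cases "M w = (b - a) * k 3")
   case True
   hence ba: "b - a ~= 0" using False by auto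
   have "conic_b k (w $ 3) (w $ 4) a = 0" using e4 ba by simp
   moreover have "(b - a) * conic_a k (w $ 3) (w $ 4) a = 0" using e3 True by algebra
   hence "conic_a k (w $ 3) (w $ 4) a = 0" using ba by simp
   moreover have "conic_c k (w $ 3) (w $ 4) a = 0"
    using True ab(1) unfolding conic_c_def M_def by algebra
   ultimately show ?thesis using K conic unfolding conic_through_def by blast
  next
   case False
   hence "a = 0" "w $ 3 = 0" using e1 e2 by auto
   thus ?thesis using K conic_b_axis by simp
  qed
  thus ?thesis using w(1) by (simp add: L_def)
 qed
qed

lemma line_L: "is_line L" "proj_irreducible L" "proj_dim L = 1"
proof -
 have cl: "proj_closed L"
  unfolding L_def by (intro proj_closed_Int proj_closed_hypersurface[OF hpoly_coord])
 have L: "L = {s *s vector [1, 0, 0, 0] + t *s vector [0, 1, 0, 0] | s t. s ~= 0 | t ~= 0}"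
 proof (intro equalityI subsetI)
  fix w assume "w \<in> L"
  hence "w = w $ 1 *s vector [1, 0, 0, 0] + w $ 2 *s vector [0, 1, 0, 0]" "w $ 1 ~= 0 | w $ 2 ~= 0"
   by (auto simp: L_def vec4_eq_iff)
  thus "w \<in> {s *s vector [1, 0, 0, 0] + t *s vector [0, 1, 0, 0] | s t. s ~= 0 | t ~= 0}" by blast
 qed (auto simp: L_def vec4_eq_iff)
 have ind: "s = 0 & t = 0" if "s *s vector [1, 0, 0, 0] + t *s vector [0, 1, 0, 0] = (0 :: 'k^4)" for s t
  using that by (auto simp: vec4_eq_iff)
 show "is_line L" "proj_irreducible L" "proj_dim L = 1"
  using line_irreducible[OF ind L cl] is_lineI[OF ind L] by blast+
qed

lemma conic_C: "is_smooth_plane_conic C" "proj_irreducible C" "proj_dim C = 1"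
proof -
 \<comment> \<open>The solution of M = 0 for w1 and of E = 0 for w2, with (w3 : w4) = (s : t) and
   denominators cleared.\<close>
 define gam :: "'k => 'k => 'k^4" where
  "gam s t = vector [- qf (vector [k 5, k 4, 0]) s t, qf (vector [k 1, k 6, k 2]) s t, k 3 * (s * s), k 3 * (s * t)]" for s t
 have cl: "proj_closed C"
  unfolding C_def by (intro proj_closed_Int proj_closed_hypersurface[OF hpoly_M] proj_closed_hypersurface[OF hpoly_E])
 have CE: "w = (w $ 3 / k 3) *s gam 1 (w $ 4 / w $ 3)" if "M w = 0" "E w = 0" "w $ 3 ~= 0" for w
 proof -
  have "k 3 * w $ 1 = - (k 5 * w $ 3 + k 4 * w $ 4)" using that(1) unfolding M_def by algebra
  moreover have "w $ 3 * (k 3 * w $ 2) = k 1 * (w $ 3 * w $ 3) + k 6 * (w $ 3 * w $ 4) + k 2 * (w $ 4 * w $ 4)"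
   using that(2) unfolding E_def by algebra
  ultimately show ?thesis using that(3) k3
   by (simp add: gam_def vec4_eq_iff qf_def divide_simps) (simp add: algebra_simps)
 qed
 have C: "C = {c *s gam s t | c s t. c ~= 0 & nz s t}"
 proof (intro equalityI subsetI)
  fix w assume "w \<in> C"
  hence w: "w ~= 0" "M w = 0" "E w = 0" by (auto simp: C_def)
  show "w \<in> {c *s gam s t | c s t. c ~= 0 & nz s t}"
  proof (cases "w $ 3 = 0")
   case True
   hence "w $ 4 = 0" using w(3) k2 by (simp add: E_def)
   moreover from this True have "w $ 1 = 0" using w(2) k3 by (simp add: M_def)
   ultimately have "w = (w $ 2 / k 2) *s gam 0 1" "w $ 2 / k 2 ~= 0"
    using True w(1) k2 by (auto simp: gam_def vec4_eq_iff qf_def)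
   thus ?thesis using one_neq_zero by blast
  next
   case False
   hence "w $ 3 / k 3 ~= 0" using k3 by simp
   thus ?thesis using CE[OF w(2,3) False] one_neq_zero by blast
  qed
 next
  fix w assume "w \<in> {c *s gam s t | c s t. c ~= 0 & nz s t}"
  then obtain c s t where w: "w = c *s gam s t" "c ~= 0" "nz s t" by blast
  have "w ~= 0" using w k2 k3 by (auto simp: gam_def vec4_eq_iff qf_def)
  moreover have "M w = 0" "E w = 0" unfolding w M_def E_def gam_def qf_def by simp_all algebra+
  ultimately show "w \<in> C" by (simp add: C_def)
 qed
 have q: "bform 2 0 (%p :: 'k quad. qf a (fst p) (fst (snd p)))" for a :: "'k^3" by (rule bform_qf)
 have "\<forall>i. bform 2 0 (%(s, t, u, v). gam s t $ i)"
  using bform_smult[OF q, of "-1" "vector [k 5, k 4, 0]"] q[of "vector [k 1, k 6, k 2]"]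
   q[of "vector [k 3, 0, 0]"] q[of "vector [0, k 3, 0]"]
  unfolding forall_4 gam_def case_prod_unfold by (simp add: qf_def)
 hence bf: "bform 2 0 (%(s, t, u, v). gam s t $ i)" for i by blast
 have "gam 0 1 ~= c *s gam 1 0" for c using k2 k3 by (auto simp: gam_def vec4_eq_iff qf_def)
 thus "proj_irreducible C" "proj_dim C = 1" using curve_irreducible[OF bf C cl] by blast+
 define c where "c = (%i :: 4. if i = 1 then k 3 else if i = 3 then k 5 else if i = 4 then k 4 else 0)"
 have M: "M w = (\<Sum>i\<in>UNIV. c i * w $ i)" for w by (simp add: M_def c_def sum_4)
 have "M (axis 1 1) ~= 0" using k3 by (simp add: M_def axis_def)
 hence W: "vec.subspace {w. M w = 0}" "vec.dim {w. M w = 0} = 3"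
  using dim_linear_kernel[of c "axis 1 1"] unfolding M by auto
 show "is_smooth_plane_conic C"
 proof (rule is_smooth_plane_conicI[OF W hpoly_E])
  show "C = {w \<in> {w. M w = 0}. w ~= 0 & E w = 0}" by (auto simp: C_def)
  fix w assume "w \<in> C"
  hence w: "w ~= 0" "M w = 0" "E w = 0" by (auto simp: C_def)
  show "\<exists>d\<in>{w. M w = 0}. ddir E w d ~= 0"
  proof (cases "w $ 3 = 0")
   case True
   hence "w $ 4 = 0" using w(3) k2 by (simp add: E_def)
   moreover from this True have "w $ 1 = 0" using w(2) k3 by (simp add: M_def)
   ultimately have "w $ 2 ~= 0" using True w(1) by (auto simp: vec4_eq_iff)
   thus ?thesis using True \<open>w $ 4 = 0\<close> k3
    by (intro bexI[of _ "vector [- k 5 / k 3, 0, 1, 0]"]) (auto simp: ddir_E M_def)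
  next
   case False
   thus ?thesis using k3 by (intro bexI[of _ "axis 2 1"]) (auto simp: ddir_E M_def axis_def)
  qed
 qed
qed

theorem codim1: "codim1_singular_locus (surf Phi) = C \<union> L"
proof -
 have x_nz: "x ~= 0"
 proof
  assume "x = 0"
  hence "1 *s x + 0 *s y + 0 *s z = 0" by simp
  thus False using ind unfolding indep3_def by (metis one_neq_zero)
 qed
 obtain s t where st: "nz s t" "qf x s t ~= 0" using qf_nonzero[OF x_nz] .
 \<comment> \<open>Chosen so that \<open>M\<close> takes the value 1, which puts the point off the
   conic \<open>C\<close>.\<close>
 define u where "u = (1 - (k 3 * qf z s t + k 5 * qf x s t + k 4 * qf y s t)) / (k 3 * qf x s t)"
 define w1 where "w1 = 1 *s Phi (s, t, u, 1)"
 have w1: "w1 \<in> surf Phi" unfolding w1_def by (intro surfI st(1)) auto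
 have "M w1 = k 3 * qf x s t * u + (k 3 * qf z s t + k 5 * qf x s t + k 4 * qf y s t)"
  unfolding w1_def M_def Phi_def by (simp add: algebra_simps)
 also have "\<dots> = 1" using st(2) k3 by (simp add: u_def)
 finally have "w1 \<notin> C" by (simp add: C_def)
 moreover have "w1 \<notin> L" using st(2) by (simp add: w1_def L_def Phi_def)
 ultimately obtain d1 where d1: "ddir G w1 d1 ~= 0" using ddir_G_zero_iff[OF w1] by blast
 have sub: "C \<subseteq> surf Phi" "L \<subseteq> surf Phi"
  by (auto simp: surf_Phi C_def L_def G_def) (simp add: E_def)
 hence "L \<subset> surf Phi" using w1 \<open>w1 \<notin> L\<close> by blast
 hence dim: "proj_dim (surf Phi) = 2"
  using proj_dim_surface[OF bf _ line_L(2,3)] irreducible by (simp add: proj_irreducible_def)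
 have "singular_locus (surf Phi) = {w \<in> surf Phi. \<forall>d. ddir G w d = 0}"
  by (rule singular_locus[OF w1 d1 dim])
 also have "\<dots> = {w \<in> surf Phi. w \<in> C \<union> L}" using ddir_G_zero_iff by (intro Collect_cong) blast
 also have "\<dots> = \<Union>{C, L}" using sub by auto
 finally have "codim1_singular_locus (surf Phi) = \<Union>{C, L}"
  using line_L conic_C by (intro codim1_singular_locus_curves) auto
 thus ?thesis by simp
qed

end

section \<open>A syzygy of bidegree (0,3)\<close>

lemma solve_2x2:
 fixes a b c d :: "'k::field"
 assumes "a * d - b * c ~= 0"
 obtains u v where "a * u + b * v = x" "c * u + d * v = y"
proof (rule that)
 show "a * ((x * d - b * y) / (a * d - b * c)) + b * ((a * y - x * c) / (a * d - b * c)) = x"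
  "c * ((x * d - b * y) / (a * d - b * c)) + d * ((a * y - x * c) / (a * d - b * c)) = y"
  using assms by (simp_all add: divide_simps) (simp_all add: algebra_simps)
qed

text \<open>
 The gradient equations of \<open>conic (x\<^sub>1x\<^sub>3 - x\<^sub>2\<^sup>2) (x\<^sub>1x\<^sub>4 - x\<^sub>2x\<^sub>3) (x\<^sub>2x\<^sub>4 - x\<^sub>3\<^sup>2)\<close> in terms of the gradient
 \<open>(a, b, c)\<close> of the conic. Euler's relation is needed as an extra premise in characteristic 2.
\<close>

lemma cubic_gradient:
 fixes a b c x1 x2 x3 x4 :: "'k::field"
 assumes "a * x3 + b * x4 = 0" "c * x4 - 2 * a * x2 - b * x3 = 0" "a * x1 - b * x2 - 2 * c * x3 = 0"
  "b * x1 + c * x2 = 0" and euler: "a * (x1 * x3 - x2 * x2) + b * (x1 * x4 - x2 * x3) + c * (x2 * x4 - x3 * x3) = 0"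
  and abc: "a ~= 0 | b ~= 0 | c ~= 0"
 shows "x1 * x3 - x2 * x2 = 0 & x1 * x4 - x2 * x3 = 0 & x2 * x4 - x3 * x3 = 0"
proof (cases "b = 0")
 case True
 hence *: "a * x3 = 0" "c * x4 = 2 * a * x2" "a * x1 = 2 * c * x3" "c * x2 = 0" using assms by auto
 show ?thesis
 proof (cases "a = 0")
  case True
  hence "c ~= 0" using abc \<open>b = 0\<close> by simp
  hence "x2 = 0" "x4 = 0" using * True by auto
  thus ?thesis using euler True \<open>b = 0\<close> \<open>c ~= 0\<close> by simp
 next
  case False
  hence x3: "x3 = 0" using * by simp
  hence x1: "x1 = 0" using * False by simp
  hence "x2 = 0" using euler False \<open>b = 0\<close> x3 *(4) by auto
  thus ?thesis using x1 x3 by simp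
 qed
next
 case False
 \<comment> \<open>Normalize b = 1. Eliminating x1 and x4 leaves a linear system for (x2, x3), which
   has only the zero solution unless a' c' = 1.\<close>
 define a' c' where "a' = a / b" and "c' = c / b"
 have ac: "a = b * a'" "c = b * c'" using False by (simp_all add: a'_def c'_def)
 have "b * (a' * x3 + x4) = 0" "b * (c' * x4 - 2 * a' * x2 - x3) = 0" "b * (a' * x1 - x2 - 2 * c' * x3) = 0"
  "b * (x1 + c' * x2) = 0" using assms(1-4) unfolding ac by algebra+
 moreover have "b * (a' * (x1 * x3 - x2 * x2) + (x1 * x4 - x2 * x3) + c' * (x2 * x4 - x3 * x3)) = 0"
  using euler unfolding ac by algebra
 ultimately have "a' * x3 + x4 = 0" "c' * x4 - 2 * a' * x2 - x3 = 0" "a' * x1 - x2 - 2 * c' * x3 = 0" "x1 + c' * x2 = 0"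
  and e: "a' * (x1 * x3 - x2 * x2) + (x1 * x4 - x2 * x3) + c' * (x2 * x4 - x3 * x3) = 0"
  using False by simp_all
 hence x: "x4 = - a' * x3" "x1 = - c' * x2" and r: "(1 + a' * c') * x3 = - 2 * a' * x2" "(1 + a' * c') * x2 = - 2 * c' * x3"
  by algebra+
 have d: "(1 - a' * c') * (1 - a' * c') * x2 = 0" "(1 - a' * c') * (1 - a' * c') * x3 = 0"
  using r by algebra+
 show ?thesis
 proof (cases "a' * c' = 1")
  case False
  hence "x2 = 0" "x3 = 0" using d by auto
  thus ?thesis using x by simp
 next
  \<comment> \<open>Here the linear equations carry no information in characteristic 2, and Euler's
    relation becomes a perfect square.\<close>
  case True
  have "(a' * x2 + x3) * (a' * x2 + x3) = 0" using e True unfolding x by algebra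
  hence x3: "x3 = - a' * x2" by (simp add: eq_neg_iff_add_eq_0 add.commute)
  show ?thesis unfolding x x3 using True by algebra
 qed
qed

text \<open>The generators x u, x v + y u, y v + z u, z v are the coefficients of a product of
  polynomials of degrees two and one. The last hypothesis makes the coordinate change
  \<open>T\<close> below invertible.\<close>

locale twisted_cubic_form =
 fixes x y z :: "'k::alg_closed_field^3" and k :: "nat => 'k"
 assumes ind: "indep3 x y z" and conic: "conic_through x y z k" and k2: "k 2 ~= 0"
  and pf: "k 4 * k 6 - (k 2 + k 5) * k 2 - k 1 * k 3 ~= 0"
begin

definition pff where "pff = k 4 * k 6 - (k 2 + k 5) * k 2 - k 1 * k 3"

definition Phi :: "'k quad => 'k^4" where
 "Phi = (%(s, t, u, v). vector [qf x s t * u, qf x s t * v + qf y s t * u, qf y s t * v + qf z s t * u, qf z s t * v])"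

text \<open>\<open>T'\<close> equals - T - k5 times the identity, and \<open>T ** T'\<close> is
  \<open>pff\<close> times the identity. Its purpose is to carry the line spanned by the values of
  \<open>Phi\<close> at fixed (s, t) to a chord of the standard twisted cubic, with the quadratic
  form (x, y, z) at (s, t).\<close>

definition T :: "'k^4^4" where
 "T = vector [vector [k 2, k 4, k 3, 0], vector [- k 6, - (k 2 + k 5), 0, k 3],
  vector [k 1, 0, - (k 2 + k 5), - k 4], vector [0, k 1, k 6, k 2]]"

definition T' :: "'k^4^4" where
 "T' = vector [vector [- (k 2 + k 5), - k 4, - k 3, 0], vector [k 6, k 2, 0, - k 3],
  vector [- k 1, 0, k 2, k 4], vector [0, - k 1, - k 6, - (k 2 + k 5)]]"

definition A :: "'k^4^4" where "A = (\<chi> i j. inverse pff * T $ i $ j)"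

lemma pff_nz: "pff ~= 0" using pf by (simp add: pff_def)

lemma inverse_A: "inverse_pair A T'"
proof -
 define r where "r = inverse pff"
 have "r * pff = 1" using pff_nz by (simp add: r_def)
 hence r: "r * (k 4 * k 6 - (k 2 + k 5) * k 2 - k 1 * k 3) = 1" by (simp add: pff_def)
 have "A ** T' = mat 1"
  unfolding vec_eq_iff forall_4 matrix_matrix_mult_def A_def T_def T'_def r_def[symmetric]
  using r by (simp add: sum_4 mat_def del: One_nat_def) algebra
 thus ?thesis by (simp add: inverse_pair_def matrix_left_right_inverse)
qed

definition Psi :: "'k quad => 'k^4" where
 "Psi p = T' *v Phi p"

lemma surf_Phi_eq: "surf Phi = (*v) A ` surf Psi" by (rule surf_reparam[OF inverse_A])
  (force simp: Psi_def inverse_pair_apply[OF inverse_A])+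

lemma Psi_coords:
 "Psi (s, t, u, v) $ 1 = (- (k 2 + k 5) * qf x s t - k 4 * qf y s t - k 3 * qf z s t) * u + (- k 4 * qf x s t - k 3 * qf y s t) * v"
 "Psi (s, t, u, v) $ 2 = (k 6 * qf x s t + k 2 * qf y s t) * u + (k 2 * qf x s t - k 3 * qf z s t) * v"
 "Psi (s, t, u, v) $ 3 = (k 2 * qf z s t - k 1 * qf x s t) * u + (k 2 * qf y s t + k 4 * qf z s t) * v"
 "Psi (s, t, u, v) $ 4 = (- k 1 * qf y s t - k 6 * qf z s t) * u + (- k 1 * qf x s t - k 6 * qf y s t - (k 2 + k 5) * qf z s t) * v"
 by (simp_all add: Psi_def Phi_def T'_def matrix_vector_mult_def sum_4 algebra_simps)

text \<open>
 The points \<open>w\<close> of the chord of the twisted cubic whose end points are the roots of the binary form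
 with coefficients \<open>X, Y, Z\<close>.
\<close>

definition chord :: "'k => 'k => 'k => 'k^4 => bool" where
 "chord X Y Z w \<longleftrightarrow> Z * w $ 1 - Y * w $ 2 + X * w $ 3 = 0 & Z * w $ 2 - Y * w $ 3 + X * w $ 4 = 0"

text \<open>The minors that define the twisted cubic. They are also the coefficients of a chord
  through \<open>w\<close>, provided that \<open>w\<close> is off the cubic; so \<open>G\<close>
  says that this chord belongs to the family parametrized by the conic.\<close>

definition q0 :: "'k^4 => 'k" where "q0 w = w $ 1 * w $ 3 - w $ 2 * w $ 2"
definition q1 :: "'k^4 => 'k" where "q1 w = w $ 1 * w $ 4 - w $ 2 * w $ 3"
definition q2 :: "'k^4 => 'k" where "q2 w = w $ 2 * w $ 4 - w $ 3 * w $ 3"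
definition G :: "'k^4 => 'k" where "G w = conic k (q0 w) (q1 w) (q2 w)"

lemma conic_zero: "conic k (qf x s t) (qf y s t) (qf z s t) = 0"
 using conic by (simp add: conic_through_def)

lemma chord_Psi: "chord (qf x s t) (qf y s t) (qf z s t) (Psi (s, t, u, v))"
 using conic_zero[of s t] unfolding chord_def Psi_coords conic_def by (intro conjI) algebra+

lemma xz_coprime:
 assumes "qf x s t = 0" "qf z s t = 0"
 shows "s = 0 & t = 0"
proof -
 have "qf y s t = 0" using conic_zero[of s t] assms k2 by (simp add: conic_def)
 thus ?thesis using indep3_no_common_zero[OF ind] assms by blast
qed

lemma chord_zero:
 assumes "chord X Y Z w" "nz X Z"
  "X ~= 0 ==> w $ 1 = 0 & w $ 2 = 0" "X = 0 ==> w $ 3 = 0 & w $ 4 = 0"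
 shows "w = 0" using assms by (cases "X = 0") (auto simp: chord_def vec4_eq_iff)

lemma chord_linear: "chord X Y Z v ==> chord X Y Z w ==> chord X Y Z (v - w)"
 unfolding chord_def vector_minus_component by algebra

text \<open>The first two coordinates determine a vector of the chord if X is nonzero, the last two
  if X = 0. In these coordinates (u, v) acts with determinant pff X^2 or pff Z^2, by the equation of
  the conic.\<close>

lemma chord_covered:
 assumes st: "nz s t" and ch: "chord (qf x s t) (qf y s t) (qf z s t) w"
 shows "\<exists>u v. w = Psi (s, t, u, v)"
proof -
 let ?X = "qf x s t" and ?Y = "qf y s t" and ?Z = "qf z s t"
 have XZ: "?X ~= 0 | ?Z ~= 0" using xz_coprime st by blast
 have "\<exists>u v. (?X ~= 0 --> Psi (s, t, u, v) $ 1 = w $ 1 & Psi (s, t, u, v) $ 2 = w $ 2) &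
   (?X = 0 --> Psi (s, t, u, v) $ 3 = w $ 3 & Psi (s, t, u, v) $ 4 = w $ 4)"
 proof (cases "?X = 0")
  case False
  have "(- (k 2 + k 5) * ?X - k 4 * ?Y - k 3 * ?Z) * (k 2 * ?X - k 3 * ?Z) -
    (- k 4 * ?X - k 3 * ?Y) * (k 6 * ?X + k 2 * ?Y) = pff * (?X * ?X)"
   using conic_zero[of s t] unfolding pff_def conic_def by algebra
  hence "(- (k 2 + k 5) * ?X - k 4 * ?Y - k 3 * ?Z) * (k 2 * ?X - k 3 * ?Z) -
    (- k 4 * ?X - k 3 * ?Y) * (k 6 * ?X + k 2 * ?Y) ~= 0" using False pff_nz by simp
  from solve_2x2[OF this, of "w $ 1" "w $ 2"] show ?thesis unfolding Psi_coords using False by metis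
 next
  case True
  have "(k 2 * ?Z - k 1 * ?X) * (- k 1 * ?X - k 6 * ?Y - (k 2 + k 5) * ?Z) -
    (k 2 * ?Y + k 4 * ?Z) * (- k 1 * ?Y - k 6 * ?Z) = pff * (?Z * ?Z)"
   using conic_zero[of s t] unfolding pff_def conic_def by algebra
  hence "(k 2 * ?Z - k 1 * ?X) * (- k 1 * ?X - k 6 * ?Y - (k 2 + k 5) * ?Z) -
    (k 2 * ?Y + k 4 * ?Z) * (- k 1 * ?Y - k 6 * ?Z) ~= 0" using True XZ pff_nz by simp
  from solve_2x2[OF this, of "w $ 3" "w $ 4"] show ?thesis unfolding Psi_coords using True by metis
 qed
 then obtain u v where uv: "?X ~= 0 ==> Psi (s, t, u, v) $ 1 = w $ 1 & Psi (s, t, u, v) $ 2 = w $ 2"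
   "?X = 0 ==> Psi (s, t, u, v) $ 3 = w $ 3 & Psi (s, t, u, v) $ 4 = w $ 4" by blast
 have "w - Psi (s, t, u, v) = 0"
  by (rule chord_zero[OF chord_linear[OF ch chord_Psi] XZ]) (use uv in auto)
 thus ?thesis by (metis eq_iff_diff_eq_0)
qed

lemma Psi_nonzero:
 assumes "nz s t" "nz u v"
 shows "Psi (s, t, u, v) ~= 0"
proof
 assume "Psi (s, t, u, v) = 0"
 hence "Phi (s, t, u, v) = 0"
  unfolding Psi_def using matrix_vector_eq_0[OF inverse_pair_sym[OF inverse_A]] by blast
 hence "qf x s t * u = 0" "qf x s t * v + qf y s t * u = 0" "qf y s t * v + qf z s t * u = 0" "qf z s t * v = 0"
  by (auto simp: Phi_def vec4_eq_iff)
 hence "qf x s t = 0 & qf y s t = 0 & qf z s t = 0" using assms(2) by (cases "u = 0") auto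
 thus False using indep3_no_common_zero[OF ind] assms(1) by blast
qed

lemma bform_Psi: "bform 2 1 (%p. Psi p $ i)"
proof -
 have "\<forall>i. bform 2 1 (%p. Phi p $ i)" unfolding forall_4 Phi_def case_prod_unfold vector_4
  by (intro conjI bform_add bform_qf_mult bform_vars)
 thus ?thesis unfolding Psi_def matrix_vector_mult_def
  by (simp del: One_nat_def) (intro bform_sum bform_smult, blast)
qed

lemma hpoly_q: "hpoly 2 q0" "hpoly 2 q1" "hpoly 2 q2"
proof -
 have "hpoly (1 + 1) q0" "hpoly (1 + 1) q1" "hpoly (1 + 1) q2"
  unfolding q0_def[abs_def] q1_def[abs_def] q2_def[abs_def]
  by (intro hpoly_diff hpoly_mult hpoly_coord)+
 thus "hpoly 2 q0" "hpoly 2 q1" "hpoly 2 q2" by (auto elim: hpoly_cong_degree)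
qed

lemma hpoly_G: "hpoly 4 G"
proof -
 have "hpoly (2 + 2) G"
  unfolding G_def[abs_def] conic_def by (intro hpoly_add hpoly_smult hpoly_mult hpoly_q)
 thus ?thesis by (rule hpoly_cong_degree) simp
qed

text \<open>Along the chord (q0, q1, q2) is proportional to (X, Y, Z), so the equation of the conic
  is inherited. The three cases clear a nonzero coordinate each.\<close>

lemma on_chord:
 assumes "chord X Y Z w" "conic k X Y Z = 0" "X ~= 0 | Y ~= 0 | Z ~= 0"
 shows "G w = 0"
proof -
 have r: "X * q1 w = q0 w * Y" "X * q2 w = q0 w * Z" "Y * q2 w = q1 w * Z"
  using assms(1) unfolding chord_def q0_def q1_def q2_def by algebra+
 have "X * X * G w = conic k (q0 w * X) (q0 w * Y) (q0 w * Z)"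
  unfolding G_def conic_scale[symmetric] r by (simp only: mult.commute)
 moreover have "Y * Y * G w = conic k (q1 w * X) (q1 w * Y) (q1 w * Z)"
  unfolding G_def conic_scale[symmetric] using r by (simp only: mult.commute)
 moreover have "Z * Z * G w = conic k (q2 w * X) (q2 w * Y) (q2 w * Z)"
  unfolding G_def conic_scale[symmetric] using r by (simp only: mult.commute)
 ultimately show ?thesis using assms(2,3) unfolding conic_scale by auto
qed

definition C :: "('k^4) set" where
 "C = {w. w ~= 0 & q0 w = 0} \<inter> {w. w ~= 0 & q1 w = 0} \<inter> {w. w ~= 0 & q2 w = 0}"

definition gam :: "'k => 'k => 'k^4" where "gam a b = vector [a^3, a^2 * b, a * b^2, b^3]"

lemma C_param: "C = {c *s gam a b | c a b. c ~= 0 & nz a b}"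
proof (intro equalityI subsetI)
 fix w assume "w \<in> C"
 hence w: "w ~= 0" "w $ 1 * w $ 3 = w $ 2 * w $ 2" "w $ 1 * w $ 4 = w $ 2 * w $ 3" "w $ 2 * w $ 4 = w $ 3 * w $ 3"
  by (auto simp: C_def q0_def q1_def q2_def)
 show "w \<in> {c *s gam a b | c a b. c ~= 0 & nz a b}"
 proof (cases "w $ 1 = 0")
  case True
  hence "w = w $ 4 *s gam 0 1" "w $ 4 ~= 0" using w by (auto simp: vec4_eq_iff gam_def)
  thus ?thesis using one_neq_zero by blast
 next
  case False
  have 3: "w $ 3 = w $ 2 * w $ 2 / w $ 1" using w(2) False by (simp add: field_simps)
  have 4: "w $ 4 = w $ 2 * w $ 2 * w $ 2 / (w $ 1 * w $ 1)"
   using w(3) False unfolding 3 by (simp add: field_simps)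
  have "w = w $ 1 *s gam 1 (w $ 2 / w $ 1)"
   using False 3 4 by (simp add: vec4_eq_iff gam_def power2_eq_square power3_eq_cube)
  thus ?thesis using one_neq_zero False by blast
 qed
next
 fix w assume "w \<in> {c *s gam a b | c a b. c ~= 0 & nz a b}"
 then obtain c a b where w: "w = c *s gam a b" "c ~= 0" "nz a b" by blast
 have "w ~= 0" using w by (auto simp: gam_def vec4_eq_iff)
 moreover have "q0 w = 0" "q1 w = 0" "q2 w = 0"
  unfolding w(1) q0_def q1_def q2_def gam_def by (simp_all add: power2_eq_square power3_eq_cube)
 ultimately show "w \<in> C" by (simp add: C_def)
qed

lemma surf_Psi: "surf Psi = {w. w ~= 0 & G w = 0}"
proof (intro equalityI subsetI)
 fix w assume "w \<in> surf Psi"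
 then obtain c s t u v where w: "c ~= 0" "nz s t" "nz u v" "w = c *s Psi (s, t, u, v)"
  by (rule surfE)
 have "G (Psi (s, t, u, v)) = 0"
  using on_chord[OF chord_Psi conic_zero] xz_coprime[of s t] w(2) by blast
 thus "w \<in> {w. w ~= 0 & G w = 0}" using Psi_nonzero[OF w(2,3)] w(1,4) hpoly_scale[OF hpoly_G] by simp
next
 fix w assume "w \<in> {w. w ~= 0 & G w = 0}"
 hence w: "w ~= 0" "G w = 0" by auto
 obtain s t where st: "nz s t" "chord (qf x s t) (qf y s t) (qf z s t) w"
 proof (cases "w \<in> C")
  case True
  then obtain c a b where c: "w = c *s gam a b" unfolding C_param by blast
  \<comment> \<open>A chord contains the point (a : b) of the cubic as soon as its quadratic form
    satisfies Z a^2 - Y a b + X b^2 = 0; this is a binary quadratic equation in (s, t).\<close>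
  obtain s t where st: "nz s t" "qf (1 *s ((a * a) *s z + (b * b) *s x) + (- (a * b)) *s y) s t = 0"
   using qf_root by blast
  hence "a * a * qf z s t + b * b * qf x s t - a * b * qf y s t = 0" unfolding qf_linear by simp
  hence "chord (qf x s t) (qf y s t) (qf z s t) w"
   unfolding chord_def c gam_def power2_eq_square power3_eq_cube by simp algebra
  thus ?thesis using that st(1) by blast
 next
  case False
  obtain s t where st: "q0 w = qf x s t" "q1 w = qf y s t" "q2 w = qf z s t"
   using w(2) conic unfolding G_def conic_through_def by metis
  have "chord (q0 w) (q1 w) (q2 w) w"
   unfolding chord_def q0_def q1_def q2_def by (intro conjI) algebra+
  moreover have "nz s t"
  proof (rule ccontr)
   assume "\<not> nz s t"
   hence "q0 w = 0" "q1 w = 0" "q2 w = 0" unfolding st by (simp_all add: qf_def)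
   thus False using False w(1) by (simp add: C_def)
  qed
  ultimately show ?thesis using that st by simp
 qed
 obtain u v where uv: "w = Psi (s, t, u, v)" using chord_covered[OF st] by blast
 have "nz u v" using uv w(1) by (auto simp: vec4_eq_iff Psi_coords)
 thus "w \<in> surf Psi" using surfI[OF one_neq_zero st(1), of u v Psi] uv by simp
qed

sublocale param_hypersurface Psi 2 1 4 G by unfold_locales (rule bform_Psi hpoly_G surf_Psi)+

lemma path_poly_parts [simp]: "path_poly q0" "path_poly q1" "path_poly q2"
 using path_poly_hpoly hpoly_q by blast+

lemma ddir_q:
 "ddir q0 w d = w $ 1 * d $ 3 + d $ 1 * w $ 3 - 2 * w $ 2 * d $ 2"
 "ddir q1 w d = w $ 1 * d $ 4 + d $ 1 * w $ 4 - w $ 2 * d $ 3 - d $ 2 * w $ 3"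
 "ddir q2 w d = w $ 2 * d $ 4 + d $ 2 * w $ 4 - 2 * w $ 3 * d $ 3"
 unfolding q0_def[abs_def] q1_def[abs_def] q2_def[abs_def] by (simp_all add: ddir_simps algebra_simps)

lemma ddir_G:
 "ddir G w d = conic_a k (q0 w) (q1 w) (q2 w) * ddir q0 w d + conic_b k (q0 w) (q1 w) (q2 w) * ddir q1 w d +
  conic_c k (q0 w) (q1 w) (q2 w) * ddir q2 w d"
 unfolding G_def[abs_def] conic_def conic_a_def conic_b_def conic_c_def
 by (simp add: ddir_simps) algebra

lemma ddir_G_zero_iff:
 assumes "w \<in> surf Psi"
 shows "(\<forall>d. ddir G w d = 0) \<longleftrightarrow> w \<in> C"
proof
 assume "w \<in> C"
 thus "\<forall>d. ddir G w d = 0" by (simp add: C_def ddir_G conic_a_def conic_b_def conic_c_def)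
next
 assume zero: "\<forall>d. ddir G w d = 0"
 have w: "w ~= 0" "G w = 0" using assms surf_Psi by auto
 let ?a = "conic_a k (q0 w) (q1 w) (q2 w)" and ?b = "conic_b k (q0 w) (q1 w) (q2 w)"
  and ?c = "conic_c k (q0 w) (q1 w) (q2 w)"
 have "ddir G w (axis 1 1) = ?a * w $ 3 + ?b * w $ 4"
  "ddir G w (axis 2 1) = ?c * w $ 4 - 2 * ?a * w $ 2 - ?b * w $ 3"
  "ddir G w (axis 3 1) = ?a * w $ 1 - ?b * w $ 2 - 2 * ?c * w $ 3"
  "ddir G w (axis 4 1) = ?b * w $ 1 + ?c * w $ 2"
  by (simp_all add: ddir_G ddir_q axis_def algebra_simps)
 hence grad: "?a * w $ 3 + ?b * w $ 4 = 0" "?c * w $ 4 - 2 * ?a * w $ 2 - ?b * w $ 3 = 0"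
  "?a * w $ 1 - ?b * w $ 2 - 2 * ?c * w $ 3 = 0" "?b * w $ 1 + ?c * w $ 2 = 0" using zero by auto
 have "?a * q0 w + ?b * q1 w + ?c * q2 w = 2 * G w"
  unfolding G_def conic_def conic_a_def conic_b_def conic_c_def by algebra
 hence euler: "?a * q0 w + ?b * q1 w + ?c * q2 w = 0" using w(2) by simp
 show "w \<in> C"
 proof (cases "?a = 0 & ?b = 0 & ?c = 0")
  case True
  hence "q0 w = 0 & q1 w = 0 & q2 w = 0" using conic w(2) unfolding G_def conic_through_def by blast
  thus ?thesis using w(1) by (simp add: C_def)
 next
  case False
  hence "?a ~= 0 | ?b ~= 0 | ?c ~= 0" by blast
  moreover obtain a b c where abc: "a = ?a" "b = ?b" "c = ?c" by blast
  ultimately have "a ~= 0 | b ~= 0 | c ~= 0" by simp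
  moreover have "a * q0 w + b * q1 w + c * q2 w = 0" unfolding abc by (rule euler)
  ultimately have "q0 w = 0 & q1 w = 0 & q2 w = 0"
   unfolding q0_def q1_def q2_def by (intro cubic_gradient[OF grad[folded abc]])
  thus ?thesis using w(1) by (simp add: C_def)
 qed
qed

lemma curve_C: "proj_irreducible C" "proj_dim C = 1"
proof -
 have cl: "proj_closed C"
  unfolding C_def by (intro proj_closed_Int; rule proj_closed_hypersurface; rule hpoly_q)
 have mon: "bform 3 0 (%(s, t, u, v). s^i * t^(3 - i) :: 'k)" if "i \<le> 3" for i
  using bform_bmon[OF that, of 0 0] by (simp add: bmon_def case_prod_unfold)
 have "\<forall>i. bform 3 0 (%(s, t, u, v). gam s t $ i)"
  using mon[of 3] mon[of 2] mon[of 1] mon[of 0] unfolding forall_4 gam_def case_prod_unfold by simp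
 hence bf: "bform 3 0 (%(s, t, u, v). gam s t $ i)" for i by blast
 have "gam 0 1 ~= c *s gam 1 0" for c by (auto simp: gam_def vec4_eq_iff)
 thus "proj_irreducible C" "proj_dim C = 1" using curve_irreducible[OF bf C_param cl] by blast+
qed

theorem codim1: "is_twisted_cubic (codim1_singular_locus (surf Phi))"
proof -
 have x_nz: "x ~= 0"
 proof
  assume "x = 0"
  hence "1 *s x + 0 *s y + 0 *s z = 0" by simp
  thus False using ind unfolding indep3_def by (metis one_neq_zero)
 qed
 obtain s t where st: "nz s t" "qf x s t ~= 0" using qf_nonzero[OF x_nz] .
 define r where "r = qf y s t / qf x s t"
 \<comment> \<open>The point of the chord with first coordinates 0 and 1. There q0 = -1, so it is
   off the cubic.\<close>
 define w1 :: "'k^4" where "w1 = vector [0, 1, r, r * r - qf z s t / qf x s t]"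
 have "chord (qf x s t) (qf y s t) (qf z s t) w1"
  using st(2) by (simp add: chord_def w1_def r_def field_simps)
 then obtain u v where uv: "w1 = Psi (s, t, u, v)" using chord_covered[OF st(1)] by blast
 have "w1 ~= 0" by (simp add: w1_def vec4_eq_iff)
 hence "nz u v" using uv by (auto simp: vec4_eq_iff Psi_coords)
 hence w1: "w1 \<in> surf Psi" using surfI[OF one_neq_zero st(1), of u v Psi] uv by simp
 have w1C: "w1 \<notin> C" by (simp add: C_def q0_def w1_def)
 then obtain d1 where d1: "ddir G w1 d1 ~= 0" using ddir_G_zero_iff[OF w1] by blast
 have sub: "C \<subseteq> surf Psi" by (auto simp: surf_Psi C_def G_def conic_def)
 hence "C \<subset> surf Psi" using w1 w1C by blast
 hence dim: "proj_dim (surf Psi) = 2"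
  using proj_dim_surface[OF bf _ curve_C] irreducible by (simp add: proj_irreducible_def)
 have "singular_locus (surf Psi) = {w \<in> surf Psi. \<forall>d. ddir G w d = 0}"
  by (rule singular_locus[OF w1 d1 dim])
 also have "\<dots> = {w \<in> surf Psi. w \<in> C}" using ddir_G_zero_iff by (intro Collect_cong) blast
 also have "\<dots> = \<Union>{C}" using sub by auto
 finally have "codim1_singular_locus (surf Psi) = \<Union>{C}"
  using curve_C by (intro codim1_singular_locus_curves) auto
 thus ?thesis unfolding surf_Phi_eq codim1_singular_locus_image[OF inverse_A]
  using is_twisted_cubic_image[OF inverse_A is_twisted_cubicI[OF C_param[unfolded gam_def]]] by simp
qed

end

section \<open>Linear algebra for spaces of forms\<close>

lemma exists_kernel_vector:
 fixes f :: "'k::field^'n => 'k^'m"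
 assumes "Vector_Spaces.linear (*s) (*s) f" "CARD('m) < CARD('n)"
 obtains x where "x ~= 0" "f x = 0"
proof -
 have "\<not> inj f"
 proof
  assume "inj f"
  hence "vec.dim (f ` UNIV) = vec.dim (UNIV :: ('k^'n) set)"
   using vec.dim_image_eq[OF assms(1), of UNIV] by (simp add: inj_on_subset)
  moreover have "vec.dim (f ` UNIV) \<le> vec.dim (UNIV :: ('k^'m) set)" by (rule vec.dim_subset) simp
  ultimately show False using assms(2) by (simp add: card_cart_basis)
 qed
 thus ?thesis using that vec.linear_inj_iff_eq_0[OF assms(1)] by auto
qed

definition indep4 :: "'k::field^4 => 'k^4 => 'k^4 => 'k^4 => bool" where
 "indep4 x y z w \<longleftrightarrow>
  (\<forall>a b c d. a *s x + b *s y + c *s z + d *s w = 0 --> a = 0 & b = 0 & c = 0 & d = 0)"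

lemma indep4_inverse_pair:
 assumes "indep4 x y z w"
 obtains N where "inverse_pair N (vector [x, y, z, w])"
proof -
 define M :: "'a^4^4" where "M = vector [x, y, z, w]"
 have "\<exists>N. M ** N = mat 1" unfolding matrix_right_invertible_independent_rows
  using assms by (simp add: sum_4 row_def M_def indep4_def forall_4 vec_nth_inverse)
 then obtain N where "M ** N = mat 1" by blast
 moreover from this have "N ** M = mat 1" by (simp add: matrix_left_right_inverse)
 ultimately show ?thesis using that by (simp add: M_def inverse_pair_def)
qed

lemma not_in_span:
 fixes S :: "('k::field^'n) set"
 assumes "finite S" "card S < CARD('n)"
 obtains w where "w \<notin> vec.span S"
proof -
 have "\<not> UNIV \<subseteq> vec.span S" using vec.dim_le_card[of UNIV S] assms by (auto simp: card_cart_basis)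
 thus ?thesis using that by blast
qed

lemma not_in_span_coeff:
 fixes w :: "'k::field^'n"
 assumes "w \<notin> vec.span S" "x \<in> vec.span S" "x + d *s w = 0"
 shows "d = 0"
proof (rule ccontr)
 assume d: "d ~= 0"
 have "d *s w = - x" using assms(3) by (simp add: add_eq_0_iff)
 hence "(1 / d) *s (d *s w) = (1 / d) *s (- x)" by simp
 hence "w = (1 / d) *s (- x)" using d by (simp add: vector_smult_assoc)
 thus False using assms(1,2) vec.span_neg vec.span_scale by metis
qed

lemma indep3_extend:
 fixes x y :: "'k::field^3"
 assumes "!!a b. a *s x + b *s y = 0 ==> a = 0 & b = 0"
 obtains z where "indep3 x y z"
proof -
 have "card {x, y} < 3" by (auto simp: card_insert_if)
 then obtain z where z: "z \<notin> vec.span {x, y}" using not_in_span[of "{x, y}"] by auto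
 have "a = 0 & b = 0 & c = 0" if eq: "a *s x + b *s y + c *s z = 0" for a b c
 proof -
  have "a *s x + b *s y \<in> vec.span {x, y}"
   by (intro vec.span_scale vec.span_add) (auto intro: vec.span_base)
  hence "c = 0" using not_in_span_coeff[OF z] eq by blast
  thus ?thesis using assms[of a b] eq by simp
 qed
 thus ?thesis using that unfolding indep3_def by blast
qed

lemma indep4_extend3:
 fixes x y z :: "'k::field^4"
 assumes "!!a b c. a *s x + b *s y + c *s z = 0 ==> a = 0 & b = 0 & c = 0"
 obtains w where "indep4 x y z w"
proof -
 have "card {x, y, z} < 4" by (auto simp: card_insert_if)
 then obtain w where w: "w \<notin> vec.span {x, y, z}" using not_in_span[of "{x, y, z}"] by auto
 have "a = 0 & b = 0 & c = 0 & d = 0" if eq: "a *s x + b *s y + c *s z + d *s w = 0" for a b c d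
 proof -
  have "a *s x + b *s y + c *s z \<in> vec.span {x, y, z}"
   by (intro vec.span_scale vec.span_add) (auto intro: vec.span_base)
  hence "d = 0" using not_in_span_coeff[OF w] eq by blast
  thus ?thesis using assms[of a b c] eq by simp
 qed
 thus ?thesis using that unfolding indep4_def by blast
qed

lemma indep4_extend2:
 fixes x y :: "'k::field^4"
 assumes "!!a b. a *s x + b *s y = 0 ==> a = 0 & b = 0"
 obtains z w where "indep4 x y z w"
proof -
 have "card {x, y} < 4" by (auto simp: card_insert_if)
 then obtain z where z: "z \<notin> vec.span {x, y}" using not_in_span[of "{x, y}"] by auto
 have "a = 0 & b = 0 & c = 0" if eq: "a *s x + b *s y + c *s z = 0" for a b c
 proof -
  have "a *s x + b *s y \<in> vec.span {x, y}"
   by (intro vec.span_scale vec.span_add) (auto intro: vec.span_base)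
  hence "c = 0" using not_in_span_coeff[OF z] eq by blast
  thus ?thesis using assms[of a b] eq by simp
 qed
 then obtain w where "indep4 x y z w" using indep4_extend3 by metis
 thus ?thesis using that by blast
qed

definition lmul :: "'k::field^2 => 'k^2 => 'k^3" where
 "lmul l m = vector [l $ 1 * m $ 1, l $ 1 * m $ 2 + l $ 2 * m $ 1, l $ 2 * m $ 2]"

lemma qf_lmul [simp]: "qf (lmul l m) s t = lf l s t * lf m s t"
 by (simp add: lmul_def qf_def lf_def algebra_simps)

lemma lmul_linear: "lmul l (a *s m + b *s n) = a *s lmul l m + b *s lmul l n"
 by (simp add: lmul_def vec3_eq_iff algebra_simps)

lemma lmul_0 [simp]: "lmul l 0 = 0" by (simp add: lmul_def vec3_eq_iff)

lemma lmul_commute: "lmul l m = lmul m l" by (simp add: lmul_def vec3_eq_iff algebra_simps)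

lemma lmul_cancel: "lmul l m = 0 ==> l = 0 | m = 0"
 by (auto simp: lmul_def vec3_eq_iff vec_eq_iff forall_2)

lemma qf_factor:
 assumes "qf a s0 t0 = 0" "nz s0 t0"
 obtains m where "a = lmul (vector [t0, - s0]) m"
proof (cases "t0 = 0")
 case True
 hence "s0 ~= 0" "a $ 1 = 0" using assms by (auto simp: qf_def)
 hence "a = lmul (vector [t0, - s0]) (vector [- a $ 2 / s0, - a $ 3 / s0])"
  using True by (simp add: lmul_def vec3_eq_iff)
 thus ?thesis by (rule that)
next
 case False
 define m1 where "m1 = a $ 1 / t0"
 define m2 where "m2 = (a $ 2 + s0 * m1) / t0"
 have m: "t0 * m1 = a $ 1" "t0 * m2 = a $ 2 + s0 * m1" using False by (simp_all add: m1_def m2_def)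
 have "a $ 1 * (s0 * s0) + a $ 2 * (s0 * t0) + a $ 3 * (t0 * t0) = 0" using assms(1) by (simp add: qf_def)
 hence "t0 * t0 * (a $ 3 + s0 * m2) = 0" using m by algebra
 hence "a $ 3 = - (s0 * m2)" using False by (simp add: add_eq_0_iff2)
 hence "a = lmul (vector [t0, - s0]) (vector [m1, m2])" using m by (simp add: lmul_def vec3_eq_iff)
 thus ?thesis by (rule that)
qed

lemma qf_add [simp]: "qf (a + b) s t = qf a s t + qf b s t"
 and qf_scale [simp]: "qf (c *s a) s t = c * qf a s t"
 and qf_0 [simp]: "qf 0 s t = 0" by (simp_all add: qf_def algebra_simps)

lemma qf_uminus [simp]: "qf (- a) s t = - qf a s t"
 and qf_diff [simp]: "qf (a - b) s t = qf a s t - qf b s t" by (simp_all add: qf_def algebra_simps)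

section \<open>The space \<open>U\<close> of forms and its syzygies\<close>

definition vdot :: "'k::field^4 => 'k^4 => 'k" where
 "vdot c x = c $ 1 * x $ 1 + c $ 2 * x $ 2 + c $ 3 * x $ 3 + c $ 4 * x $ 4"

text \<open>A four-dimensional space \<open>U\<close> of forms of bidegree (2,1), with basis \<open>A $ i * u + B $ i * v\<close>.\<close>

locale form_space =
 fixes A B :: "'k::alg_closed_field^3^4"
 assumes nondeg: "!!c. c v* A = 0 ==> c v* B = 0 ==> c = 0"
  and bpf: "!!s t u v. (!!i. qf (A $ i) s t * u + qf (B $ i) s t * v = 0) ==>
   (s = 0 & t = 0) | (u = 0 & v = 0)"
begin

definition Phi :: "'k quad => 'k^4" where
 "Phi = (%(s, t, u, v). \<chi> i. qf (A $ i) s t * u + qf (B $ i) s t * v)"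

text \<open>The element of \<open>U\<close> with coefficient vector \<open>c\<close> is the form a u
  + b v. Relations between elements of \<open>U\<close> can thus be added and scaled in all three
  slots at once.\<close>

definition is_coord :: "'k^4 => 'k^3 => 'k^3 => bool" where
 "is_coord c a b \<longleftrightarrow> c v* A = a & c v* B = b"

lemma is_coord_self: "is_coord c (c v* A) (c v* B)" by (simp add: is_coord_def)

lemma is_coord_add: "is_coord c a b ==> is_coord c' a' b' ==> is_coord (c + c') (a + a') (b + b')"
 by (auto simp: is_coord_def vector_matrix_left_distrib)

lemma is_coord_scale: "is_coord c a b ==> is_coord (r *s c) (r *s a) (r *s b)"
proof -
 have "(r *s c) v* M = r *s (c v* M)" for M :: "'k^3^4"
  by (simp add: vector_matrix_mult_def vec_eq_iff sum_4 algebra_simps)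
 thus "is_coord c a b ==> is_coord (r *s c) (r *s a) (r *s b)" by (auto simp: is_coord_def)
qed

lemma is_coord_uminus: "is_coord c a b ==> is_coord (- c) (- a) (- b)"
 using is_coord_scale[of c a b "-1"] by simp

lemma is_coord_diff: "is_coord c a b ==> is_coord c' a' b' ==> is_coord (c - c') (a - a') (b - b')"
 using is_coord_add[OF _ is_coord_uminus, of c a b c' a' b'] by simp

lemmas is_coord_intros = is_coord_add is_coord_scale is_coord_uminus is_coord_diff is_coord_self

lemma is_coord_0_iff: "is_coord c 0 0 \<longleftrightarrow> c = 0" using nondeg by (auto simp: is_coord_def)

lemma is_coord_0D: "is_coord c a b ==> a = 0 ==> b = 0 ==> c = 0" using is_coord_0_iff by blast

lemma vdot_Phi:
 assumes "is_coord c a b"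
 shows "vdot c (Phi (s, t, u, v)) = qf a s t * u + qf b s t * v"
proof -
 have "a = c $ 1 *s A $ 1 + c $ 2 *s A $ 2 + c $ 3 *s A $ 3 + c $ 4 *s A $ 4"
  "b = c $ 1 *s B $ 1 + c $ 2 *s B $ 2 + c $ 3 *s B $ 3 + c $ 4 *s B $ 4"
  using assms by (auto simp: is_coord_def vector_matrix_mult_def vec_eq_iff sum_4 mult.commute)
 thus ?thesis by (simp add: vdot_def Phi_def algebra_simps)
qed

lemma common_zero:
 assumes "indep4 c1 c2 c3 c4" "vdot c1 (Phi (s, t, u, v)) = 0" "vdot c2 (Phi (s, t, u, v)) = 0"
  "vdot c3 (Phi (s, t, u, v)) = 0" "vdot c4 (Phi (s, t, u, v)) = 0"
 shows "(s = 0 & t = 0) | (u = 0 & v = 0)"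
proof -
 obtain N where N: "inverse_pair N (vector [c1, c2, c3, c4])" using indep4_inverse_pair[OF assms(1)] .
 have "(vector [c1, c2, c3, c4] :: 'k^4^4) *v Phi (s, t, u, v) = 0"
  using assms(2-5) by (simp add: vec4_eq_iff matrix_vector_mult_def vdot_def sum_4)
 hence "Phi (s, t, u, v) = 0" using matrix_vector_eq_0[OF inverse_pair_sym[OF N]] by blast
 hence "qf (A $ i) s t * u + qf (B $ i) s t * v = 0" for i by (simp add: Phi_def vec_eq_iff)
 thus ?thesis using bpf by blast
qed

lemma surf_basis:
 assumes ind: "indep4 c1 c2 c3 c4" and det: "m1 * m4 - m2 * m3 ~= 0"
  and Psi: "!!s t u v. Psi (s, t, m1 * u + m2 * v, m3 * u + m4 * v) =
    vector [vdot c1 (Phi (s, t, u, v)), vdot c2 (Phi (s, t, u, v)),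
     vdot c3 (Phi (s, t, u, v)), vdot c4 (Phi (s, t, u, v))]"
 obtains N M where "inverse_pair N M" "surf Phi = (*v) N ` surf Psi"
proof -
 obtain N where N: "inverse_pair N (vector [c1, c2, c3, c4])" using indep4_inverse_pair[OF ind] .
 have M: "(vector [c1, c2, c3, c4] :: 'k^4^4) *v Phi (s, t, u, v) = Psi (s, t, m1 * u + m2 * v, m3 * u + m4 * v)" for s t u v
  unfolding Psi vec4_eq_iff by (simp add: matrix_vector_mult_def vdot_def sum_4)
 have eq: "Phi (s, t, u, v) = N *v Psi (s, t, m1 * u + m2 * v, m3 * u + m4 * v)" for s t u v
  unfolding M[symmetric] using N by simp
 have "surf Phi = (*v) N ` surf Psi"
 proof (rule surf_reparam[OF N])
  fix s t u v :: 'k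
  assume p: "(s, t, u, v) \<in> param_dom"
  have "m1 * u + m2 * v ~= 0 | m3 * u + m4 * v ~= 0"
  proof (rule ccontr)
   assume "\<not> ?thesis"
   hence "m1 * u + m2 * v = 0" "m3 * u + m4 * v = 0" by auto
   hence "(m1 * m4 - m2 * m3) * u = 0" "(m1 * m4 - m2 * m3) * v = 0" by algebra+
   thus False using det p by (auto simp: param_dom_def)
  qed
  thus "\<exists>x\<in>param_dom. Phi (s, t, u, v) = N *v Psi x"
   using p by (intro bexI[of _ "(s, t, m1 * u + m2 * v, m3 * u + m4 * v)"]) (auto simp: param_dom_def eq)
  obtain u' v' where uv: "m1 * u' + m2 * v' = u" "m3 * u' + m4 * v' = v" using solve_2x2[OF det] .
  hence "(s, t, u', v') \<in> param_dom" using p by (auto simp: param_dom_def)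
  thus "\<exists>x\<in>param_dom. Phi x = N *v Psi (s, t, u, v)" using eq[of s t u' v'] uv by auto
 qed
 thus ?thesis using that N by blast
qed

lemma surf_basis':
 assumes ind: "indep4 c1 c2 c3 c4"
  and "!!s t u v. Psi (s, t, u, v) = vector [vdot c1 (Phi (s, t, u, v)), vdot c2 (Phi (s, t, u, v)),
     vdot c3 (Phi (s, t, u, v)), vdot c4 (Phi (s, t, u, v))]"
 obtains N M where "inverse_pair N M" "surf Phi = (*v) N ` surf Psi"
 using surf_basis[of c1 c2 c3 c4 1 1 0 0 Psi] assms by auto

text \<open>These predicates store syzygies in solved form: u c + v d = 0 means c = q v and d = - q
  u, and similarly for u^2 c + u v d + v^2 e = 0 and s c + t d = 0. The equations themselves are
  recovered in \<open>syz01_iff\<close>, \<open>syz02_iff\<close> and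
  \<open>syz10_iff\<close>.\<close>

definition syz01 :: "'k^4 => 'k^4 => bool" where
 "syz01 c d \<longleftrightarrow> (\<exists>q. is_coord c 0 q & is_coord d (- q) 0)"

definition syz02 :: "'k^4 => 'k^4 => 'k^4 => bool" where
 "syz02 c d e \<longleftrightarrow> (\<exists>a b. is_coord c 0 a & is_coord d (- a) (- b) & is_coord e b 0)"

definition syz10 :: "'k^4 => 'k^4 => bool" where
 "syz10 c d \<longleftrightarrow> (\<exists>(g :: 'k^2) (h :: 'k^2). is_coord c (vector [0, g $ 1, g $ 2]) (vector [0, h $ 1, h $ 2]) &
  is_coord d (- vector [g $ 1, g $ 2, 0]) (- vector [h $ 1, h $ 2, 0]))"

end

section \<open>Normal forms\<close>

context form_space
begin

theorem two_syz01:
 assumes syz: "syz01 c d" "syz01 c' d'"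
  and ind: "!!a b. a *s c + b *s c' = 0 ==> a *s d + b *s d' = 0 ==> a = 0 & b = 0"
 shows "codim1_singular_locus (surf Phi) = {}"
proof -
 obtain q1 where q1: "is_coord c 0 q1" "is_coord d (- q1) 0" using syz(1) by (auto simp: syz01_def)
 obtain q2 where q2: "is_coord c' 0 q2" "is_coord d' (- q2) 0" using syz(2) by (auto simp: syz01_def)
 have q: "a = 0 & b = 0" if z: "a *s q1 + b *s q2 = 0" for a b
 proof (rule ind)
  have "is_coord (a *s c + b *s c') (a *s 0 + b *s 0) (a *s q1 + b *s q2)"
   by (intro is_coord_intros q1 q2)
  thus "a *s c + b *s c' = 0" using z by (intro is_coord_0D) auto
  have "is_coord (a *s d + b *s d') (a *s (- q1) + b *s (- q2)) (a *s 0 + b *s 0)"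
   by (intro is_coord_intros q1 q2)
  moreover have "a *s (- q1) + b *s (- q2) = - (a *s q1 + b *s q2)" by simp
  ultimately show "a *s d + b *s d' = 0" using z by (intro is_coord_0D) auto
 qed
 \<comment> \<open>The four vectors represent q1 u, q1 v, q2 u, q2 v, with \<open>q1\<close> and
   \<open>q2\<close> independent.\<close>
 have ind4: "indep4 (- d) c (- d') c'" unfolding indep4_def
 proof (intro allI impI)
  fix x1 x2 x3 x4
  assume z: "x1 *s (- d) + x2 *s c + x3 *s (- d') + x4 *s c' = 0"
  have "is_coord (x1 *s (- d) + x2 *s c + x3 *s (- d') + x4 *s c')
    (x1 *s (- (- q1)) + x2 *s 0 + x3 *s (- (- q2)) + x4 *s 0)
    (x1 *s (- 0) + x2 *s q1 + x3 *s (- 0) + x4 *s q2)" by (intro is_coord_intros q1 q2)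
  hence "x1 *s q1 + x3 *s q2 = 0" "x2 *s q1 + x4 *s q2 = 0"
   unfolding z by (simp_all add: is_coord_def)
  thus "x1 = 0 & x2 = 0 & x3 = 0 & x4 = 0" using q by blast
 qed
 have val: "vdot (- d) (Phi (s, t, u, v)) = qf q1 s t * u" "vdot c (Phi (s, t, u, v)) = qf q1 s t * v"
  "vdot (- d') (Phi (s, t, u, v)) = qf q2 s t * u" "vdot c' (Phi (s, t, u, v)) = qf q2 s t * v" for s t u v
  using vdot_Phi[OF is_coord_uminus[OF q1(2)]] vdot_Phi[OF q1(1)] vdot_Phi[OF is_coord_uminus[OF q2(2)]]
   vdot_Phi[OF q2(1)] by simp_all
 interpret Q: quadric_form q1 q2
 proof
  fix s t assume "qf q1 s t = 0" "qf q2 s t = 0"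
  thus "s = 0 & t = 0" using common_zero[OF ind4, of s t 1 0] by (simp add: val)
 qed
 obtain N M where NM: "inverse_pair N M" "surf Phi = (*v) N ` surf Q.Phi"
  using surf_basis'[OF ind4, of Q.Phi] by (auto simp: val Q.Phi_def)
 show ?thesis unfolding NM(2) codim1_singular_locus_image[OF NM(1)] Q.codim1 by simp
qed

theorem one_syz10:
 assumes syz: "syz10 c d" and nz: "nz c d"
 shows "is_line (codim1_singular_locus (surf Phi))"
proof -
 obtain g h :: "'k^2" where gh: "is_coord c (vector [0, g $ 1, g $ 2]) (vector [0, h $ 1, h $ 2])"
  "is_coord d (- vector [g $ 1, g $ 2, 0]) (- vector [h $ 1, h $ 2, 0])"
  using syz unfolding syz10_def by blast
 have nzgh: "nz g h"
 proof (rule ccontr)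
  assume "\<not> ?thesis"
  hence "c = 0" "d = 0" using gh by (auto intro!: is_coord_0D[OF gh(1)] is_coord_0D[OF gh(2)] simp: vec3_eq_iff)
  thus False using nz by simp
 qed
 have ind: "a = 0 & b = 0" if z: "a *s (- d) + b *s c = 0" for a b
 proof -
  have "is_coord (a *s (- d) + b *s c) (a *s (- (- vector [g $ 1, g $ 2, 0])) + b *s vector [0, g $ 1, g $ 2])
   (a *s (- (- vector [h $ 1, h $ 2, 0])) + b *s vector [0, h $ 1, h $ 2])"
   by (intro is_coord_intros gh)
  hence "a *s vector [g $ 1, g $ 2, 0] + b *s vector [0, g $ 1, g $ 2] = (0 :: 'k^3)"
    "a *s vector [h $ 1, h $ 2, 0] + b *s vector [0, h $ 1, h $ 2] = (0 :: 'k^3)"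
   unfolding z by (simp_all add: is_coord_def)
  thus ?thesis using nzgh by (auto simp: vec3_eq_iff vec_eq_iff forall_2)
 qed
 obtain e f where ind4: "indep4 (- d) c e f" using indep4_extend2[of "- d" c] ind by metis
 define a2 b2 a3 b3 where ab: "a2 = e v* A" "b2 = e v* B" "a3 = f v* A" "b3 = f v* B"
 have val12: "vdot (- d) (Phi (s, t, u, v)) = s * (lf g s t * u + lf h s t * v)"
  "vdot c (Phi (s, t, u, v)) = t * (lf g s t * u + lf h s t * v)" for s t u v
  unfolding vdot_Phi[OF is_coord_uminus[OF gh(2)]] vdot_Phi[OF gh(1)]
  by (simp_all add: qf_def lf_def algebra_simps)
 have val34: "vdot e (Phi (s, t, u, v)) = qf a2 s t * u + qf b2 s t * v"
  "vdot f (Phi (s, t, u, v)) = qf a3 s t * u + qf b3 s t * v" for s t u v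
  unfolding ab by (rule vdot_Phi[OF is_coord_self])+
 note val = val12 val34
 interpret Q: linear_syzygy_form g h a2 b2 a3 b3
 proof
  show "nz g h" by fact
  fix s t u v assume "lf g s t * u + lf h s t * v = 0" "qf a2 s t * u + qf b2 s t * v = 0"
   "qf a3 s t * u + qf b3 s t * v = 0"
  thus "(s = 0 & t = 0) | (u = 0 & v = 0)" using common_zero[OF ind4, of s t u v] by (simp add: val)
 qed
 obtain N M where NM: "inverse_pair N M" "surf Phi = (*v) N ` surf Q.Phi"
  using surf_basis'[OF ind4, of Q.Phi] by (auto simp: val Q.Phi_def)
 show ?thesis unfolding NM(2) codim1_singular_locus_image[OF NM(1)]
  by (rule is_line_image[OF NM(1) Q.codim1(2)])
qed

text \<open>\<open>x * g\<close> and \<open>y * g\<close> in \<open>U\<close>, where \<open>g = l * u + m * v\<close> and the linear forms \<open>x, y\<close> span \<open>s, t\<close>.\<close>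

lemma common_factor_syz10:
 fixes x y :: "'k^2"
 assumes det: "x $ 1 * y $ 2 - y $ 1 * x $ 2 ~= 0"
  and r: "is_coord r (lmul x l) (lmul x m)" "is_coord r' (lmul y l) (lmul y m)"
 obtains a b d where "nz a b" "syz10 (a *s r + b *s r') d"
proof -
 obtain a b where ab: "x $ 1 * a + y $ 1 * b = 0" "x $ 2 * a + y $ 2 * b = 1"
  using solve_2x2[OF det] .
 obtain a' b' where ab': "x $ 1 * a' + y $ 1 * b' = 1" "x $ 2 * a' + y $ 2 * b' = 0"
  using solve_2x2[OF det] .
 have v: "a *s x + b *s y = vector [0, 1]" "a' *s x + b' *s y = vector [1, 0]"
  using ab ab' by (simp_all add: vec_eq_iff forall_2 mult.commute)
 have *: "a *s lmul x n + b *s lmul y n = vector [0, n $ 1, n $ 2]"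
  "a' *s lmul x n + b' *s lmul y n = vector [n $ 1, n $ 2, 0]" for n
  unfolding lmul_commute[of _ n] lmul_linear[symmetric] v by (simp_all add: lmul_def)
 have "is_coord (a *s r + b *s r') (a *s lmul x l + b *s lmul y l) (a *s lmul x m + b *s lmul y m)"
  "is_coord (- (a' *s r + b' *s r')) (- (a' *s lmul x l + b' *s lmul y l)) (- (a' *s lmul x m + b' *s lmul y m))"
  by (intro is_coord_intros r)+
 hence "syz10 (a *s r + b *s r') (- (a' *s r + b' *s r'))" unfolding syz10_def * by blast
 moreover have "nz a b" using ab(2) by auto
 ultimately show ?thesis using that by blast
qed

text \<open>With u' = m1 u + m2 v and v' = m3 u + m4 v the basis is x u' + z v', z u', x v', y v'. A
  common root of \<open>x\<close> and \<open>z\<close> would be a base point; a common root of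
  \<open>x\<close> and \<open>y\<close> would give x v' and y v' a common factor of bidegree (1,1),
  hence a (1,0) syzygy.\<close>

lemma conic_line_basis:
 assumes xyz: "indep3 x y z" and ind: "indep4 r1 r2 r3 r4" and det: "m1 * m4 - m2 * m3 ~= 0"
  and r: "is_coord r1 (m1 *s x + m3 *s z) (m2 *s x + m4 *s z)" "is_coord r2 (m1 *s z) (m2 *s z)"
   "is_coord r3 (m3 *s x) (m4 *s x)" "is_coord r4 (m3 *s y) (m4 *s y)"
  and no10: "!!c d. syz10 c d ==> c = 0"
 shows "\<exists>C L. is_smooth_plane_conic C & is_line L & codim1_singular_locus (surf Phi) = C \<union> L"
proof -
 obtain k where k: "conic_through x y z k" using conic_exists[OF xyz] .
 have val: "vdot r1 (Phi (s, t, u, v)) = qf x s t * (m1 * u + m2 * v) + qf z s t * (m3 * u + m4 * v)"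
  "vdot r2 (Phi (s, t, u, v)) = qf z s t * (m1 * u + m2 * v)"
  "vdot r3 (Phi (s, t, u, v)) = qf x s t * (m3 * u + m4 * v)"
  "vdot r4 (Phi (s, t, u, v)) = qf y s t * (m3 * u + m4 * v)" for s t u v
  using r[THEN vdot_Phi] by (simp_all add: algebra_simps)
 have k2: "k 2 ~= 0"
 proof
  assume "k 2 = 0"
  hence "conic k 0 1 0 = 0" by (simp add: conic_def)
  then obtain s t where st: "qf x s t = 0" "qf y s t = 1" "qf z s t = 0"
   using k unfolding conic_through_def by metis
  obtain u v where uv: "m1 * u + m2 * v = 1" "m3 * u + m4 * v = 0" using solve_2x2[OF det] .
  have "(s = 0 & t = 0) | (u = 0 & v = 0)"
   using common_zero[OF ind, of s t u v] by (simp add: val st uv)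
  thus False using st(2) uv(1) by (auto simp: qf_def)
 qed
 have k3: "k 3 ~= 0"
 proof
  assume "k 3 = 0"
  hence "conic k 0 0 1 = 0" by (simp add: conic_def)
  then obtain s t where st: "qf x s t = 0" "qf y s t = 0" "qf z s t = 1"
   using k unfolding conic_through_def by metis
  hence nz: "nz s t" by (auto simp: qf_def)
  define l :: "'k^2" where "l = vector [t, - s]"
  obtain x' where x': "x = lmul l x'" unfolding l_def by (rule qf_factor[OF st(1) nz])
  obtain y' where y': "y = lmul l y'" unfolding l_def by (rule qf_factor[OF st(2) nz])
  have "x' $ 1 * y' $ 2 - y' $ 1 * x' $ 2 ~= 0"
  proof
   assume "x' $ 1 * y' $ 2 - y' $ 1 * x' $ 2 = 0"
   hence eq: "x' $ 1 * y' $ 2 = y' $ 1 * x' $ 2" by simp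
   then obtain a b where ab: "nz a b" "x' $ 1 * a + y' $ 1 * b = 0" "x' $ 2 * a + y' $ 2 * b = 0"
    by (rule singular_linear_pair[of "x' $ 1" "y' $ 2" "y' $ 1" "x' $ 2"])
   have "a *s x' + b *s y' = 0" using ab(2,3) by (simp add: vec_eq_iff forall_2 mult.commute)
   hence "a *s x + b *s y + 0 *s z = 0" unfolding x' y' using lmul_linear[of l a x' b y'] by simp
   thus False using xyz ab(1) unfolding indep3_def by blast
  qed
  moreover have "is_coord r3 (lmul x' (m3 *s l)) (lmul x' (m4 *s l))" "is_coord r4 (lmul y' (m3 *s l)) (lmul y' (m4 *s l))"
   using r(3,4) unfolding x' y' by (simp_all add: lmul_def vector_smult_assoc vec3_eq_iff is_coord_def algebra_simps)
  ultimately obtain a b d where ab: "nz a b" "syz10 (a *s r3 + b *s r4) d"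
   by (rule common_factor_syz10)
  hence "a *s r3 + b *s r4 = 0" using no10 by blast
  hence "0 *s r1 + 0 *s r2 + a *s r3 + b *s r4 = 0" by simp
  thus False using ind ab(1) unfolding indep4_def by blast
 qed
 interpret Q: conic_line_form x y z k using xyz k k2 k3 by unfold_locales
 obtain N M where NM: "inverse_pair N M" "surf Phi = (*v) N ` surf Q.Phi"
  using surf_basis[OF ind det, of Q.Phi] by (auto simp: val Q.Phi_def)
 have "codim1_singular_locus (surf Phi) = (*v) N ` Q.C \<union> (*v) N ` Q.L"
  unfolding NM(2) codim1_singular_locus_image[OF NM(1)] Q.codim1 by (rule image_Un)
 thus ?thesis
  using is_smooth_plane_conic_image[OF NM(1) Q.conic_C(1)] is_line_image[OF NM(1) Q.line_L(1)] by blast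
qed

text \<open>The syzygy provides a v, a u + b v and b u, where \<open>a\<close> and \<open>b\<close>
  are independent since otherwise a (0,1) syzygy appears. A fourth element is reduced modulo these
  three to a product y (al u + bet v), whose linear factor becomes the new v.\<close>

theorem one_syz02:
 assumes syz: "syz02 c d e" and nz: "c ~= 0 | d ~= 0 | e ~= 0"
  and no01: "!!c d. syz01 c d ==> c = 0"
  and no10: "!!c d. syz10 c d ==> c = 0"
 shows "\<exists>C L. is_smooth_plane_conic C & is_line L & codim1_singular_locus (surf Phi) = C \<union> L"
proof -
 have no01': "q = 0" if "is_coord c1 0 q" "is_coord c2 q 0" for c1 c2 q
 proof -
  have "is_coord (- c2) (- q) (- 0)" by (rule is_coord_uminus[OF that(2)])
  hence "syz01 c1 (- c2)" using that(1) unfolding syz01_def by auto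
  hence "c1 = 0" by (rule no01)
  thus ?thesis using that(1) by (simp add: is_coord_def)
 qed
 obtain a b where ab: "is_coord c 0 a" "is_coord d (- a) (- b)" "is_coord e b 0"
  using syz unfolding syz02_def by blast
 have d': "is_coord (- d) a b" using is_coord_uminus[OF ab(2)] by simp
 have nz': "nz a b" using nz ab is_coord_0D by fastforce
 have ind: "x = 0 & y = 0" if z: "x *s a + y *s b = 0" for x y
 proof (rule ccontr)
  assume xy: "\<not> ?thesis"
  show False
  proof (cases "x = 0")
   case True
   hence "b = 0" using z xy by (simp add: vec.scale_eq_0_iff)
   hence "a = 0" using no01'[OF ab(1), of "- d"] d' by simp
   thus False using nz' \<open>b = 0\<close> by simp
  next
   case False
   define r where "r = - y / x"
   have "(1 / x) *s (x *s a + y *s b) = 0" using z by simp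
   hence a: "a = r *s b" using False by (simp add: r_def vec_eq_iff divide_simps add_eq_0_iff2)
   have "is_coord (- d - r *s e) (a - r *s b) (b - r *s 0)" by (intro is_coord_intros d' ab)
   hence "is_coord (- d - r *s e) 0 b" using a by simp
   hence "b = 0" using no01' ab(3) by blast
   thus False using a nz' by simp
  qed
 qed
 obtain y0 where y0: "indep3 a b y0" using indep3_extend[of a b] ind by metis
 have ind3: "x = 0 & y = 0 & z = 0" if zero: "x *s c + y *s e + z *s (- d) = 0" for x y z
 proof -
  have "is_coord (x *s c + y *s e + z *s (- d)) (x *s 0 + y *s b + z *s a) (x *s a + y *s 0 + z *s b)"
   by (intro is_coord_intros d' ab)
  hence "z *s a + y *s b = 0" "x *s a + z *s b = 0"
   unfolding zero by (simp_all add: is_coord_def add.commute)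
  thus ?thesis using ind by blast
 qed
 obtain w where w: "indep4 c e (- d) w" using indep4_extend3[of c e "- d"] ind3 by metis
 obtain f1 f2 f3 where f: "w v* A = f1 *s a + f2 *s b + f3 *s y0" using indep3_span[OF y0] by blast
 obtain g1 g2 g3 where g: "w v* B = g1 *s a + g2 *s b + g3 *s y0" using indep3_span[OF y0] by blast
 have w_nz: "w + (x1 *s c + x2 *s e + x3 *s (- d)) ~= 0" for x1 x2 x3
 proof
  assume "w + (x1 *s c + x2 *s e + x3 *s (- d)) = 0"
  hence "x1 *s c + x2 *s e + x3 *s (- d) + 1 *s w = 0" by (simp add: add.commute)
  thus False using w unfolding indep4_def by (metis one_neq_zero)
 qed
 define gam where "gam = g2 - f1"
 \<comment> \<open>The corrections remove \<open>a\<close> and \<open>b\<close> from the u-part and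
   \<open>a\<close> from the v-part; only the multiple \<open>gam\<close> of b v remains beside
   \<open>y0\<close>.\<close>
 define w1 where "w1 = w + ((- g1) *s c + (- f2) *s e + (- f1) *s (- d))"
 have "is_coord w1 (w v* A + ((- g1) *s 0 + (- f2) *s b + (- f1) *s a)) (w v* B + ((- g1) *s a + (- f2) *s 0 + (- f1) *s b))"
  unfolding w1_def by (intro is_coord_intros d' ab)
 hence w1: "is_coord w1 (f3 *s y0) (gam *s b + g3 *s y0)"
  unfolding f g gam_def by (simp add: algebra_simps)
 \<comment> \<open>To make both parts proportional to one \<open>y\<close>: if \<open>g3\<close> is
   nonzero, gam b is absorbed into \<open>y\<close>, with a multiple of b u as compensation.
   Otherwise subtracting gam (a u + b v) cancels gam b v and shifts \<open>y0\<close> by a multiple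
   of \<open>a\<close>.\<close>
 have "\<exists>x2 x3 y al bet y1 y2. is_coord (w1 + (x2 *s e + x3 *s (- d))) (al *s y) (bet *s y) &
   (al ~= 0 | bet ~= 0) & y = y0 + (y1 *s a + y2 *s b)"
 proof (cases "g3 = 0")
  case False
  have "is_coord (w1 + ((f3 * (gam / g3)) *s e + 0 *s (- d))) (f3 *s y0 + ((f3 * (gam / g3)) *s b + 0 *s a))
   (gam *s b + g3 *s y0 + ((f3 * (gam / g3)) *s 0 + 0 *s b))" by (intro is_coord_intros d' ab w1)
  moreover have "f3 *s y0 + ((f3 * (gam / g3)) *s b + 0 *s a) = f3 *s (y0 + (0 *s a + (gam / g3) *s b))"
   "gam *s b + g3 *s y0 + ((f3 * (gam / g3)) *s 0 + 0 *s b) = g3 *s (y0 + (0 *s a + (gam / g3) *s b))"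
   using False by (simp_all add: vec_eq_iff algebra_simps)
  ultimately show ?thesis using False by metis
 next
  case True
  have f3: "f3 ~= 0"
  proof
   assume "f3 = 0"
   hence "is_coord w1 0 (gam *s b)" using w1 True by simp
   moreover have "is_coord (gam *s e) (gam *s b) (gam *s 0)" by (intro is_coord_intros ab)
   ultimately have "gam *s b = 0" using no01'[of w1 "gam *s b" "gam *s e"] by simp
   hence "w1 = 0" using \<open>is_coord w1 0 (gam *s b)\<close> is_coord_0D by blast
   thus False using w_nz unfolding w1_def by blast
  qed
  have "is_coord (w1 + (0 *s e + (- gam) *s (- d))) (f3 *s y0 + (0 *s b + (- gam) *s a))
   (gam *s b + g3 *s y0 + (0 *s 0 + (- gam) *s b))" by (intro is_coord_intros d' ab w1)
  moreover have "f3 *s y0 + (0 *s b + (- gam) *s a) = f3 *s (y0 + ((- gam / f3) *s a + 0 *s b))"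
   "gam *s b + g3 *s y0 + (0 *s 0 + (- gam) *s b) = 0 *s (y0 + ((- gam / f3) *s a + 0 *s b))"
   using f3 True by (simp_all add: vec_eq_iff algebra_simps)
  ultimately show ?thesis using f3 by metis
 qed
 then obtain x2 x3 y al bet y1 y2 where w2: "is_coord (w1 + (x2 *s e + x3 *s (- d))) (al *s y) (bet *s y)"
  and ab_nz: "al ~= 0 | bet ~= 0" and y: "y = y0 + (y1 *s a + y2 *s b)" by blast
 define w2 where "w2 = w1 + (x2 *s e + x3 *s (- d))"
 have w2_eq: "w2 = w + ((- g1) *s c + (x2 - f2) *s e + (x3 - f1) *s (- d))"
  by (simp add: w2_def w1_def vec_eq_iff algebra_simps)
 have indc: "r1 = 0 & r2 = 0 & r3 = 0 & r4 = 0"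
  if "r1 *s c + r2 *s e + r3 *s (- d) + r4 *s w2 = 0" for r1 r2 r3 r4
 proof -
  have "(r1 - r4 * g1) *s c + (r2 + r4 * (x2 - f2)) *s e + (r3 + r4 * (x3 - f1)) *s (- d) + r4 *s w = 0"
   using that unfolding w2_eq by (simp add: vec_eq_iff algebra_simps)
  hence "r1 - r4 * g1 = 0" "r2 + r4 * (x2 - f2) = 0" "r3 + r4 * (x3 - f1) = 0" "r4 = 0"
   using w unfolding indep4_def by blast+
  thus ?thesis by simp
 qed
 have indy: "p1 = 0 & p2 = 0 & p3 = 0" if "p1 *s a + p2 *s b + p3 *s y = 0" for p1 p2 p3
 proof -
  have "(p1 + p3 * y1) *s a + (p2 + p3 * y2) *s b + p3 *s y0 = 0"
   using that unfolding y by (simp add: vec_eq_iff algebra_simps)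
  hence "p1 + p3 * y1 = 0" "p2 + p3 * y2 = 0" "p3 = 0" using y0 unfolding indep3_def by blast+
  thus ?thesis by simp
 qed
 show ?thesis
 proof (cases "bet = 0")
  case True
  hence al: "al ~= 0" using ab_nz by simp
  show ?thesis
  \<comment> \<open>The linear factor is a multiple of u, so u and v change places, and with them
    \<open>a\<close> and \<open>b\<close>.\<close>
  proof (rule conic_line_basis[of b y a "- d" c e "(1 / al) *s w2" 0 0 1 1])
   show "indep3 b y a" unfolding indep3_def
   proof (intro allI impI)
    fix p1 p2 p3 assume "p1 *s b + p2 *s y + p3 *s a = 0"
    hence "p3 *s a + p1 *s b + p2 *s y = 0" by (simp add: algebra_simps)
    thus "p1 = 0 & p2 = 0 & p3 = 0" using indy by blast
   qed
   show "indep4 (- d) c e ((1 / al) *s w2)" unfolding indep4_def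
   proof (intro allI impI)
    fix p1 p2 p3 p4 assume "p1 *s (- d) + p2 *s c + p3 *s e + p4 *s ((1 / al) *s w2) = 0"
    hence "p2 *s c + p3 *s e + p1 *s (- d) + (p4 / al) *s w2 = 0"
     by (simp add: vec_eq_iff algebra_simps)
    hence "p2 = 0" "p3 = 0" "p1 = 0" "p4 / al = 0" using indc by blast+
    thus "p1 = 0 & p2 = 0 & p3 = 0 & p4 = 0" using al by simp
   qed
   have "is_coord ((1 / al) *s w2) ((1 / al) *s (al *s y)) ((1 / al) *s (bet *s y))"
    unfolding w2_def by (intro is_coord_scale w2)
   thus "is_coord ((1 / al) *s w2) (1 *s y) (0 *s y)" using al True by (simp add: vector_smult_assoc)
  qed (use d' ab no10 in auto)
 next
  case False
  \<comment> \<open>The new v is tha u + v. Replacing \<open>a\<close> by a + tha b restores the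
    shape of the three syzygy elements, which explains the coefficients 2 tha and tha^2.\<close>
  define tha where "tha = al / bet"
  show ?thesis
  proof (rule conic_line_basis[of "a + tha *s b" y b "- d + (2 * tha) *s e" e
     "c + tha *s (- d) + (tha * tha) *s e" "(1 / bet) *s w2" 1 1 0 tha])
   show "indep3 (a + tha *s b) y b" unfolding indep3_def
   proof (intro allI impI)
    fix p1 p2 p3 assume "p1 *s (a + tha *s b) + p2 *s y + p3 *s b = 0"
    hence "p1 *s a + (p3 + p1 * tha) *s b + p2 *s y = 0" by (simp add: vec_eq_iff algebra_simps)
    hence "p1 = 0" "p3 + p1 * tha = 0" "p2 = 0" using indy by blast+
    thus "p1 = 0 & p2 = 0 & p3 = 0" by simp
   qed
   show "indep4 (- d + (2 * tha) *s e) e (c + tha *s (- d) + (tha * tha) *s e) ((1 / bet) *s w2)"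
    unfolding indep4_def
   proof (intro allI impI)
    fix p1 p2 p3 p4
    assume "p1 *s (- d + (2 * tha) *s e) + p2 *s e + p3 *s (c + tha *s (- d) + (tha * tha) *s e) +
     p4 *s ((1 / bet) *s w2) = 0"
    hence "p3 *s c + (p2 + p1 * (2 * tha) + p3 * (tha * tha)) *s e + (p1 + p3 * tha) *s (- d) + (p4 / bet) *s w2 = 0"
     by (simp add: vec_eq_iff algebra_simps)
    hence "p3 = 0" "p2 + p1 * (2 * tha) + p3 * (tha * tha) = 0" "p1 + p3 * tha = 0" "p4 / bet = 0"
     using indc by blast+
    thus "p1 = 0 & p2 = 0 & p3 = 0 & p4 = 0" using False by simp
   qed
   have "is_coord (- d + (2 * tha) *s e) (a + (2 * tha) *s b) (b + (2 * tha) *s 0)"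
    by (intro is_coord_intros d' ab)
   moreover have "a + (2 * tha) *s b = 1 *s (a + tha *s b) + tha *s b"
    "b + (2 * tha) *s 0 = 0 *s (a + tha *s b) + 1 *s b" by (simp_all add: vec_eq_iff algebra_simps)
   ultimately show "is_coord (- d + (2 * tha) *s e) (1 *s (a + tha *s b) + tha *s b) (0 *s (a + tha *s b) + 1 *s b)"
    by simp
   have "is_coord (c + tha *s (- d) + (tha * tha) *s e) (0 + tha *s a + (tha * tha) *s b) (a + tha *s b + (tha * tha) *s 0)"
    by (intro is_coord_intros d' ab)
   thus "is_coord (c + tha *s (- d) + (tha * tha) *s e) (tha *s (a + tha *s b)) (1 *s (a + tha *s b))"
    by (simp add: algebra_simps vector_smult_assoc)
   have "is_coord ((1 / bet) *s w2) ((1 / bet) *s (al *s y)) ((1 / bet) *s (bet *s y))"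
    unfolding w2_def by (intro is_coord_scale w2)
   thus "is_coord ((1 / bet) *s w2) (tha *s y) (1 *s y)" using False by (simp add: tha_def vector_smult_assoc)
  qed (use ab no10 in auto)
 qed
qed

end

section \<open>Spaces of forms without syzygies of bidegrees (0,2) and (1,0)\<close>

definition line_poly :: "('k::field => 'k => 'k) => bool" where
 "line_poly f \<longleftrightarrow> (\<forall>s t d e. \<exists>P. \<forall>r. f (s + r * d) (t + r * e) = poly P r)"

lemma line_poly_lf: "line_poly (lf a)" unfolding line_poly_def
proof (intro allI)
 fix s t d e :: 'a
 have "\<forall>r. lf a (s + r * d) (t + r * e) = poly [:lf a s t, lf a d e:] r"
  by (simp add: lf_def algebra_simps)
 thus "\<exists>P. \<forall>r. lf a (s + r * d) (t + r * e) = poly P r" by blast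
qed

lemma line_poly_qf: "line_poly (qf a)" unfolding line_poly_def
proof (intro allI)
 fix s t d e :: 'a
 have "\<forall>r. qf a (s + r * d) (t + r * e) = poly [:qf a s t,
   2 * a $ 1 * s * d + a $ 2 * (s * e + t * d) + 2 * a $ 3 * t * e, qf a d e:] r"
  by (simp add: qf_def algebra_simps)
 thus "\<exists>P. \<forall>r. qf a (s + r * d) (t + r * e) = poly P r" by blast
qed

lemma line_poly_mult: "line_poly f ==> line_poly g ==> line_poly (%s t. f s t * g s t)"
 unfolding line_poly_def by (metis poly_mult)

lemma line_poly_diff: "line_poly f ==> line_poly g ==> line_poly (%s t. f s t - g s t)"
 unfolding line_poly_def by (metis poly_diff)

text \<open>On a line in a direction where \<open>l\<close> does not vanish, \<open>l\<close> has a
  single zero. Two polynomials that agree off one parameter agree there too.\<close>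

lemma lf_cancel:
 fixes l :: "'k::alg_closed_field^2"
 assumes "line_poly f" "line_poly g" "l ~= 0" "!!s t. lf l s t * f s t = lf l s t * g s t"
 shows "f s t = g s t"
proof -
 have "lf l 1 0 ~= 0 | lf l 0 1 ~= 0" using assms(3) by (simp add: lf_def vec_eq_iff forall_2)
 then obtain d e where de: "lf l d e ~= 0" by blast
 obtain P where P: "f (s + r * d) (t + r * e) - g (s + r * d) (t + r * e) = poly P r" for r
  using line_poly_diff[OF assms(1,2)] unfolding line_poly_def by meson
 have "P = 0"
 proof (rule poly_zeroI[of "{- lf l s t / lf l d e}"])
  fix r assume r: "r \<notin> {- lf l s t / lf l d e}"
  have "lf l (s + r * d) (t + r * e) = lf l s t + r * lf l d e" by (simp add: lf_def algebra_simps)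
  hence "lf l (s + r * d) (t + r * e) ~= 0" using r de by (auto simp: field_simps add_eq_0_iff)
  thus "poly P r = 0" using assms(4)[of "s + r * d" "t + r * e"] P[of r] by simp
 qed simp
 thus ?thesis using P[of 0] by simp
qed

lemma qf_eqI:
 assumes "!!s t. qf a s t = qf b s t"
 shows "a = b" using assms[of 1 0] assms[of 0 1] assms[of 1 1] by (simp add: qf_def vec3_eq_iff)

text \<open>The common root gives \<open>A\<close> and \<open>C\<close> a common linear factor l.
  The other factor of \<open>A\<close> does not divide that of \<open>C\<close>, by
  non-proportionality, so it divides \<open>D\<close>.\<close>

lemma rectangle_factor_aux:
 fixes A B C D :: "'k::alg_closed_field^3"
 assumes eq: "!!s t. qf A s t * qf B s t = qf C s t * qf D s t"
  and A: "A ~= 0" "!!c. C ~= c *s A"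
  and r: "nz s1 t1" "qf A s1 t1 = 0" "qf C s1 t1 = 0"
 obtains l al gam m where "A = lmul l al" "C = lmul l gam" "B = lmul m gam" "D = lmul m al"
proof -
 define l :: "'k^2" where "l = vector [t1, - s1]"
 have l: "l ~= 0" using r(1) by (auto simp: l_def vec_eq_iff forall_2)
 obtain al where al: "A = lmul l al" unfolding l_def using qf_factor r by metis
 obtain gam where gam: "C = lmul l gam" unfolding l_def using qf_factor r by metis
 have eq2: "lf al s t * qf B s t = lf gam s t * qf D s t" for s t
 proof (rule lf_cancel[OF _ _ l, of "%s t. lf al s t * qf B s t" "%s t. lf gam s t * qf D s t"])
  show "lf l s t * (lf al s t * qf B s t) = lf l s t * (lf gam s t * qf D s t)" for s t
   using eq[of s t] by (simp add: al gam mult.assoc)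
 qed (intro line_poly_mult line_poly_lf line_poly_qf)+
 have alnz: "al ~= 0" using A al by auto
 hence s2: "- al $ 2 ~= 0 | al $ 1 ~= 0" by (auto simp: vec_eq_iff forall_2)
 have vec: "vector [al $ 1, - (- al $ 2)] = al" by (simp add: vec_eq_iff forall_2)
 have "lf gam (- al $ 2) (al $ 1) ~= 0"
 proof
  assume "lf gam (- al $ 2) (al $ 1) = 0"
  hence "qf (lmul gam gam) (- al $ 2) (al $ 1) = 0" "gam $ 2 * al $ 1 = gam $ 1 * al $ 2"
   by (simp_all add: lf_def)
  then obtain c where "gam = c *s al"
  proof (cases "al $ 1 = 0")
   case True
   hence "al $ 2 ~= 0" "gam $ 1 = 0" using s2 \<open>gam $ 2 * al $ 1 = gam $ 1 * al $ 2\<close> by auto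
   hence "gam = (gam $ 2 / al $ 2) *s al" using True by (simp add: vec_eq_iff forall_2)
   thus ?thesis by (rule that)
  next
   case False
   hence "gam = (gam $ 1 / al $ 1) *s al"
    using \<open>gam $ 2 * al $ 1 = gam $ 1 * al $ 2\<close> by (simp add: vec_eq_iff forall_2 field_simps)
   thus ?thesis by (rule that)
  qed
  hence "C = c *s A" unfolding al gam using lmul_linear[of l c al 0 0] by simp
  thus False using A(2) by blast
 qed
 moreover have "lf al (- al $ 2) (al $ 1) = 0" by (simp add: lf_def)
 ultimately have "qf D (- al $ 2) (al $ 1) = 0" using eq2[of "- al $ 2" "al $ 1"] by simp
 then obtain m where m: "D = lmul al m" using qf_factor[OF _ s2] vec by metis
 have "qf B s t = qf (lmul m gam) s t" for s t
 proof (rule lf_cancel[OF _ _ alnz, of "qf B" "qf (lmul m gam)"])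
  show "lf al s t * qf B s t = lf al s t * qf (lmul m gam) s t" for s t
   using eq2[of s t] by (simp add: m mult_ac)
 qed (intro line_poly_qf)+
 hence "B = lmul m gam" by (rule qf_eqI)
 thus ?thesis using that al gam m lmul_commute[of al m] by blast
qed

text \<open>A root of \<open>A\<close> is a root of \<open>C\<close> or of \<open>D\<close>; up to
  exchanging these two the previous lemma applies.\<close>

lemma rectangle_factor:
 fixes A B C D :: "'k::alg_closed_field^3"
 assumes eq: "!!s t. qf A s t * qf B s t = qf C s t * qf D s t"
  and A: "A ~= 0" "!!c. C ~= c *s A" "!!c. D ~= c *s A"
 obtains l al gam m where "A = lmul l al" "C = lmul l gam" "B = lmul m gam" "D = lmul m al"
proof -
 obtain s1 t1 where r: "nz s1 t1" "qf A s1 t1 = 0" using qf_root by blast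
 show ?thesis
 proof (cases "qf C s1 t1 = 0")
  case True
  show ?thesis by (rule rectangle_factor_aux[OF eq A(1,2) r True]) (rule that)
 next
  case False
  hence "qf D s1 t1 = 0" using eq[of s1 t1] r(2) by simp
  have eq': "qf A s t * qf B s t = qf D s t * qf C s t" for s t using eq[of s t] by (simp add: mult.commute)
  obtain l al gam m where "A = lmul l al" "D = lmul l gam" "B = lmul m gam" "C = lmul m al"
   by (rule rectangle_factor_aux[OF eq' A(1,3) r \<open>qf D s1 t1 = 0\<close>])
  thus ?thesis using that lmul_commute by metis
 qed
qed

section \<open>Type 1: from a (0,3) syzygy to the twisted cubic\<close>

context form_space
begin

text \<open>If the expression in \<open>k\<close> vanished, k2 times the equation of the conic would
  take the form A' B' = C' D'. Factoring both sides into linear forms yields two elements of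
  \<open>U\<close> with a common factor of bidegree (1,1), hence a forbidden (1,0) syzygy.\<close>

lemma twisted_basis:
 assumes xyz: "indep3 x y z" and k: "conic_through x y z k" and k2: "k 2 ~= 0"
  and ind: "indep4 r1 r2 r3 r4"
  and r: "is_coord r1 x (tau *s x)" "is_coord r2 y (x + tau *s y)" "is_coord r3 z (y + tau *s z)" "is_coord r4 0 z"
  and no10: "!!c d. syz10 c d ==> c = 0"
 shows "is_twisted_cubic (codim1_singular_locus (surf Phi))"
proof -
 have val: "vdot r1 (Phi (s, t, u, v)) = qf x s t * (1 * u + tau * v)"
  "vdot r2 (Phi (s, t, u, v)) = qf x s t * (0 * u + 1 * v) + qf y s t * (1 * u + tau * v)"
  "vdot r3 (Phi (s, t, u, v)) = qf y s t * (0 * u + 1 * v) + qf z s t * (1 * u + tau * v)"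
  "vdot r4 (Phi (s, t, u, v)) = qf z s t * (0 * u + 1 * v)" for s t u v
  using r[THEN vdot_Phi] by (simp_all add: algebra_simps)
 have pf: "k 4 * k 6 - (k 2 + k 5) * k 2 - k 1 * k 3 ~= 0"
 proof
  assume pf0: "k 4 * k 6 - (k 2 + k 5) * k 2 - k 1 * k 3 = 0"
  define A' where "A' = k 2 *s y + k 4 *s z"
  define B' where "B' = k 2 *s y + k 6 *s x"
  define C' where "C' = k 2 *s x - k 3 *s z"
  define D' where "D' = k 2 *s z - k 1 *s x"
  have eq: "qf A' s t * qf B' s t = qf C' s t * qf D' s t" for s t
  proof -
   have "conic k (qf x s t) (qf y s t) (qf z s t) = 0" using k unfolding conic_through_def by blast
   hence "k 2 * conic k (qf x s t) (qf y s t) (qf z s t) = 0" by simp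
   thus ?thesis using pf0
    unfolding A'_def B'_def C'_def D'_def conic_def qf_add qf_scale qf_diff by algebra
  qed
  have indz: "a = 0 & b = 0 & c = 0" if "a *s x + b *s y + c *s z = 0" for a b c
   using xyz that unfolding indep3_def by blast
  have A: "A' ~= 0"
  proof
   assume "A' = 0"
   hence "0 *s x + k 2 *s y + k 4 *s z = 0" by (simp add: A'_def)
   thus False using indz k2 by blast
  qed
  have CA: "C' ~= c *s A'" for c
  proof
   assume "C' = c *s A'"
   hence "k 2 *s x + (- c * k 2) *s y + (- k 3 - c * k 4) *s z = 0"
    by (simp add: A'_def C'_def vec_eq_iff algebra_simps)
   thus False using indz k2 by blast
  qed
  have DA: "D' ~= c *s A'" for c
  proof
   assume "D' = c *s A'"
   hence "(- k 1) *s x + (- c * k 2) *s y + (k 2 - c * k 4) *s z = 0"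
    by (simp add: A'_def D'_def vec_eq_iff algebra_simps)
   hence "- c * k 2 = 0" "k 2 - c * k 4 = 0" using indz by blast+
   thus False using k2 by simp
  qed
  obtain l al gam m where f: "A' = lmul l al" "C' = lmul l gam" "B' = lmul m gam" "D' = lmul m al"
   using rectangle_factor[OF eq A CA DA] .
  have det: "al $ 1 * gam $ 2 - gam $ 1 * al $ 2 ~= 0"
  proof
   assume "al $ 1 * gam $ 2 - gam $ 1 * al $ 2 = 0"
   hence "al $ 1 * gam $ 2 = gam $ 1 * al $ 2" by simp
   then obtain a b where ab: "nz a b" "al $ 1 * a + gam $ 1 * b = 0" "al $ 2 * a + gam $ 2 * b = 0"
    by (rule singular_linear_pair[of "al $ 1" "gam $ 2" "gam $ 1" "al $ 2"])
   have "a *s al + b *s gam = 0" using ab(2,3) by (simp add: vec_eq_iff forall_2 mult.commute)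
   hence z: "a *s A' + b *s C' = 0" unfolding f using lmul_linear[of l a al b gam] by simp
   show False
   proof (cases "b = 0")
    case True
    thus False using z A ab(1) by (simp add: vec.scale_eq_0_iff)
   next
    case False
    have "C' = (- a / b) *s A'"
     using z False by (simp add: vec_eq_iff divide_simps add_eq_0_iff2 mult.commute add.commute)
    thus False using CA by blast
   qed
  qed
  define g where "g = k 2 *s r2 + (- k 3) *s r4 + k 6 *s r1"
  define h where "h = k 2 *s r3 + k 4 *s r4 + (- k 1) *s r1"
  have "is_coord g (k 2 *s y + (- k 3) *s 0 + k 6 *s x) (k 2 *s (x + tau *s y) + (- k 3) *s z + k 6 *s (tau *s x))"
   unfolding g_def by (intro is_coord_intros r)
  moreover have "k 2 *s y + (- k 3) *s 0 + k 6 *s x = lmul gam m"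
   unfolding lmul_commute[of gam] f(3)[symmetric] B'_def by simp
  moreover have "k 2 *s (x + tau *s y) + (- k 3) *s z + k 6 *s (tau *s x) = 1 *s C' + tau *s B'"
   unfolding C'_def B'_def by (simp add: vec_eq_iff algebra_simps)
  moreover have "1 *s C' + tau *s B' = lmul gam (1 *s l + tau *s m)"
   unfolding f lmul_linear lmul_commute[of _ gam] ..
  ultimately have g: "is_coord g (lmul gam m) (lmul gam (1 *s l + tau *s m))" by simp
  have "is_coord h (k 2 *s z + k 4 *s 0 + (- k 1) *s x) (k 2 *s (y + tau *s z) + k 4 *s z + (- k 1) *s (tau *s x))"
   unfolding h_def by (intro is_coord_intros r)
  moreover have "k 2 *s z + k 4 *s 0 + (- k 1) *s x = lmul al m"
   unfolding lmul_commute[of al] f(4)[symmetric] D'_def by simp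
  moreover have "k 2 *s (y + tau *s z) + k 4 *s z + (- k 1) *s (tau *s x) = 1 *s A' + tau *s D'"
   unfolding A'_def D'_def by (simp add: vec_eq_iff algebra_simps)
  moreover have "1 *s A' + tau *s D' = lmul al (1 *s l + tau *s m)"
   unfolding f lmul_linear lmul_commute[of _ al] ..
  ultimately have h: "is_coord h (lmul al m) (lmul al (1 *s l + tau *s m))" by simp
  obtain a b d where ab: "nz a b" "syz10 (a *s h + b *s g) d"
   by (rule common_factor_syz10[OF det h g])
  have "a *s h + b *s g = 0" using ab(2) by (rule no10)
  hence "(b * k 6 - a * k 1) *s r1 + (b * k 2) *s r2 + (a * k 2) *s r3 + (a * k 4 - b * k 3) *s r4 = 0"
   unfolding g_def h_def by (simp add: vec_eq_iff algebra_simps)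
  hence "b * k 2 = 0" "a * k 2 = 0" using ind unfolding indep4_def by blast+
  thus False using ab(1) k2 by simp
 qed
 interpret Q: twisted_cubic_form x y z k using xyz k k2 pf by unfold_locales
 have "\<exists>N M. inverse_pair N M & surf Phi = (*v) N ` surf Q.Phi"
  by (rule surf_basis[OF ind, of 1 1 tau 0 Q.Phi]) (auto simp: val Q.Phi_def)
 then obtain N M where NM: "inverse_pair N M" "surf Phi = (*v) N ` surf Q.Phi" by blast
 show ?thesis unfolding NM(2) codim1_singular_locus_image[OF NM(1)]
  by (rule is_twisted_cubic_image[OF NM(1) Q.codim1])
qed

text \<open>The new point (0, 1, 0) is the old (- tau, 1, 0), where the conic takes the value k1
  tau^2 - k6 tau + k2. Were this zero for all tau, the conic would contain the line c = 0 and be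
  singular at a point of it.\<close>

lemma shear_k2:
 fixes x y z :: "'k^3"
 assumes "indep3 x y z"
 obtains tau k where "indep3 (x + tau *s y + (tau * tau) *s z) (y + (2 * tau) *s z) z"
  "conic_through (x + tau *s y + (tau * tau) *s z) (y + (2 * tau) *s z) z k" "k 2 ~= 0"
proof -
 obtain k where k: "conic_through x y z k" using conic_exists[OF assms] .
 have "[:k 2, - k 6, k 1:] ~= 0"
 proof
  assume "[:k 2, - k 6, k 1:] = 0"
  hence k0: "k 2 = 0" "k 6 = 0" "k 1 = 0" by auto
  obtain a b where ab: "nz a b" "k 5 * a + k 4 * b = 0"
  proof (cases "k 5 = 0")
   case True
   thus ?thesis using that[of 1 0] by simp
  next
   case False
   thus ?thesis using that[of "k 4" "- k 5"] by (simp add: mult.commute)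
  qed
  have "conic k a b 0 = 0" "conic_a k a b 0 = 0" "conic_b k a b 0 = 0" "conic_c k a b 0 = 0"
   using k0 ab(2) by (simp_all add: conic_def conic_a_def conic_b_def conic_c_def add.commute)
  hence "a = 0 & b = 0" using k unfolding conic_through_def by blast
  thus False using ab(1) by simp
 qed
 then obtain tau where tau: "poly [:k 2, - k 6, k 1:] tau ~= 0" using avoid_roots[of _ "{}"] by blast
 define x' where "x' = x + tau *s y + (tau * tau) *s z"
 define y' where "y' = y + (2 * tau) *s z"
 have ind: "indep3 x' y' z" unfolding indep3_def
 proof (intro allI impI)
  fix a b c assume "a *s x' + b *s y' + c *s z = 0"
  hence "a *s x + (a * tau + b) *s y + (a * (tau * tau) + b * (2 * tau) + c) *s z = 0"
   unfolding x'_def y'_def by (simp add: vec_eq_iff algebra_simps)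
  hence "a = 0" "a * tau + b = 0" "a * (tau * tau) + b * (2 * tau) + c = 0"
   using assms unfolding indep3_def by blast+
  thus "a = 0 & b = 0 & c = 0" by simp
 qed
 obtain k' where k': "conic_through x' y' z k'" using conic_exists[OF ind] .
 have "k' 2 ~= 0"
 proof
  assume "k' 2 = 0"
  hence "conic k' 0 1 0 = 0" by (simp add: conic_def)
  then obtain s t where st: "0 = qf x' s t" "1 = qf y' s t" "0 = qf z s t"
   using k' unfolding conic_through_def by blast
  hence "qf z s t = 0" "qf y s t = 1" "qf x s t = - tau"
   by (simp_all add: x'_def y'_def eq_neg_iff_add_eq_0)
  moreover have "conic k (qf x s t) (qf y s t) (qf z s t) = 0" using k unfolding conic_through_def by blast
  ultimately show False using tau by (simp add: conic_def algebra_simps)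
 qed
 thus ?thesis using that ind k' unfolding x'_def y'_def by blast
qed

text \<open>A dimension count: 3 * 3 + 4 * 4 = 25 unknowns satisfy 2 * 4 * 3 = 24 linear equations.
  The elements obtained fulfil v^3 c0 - u v^2 c1 + u^2 v c2 - u^3 c3 = 0, a syzygy of bidegree
  (0,3).\<close>

lemma exists_twisted_triple:
 obtains x y z c0 c1 c2 c3 where "is_coord c0 x 0" "is_coord c1 y x" "is_coord c2 z y" "is_coord c3 0 z"
  "x ~= 0 | y ~= 0 | z ~= 0"
proof -
 define X :: "'k^((3 \<times> 3) + (4 \<times> 4)) => 3 => 'k^3" where "X w r = (\<chi> j. w $ Inl (r, j))" for w r
 define c :: "'k^((3 \<times> 3) + (4 \<times> 4)) => 4 => 'k^4" where "c w i = (\<chi> j. w $ Inr (i, j))" for w i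
 define P :: "'k^((3 \<times> 3) + (4 \<times> 4)) => 4 => 'k^3" where
  "P w i = (if i = 1 then X w 1 else if i = 2 then X w 2 else if i = 3 then X w 3 else 0)" for w i
 define Q :: "'k^((3 \<times> 3) + (4 \<times> 4)) => 4 => 'k^3" where
  "Q w i = (if i = 1 then 0 else if i = 2 then X w 1 else if i = 3 then X w 2 else X w 3)" for w i
 define f :: "'k^((3 \<times> 3) + (4 \<times> 4)) => 'k^((4 \<times> 3) + (4 \<times> 3))" where
  "f w = (\<chi> m. case m of Inl (i, j) => (P w i - c w i v* A) $ j | Inr (i, j) => (Q w i - c w i v* B) $ j)" for w
 have X_lin: "X (w + w') r = X w r + X w' r" "X (a *s w) r = a *s X w r" for w w' a r
  by (simp_all add: X_def vec_eq_iff)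
 have c_lin: "c (w + w') i = c w i + c w' i" "c (a *s w) i = a *s c w i" for w w' a i
  by (simp_all add: c_def vec_eq_iff)
 have PQ_lin: "P (w + w') i = P w i + P w' i" "P (a *s w) i = a *s P w i"
  "Q (w + w') i = Q w i + Q w' i" "Q (a *s w) i = a *s Q w i" for w w' a i
  by (simp_all add: P_def Q_def X_lin)
 have sc: "(a *s d) v* M = a *s (d v* M)" for a d and M :: "'k^3^4"
  by (simp add: vector_matrix_mult_def vec_eq_iff sum_4 algebra_simps)
 have "Vector_Spaces.linear (*s) (*s) f" unfolding Vector_Spaces.linear_iff
  by (intro conjI allI vec.vector_space_axioms)
   (auto simp: f_def vec_eq_iff PQ_lin c_lin vector_matrix_left_distrib sc algebra_simps split: sum.split)
 moreover have "CARD((4 \<times> 3) + (4 \<times> 3)) < CARD((3 \<times> 3) + (4 \<times> 4))" by simp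
 ultimately obtain w where w: "w ~= 0" "f w = 0" by (rule exists_kernel_vector)
 have co: "is_coord (c w i) (P w i) (Q w i)" for i
 proof -
  have "f w $ Inl (i, j) = 0" "f w $ Inr (i, j) = 0" for j using w(2) by simp_all
  thus ?thesis by (simp add: f_def is_coord_def vec_eq_iff)
 qed
 have "X w 1 ~= 0 | X w 2 ~= 0 | X w 3 ~= 0"
 proof (rule ccontr)
  assume "\<not> ?thesis"
  hence X: "X w r = 0" for r using exhaust_3[of r] by auto
  hence "c w i = 0" for i using is_coord_0D[OF co] by (simp add: P_def Q_def)
  hence "w $ Inr (i, j) = 0" for i j by (simp add: c_def vec_eq_iff)
  moreover have "w $ Inl (i, j) = 0" for i j using X[of i] by (simp add: X_def vec_eq_iff)
  ultimately have "w $ m = 0" for m by (cases m) auto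
  thus False using w(1) by (simp add: vec_eq_iff)
 qed
 thus ?thesis
  using that[of "c w 1" "X w 1" "c w 2" "X w 2" "c w 3" "X w 3" "c w 4"] co[of 1] co[of 2] co[of 3] co[of 4]
  by (simp add: P_def Q_def)
qed

text \<open>A linear relation between \<open>x\<close>, \<open>y\<close>, \<open>z\<close> would
  lower the degree: the combinations \<open>1\<close> to \<open>4\<close> are syzygies of bidegree
  (0,2), and their vanishing kills all four elements. So the triple is independent, and a shear
  brings it into the form of \<open>twisted_basis\<close>.\<close>

theorem no_syz02:
 assumes no02: "!!c d e. syz02 c d e ==> c = 0 & d = 0 & e = 0"
  and no10: "!!c d. syz10 c d ==> c = 0"
 shows "is_twisted_cubic (codim1_singular_locus (surf Phi))"
proof -
 obtain x y z c0 c1 c2 c3 where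
  c: "is_coord c0 x 0" "is_coord c1 y x" "is_coord c2 z y" "is_coord c3 0 z"
  and nz: "x ~= 0 | y ~= 0 | z ~= 0" by (rule exists_twisted_triple)
 have no02': "c = 0 & d = 0 & e = 0"
  if "is_coord c a0 a" "is_coord d a' b'" "is_coord e b b0" "a0 = 0" "b0 = 0" "a' = - a" "b' = - b" for c d e a0 a a' b' b b0
  using that no02 unfolding syz02_def by blast
 have xyz: "indep3 x y z" unfolding indep3_def
 proof (rule ccontr)
  assume "\<not> (\<forall>a b c. a *s x + b *s y + c *s z = 0 --> a = 0 & b = 0 & c = 0)"
  then obtain l m n where rel: "l *s x + m *s y + n *s z = 0" and lmn: "l ~= 0 | m ~= 0 | n ~= 0" by blast
  have rel': "l *s x = - (m *s y + n *s z)" "n *s z = - (l *s x + m *s y)"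
   using rel by (simp_all add: eq_neg_iff_add_eq_0 algebra_simps)
  have 1: "l *s c0 + m *s c1 + n *s c2 = 0 & (- m) *s c0 + (- n) *s c1 = 0 & n *s c0 = 0"
  proof (rule no02')
   show "is_coord (l *s c0 + m *s c1 + n *s c2) (l *s x + m *s y + n *s z) (l *s 0 + m *s x + n *s y)"
    "is_coord ((- m) *s c0 + (- n) *s c1) ((- m) *s x + (- n) *s y) ((- m) *s 0 + (- n) *s x)"
    "is_coord (n *s c0) (n *s x) (n *s 0)" by (intro is_coord_intros c)+
  qed (use rel in simp_all)
  have 2: "l *s c3 = 0 & (- l) *s c2 + (- m) *s c3 = 0 & l *s c1 + m *s c2 + n *s c3 = 0"
  proof (rule no02')
   show "is_coord (l *s c3) (l *s 0) (l *s z)"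
    "is_coord ((- l) *s c2 + (- m) *s c3) ((- l) *s z + (- m) *s 0) ((- l) *s y + (- m) *s z)"
    "is_coord (l *s c1 + m *s c2 + n *s c3) (l *s y + m *s z + n *s 0) (l *s x + m *s y + n *s z)"
    by (intro is_coord_intros c)+
  qed (use rel in simp_all)
  have 3: "n *s c3 = 0 & l *s c0 + m *s c1 = 0 & (- m) *s c0 = 0"
  proof (rule no02')
   show "is_coord (n *s c3) (n *s 0) (n *s z)"
    "is_coord (l *s c0 + m *s c1) (l *s x + m *s y) (l *s 0 + m *s x)"
    "is_coord ((- m) *s c0) ((- m) *s x) ((- m) *s 0)" by (intro is_coord_intros c)+
  qed (use rel' in simp_all)
  have 4: "(- m) *s c3 = 0 & m *s c2 + n *s c3 = 0 & l *s c0 = 0"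
  proof (rule no02')
   show "is_coord ((- m) *s c3) ((- m) *s 0) ((- m) *s z)"
    "is_coord (m *s c2 + n *s c3) (m *s z + n *s 0) (m *s y + n *s z)"
    "is_coord (l *s c0) (l *s x) (l *s 0)" by (intro is_coord_intros c)+
  qed (use rel' in simp_all)
  have c0: "c0 = 0" using 1 3 4 lmn by (auto simp: vec.scale_eq_0_iff)
  have c3: "c3 = 0" using 2 3 4 lmn by (auto simp: vec.scale_eq_0_iff)
  have z: "l *s c2 = 0" "m *s c2 = 0" "m *s c1 = 0" "n *s c1 = 0"
   using 1 2 3 4 c0 c3 by (auto simp: vec.scale_eq_0_iff)
  moreover have "l *s c1 = 0" "n *s c2 = 0" using 1 2 c0 c3 z by auto
  ultimately have c12: "c1 = 0" "c2 = 0" using lmn by (auto simp: vec.scale_eq_0_iff)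
  have "x = 0" "y = 0" "z = 0" using c(1,3,4) unfolding c0 c3 c12 by (simp_all add: is_coord_def)
  thus False using nz by simp
 qed
 obtain tau k where k: "indep3 (x + tau *s y + (tau * tau) *s z) (y + (2 * tau) *s z) z"
  "conic_through (x + tau *s y + (tau * tau) *s z) (y + (2 * tau) *s z) z k" "k 2 ~= 0"
  by (rule shear_k2[OF xyz])
 \<comment> \<open>The basis adapted to the replacement of u by u + tau v; the coefficients 2 and 3
   are binomial.\<close>
 define r1 where "r1 = c0 + tau *s c1 + (tau * tau) *s c2 + (tau * tau * tau) *s c3"
 define r2 where "r2 = c1 + (2 * tau) *s c2 + (3 * (tau * tau)) *s c3"
 define r3 where "r3 = c2 + (3 * tau) *s c3"
 have r1: "is_coord r1 (x + tau *s y + (tau * tau) *s z + (tau * tau * tau) *s 0) (0 + tau *s x + (tau * tau) *s y + (tau * tau * tau) *s z)"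
  unfolding r1_def by (intro is_coord_intros c)
 have r2: "is_coord r2 (y + (2 * tau) *s z + (3 * (tau * tau)) *s 0) (x + (2 * tau) *s y + (3 * (tau * tau)) *s z)"
  unfolding r2_def by (intro is_coord_intros c)
 have r3: "is_coord r3 (z + (3 * tau) *s 0) (y + (3 * tau) *s z)"
  unfolding r3_def by (intro is_coord_intros c)
 show ?thesis
 proof (rule twisted_basis[OF k])
  show "indep4 r1 r2 r3 c3" unfolding indep4_def
  proof (intro allI impI)
   fix p1 p2 p3 p4 assume zero: "p1 *s r1 + p2 *s r2 + p3 *s r3 + p4 *s c3 = 0"
   define p2' where "p2' = p1 * tau + p2"
   define p3' where "p3' = p1 * (tau * tau) + p2 * (2 * tau) + p3"
   define p4' where "p4' = p1 * (tau * tau * tau) + p2 * (3 * (tau * tau)) + p3 * (3 * tau) + p4"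
   have z: "p1 *s c0 + p2' *s c1 + p3' *s c2 + p4' *s c3 = 0"
    using zero unfolding r1_def r2_def r3_def p2'_def p3'_def p4'_def
    by (simp add: vec_eq_iff algebra_simps)
   have "is_coord (p1 *s c0 + p2' *s c1 + p3' *s c2 + p4' *s c3)
     (p1 *s x + p2' *s y + p3' *s z + p4' *s 0) (p1 *s 0 + p2' *s x + p3' *s y + p4' *s z)"
    by (intro is_coord_intros c)
   hence "p1 *s x + p2' *s y + p3' *s z = 0" "p2' *s x + p3' *s y + p4' *s z = 0"
    unfolding z by (simp_all add: is_coord_def)
   hence "p1 = 0" "p2' = 0" "p3' = 0" "p4' = 0" using xyz unfolding indep3_def by blast+
   thus "p1 = 0 & p2 = 0 & p3 = 0 & p4 = 0" by (simp add: p2'_def p3'_def p4'_def)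
  qed
  show "is_coord r1 (x + tau *s y + (tau * tau) *s z) (tau *s (x + tau *s y + (tau * tau) *s z))"
   using r1 by (simp add: is_coord_def vec_eq_iff algebra_simps)
  show "is_coord r2 (y + (2 * tau) *s z) (x + tau *s y + (tau * tau) *s z + tau *s (y + (2 * tau) *s z))"
   using r2 by (simp add: is_coord_def vec_eq_iff algebra_simps)
  show "is_coord r3 z (y + (2 * tau) *s z + tau *s z)"
   using r3 by (simp add: is_coord_def vec_eq_iff algebra_simps)
 qed (use c no10 in auto)
qed

end

section \<open>Evaluation on the bigraded ring\<close>

definition bev :: "'k::field => 'k => 'k => 'k => 'k bipoly => 'k" where
 "bev s t u v = eval_mpoly (case_bvar s t u v)"

definition bconst :: "'k::field => 'k bipoly" where
 "bconst c = single 0 c"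

definition bvr :: "bvar => 'k::field bipoly" where
 "bvr w = single (single w 1) 1"

definition subst :: "'k::field bipoly => 'k bipoly => 'k bipoly => 'k bipoly => 'k bipoly => 'k bipoly" where
 "subst S T U V = mp_hom bconst (case_bvar S T U V)"

lemma coeff_hom_bconst: "coeff_hom bconst"
 by unfold_locales (simp_all add: bconst_def single_add mult_single)

lemma eval_bicoords: "eval_mpoly (bicoords a b) = bev (a $ 1) (a $ 2) (b $ 1) (b $ 2)"
proof -
 have "bicoords a b = case_bvar (a $ 1) (a $ 2) (b $ 1) (b $ 2)"
  by (rule ext) (simp add: bicoords_def split: bvar.split)
 thus ?thesis by (simp add: bev_def)
qed

lemma bev_simps [simp]:
 "bev s t u v (f + g) = bev s t u v f + bev s t u v g"
 "bev s t u v (f * g) = bev s t u v f * bev s t u v g"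
 "bev s t u v (f - g) = bev s t u v f - bev s t u v g"
 "bev s t u v (- f) = - bev s t u v f"
 "bev s t u v (bconst c) = c"
 "bev s t u v (bvr w) = case_bvar s t u v w"
 "bev s t u v 0 = 0" "bev s t u v 1 = 1"
 "bev s t u v (f ^ n) = bev s t u v f ^ n" unfolding bev_def eval_mpoly_eq_hom bconst_def bvr_def
 by (simp_all add: coeff_hom.mp_hom_add[OF coeff_hom_id] coeff_hom.mp_hom_mult[OF coeff_hom_id]
   coeff_hom.mp_hom_diff[OF coeff_hom_id] coeff_hom.mp_hom_uminus[OF coeff_hom_id]
   coeff_hom.mp_hom_single[OF coeff_hom_id] coeff_hom.mp_hom_0[OF coeff_hom_id]
   coeff_hom.mp_hom_1[OF coeff_hom_id] coeff_hom.mp_hom_power[OF coeff_hom_id])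

lemma bev_sum [simp]: "bev s t u v (\<Sum>i\<in>A. f i) = (\<Sum>i\<in>A. bev s t u v (f i))"
 by (simp add: bev_def eval_mpoly_sum)

lemma UNIV_bvar: "(UNIV :: bvar set) = {Var_s, Var_t, Var_u, Var_v}" using bvar.exhaust by auto

lemma mon_eval_bvar:
 "mon_eval x m = x Var_s ^ lookup m Var_s * x Var_t ^ lookup m Var_t *
  x Var_u ^ lookup m Var_u * x Var_v ^ lookup m Var_v"
proof -
 have "finite (UNIV :: bvar set)" unfolding UNIV_bvar by simp
 hence "mon_eval x m = (\<Prod>w\<in>UNIV. x w ^ lookup m w)" by (rule mon_eval_superset) simp
 thus ?thesis unfolding UNIV_bvar by (simp add: mult.assoc)
qed

lemma bev_single: "bev s t u v (single m c) =
 c * (s ^ lookup m Var_s * t ^ lookup m Var_t *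
  u ^ lookup m Var_u * v ^ lookup m Var_v)" by (simp add: bev_def eval_mpoly_single mon_eval_bvar)

lemma bvar_mon_eqI:
 assumes "lookup m Var_s = lookup n Var_s"
  "lookup m Var_t = lookup n Var_t"
  "lookup m Var_u = lookup n Var_u"
  "lookup m Var_v = lookup n Var_v"
 shows "m = n"
proof (rule poly_mapping_eqI)
 fix w show "lookup m w = lookup n w" by (cases w) (simp_all add: assms)
qed

lemma digits_inj:
 fixes a b a' b' N :: nat
 assumes "a + N * b = a' + N * b'" "a < N" "a' < N"
 shows "a = a' & b = b'"
proof -
 have "(a + N * b) mod N = a" "(a' + N * b') mod N = a'" using assms(2,3) by simp_all
 hence "a = a'" using assms(1) by metis
 thus ?thesis using assms by auto
qed

text \<open>Kronecker substitution \<open>(s, t, u, v) = (r, r\<^sup>N, \<dots>)\<close> separates the finitely many monomials of \<open>f\<close>.\<close>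

lemma bipoly_zeroI:
 fixes f :: "'k::alg_closed_field bipoly"
 assumes "!!s t u v. bev s t u v f = 0"
 shows "f = 0"
proof (rule ccontr)
 assume "f ~= 0"
 then obtain m0 where m0: "m0 \<in> keys f" by (metis keys_eq_empty ex_in_conv)
 define e where "e = (%m :: bvar \<Rightarrow>\<^sub>0 nat. lookup m)"
 define N where "N = Suc (\<Sum>m\<in>keys f. e m Var_s + e m Var_t + e m Var_u + e m Var_v)"
 define code where "code m = e m Var_s + N * (e m Var_t + N * (e m Var_u + N * e m Var_v))" for m
 have less: "e m w < N" if "m \<in> keys f" for m w
 proof -
  have "e m Var_s + e m Var_t + e m Var_u + e m Var_v \<le>
    (\<Sum>m\<in>keys f. e m Var_s + e m Var_t + e m Var_u + e m Var_v)"
   by (rule member_le_sum[OF that]) auto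
  moreover have "e m w \<le> e m Var_s + e m Var_t + e m Var_u + e m Var_v" by (cases w) auto
  ultimately show ?thesis unfolding N_def by linarith
 qed
 have inj: "m = m'" if m: "m \<in> keys f" "m' \<in> keys f" "code m = code m'" for m m'
 proof -
  note 1 = digits_inj[OF m(3)[unfolded code_def] less[OF m(1)] less[OF m(2)]]
  note 2 = digits_inj[OF conjunct2[OF 1] less[OF m(1)] less[OF m(2)]]
  note 3 = digits_inj[OF conjunct2[OF 2] less[OF m(1)] less[OF m(2)]]
  show ?thesis using 1 2 3 unfolding e_def by (intro bvar_mon_eqI) auto
 qed
 define P where "P = (\<Sum>m\<in>keys f. monom (lookup f m) (code m))"
 have "poly P r = bev r (r ^ N) (r ^ (N * N)) (r ^ (N * N * N)) f" for r
 proof -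
  have "bev r (r ^ N) (r ^ (N * N)) (r ^ (N * N * N)) f =
    (\<Sum>m\<in>keys f. bev r (r ^ N) (r ^ (N * N)) (r ^ (N * N * N))
     (single m (lookup f m)))" by (subst mpoly_eq_sum_single[of f]) (rule bev_sum)
  also have "\<dots> = poly P r" unfolding P_def poly_sum
  proof (rule sum.cong[OF refl])
   fix m
   have "r ^ code m = r ^ e m Var_s * (r ^ N) ^ e m Var_t * (r ^ (N * N)) ^ e m Var_u * (r ^ (N * N * N)) ^ e m Var_v"
    unfolding code_def power_mult[symmetric] power_add[symmetric] by (rule arg_cong[of _ _ "(^) r"]) (simp add: algebra_simps)
   thus "bev r (r ^ N) (r ^ (N * N)) (r ^ (N * N * N)) (single m (lookup f m)) =
     poly (monom (lookup f m) (code m)) r" by (simp add: bev_single poly_monom e_def)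
  qed
  finally show ?thesis by simp
 qed
 hence "P = 0" using assms by (intro poly_fun_eqI) simp
 have "coeff P (code m0) = (\<Sum>m\<in>keys f. if code m = code m0 then lookup f m else 0)"
  unfolding P_def coeff_sum by (rule sum.cong) auto
 also have "\<dots> = (\<Sum>m\<in>keys f. if m = m0 then lookup f m else 0)" using inj m0 by (intro sum.cong) auto
 also have "\<dots> = lookup f m0" using m0 by (simp add: sum.delta)
 finally show False using \<open>P = 0\<close> m0 by (simp add: in_keys_iff)
qed

lemma bipoly_eqI:
 fixes f g :: "'k::alg_closed_field bipoly"
 assumes "!!s t u v. bev s t u v f = bev s t u v g"
 shows "f = g" using bipoly_zeroI[of "f - g"] assms by simp

lemma bipoly_induct [case_names const var add]:
 fixes f :: "'k::alg_closed_field bipoly"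
 assumes const: "!!c. P (bconst c)" and var: "!!w f. P f ==> P (bvr w * f)"
  and add: "!!f g. P f ==> P g ==> P (f + g)"
 shows "P f"
proof -
 have pow: "P (bvr w ^ n * f)" if "P f" for w n f
  using that by (induction n) (simp_all add: mult.assoc var)
 have single: "P (single m c)" for m c
 proof -
  have "single m c = bvr Var_s ^ lookup m Var_s *
   (bvr Var_t ^ lookup m Var_t * (bvr Var_u ^ lookup m Var_u *
    (bvr Var_v ^ lookup m Var_v * bconst c)))" by (rule bipoly_eqI) (simp add: bev_single mult_ac)
  thus ?thesis by (simp add: pow const)
 qed
 have "P (\<Sum>m\<in>A. single m (lookup f m))" for A
 proof (induction A rule: infinite_finite_induct)
  case empty
  show ?case using const[of 0] by (simp add: bconst_def)
 next
  case (infinite A)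
  show ?case using const[of 0] infinite by (simp add: bconst_def)
 qed (simp add: add single)
 thus ?thesis using mpoly_eq_sum_single[of f] by metis
qed

lemma bev_subst [simp]:
 fixes f :: "'k::alg_closed_field bipoly"
 shows "bev s t u v (subst S T U V f) = bev (bev s t u v S) (bev s t u v T) (bev s t u v U) (bev s t u v V) f"
proof (induction f rule: bipoly_induct)
 case (const c)
 have "subst S T U V (bconst c) = bconst c"
  unfolding subst_def bconst_def[of c] coeff_hom.mp_hom_single[OF coeff_hom_bconst] by (simp add: bconst_def)
 thus ?case by simp
next
 case (var w f)
 have "subst S T U V (bvr w) = case_bvar S T U V w"
  unfolding subst_def bvr_def coeff_hom.mp_hom_single[OF coeff_hom_bconst] by (simp add: bconst_def)
 thus ?case
  using var by (cases w) (simp_all add: subst_def coeff_hom.mp_hom_mult[OF coeff_hom_bconst])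
next
 case (add f g)
 thus ?case by (simp add: subst_def coeff_hom.mp_hom_add[OF coeff_hom_bconst])
qed

lemma subst_hom:
 fixes f g :: "'k::alg_closed_field bipoly"
 shows "subst S T U V (f + g) = subst S T U V f + subst S T U V g"
  "subst S T U V (f * g) = subst S T U V f * subst S T U V g"
  "subst S T U V (bconst c) = bconst c"
  "subst S T U V (bvr w) = case_bvar S T U V w" by (rule bipoly_eqI, simp split: bvar.split)+

lemma subst_mod:
 fixes f :: "'k::alg_closed_field bipoly"
 assumes J: "ideal.subspace J" and v: "bvr Var_s - S \<in> J" "bvr Var_t - T \<in> J" "bvr Var_u - U \<in> J" "bvr Var_v - V \<in> J"
 shows "f - subst S T U V f \<in> J"
proof (induction f rule: bipoly_induct)
 case (const c)
 show ?case using ideal.subspace_0[OF J] by (simp add: subst_hom)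
next
 case (var w f)
 have "bvr w - case_bvar S T U V w \<in> J" using v by (cases w) simp_all
 hence "subst S T U V f * (bvr w - case_bvar S T U V w) \<in> J" by (rule ideal.subspace_scale[OF J])
 moreover have "bvr w * (f - subst S T U V f) \<in> J" using var by (rule ideal.subspace_scale[OF J])
 ultimately have "subst S T U V f * (bvr w - case_bvar S T U V w) + bvr w * (f - subst S T U V f) \<in> J"
  by (rule ideal.subspace_add[OF J])
 moreover have "subst S T U V f * (bvr w - case_bvar S T U V w) + bvr w * (f - subst S T U V f) =
   bvr w * f - subst S T U V (bvr w * f)" unfolding subst_hom by (simp add: algebra_simps)
 ultimately show ?case by simp
next
 case (add f g)
 have "f - subst S T U V f + (g - subst S T U V g) \<in> J" by (rule ideal.subspace_add[OF J add])
 thus ?case unfolding subst_hom by (simp add: algebra_simps)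
qed

lemma bev_poly:
 fixes f :: "'k::alg_closed_field bipoly"
 shows "\<exists>P. \<forall>r. bev (poly p1 r) (poly p2 r) (poly p3 r) (poly p4 r) f = poly P r"
proof (induction f rule: bipoly_induct)
  case (const c)
  show ?case by (rule exI[of _ "[:c:]"]) simp
 next
  case (var w f)
  then obtain P where "\<forall>r. bev (poly p1 r) (poly p2 r) (poly p3 r) (poly p4 r) f = poly P r" by blast
  thus ?case by (intro exI[of _ "case_bvar p1 p2 p3 p4 w * P"]) (simp split: bvar.split)
 next
  case (add f g)
  thus ?case by (metis bev_simps(1) poly_add)
qed

text \<open>Interpolate linearly between a point where \<open>f\<close> is nonzero and one where
  \<open>g\<close> is nonzero; on this line both become nonzero univariate polynomials.\<close>

lemma bipoly_mult_eq_0: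
 fixes f g :: "'k::alg_closed_field bipoly"
 assumes "f * g = 0"
 shows "f = 0 | g = 0"
proof (rule ccontr)
 assume "\<not> ?thesis"
 then obtain s t u v s' t' u' v' where f: "bev s t u v f ~= 0" and g: "bev s' t' u' v' g ~= 0"
  using bipoly_zeroI by metis
 define p where "p = (%a b :: 'k. [:a, b - a:])"
 obtain P where P: "\<forall>r. bev (poly (p s s') r) (poly (p t t') r) (poly (p u u') r) (poly (p v v') r) f = poly P r"
  using bev_poly[of "p s s'" "p t t'" "p u u'" "p v v'" f] by blast
 obtain Q where Q: "\<forall>r. bev (poly (p s s') r) (poly (p t t') r) (poly (p u u') r) (poly (p v v') r) g = poly Q r"
  using bev_poly[of "p s s'" "p t t'" "p u u'" "p v v'" g] by blast
 have "poly P 0 ~= 0" "poly Q 1 ~= 0" using f g P[rule_format, of 0] Q[rule_format, of 1] by (simp_all add: p_def)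
 hence "P * Q ~= 0" by auto
 then obtain r where "poly (P * Q) r ~= 0" using poly_fun_eqI[of "P * Q" 0] by auto
 moreover have "poly (P * Q) r = bev (poly (p s s') r) (poly (p t t') r) (poly (p u u') r) (poly (p v v') r) (f * g)"
  by (simp add: P Q)
 ultimately show False using assms by simp
qed

lemma bform_bev:
 assumes "f \<in> bigraded_piece a b"
 shows "bform a b (%(s, t, u, v). bev s t u v f)"
proof -
 have eq: "(%(s, t, u, v). bev s t u v f) = (%x. \<Sum>m\<in>keys f. lookup f m *
   bmon a b (lookup m Var_s, lookup m Var_u) x)"
 proof (rule ext, clarify)
  fix s t u v
  have "bev s t u v f = (\<Sum>m\<in>keys f. bev s t u v (single m (lookup f m)))"
   by (subst mpoly_eq_sum_single[of f]) (rule bev_sum)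
  also have "\<dots> = (\<Sum>m\<in>keys f. lookup f m *
   bmon a b (lookup m Var_s, lookup m Var_u) (s, t, u, v))"
  proof (rule sum.cong[OF refl])
   fix m assume "m \<in> keys f"
   hence "bidegree m = (a, b)" using assms by (simp add: bigraded_piece_def)
   hence "a - lookup m Var_s = lookup m Var_t"
    "b - lookup m Var_u = lookup m Var_v" by (auto simp: bidegree_def)
   thus "bev s t u v (single m (lookup f m)) = lookup f m *
    bmon a b (lookup m Var_s, lookup m Var_u) (s, t, u, v)" by (simp add: bev_single bmon_def)
  qed
  finally show "bev s t u v f = (\<Sum>m\<in>keys f. lookup f m *
   bmon a b (lookup m Var_s, lookup m Var_u) (s, t, u, v))" .
 qed
 show ?thesis unfolding eq
  using assms by (intro bform_sum bform_smult bform_bmon) (auto simp: bigraded_piece_def bidegree_def)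
qed

section \<open>Coefficients of forms of small bidegree\<close>

lemma exI2: "P a b ==> \<exists>a b. P a b" by blast
lemma exI3: "P a b c ==> \<exists>a b c. P a b c" by blast

lemma bform_21:
 assumes "bform 2 1 f"
 obtains a b where "!!s t u v. f (s, t, u, v) = qf a s t * u + qf b s t * v"
proof -
 have "\<exists>a b. \<forall>s t u v. f (s, t, u, v) = qf a s t * u + qf b s t * v" using assms
 proof (induction rule: bform_induct)
  case zero
  show ?case by (intro exI[of _ 0]) simp
 next
  case (step c i j g)
  then obtain a b where ab: "g (s, t, u, v) = qf a s t * u + qf b s t * v" for s t u v by blast
  have i: "i = 0 | i = 1 | i = 2" using step(1) by linarith
  define d :: "'a^3" where "d = (if i = 0 then vector [0, 0, 1] else if i = 1 then vector [0, 1, 0] else vector [1, 0, 0])"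
  have d: "qf d s t = s ^ i * t ^ (2 - i)" for s t using i by (auto simp: d_def qf_def power2_eq_square)
  have "j = 0 | j = 1" using step(2) by linarith
  thus ?case
  proof
   assume "j = 0"
   thus ?thesis by (intro exI2[of _ a "b + c *s d"] allI) (simp add: bmon_def ab d power2_eq_square, (simp only: distrib_right distrib_left ac_simps)?)
  next
   assume "j = 1"
   thus ?thesis by (intro exI2[of _ "a + c *s d" b] allI) (simp add: bmon_def ab d power2_eq_square, (simp only: distrib_right distrib_left ac_simps)?)
  qed
 qed
 thus ?thesis using that by blast
qed

lemma bform_01:
 assumes "bform 0 1 f"
 obtains a b where "!!s t u v. f (s, t, u, v) = a * u + b * v"
proof -
 have "\<exists>a b. \<forall>s t u v. f (s, t, u, v) = a * u + b * v" using assms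
 proof (induction rule: bform_induct)
  case zero
  show ?case by (intro exI[of _ 0]) simp
 next
  case (step c i j g)
  then obtain a b where ab: "g (s, t, u, v) = a * u + b * v" for s t u v by blast
  have "j = 0 | j = 1" using step(2) by linarith
  thus ?case
  proof
   assume "j = 0"
   thus ?thesis using step(1,2) by (intro exI2[of _ a "b + c"] allI) (simp add: bmon_def ab power2_eq_square, (simp only: distrib_right distrib_left ac_simps)?)
  next
   assume "j = 1"
   thus ?thesis using step(1,2) by (intro exI2[of _ "a + c" b] allI) (simp add: bmon_def ab power2_eq_square, (simp only: distrib_right distrib_left ac_simps)?)
  qed
 qed
 thus ?thesis using that by blast
qed

lemma bform_10:
 assumes "bform 1 0 f"
 obtains a b where "!!s t u v. f (s, t, u, v) = a * s + b * t"
proof -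
 have "\<exists>a b. \<forall>s t u v. f (s, t, u, v) = a * s + b * t" using assms
 proof (induction rule: bform_induct)
  case zero
  show ?case by (intro exI[of _ 0]) simp
 next
  case (step c i j g)
  then obtain a b where ab: "g (s, t, u, v) = a * s + b * t" for s t u v by blast
  have "i = 0 | i = 1" using step(1) by linarith
  thus ?case
  proof
   assume "i = 0"
   thus ?thesis using step(1,2) by (intro exI2[of _ a "b + c"] allI) (simp add: bmon_def ab power2_eq_square, (simp only: distrib_right distrib_left ac_simps)?)
  next
   assume "i = 1"
   thus ?thesis using step(1,2) by (intro exI2[of _ "a + c" b] allI) (simp add: bmon_def ab power2_eq_square, (simp only: distrib_right distrib_left ac_simps)?)
  qed
 qed
 thus ?thesis using that by blast
qed

lemma bform_02:
 assumes "bform 0 2 f"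
 obtains a b c where "!!s t u v. f (s, t, u, v) = a * (u * u) + b * (u * v) + c * (v * v)"
proof -
 have "\<exists>a b c. \<forall>s t u v. f (s, t, u, v) = a * (u * u) + b * (u * v) + c * (v * v)" using assms
 proof (induction rule: bform_induct)
  case zero
  show ?case by (intro exI[of _ 0]) simp
 next
  case (step r i j g)
  then obtain a b c where ab: "g (s, t, u, v) = a * (u * u) + b * (u * v) + c * (v * v)" for s t u v by blast
  have "j = 0 | j = 1 | j = 2" using step(2) by linarith
  thus ?case
  proof (elim disjE)
   assume "j = 0"
   thus ?thesis using step(1,2) by (intro exI3[of _ a b "c + r"] allI) (simp add: bmon_def ab power2_eq_square, (simp only: distrib_right distrib_left ac_simps)?)
  next
   assume "j = 1"
   thus ?thesis using step(1,2) by (intro exI3[of _ a "b + r" c] allI) (simp add: bmon_def ab power2_eq_square, (simp only: distrib_right distrib_left ac_simps)?)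
  next
   assume "j = 2"
   thus ?thesis using step(1,2) by (intro exI3[of _ "a + r" b c] allI) (simp add: bmon_def ab power2_eq_square, (simp only: distrib_right distrib_left ac_simps)?)
  qed
 qed
 thus ?thesis using that by blast
qed

section \<open>The ideal generated by a space of forms\<close>

text \<open>Formulated through values because values determine elements of the ring. A change of
  basis of \<open>U\<close> is then just a matrix applied to \<open>Phi\<close>.\<close>

definition form_ideal :: "('k quad => 'k^4) => 'k::field bipoly set" where
 "form_ideal Phi = {x. \<exists>h :: 4 => 'k bipoly. \<forall>s t u v.
  bev s t u v x = (\<Sum>i\<in>UNIV. bev s t u v (h i) * Phi (s, t, u, v) $ i)}"

lemma form_ideal_subspace: "ideal.subspace (form_ideal Phi)"
proof (rule ideal.subspaceI)
 show "0 \<in> form_ideal Phi" unfolding form_ideal_def by (auto intro!: exI[of _ "%_. 0"])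
 show "x + y \<in> form_ideal Phi" if xy: "x \<in> form_ideal Phi" "y \<in> form_ideal Phi" for x y
 proof -
  obtain h h' where "\<forall>s t u v. bev s t u v x = (\<Sum>i\<in>UNIV. bev s t u v (h i) * Phi (s, t, u, v) $ i)"
   "\<forall>s t u v. bev s t u v y = (\<Sum>i\<in>UNIV. bev s t u v (h' i) * Phi (s, t, u, v) $ i)"
   using xy unfolding form_ideal_def by blast
  thus ?thesis unfolding form_ideal_def
   by (intro CollectI exI[of _ "%i. h i + h' i"]) (simp add: distrib_right sum.distrib)
 qed
 show "c * x \<in> form_ideal Phi" if x: "x \<in> form_ideal Phi" for c x
 proof -
  obtain h where "\<forall>s t u v. bev s t u v x = (\<Sum>i\<in>UNIV. bev s t u v (h i) * Phi (s, t, u, v) $ i)"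
   using x unfolding form_ideal_def by blast
  thus ?thesis unfolding form_ideal_def
   by (intro CollectI exI[of _ "%i. c * h i"]) (simp add: sum_distrib_left mult.assoc)
 qed
qed

lemma form_idealI4:
 assumes "!!s t u v. bev s t u v x = bev s t u v h1 * Phi (s, t, u, v) $ 1 + bev s t u v h2 * Phi (s, t, u, v) $ 2 +
  bev s t u v h3 * Phi (s, t, u, v) $ 3 + bev s t u v h4 * Phi (s, t, u, v) $ 4"
 shows "x \<in> form_ideal Phi"
proof -
 define h where "h = (%i :: 4. if i = 1 then h1 else if i = 2 then h2 else if i = 3 then h3 else h4)"
 have "bev s t u v x = (\<Sum>i\<in>UNIV. bev s t u v (h i) * Phi (s, t, u, v) $ i)" for s t u v
  unfolding sum_4 assms by (simp add: h_def)
 thus ?thesis unfolding form_ideal_def by blast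
qed

lemma form_ideal_matrix_subset:
 assumes "!!p. Psi p = M *v Phi p"
 shows "form_ideal Psi \<subseteq> form_ideal Phi"
proof
 fix x assume "x \<in> form_ideal Psi"
 then obtain h where h: "!!s t u v. bev s t u v x = (\<Sum>i\<in>UNIV. bev s t u v (h i) * Psi (s, t, u, v) $ i)"
  unfolding form_ideal_def by blast
 have "bev s t u v x = (\<Sum>j\<in>UNIV. bev s t u v (\<Sum>i\<in>UNIV. h i * bconst (M $ i $ j)) * Phi (s, t, u, v) $ j)" for s t u v
 proof -
  have "bev s t u v x = (\<Sum>i\<in>UNIV. \<Sum>j\<in>UNIV. bev s t u v (h i) * (M $ i $ j * Phi (s, t, u, v) $ j))"
   unfolding h assms by (simp add: matrix_vector_mult_def sum_distrib_left)
  also have "\<dots> = (\<Sum>j\<in>UNIV. \<Sum>i\<in>UNIV. bev s t u v (h i) * (M $ i $ j * Phi (s, t, u, v) $ j))"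
   by (rule sum.swap)
  also have "\<dots> = (\<Sum>j\<in>UNIV. bev s t u v (\<Sum>i\<in>UNIV. h i * bconst (M $ i $ j)) * Phi (s, t, u, v) $ j)"
   by (simp add: sum_distrib_right mult.assoc)
  finally show ?thesis .
 qed
 thus "x \<in> form_ideal Phi" unfolding form_ideal_def
  by (intro CollectI exI[of _ "%j. \<Sum>i\<in>UNIV. h i * bconst (M $ i $ j)"] allI)
qed

lemma form_ideal_matrix:
 assumes M: "inverse_pair N M" and "!!p. Psi p = M *v Phi p"
 shows "form_ideal Psi = form_ideal Phi"
proof
 show "form_ideal Psi \<subseteq> form_ideal Phi" by (rule form_ideal_matrix_subset) fact
 have "Phi p = N *v Psi p" for p using assms by simp
 thus "form_ideal Phi \<subseteq> form_ideal Psi" by (rule form_ideal_matrix_subset)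
qed

lemma linear_form_root_multiple:
 fixes l m :: "'k::field^2"
 assumes "l ~= 0" "l $ 1 * m $ 2 = l $ 2 * m $ 1"
 obtains c where "m = c *s l"
proof (cases "l $ 1 = 0")
 case True
 hence "l $ 2 ~= 0" "m $ 1 = 0" using assms by (auto simp: vec_eq_iff forall_2)
 hence "m = (m $ 2 / l $ 2) *s l" using True by (simp add: vec_eq_iff forall_2)
 thus ?thesis by (rule that)
next
 case False
 hence "m = (m $ 1 / l $ 1) *s l" using assms(2) by (simp add: vec_eq_iff forall_2 field_simps)
 thus ?thesis by (rule that)
qed

text \<open>The matrix with rows (l1, l2) and (l3, l4) is singular. If \<open>l1\<close> is nonzero
  it divides the product of \<open>l2\<close> and \<open>l3\<close>, hence is proportional to one of
  them: columns or rows are dependent.\<close>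

lemma lmul_eq_proportional:
 fixes l1 l2 l3 l4 :: "'k::field^2"
 assumes "lmul l1 l4 = lmul l2 l3"
 obtains (rows) a b where "nz a b" "a *s l1 + b *s l3 = 0" "a *s l2 + b *s l4 = 0"
 | (columns) a b l m where "nz a b" "l1 = a *s l" "l2 = b *s l" "l3 = a *s m" "l4 = b *s m"
proof (cases "l1 = 0")
 case True
 hence "lmul l2 l3 = 0" using assms by (simp add: lmul_commute[of 0])
 hence "l2 = 0 | l3 = 0" by (rule lmul_cancel)
 thus ?thesis
 proof
  assume "l2 = 0"
  thus ?thesis using rows[of 1 0] True by simp
 next
  assume "l3 = 0"
  thus ?thesis using columns[of 0 1 l2 l4] True by simp
 qed
next
 case False
 have "lf l2 (- l1 $ 2) (l1 $ 1) * lf l3 (- l1 $ 2) (l1 $ 1) = 0"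
  unfolding qf_lmul[symmetric] assms[symmetric] by (simp add: lf_def)
 hence "l1 $ 1 * l2 $ 2 = l1 $ 2 * l2 $ 1 | l1 $ 1 * l3 $ 2 = l1 $ 2 * l3 $ 1"
  by (simp only: mult_eq_0_iff lf_def) (simp add: mult.commute add_eq_0_iff2 add.commute)
 thus ?thesis
 proof
  assume "l1 $ 1 * l2 $ 2 = l1 $ 2 * l2 $ 1"
  then obtain c where c: "l2 = c *s l1" using False linear_form_root_multiple by metis
  have "lmul l1 (1 *s l4 + (- c) *s l3) = 1 *s lmul l1 l4 + (- c) *s lmul l1 l3" by (rule lmul_linear)
  also have "\<dots> = 0" unfolding assms c using lmul_linear[of l3 c l1 0 0] by (simp add: lmul_commute[of _ l3])
  finally have "l4 = c *s l3" using lmul_cancel[of l1] False by fastforce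
  thus ?thesis using columns[of 1 c l1 l3] c by simp
 next
  assume "l1 $ 1 * l3 $ 2 = l1 $ 2 * l3 $ 1"
  then obtain c where c: "l3 = c *s l1" using False linear_form_root_multiple by metis
  have "lmul l1 (1 *s l4 + (- c) *s l2) = 1 *s lmul l1 l4 + (- c) *s lmul l1 l2" by (rule lmul_linear)
  also have "\<dots> = 0" unfolding assms c using lmul_linear[of l2 c l1 0 0] by (simp add: lmul_commute[of _ l2])
  finally have "l4 = c *s l2" using lmul_cancel[of l1] False by fastforce
  thus ?thesis using rows[of "- c" 1] c by simp
 qed
qed

section \<open>Consequences of missing and of unique syzygies\<close>

context form_space
begin

text \<open>
 Without syzygies of bidegree (1,0) the eight products of \<open>s, t\<close> with a basis of \<open>U\<close> are a basis
 of the eight-dimensional space of forms of bidegree (3,1).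
\<close>

lemma cubics_in_ideal:
 fixes a b :: "'k^4"
 assumes no10: "!!c d. syz10 c d ==> c = 0"
  and x: "!!s t u v. bev s t u v x = (a $ 1 * (s * s * s) + a $ 2 * (s * s * t) + a $ 3 * (s * t * t) + a $ 4 * (t * t * t)) * u +
   (b $ 1 * (s * s * s) + b $ 2 * (s * s * t) + b $ 3 * (s * t * t) + b $ 4 * (t * t * t)) * (v :: 'k)"
 shows "x \<in> form_ideal Phi"
proof -
 define L :: "'k^3 => 'k^3 => 'k^4" where "L p r = vector [p $ 1, p $ 2 + r $ 1, p $ 3 + r $ 2, r $ 3]" for p r
 have L: "L p r $ 1 * (s * s * s) + L p r $ 2 * (s * s * t) + L p r $ 3 * (s * t * t) + L p r $ 4 * (t * t * t) =
   s * qf p s t + t * qf r s t" for p r s t by (simp add: L_def qf_def algebra_simps)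
 define c :: "'k^(4 + 4) => 'k^4" where "c w = (\<chi> j. w $ Inl j)" for w
 define d :: "'k^(4 + 4) => 'k^4" where "d w = (\<chi> j. w $ Inr j)" for w
 define f :: "'k^(4 + 4) => 'k^(4 + 4)" where
  "f w = (\<chi> m. case m of Inl j => L (c w v* A) (d w v* A) $ j | Inr j => L (c w v* B) (d w v* B) $ j)" for w
 have lin: "c (w + w') = c w + c w'" "c (r *s w) = r *s c w" "d (w + w') = d w + d w'" "d (r *s w) = r *s d w" for w w' r
  by (simp_all add: c_def d_def vec_eq_iff)
 have sc: "(r *s e) v* M = r *s (e v* M)" for r e and M :: "'k^3^4"
  by (simp add: vector_matrix_mult_def vec_eq_iff sum_4 algebra_simps)
 have Llin: "L (p + p') (r + r') = L p r + L p' r'" "L (e *s p) (e *s r) = e *s L p r" for p p' r r' e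
  by (simp_all add: L_def vec4_eq_iff algebra_simps)
 have flin: "Vector_Spaces.linear (*s) (*s) f" unfolding Vector_Spaces.linear_iff
  by (intro conjI allI vec.vector_space_axioms)
   (auto simp: f_def vec_eq_iff lin vector_matrix_left_distrib sc Llin split: sum.split)
 \<comment> \<open>A kernel vector is a syzygy of bidegree (1,0). Since source and target both have
   dimension eight, injectivity gives surjectivity.\<close>
 have "w = 0" if "f w = 0" for w
 proof -
  have z: "L (c w v* A) (d w v* A) = 0" "L (c w v* B) (d w v* B) = 0"
  proof -
   have "f w $ Inl j = 0" "f w $ Inr j = 0" for j using that by simp_all
   thus "L (c w v* A) (d w v* A) = 0" "L (c w v* B) (d w v* B) = 0" by (simp_all add: f_def vec_eq_iff)
  qed
  have form: "p = vector [0, - r $ 1, - r $ 2] & r = - vector [- r $ 1, - r $ 2, 0]" if "L p r = 0" for p r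
  proof -
   have "p $ 1 = 0" "p $ 2 + r $ 1 = 0" "p $ 3 + r $ 2 = 0" "r $ 3 = 0"
    using that by (simp_all add: L_def vec4_eq_iff)
   thus ?thesis by (simp add: vec3_eq_iff eq_neg_iff_add_eq_0)
  qed
  define g :: "'k^2" where "g = vector [- (d w v* A) $ 1, - (d w v* A) $ 2]"
  define h :: "'k^2" where "h = vector [- (d w v* B) $ 1, - (d w v* B) $ 2]"
  have eq: "c w v* A = vector [0, g $ 1, g $ 2]" "d w v* A = - vector [g $ 1, g $ 2, 0]"
   "c w v* B = vector [0, h $ 1, h $ 2]" "d w v* B = - vector [h $ 1, h $ 2, 0]"
   using form[OF z(1)] form[OF z(2)] by (simp_all add: g_def h_def)
  have "syz10 (c w) (d w)" unfolding syz10_def is_coord_def using eq by blast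
  hence c0: "c w = 0" by (rule no10)
  hence "g $ 1 = 0 & g $ 2 = 0" "h $ 1 = 0 & h $ 2 = 0" using eq(1,3) by (simp_all add: vec3_eq_iff)
  hence "d w v* A = 0" "d w v* B = 0" using eq(2,4) by (simp_all add: vec3_eq_iff)
  hence "d w = 0" by (rule nondeg)
  hence "w $ m = 0" for m using c0 by (cases m) (auto simp: c_def d_def vec_eq_iff)
  thus "w = 0" by (simp add: vec_eq_iff)
 qed
 hence "inj f" using vec.linear_inj_iff_eq_0[OF flin] by blast
 hence "surj f" by (rule vec.linear_inj_imp_surj[OF flin])
 define g :: "'k^(4 + 4)" where "g = (\<chi> m. case m of Inl j => a $ j | Inr j => b $ j)"
 obtain w where "f w = g" using \<open>surj f\<close> by (metis surjD)
 hence "f w $ Inl j = a $ j" "f w $ Inr j = b $ j" for j by (simp_all add: g_def)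
 hence ab: "a = L (c w v* A) (d w v* A)" "b = L (c w v* B) (d w v* B)" by (simp_all add: f_def vec_eq_iff)
 have "bev s t u v x = (\<Sum>i\<in>UNIV. bev s t u v (bconst (c w $ i) * bvr Var_s + bconst (d w $ i) * bvr Var_t) * Phi (s, t, u, v) $ i)" for s t u v
 proof -
  have "bev s t u v x = s * vdot (c w) (Phi (s, t, u, v)) + t * vdot (d w) (Phi (s, t, u, v))"
   unfolding x ab L vdot_Phi[OF is_coord_self] by (simp add: algebra_simps)
  thus ?thesis by (simp add: sum_4 vdot_def algebra_simps)
 qed
 thus ?thesis unfolding form_ideal_def
  by (intro CollectI exI[of _ "%i. bconst (c w $ i) * bvr Var_s + bconst (d w $ i) * bvr Var_t"] allI)
qed

text \<open>If the discriminant vanished identically, there would be a second syzygy of bidegree (0,1).\<close>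

lemma one_syz01:
 assumes syz: "syz01 c d" and nz: "nz c d"
  and uniq: "!!c' d'. syz01 c' d' ==> \<exists>a. c' = a *s c"
 obtains q y z l1 l2 l3 l4 k N M where "indep3 q y z" "pencil_form q y z l1 l2 l3 l4 k"
  "inverse_pair N M" "!!p. pencil_form.Phi q y z l1 l2 l3 l4 p = M *v Phi p"
  "surf Phi = (*v) N ` surf (pencil_form.Phi q y z l1 l2 l3 l4)"
  "lmul l1 l4 ~= lmul l2 l3"
proof -
 obtain q where q: "is_coord c 0 q" "is_coord d (- q) 0" using syz unfolding syz01_def by blast
 have q': "is_coord (- d) q 0" using is_coord_uminus[OF q(2)] by simp
 have qnz: "q ~= 0" using nz q is_coord_0D by fastforce
 obtain y z where qyz: "indep3 q y z" using indep3_complete[OF qnz] .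
 have qyz0: "a = 0 & b = 0 & c = 0" if "a *s q + b *s y + c *s z = 0" for a b c
  using qyz that unfolding indep3_def by blast
 obtain k where k: "conic_through q y z k" using conic_exists[OF qyz] .
 have ind2: "a = 0 & b = 0" if zero: "a *s (- d) + b *s c = 0" for a b
 proof -
  have "is_coord (a *s (- d) + b *s c) (a *s q + b *s 0) (a *s 0 + b *s q)" by (intro is_coord_intros q q')
  hence "a *s q = 0" "b *s q = 0" unfolding zero by (simp_all add: is_coord_def)
  thus ?thesis using qnz by (simp add: vec.scale_eq_0_iff)
 qed
 obtain e f where ef: "indep4 (- d) c e f" using indep4_extend2[of "- d" c] ind2 by metis
 \<comment> \<open>Subtracting multiples of q u and q v removes \<open>q\<close> from both parts of
   any element of \<open>U\<close>.\<close>
 have red: "\<exists>x1 x2 (l :: 'k^2) (m :: 'k^2). is_coord (w + (x1 *s (- d) + x2 *s c)) (l $ 1 *s y + m $ 1 *s z) (l $ 2 *s y + m $ 2 *s z)"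
  for w
 proof -
  obtain f1 f2 f3 where f: "w v* A = f1 *s q + f2 *s y + f3 *s z" using indep3_span[OF qyz] by blast
  obtain g1 g2 g3 where g: "w v* B = g1 *s q + g2 *s y + g3 *s z" using indep3_span[OF qyz] by blast
  have "is_coord (w + ((- f1) *s (- d) + (- g1) *s c)) (w v* A + ((- f1) *s q + (- g1) *s 0))
   (w v* B + ((- f1) *s 0 + (- g1) *s q))" by (intro is_coord_intros q q')
  moreover have "w v* A + ((- f1) *s q + (- g1) *s 0) = f2 *s y + f3 *s z"
   "w v* B + ((- f1) *s 0 + (- g1) *s q) = g2 *s y + g3 *s z" unfolding f g by simp_all
  ultimately have "is_coord (w + ((- f1) *s (- d) + (- g1) *s c))
    ((vector [f2, g2] :: 'k^2) $ 1 *s y + (vector [f3, g3] :: 'k^2) $ 1 *s z)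
    ((vector [f2, g2] :: 'k^2) $ 2 *s y + (vector [f3, g3] :: 'k^2) $ 2 *s z)" by simp
  thus ?thesis by blast
 qed
 obtain x1 x2 and l1 l2 :: "'k^2" where e: "is_coord (e + (x1 *s (- d) + x2 *s c)) (l1 $ 1 *s y + l2 $ 1 *s z) (l1 $ 2 *s y + l2 $ 2 *s z)"
  using red by blast
 obtain y1 y2 and l3 l4 :: "'k^2" where f: "is_coord (f + (y1 *s (- d) + y2 *s c)) (l3 $ 1 *s y + l4 $ 1 *s z) (l3 $ 2 *s y + l4 $ 2 *s z)"
  using red by blast
 define e' where "e' = e + (x1 *s (- d) + x2 *s c)"
 define f' where "f' = f + (y1 *s (- d) + y2 *s c)"
 note e = e[folded e'_def] and f = f[folded f'_def]
 have ind4: "indep4 (- d) c e' f'" unfolding indep4_def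
 proof (intro allI impI)
  fix p1 p2 p3 p4 assume "p1 *s (- d) + p2 *s c + p3 *s e' + p4 *s f' = 0"
  hence "(p1 + p3 * x1 + p4 * y1) *s (- d) + (p2 + p3 * x2 + p4 * y2) *s c + p3 *s e + p4 *s f = 0"
   unfolding e'_def f'_def by (simp add: vec_eq_iff algebra_simps)
  hence "p1 + p3 * x1 + p4 * y1 = 0" "p2 + p3 * x2 + p4 * y2 = 0" "p3 = 0" "p4 = 0"
   using ef unfolding indep4_def by blast+
  thus "p1 = 0 & p2 = 0 & p3 = 0 & p4 = 0" by simp
 qed
 have val1: "vdot (- d) (Phi (s, t, u, v)) = qf q s t * u" "vdot c (Phi (s, t, u, v)) = qf q s t * v" for s t u v
  unfolding vdot_Phi[OF q'] vdot_Phi[OF q(1)] by simp_all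
 have val2: "vdot e' (Phi (s, t, u, v)) = qf y s t * lf l1 u v + qf z s t * lf l2 u v"
  "vdot f' (Phi (s, t, u, v)) = qf y s t * lf l3 u v + qf z s t * lf l4 u v" for s t u v
  unfolding vdot_Phi[OF e] vdot_Phi[OF f] by (simp_all add: lf_def algebra_simps)
 note val = val1 val2
 interpret Q: pencil_form q y z l1 l2 l3 l4 k
 proof
  show "conic_through q y z k" "q ~= 0" by fact+
  fix s t u v
  assume "qf q s t * u = 0" "qf q s t * v = 0" "qf y s t * lf l1 u v + qf z s t * lf l2 u v = 0"
   "qf y s t * lf l3 u v + qf z s t * lf l4 u v = 0"
  thus "(s = 0 & t = 0) | (u = 0 & v = 0)" using common_zero[OF ind4, of s t u v] by (simp add: val)
 qed
 obtain N where N: "inverse_pair N (vector [- d, c, e', f'])" using indep4_inverse_pair[OF ind4] .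
 have eq: "Q.Phi p = vector [- d, c, e', f'] *v Phi p" for p
 proof -
  obtain s t u v where "p = (s, t, u, v)" by (cases p) auto
  moreover have "vector [- d, c, e', f'] *v w = (vector [vdot (- d) w, vdot c w, vdot e' w, vdot f' w] :: 'k^4)" for w
   by (simp add: vec4_eq_iff matrix_vector_mult_def sum_4 vdot_def)
  ultimately show ?thesis by (simp add: val Q.Phi_def)
 qed
 have surf: "surf Phi = (*v) N ` surf Q.Phi"
 proof (rule surf_reparam[OF N])
  fix s t u v :: 'k assume "(s, t, u, v) \<in> param_dom"
  moreover have "Phi (s, t, u, v) = N *v Q.Phi (s, t, u, v)" unfolding eq using N by simp
  ultimately show "\<exists>x\<in>param_dom. Phi (s, t, u, v) = N *v Q.Phi x"
   "\<exists>x\<in>param_dom. Phi x = N *v Q.Phi (s, t, u, v)" by blast+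
 qed
 have disc: "lmul l1 l4 ~= lmul l2 l3"
 proof
  assume "lmul l1 l4 = lmul l2 l3"
  thus False
  proof (cases rule: lmul_eq_proportional)
   case (rows a b)
   have "is_coord (a *s e' + b *s f') (a *s (l1 $ 1 *s y + l2 $ 1 *s z) + b *s (l3 $ 1 *s y + l4 $ 1 *s z))
    (a *s (l1 $ 2 *s y + l2 $ 2 *s z) + b *s (l3 $ 2 *s y + l4 $ 2 *s z))"
    by (intro is_coord_intros e f)
   moreover have "a *s (l1 $ i *s y + l2 $ i *s z) + b *s (l3 $ i *s y + l4 $ i *s z) = 0" for i
   proof -
    have "a *s (l1 $ i *s y + l2 $ i *s z) + b *s (l3 $ i *s y + l4 $ i *s z) =
     (a *s l1 + b *s l3) $ i *s y + (a *s l2 + b *s l4) $ i *s z"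
     by (simp add: vec_eq_iff algebra_simps)
    thus ?thesis using rows by simp
   qed
   ultimately have "a *s e' + b *s f' = 0" using is_coord_0D by blast
   hence "0 *s (- d) + 0 *s c + a *s e' + b *s f' = 0" by simp
   thus False using ind4 rows(1) unfolding indep4_def by blast
  next
   \<comment> \<open>Now \<open>e'\<close> and \<open>f'\<close> are w l and w m with independent
     linear forms \<open>l\<close>, \<open>m\<close>, so w u and w v belong to \<open>U\<close>.
     That is a second (0,1) syzygy, as \<open>w\<close> is not a multiple of
     \<open>q\<close>.\<close>
   case (columns a b l m)
   define w where "w = a *s y + b *s z"
   have wl: "l1 $ i *s y + l2 $ i *s z = l $ i *s w" "l3 $ i *s y + l4 $ i *s z = m $ i *s w" for i
    unfolding w_def columns(2-) by (simp_all add: vec_eq_iff algebra_simps)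
   note e1 = e[unfolded wl] and f1 = f[unfolded wl]
   have wnz: "w ~= 0"
   proof
    assume "w = 0"
    hence "0 *s q + a *s y + b *s z = 0" by (simp add: w_def)
    thus False using qyz0 columns(1) by blast
   qed
   have "l $ 1 * m $ 2 - m $ 1 * l $ 2 ~= 0"
   proof
    assume "l $ 1 * m $ 2 - m $ 1 * l $ 2 = 0"
    hence "l $ 1 * m $ 2 = m $ 1 * l $ 2" by simp
    then obtain x y where xy: "nz x y" "l $ 1 * x + m $ 1 * y = 0" "l $ 2 * x + m $ 2 * y = 0"
     by (rule singular_linear_pair[of "l $ 1" "m $ 2" "m $ 1" "l $ 2"])
    have "is_coord (x *s e' + y *s f') (x *s (l $ 1 *s w) + y *s (m $ 1 *s w)) (x *s (l $ 2 *s w) + y *s (m $ 2 *s w))"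
     by (intro is_coord_intros e1 f1)
    moreover have "x *s (l $ i *s w) + y *s (m $ i *s w) = (l $ i * x + m $ i * y) *s w" for i
     by (simp add: vec_eq_iff algebra_simps)
    ultimately have "is_coord (x *s e' + y *s f') ((l $ 1 * x + m $ 1 * y) *s w) ((l $ 2 * x + m $ 2 * y) *s w)"
     by (simp only:)
    hence "x *s e' + y *s f' = 0" unfolding xy(2,3) by (simp add: is_coord_0_iff)
    hence "0 *s (- d) + 0 *s c + x *s e' + y *s f' = 0" by simp
    thus False using ind4 xy(1) unfolding indep4_def by blast
   qed
   note det = this
   obtain x1 x2 where x: "l $ 1 * x1 + m $ 1 * x2 = 0" "l $ 2 * x1 + m $ 2 * x2 = 1" by (rule solve_2x2[OF det])
   obtain x3 x4 where x': "l $ 1 * x3 + m $ 1 * x4 = - 1" "l $ 2 * x3 + m $ 2 * x4 = 0" by (rule solve_2x2[OF det])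
   have comb: "is_coord (r1 *s e' + r2 *s f') ((l $ 1 * r1 + m $ 1 * r2) *s w) ((l $ 2 * r1 + m $ 2 * r2) *s w)" for r1 r2
   proof -
    have "is_coord (r1 *s e' + r2 *s f') (r1 *s (l $ 1 *s w) + r2 *s (m $ 1 *s w)) (r1 *s (l $ 2 *s w) + r2 *s (m $ 2 *s w))"
     by (intro is_coord_intros e1 f1)
    moreover have "r1 *s (l $ i *s w) + r2 *s (m $ i *s w) = (l $ i * r1 + m $ i * r2) *s w" for i
     by (simp add: vec_eq_iff algebra_simps)
    ultimately show ?thesis by simp
   qed
   have s1: "is_coord (x1 *s e' + x2 *s f') 0 w" using comb[of x1 x2] x by simp
   have "is_coord (x3 *s e' + x4 *s f') (- w) 0" using comb[of x3 x4] x' by simp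
   hence "syz01 (x1 *s e' + x2 *s f') (x3 *s e' + x4 *s f')" using s1 unfolding syz01_def by blast
   then obtain r where r: "x1 *s e' + x2 *s f' = r *s c" using uniq by blast
   have "is_coord (r *s c) (r *s 0) (r *s q)" by (intro is_coord_intros q)
   hence "r *s q = w" using s1 unfolding r by (simp add: is_coord_def)
   hence "(- r) *s q + a *s y + b *s z = 0" unfolding w_def by simp
   thus False using qyz0 columns(1) by blast
  qed
 qed
 show ?thesis by (rule that[OF qyz Q.pencil_form_axioms N eq surf disc])
qed

end

section \<open>Embedded primes\<close>

abbreviation "bS \<equiv> bvr Var_s"
abbreviation "bT \<equiv> bvr Var_t"
abbreviation "bU \<equiv> bvr Var_u"
abbreviation "bV \<equiv> bvr Var_v"

definition bqf :: "'k::field^3 => 'k bipoly" where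
 "bqf a = bconst (a $ 1) * (bS * bS) + bconst (a $ 2) * (bS * bT) + bconst (a $ 3) * (bT * bT)"

definition blf :: "'k::field^2 => 'k bipoly" where
 "blf l = bconst (l $ 1) * bU + bconst (l $ 2) * bV"

lemma bev_bqf [simp]: "bev s t u v (bqf a) = qf a s t" by (simp add: bqf_def qf_def)

lemma bev_blf [simp]: "bev s t u v (blf l) = lf l u v" by (simp add: blf_def lf_def)

lemma ideal_colon_subspace:
 assumes "ideal.subspace J"
 shows "ideal.subspace {h. h * g \<in> J}"
proof (rule ideal.subspaceI)
 show "0 \<in> {h. h * g \<in> J}" using ideal.subspace_0[OF assms] by simp
 show "x + y \<in> {h. h * g \<in> J}" if "x \<in> {h. h * g \<in> J}" "y \<in> {h. h * g \<in> J}" for x y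
  using ideal.subspace_add[OF assms, of "x * g" "y * g"] that by (simp add: distrib_right)
 show "c * x \<in> {h. h * g \<in> J}" if "x \<in> {h. h * g \<in> J}" for c x
  using ideal.subspace_scale[OF assms, of "x * g" c] that by (simp add: mult.assoc)
qed

text \<open>The prime \<open>\<langle>s, t, dlt\<rangle>\<close> of the linear form \<open>dlt\<close> in \<open>u, v\<close> with root \<open>(a, b)\<close>.\<close>

definition point_prime :: "'k::field => 'k => 'k bipoly set" where
 "point_prime a b = {f. \<forall>r. bev 0 0 (r * a) (r * b) f = 0}"

definition st_prime :: "'k::field bipoly set" where
 "st_prime = {f. \<forall>u v. bev 0 0 u v f = 0}"

lemma poly_no_zero_divisors:
 fixes P Q :: "'k::alg_closed_field poly"
 assumes "!!r. poly P r * poly Q r = 0"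
 shows "(\<forall>r. poly P r = 0) | (\<forall>r. poly Q r = 0)"
proof -
 have "P * Q = 0" using assms by (intro poly_fun_eqI) simp
 thus ?thesis by auto
qed

lemma point_prime_poly:
 fixes f :: "'k::alg_closed_field bipoly"
 shows "\<exists>P. \<forall>r. bev 0 0 (r * a) (r * b) f = poly P r"
proof -
 obtain P where "\<forall>r. bev (poly 0 r) (poly 0 r) (poly [:0, a:] r) (poly [:0, b:] r) f = poly P r"
  using bev_poly[of 0 0 "[:0, a:]" "[:0, b:]" f] by blast
 hence "\<forall>r. bev 0 0 (r * a) (r * b) f = poly P r" by simp
 thus ?thesis by blast
qed

lemma prime_point_prime: "prime_ideal (point_prime a (b :: 'k::alg_closed_field))"
 unfolding prime_ideal_def
proof (intro conjI allI impI)
 show "ideal.subspace (point_prime a b)" by (rule ideal.subspaceI) (simp_all add: point_prime_def)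
 show "1 \<notin> point_prime a b" by (simp add: point_prime_def)
 fix f g assume fg: "f * g \<in> point_prime a b"
 obtain P where P: "\<forall>r. bev 0 0 (r * a) (r * b) f = poly P r" using point_prime_poly by blast
 obtain Q where Q: "\<forall>r. bev 0 0 (r * a) (r * b) g = poly Q r" using point_prime_poly by blast
 have "poly P r * poly Q r = 0" for r using fg by (simp add: point_prime_def P Q)
 thus "f \<in> point_prime a b | g \<in> point_prime a b"
  using poly_no_zero_divisors[of P Q] P Q unfolding point_prime_def by auto
qed

lemma st_prime_iff: "f \<in> st_prime \<longleftrightarrow> subst 0 0 bU bV f = 0" for f :: "'k::alg_closed_field bipoly"
proof
 assume "f \<in> st_prime"
 thus "subst 0 0 bU bV f = 0" by (intro bipoly_eqI) (simp add: st_prime_def)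
next
 assume "subst 0 0 bU bV f = 0"
 hence "bev s t u v (subst 0 0 bU bV f) = 0" for s t u v by simp
 thus "f \<in> st_prime" by (simp add: st_prime_def)
qed

lemma prime_st_prime: "prime_ideal (st_prime :: 'k::alg_closed_field bipoly set)"
 unfolding prime_ideal_def
proof (intro conjI allI impI)
 show "ideal.subspace (st_prime :: 'k bipoly set)"
  by (rule ideal.subspaceI) (simp_all add: st_prime_def)
 show "(1 :: 'k bipoly) \<notin> st_prime" by (simp add: st_prime_def)
 fix f g :: "'k bipoly" assume "f * g \<in> st_prime"
 thus "f \<in> st_prime | g \<in> st_prime" unfolding st_prime_iff subst_hom by (rule bipoly_mult_eq_0)
qed

text \<open>Choose a linear form w in u, v with value 1 at (a, b). Modulo \<open>J\<close> the
  variables s, t, u, v become 0, 0, a w, b w, and this substitution annihilates every element that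
  vanishes on the line of the root.\<close>

lemma point_prime_subset:
 fixes J :: "'k::alg_closed_field bipoly set"
 assumes J: "ideal.subspace J" "bS \<in> J" "bT \<in> J" "blf (vector [b, - a]) \<in> J" and ab: "nz a b"
 shows "point_prime a b \<subseteq> J"
proof
 fix f assume f: "f \<in> point_prime a b"
 obtain c d where cd: "c * a + d * b = 1"
 proof (cases "a = 0")
  case True
  thus ?thesis using ab that[of 0 "1 / b"] by simp
 next
  case False
  thus ?thesis using that[of "1 / a" 0] by simp
 qed
 define w where "w = bconst c * bU + bconst d * (bV :: 'k bipoly)"
 have U: "bU - bconst a * w = bconst d * blf (vector [b, - a])"
 proof (rule bipoly_eqI)
  fix s t u v :: 'k
  have "u - a * (c * u + d * v) = d * (b * u - a * v)" using cd by algebra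
  thus "bev s t u v (bU - bconst a * w) = bev s t u v (bconst d * blf (vector [b, - a]))"
   by (simp add: w_def lf_def)
 qed
 have V: "bV - bconst b * w = bconst (- c) * blf (vector [b, - a])"
 proof (rule bipoly_eqI)
  fix s t u v :: 'k
  have "v - b * (c * u + d * v) = (- c) * (b * u - a * v)" using cd by algebra
  thus "bev s t u v (bV - bconst b * w) = bev s t u v (bconst (- c) * blf (vector [b, - a]))"
   by (simp add: w_def lf_def)
 qed
 have "f - subst 0 0 (bconst a * w) (bconst b * w) f \<in> J"
  by (rule subst_mod[OF J(1)]) (simp_all add: J(2,3) U V ideal.subspace_scale[OF J(1) J(4)])
 moreover have "subst 0 0 (bconst a * w) (bconst b * w) f = 0"
 proof (rule bipoly_eqI)
  fix s t u v :: 'k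
  have "bev 0 0 (bev s t u v w * a) (bev s t u v w * b) f = 0" using f unfolding point_prime_def by blast
  thus "bev s t u v (subst 0 0 (bconst a * w) (bconst b * w) f) = bev s t u v 0"
   by (simp add: mult.commute)
 qed
 ultimately show "f \<in> J" by simp
qed

lemma st_prime_subset:
 fixes J :: "'k::alg_closed_field bipoly set"
 assumes J: "ideal.subspace J" "bS \<in> J" "bT \<in> J"
 shows "st_prime \<subseteq> J"
proof
 fix f :: "'k bipoly" assume f: "f \<in> st_prime"
 have "f - subst 0 0 bU bV f \<in> J"
  by (rule subst_mod[OF J(1)]) (simp_all add: J(2,3) ideal.subspace_0[OF J(1)])
 thus "f \<in> J" using f by (simp add: st_prime_iff)
qed

lemma divide_root:
 fixes f :: "'k::alg_closed_field bipoly"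
 assumes uv: "subst 0 0 bU bV f = f" and f: "f \<in> point_prime a b" and ab: "nz a b"
 obtains g where "f = blf (vector [b, - a]) * g" "subst 0 0 bU bV g = g"
proof -
 let ?J = "ideal.span {bS, bT, blf (vector [b, - a])}"
 have "f \<in> ?J"
  using f point_prime_subset[OF ideal.subspace_span _ _ _ ab, of "{bS, bT, blf (vector [b, - a])}"]
  by (auto simp: ideal.span_base)
 then obtain g h k where "f - g * bS - h * bT - k * blf (vector [b, - a]) = 0"
  by (auto simp: ideal.span_breakdown_eq)
 hence eq: "f = bS * g + bT * h + blf (vector [b, - a]) * k" by (simp add: algebra_simps)
 have "f = subst 0 0 bU bV f" using uv by simp
 also have "\<dots> = blf (vector [b, - a]) * subst 0 0 bU bV k" unfolding eq by (rule bipoly_eqI) simp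
 finally show ?thesis by (rule that) (rule bipoly_eqI, simp)
qed

text \<open>Primality moves one linear factor from the right-hand side into \<open>f\<close>, since
  \<open>g\<close> is outside the prime. Cancelling it leaves the same situation once more.\<close>

lemma divide_root_twice:
 fixes f :: "'k::alg_closed_field bipoly"
 assumes uv: "subst 0 0 bU bV f = f" and eq: "g * f = h * (blf (vector [b, - a]) * blf (vector [b, - a]))"
  and g: "g \<notin> point_prime a b" and ab: "nz a b"
 obtains n where "f = blf (vector [b, - a]) * blf (vector [b, - a]) * n"
proof -
 let ?l = "blf (vector [b, - a]) :: 'k bipoly"
 have lnz: "?l ~= 0"
 proof
  assume "?l = 0"
  hence "bev 0 0 u v ?l = 0" for u v by simp
  from this[of 1 0] this[of 0 1] show False using ab by (simp add: lf_def)
 qed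
 have lm: "?l \<in> point_prime a b" by (simp add: point_prime_def lf_def)
 have sub: "ideal.subspace (point_prime a b)" using prime_point_prime unfolding prime_ideal_def by blast
 have pr: "x \<in> point_prime a b" if "g * x = ?l * y" for x y
 proof -
  have "y * ?l \<in> point_prime a b" by (rule ideal.subspace_scale[OF sub lm])
  hence "g * x \<in> point_prime a b" using that by (simp add: mult.commute)
  thus ?thesis using g prime_point_prime unfolding prime_ideal_def by blast
 qed
 have "f \<in> point_prime a b" by (rule pr[of _ "h * ?l"]) (use eq in \<open>simp add: mult_ac\<close>)
 then obtain f1 where f1: "f = ?l * f1" "subst 0 0 bU bV f1 = f1" using divide_root[OF uv _ ab] by blast
 have "?l * (g * f1 - ?l * h) = 0" using eq unfolding f1(1) by (simp add: algebra_simps)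
 hence "g * f1 - ?l * h = 0" using bipoly_mult_eq_0 lnz by blast
 hence "g * f1 = ?l * h" by simp
 hence "f1 \<in> point_prime a b" by (rule pr)
 then obtain n where "f1 = ?l * n" using divide_root[OF f1(2) _ ab] by blast
 thus ?thesis using that f1(1) by (simp add: mult.assoc)
qed

lemma st_expansion1:
 fixes f :: "'k::alg_closed_field bipoly"
 obtains a b where "f = subst 0 0 bU bV f + bS * a + bT * b"
proof -
 have "f - subst 0 0 bU bV f \<in> ideal.span {bS, bT}"
  by (rule subst_mod) (auto simp: ideal.span_base ideal.span_zero)
 then obtain a b where "f - subst 0 0 bU bV f - a * bS - b * bT = 0"
  by (auto simp: ideal.span_breakdown_eq)
 hence "f = subst 0 0 bU bV f + bS * a + bT * b" by (simp add: algebra_simps)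
 thus ?thesis by (rule that)
qed

lemma st_expansion3:
 fixes f :: "'k::alg_closed_field bipoly"
 obtains A0 A1 A2 B1 B2 B3 g1 g2 g3 g4 where
  "f = subst 0 0 bU bV A0 + (bS * subst 0 0 bU bV A1 + bT * subst 0 0 bU bV A2) +
   (bS * bS * subst 0 0 bU bV B1 + bS * bT * subst 0 0 bU bV B2 + bT * bT * subst 0 0 bU bV B3) +
   (bS * bS * bS * g1 + bS * bS * bT * g2 + bS * bT * bT * g3 + bT * bT * bT * g4)"
proof -
 obtain a b where f: "f = subst 0 0 bU bV f + bS * a + bT * b" by (rule st_expansion1)
 obtain a1 a2 where a: "a = subst 0 0 bU bV a + bS * a1 + bT * a2" by (rule st_expansion1)
 obtain b1 b2 where b: "b = subst 0 0 bU bV b + bS * b1 + bT * b2" by (rule st_expansion1)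
 obtain c1 c2 where c: "a1 = subst 0 0 bU bV a1 + bS * c1 + bT * c2" by (rule st_expansion1)
 obtain d1 d2 where d: "a2 + b1 = subst 0 0 bU bV (a2 + b1) + bS * d1 + bT * d2" by (rule st_expansion1)
 obtain e1 e2 where e: "b2 = subst 0 0 bU bV b2 + bS * e1 + bT * e2" by (rule st_expansion1)
 have "f = subst 0 0 bU bV f + bS * (subst 0 0 bU bV a + bS * a1 + bT * a2) +
   bT * (subst 0 0 bU bV b + bS * b1 + bT * b2)" using f a b by simp
 also have "\<dots> = subst 0 0 bU bV f + (bS * subst 0 0 bU bV a + bT * subst 0 0 bU bV b) +
   (bS * bS * a1 + bS * bT * (a2 + b1) + bT * bT * b2)" by (simp add: algebra_simps)
 also have "\<dots> = subst 0 0 bU bV f + (bS * subst 0 0 bU bV a + bT * subst 0 0 bU bV b) +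
   (bS * bS * (subst 0 0 bU bV a1 + bS * c1 + bT * c2) + bS * bT * (subst 0 0 bU bV (a2 + b1) + bS * d1 + bT * d2) +
   bT * bT * (subst 0 0 bU bV b2 + bS * e1 + bT * e2))" using c d e by simp
 also have "\<dots> = subst 0 0 bU bV f + (bS * subst 0 0 bU bV a + bT * subst 0 0 bU bV b) +
   (bS * bS * subst 0 0 bU bV a1 + bS * bT * subst 0 0 bU bV (a2 + b1) + bT * bT * subst 0 0 bU bV b2) +
   (bS * bS * bS * c1 + bS * bS * bT * (c2 + d1) + bS * bT * bT * (d2 + e1) + bT * bT * bT * e2)"
  by (simp add: algebra_simps)
 finally show ?thesis by (rule that)
qed

text \<open>The assumption \<open>cubics\<close> puts all forms of bidegree (3,1) into the ideal; it
  is supplied by the absence of (1,0) syzygies.\<close>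

locale pencil_ideal = pencil_form +
 assumes qyz: "indep3 q y z"
  and disc_nz: "lmul l1 l4 ~= lmul l2 l3"
  and cubics: "!!x (a :: 'a^4) (b :: 'a^4). (!!s t u v. bev s t u v x =
   (a $ 1 * (s * s * s) + a $ 2 * (s * s * t) + a $ 3 * (s * t * t) + a $ 4 * (t * t * t)) * u +
   (b $ 1 * (s * s * s) + b $ 2 * (s * s * t) + b $ 3 * (s * t * t) + b $ 4 * (t * t * t)) * v) ==>
   x \<in> form_ideal Phi"
begin

section \<open>Elements of the ideal of a pencil and its associated primes\<close>

abbreviation "J \<equiv> form_ideal Phi"

lemma qf_homogeneous: "qf x (r * s) (r * t) = r * r * qf x s t" by (simp add: qf_def algebra_simps)

lemma J_add: "x \<in> J ==> x' \<in> J ==> x + x' \<in> J" by (rule ideal.subspace_add[OF form_ideal_subspace])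

lemma J_mult: "x \<in> J ==> c * x \<in> J" by (rule ideal.subspace_scale[OF form_ideal_subspace])

lemma J_mult': "x \<in> J ==> x * c \<in> J" using J_mult[of x c] by (simp add: mult.commute)

lemma J_diff: "x \<in> J ==> x' \<in> J ==> x - x' \<in> J" by (rule ideal.subspace_diff[OF form_ideal_subspace])

definition bdisc :: "'a bipoly" where "bdisc = blf l1 * blf l4 - blf l2 * blf l3"

lemma bev_bdisc [simp]: "bev s t u v bdisc = disc u v" by (simp add: bdisc_def disc_def)

lemma generators:
 "bqf q * bU \<in> J" "bqf q * bV \<in> J"
 "bqf y * blf l1 + bqf z * blf l2 \<in> J" "bqf y * blf l3 + bqf z * blf l4 \<in> J"
 by (rule form_idealI4[of _ 1 _ 0 0 0], simp add: Phi_def)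
  (rule form_idealI4[of _ 0 _ 1 0 0], simp add: Phi_def,
   rule form_idealI4[of _ 0 _ 0 1 0], simp add: Phi_def,
   rule form_idealI4[of _ 0 _ 0 0 1], simp add: Phi_def)

text \<open>Multiply the last two generators by the adjugate of the matrix of linear forms.\<close>

lemma disc_mult: "bqf y * bdisc \<in> J" "bqf z * bdisc \<in> J"
proof -
 have "blf l4 * (bqf y * blf l1 + bqf z * blf l2) - blf l2 * (bqf y * blf l3 + bqf z * blf l4) \<in> J"
  by (intro J_diff J_mult generators)
 moreover have "blf l4 * (bqf y * blf l1 + bqf z * blf l2) - blf l2 * (bqf y * blf l3 + bqf z * blf l4) = bqf y * bdisc"
  by (simp add: bdisc_def algebra_simps)
 ultimately show "bqf y * bdisc \<in> J" by simp
 have "blf l1 * (bqf y * blf l3 + bqf z * blf l4) - blf l3 * (bqf y * blf l1 + bqf z * blf l2) \<in> J"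
  by (intro J_diff J_mult generators)
 moreover have "blf l1 * (bqf y * blf l3 + bqf z * blf l4) - blf l3 * (bqf y * blf l1 + bqf z * blf l2) = bqf z * bdisc"
  by (simp add: bdisc_def algebra_simps)
 ultimately show "bqf z * bdisc \<in> J" by simp
qed

lemma bqf_disc_U: "bqf a * (bdisc * bU) \<in> J"
proof -
 obtain c d e where a: "a = c *s q + d *s y + e *s z" using indep3_span[OF qyz] by blast
 have "(bconst c * bdisc) * (bqf q * bU) + (bconst d * bU) * (bqf y * bdisc) + (bconst e * bU) * (bqf z * bdisc) \<in> J"
  by (intro J_add J_mult generators disc_mult)
 moreover have "(bconst c * bdisc) * (bqf q * bU) + (bconst d * bU) * (bqf y * bdisc) + (bconst e * bU) * (bqf z * bdisc) =
   bqf a * (bdisc * bU)" by (rule bipoly_eqI) (simp add: a algebra_simps)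
 ultimately show ?thesis by simp
qed

lemma cubic_mult:
 assumes "!!s t u v. bev s t u v c = a $ 1 * (s * s * s) + a $ 2 * (s * s * t) + a $ 3 * (s * t * t) + (a :: 'a^4) $ 4 * (t * t * t)"
 shows "c * bU \<in> J" "c * bV \<in> J"
 by (rule cubics[of _ a 0], simp add: assms) (rule cubics[of _ 0 a], simp add: assms)

lemma cubic_mod:
 assumes "!!s t u v. bev s t u v c = a $ 1 * (s * s * s) + a $ 2 * (s * s * t) + a $ 3 * (s * t * t) + (a :: 'a^4) $ 4 * (t * t * t)"
 shows "(g - subst bS bT 0 0 g) * c \<in> J"
proof -
 have K: "ideal.subspace {h. h * c \<in> J}" by (rule ideal_colon_subspace[OF form_ideal_subspace])
 have "g - subst bS bT 0 0 g \<in> {h. h * c \<in> J}"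
  by (rule subst_mod[OF K]) (use cubic_mult[OF assms] ideal.subspace_0[OF form_ideal_subspace, of Phi] in \<open>simp_all add: mult.commute\<close>)
 thus ?thesis by simp
qed

lemma st_cubes:
 "bS * bS * bS * bU \<in> J" "bS * bS * bS * bV \<in> J" "bT * bT * bT * bU \<in> J" "bT * bT * bT * bV \<in> J"
 using cubic_mult[of "bS * bS * bS" "vector [1, 0, 0, 0]"] cubic_mult[of "bT * bT * bT" "vector [0, 0, 0, 1]"]
 by simp_all

lemma J_vanish_uv: "x \<in> J ==> bev s t 0 0 x = 0"
 unfolding form_ideal_def sum_4 by (clarsimp simp: Phi_def lf_def)

text \<open>At (r s, r t, u, v) every generator is r^2 times its value. So an element of
  \<open>J\<close> has no terms of order 0 and 1 in r, and its r^2 coefficient is a combination of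
  the generators with multipliers taken at s = t = 0.\<close>

lemma J_coefficients:
 assumes "x \<in> J"
 obtains h :: "4 => 'a bipoly" where "!!s t u v a b c W.
  (!!r. bev (r * s) (r * t) u v x = a + r * b + r * r * c + r * r * r * poly W r) ==>
  a = 0 & b = 0 & c = (\<Sum>i\<in>UNIV. bev 0 0 u v (h i) * Phi (s, t, u, v) $ i)"
proof -
 obtain h where h: "!!s t u v. bev s t u v x = (\<Sum>i\<in>UNIV. bev s t u v (h i) * Phi (s, t, u, v) $ i)"
  using assms unfolding form_ideal_def by blast
 have scale: "Phi (r * s, r * t, u, v) $ i = r * r * Phi (s, t, u, v) $ i" for r s t u v i
 proof -
  have "\<forall>i. Phi (r * s, r * t, u, v) $ i = r * r * Phi (s, t, u, v) $ i"
   unfolding forall_4 by (simp add: Phi_def qf_homogeneous distrib_left mult.assoc)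
  thus ?thesis by blast
 qed
 have "a = 0 & b = 0 & c = (\<Sum>i\<in>UNIV. bev 0 0 u v (h i) * Phi (s, t, u, v) $ i)"
  if W: "!!r. bev (r * s) (r * t) u v x = a + r * b + r * r * c + r * r * r * poly W r" for s t u v a b c W
 proof -
  have "\<exists>P. \<forall>r. bev (r * s) (r * t) u v (h i) = poly P r" for i
   using bev_poly[of "[:0, s:]" "[:0, t:]" "[:u:]" "[:v:]" "h i"] by simp
  then obtain P where P: "!!i r. bev (r * s) (r * t) u v (h i) = poly (P i) r" by metis
  define Q where "Q = (\<Sum>i\<in>UNIV. smult (Phi (s, t, u, v) $ i) (P i))"
  have "bev (r * s) (r * t) u v x = r * r * poly Q r" for r
   unfolding h scale P Q_def poly_sum sum_distrib_left by (rule sum.cong) (simp_all add: mult_ac)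
  hence "poly (pCons a (pCons b (pCons c W))) r = poly (pCons 0 (pCons 0 Q)) r" for r
   using W[of r] by (simp add: algebra_simps)
  hence "pCons a (pCons b (pCons c W)) = pCons 0 (pCons 0 Q)" by (rule poly_fun_eqI)
  hence "a = 0" "b = 0" "Q = pCons c W" by auto
  moreover have "poly Q 0 = (\<Sum>i\<in>UNIV. bev 0 0 u v (h i) * Phi (s, t, u, v) $ i)"
   unfolding Q_def poly_sum using P[of 0] by (simp add: mult.commute)
  ultimately show ?thesis by simp
 qed
 thus ?thesis by (rule that)
qed

lemma J_leading:
 assumes "f * g \<in> J" and g: "!!r s t u v. bev (r * s) (r * t) u v g = r * r * bev s t u v g"
 obtains h :: "4 => 'a bipoly" where
  "!!s t u v. bev 0 0 u v f * bev s t u v g = (\<Sum>i\<in>UNIV. bev 0 0 u v (h i) * Phi (s, t, u, v) $ i)"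
proof -
 obtain h :: "4 => 'a bipoly" where h: "!!s t u v a b c W.
  (!!r. bev (r * s) (r * t) u v (f * g) = a + r * b + r * r * c + r * r * r * poly W r) ==>
  a = 0 & b = 0 & c = (\<Sum>i\<in>UNIV. bev 0 0 u v (h i) * Phi (s, t, u, v) $ i)"
  by (rule J_coefficients[OF assms(1)]) blast
 have "bev 0 0 u v f * bev s t u v g = (\<Sum>i\<in>UNIV. bev 0 0 u v (h i) * Phi (s, t, u, v) $ i)" for s t u v
 proof -
  obtain P where P: "\<forall>r. bev (r * s) (r * t) u v f = poly P r"
   using bev_poly[of "[:0, s:]" "[:0, t:]" "[:u:]" "[:v:]" f] by auto
  obtain p0 W where W: "P = pCons p0 W" by (cases P) auto
  let ?k = "bev s t u v g"
  have "bev (r * s) (r * t) u v (f * g) = 0 + r * 0 + r * r * (p0 * ?k) + r * r * r * poly (smult ?k W) r" for r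
  proof -
   have "bev (r * s) (r * t) u v (f * g) = (p0 + r * poly W r) * (r * r * ?k)" using P by (simp add: g W)
   moreover have "(x + r * y) * (r * r * k) = 0 + r * 0 + r * r * (x * k) + r * r * r * (k * y)" for x y k :: 'a
    by algebra
   ultimately show ?thesis by simp
  qed
  hence "p0 * ?k = (\<Sum>i\<in>UNIV. bev 0 0 u v (h i) * Phi (s, t, u, v) $ i)" using h[of s t u v 0 0] by blast
  moreover have "bev 0 0 u v f = p0" using P[rule_format, of 0] by (simp add: W)
  ultimately show ?thesis by simp
 qed
 thus ?thesis by (rule that)
qed

lemma coordinates:
 assumes "!!s t. X * qf y s t + Y * qf z s t = (\<Sum>i\<in>UNIV. bet i * Phi (s, t, u, v) $ i)"
 shows "X = bet 3 * lf l1 u v + bet 4 * lf l3 u v" "Y = bet 3 * lf l2 u v + bet 4 * lf l4 u v"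
proof -
 let ?c = "bet 1 * u + bet 2 * v"
 let ?d = "bet 3 * lf l1 u v + bet 4 * lf l3 u v - X"
 let ?e = "bet 3 * lf l2 u v + bet 4 * lf l4 u v - Y"
 have "?c *s q + ?d *s y + ?e *s z = 0"
 proof (rule qf_eqI)
  fix s t show "qf (?c *s q + ?d *s y + ?e *s z) s t = qf 0 s t"
   using assms[of s t] by (simp add: sum_4 Phi_def algebra_simps)
 qed
 hence "?d = 0" "?e = 0" using qyz unfolding indep3_def by blast+
 thus "X = bet 3 * lf l1 u v + bet 4 * lf l3 u v" "Y = bet 3 * lf l2 u v + bet 4 * lf l4 u v" by simp_all
qed

lemma bdisc_nz: "bdisc ~= 0"
proof
 assume "bdisc = 0"
 hence "qf (lmul l1 l4) u v = qf (lmul l2 l3) u v" for u v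
  using bev_bdisc[of 0 0 u v] by (simp add: disc_def)
 thus False using disc_nz qf_eqI by blast
qed

text \<open>The witness is s disc u. Multiplied by s or t it lies in \<open>J\<close>, by
  \<open>bqf_disc_U\<close>. Conversely, if f times the witness lies in \<open>J\<close>, its term
  of order one in s, t vanishes, so f vanishes at s = t = 0.\<close>

lemma st_prime_associated: "st_prime \<in> associated_primes J"
proof -
 define g where "g = bS * (bdisc * bU)"
 have K: "ideal.subspace {h. h * g \<in> J}" by (rule ideal_colon_subspace[OF form_ideal_subspace])
 have "bqf (vector [1, 0, 0]) * (bdisc * bU) \<in> J" "bqf (vector [0, 1, 0]) * (bdisc * bU) \<in> J"
  by (rule bqf_disc_U)+
 moreover have "bqf (vector [1, 0, 0]) * (bdisc * bU) = bS * g" "bqf (vector [0, 1, 0]) * (bdisc * bU) = bT * g"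
  unfolding g_def by (rule bipoly_eqI, simp add: qf_def algebra_simps)+
 ultimately have "st_prime \<subseteq> {h. h * g \<in> J}" by (intro st_prime_subset[OF K]) simp_all
 moreover have "{h. h * g \<in> J} \<subseteq> st_prime"
 proof
  fix f assume "f \<in> {h. h * g \<in> J}"
  hence "f * g \<in> J" by simp
  then obtain h :: "4 => 'a bipoly" where h: "!!s t u v a b c W.
   (!!r. bev (r * s) (r * t) u v (f * g) = a + r * b + r * r * c + r * r * r * poly W r) ==>
   a = 0 & b = 0 & c = (\<Sum>i\<in>UNIV. bev 0 0 u v (h i) * Phi (s, t, u, v) $ i)"
   by (rule J_coefficients) blast
  have "bev 0 0 u v (f * (bdisc * bU)) = 0" for u v
  proof -
   obtain P where P: "\<forall>r. bev (r * 1) (r * 0) u v f = poly P r"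
    using bev_poly[of "[:0, 1:]" 0 "[:u:]" "[:v:]" f] by auto
   obtain p0 P1 where P1: "P = pCons p0 P1" by (cases P) auto
   obtain p1 W where W: "P1 = pCons p1 W" by (cases P1) auto
   let ?k = "disc u v * u"
   have "bev (r * 1) (r * 0) u v (f * g) = 0 + r * (p0 * ?k) + r * r * (p1 * ?k) + r * r * r * poly (smult ?k W) r" for r
   proof -
    have "bev (r * 1) (r * 0) u v (f * g) = poly P r * (r * ?k)" using P by (simp add: g_def)
    thus ?thesis unfolding P1 W by (simp add: algebra_simps)
   qed
   hence "p0 * ?k = 0" using h[of 1 0 u v 0 "p0 * ?k" "p1 * ?k" "smult ?k W"] by blast
   moreover have "bev 0 0 u v f = p0" using P[rule_format, of 0] by (simp add: P1)
   ultimately show ?thesis by simp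
  qed
  hence "f * (bdisc * bU) \<in> st_prime" by (simp add: st_prime_def)
  moreover have "bdisc * bU \<notin> st_prime"
  proof
   assume "bdisc * bU \<in> st_prime"
   hence "bev 0 0 u v (bdisc * bU) = 0" for u v unfolding st_prime_def by blast
   hence z: "disc u v * u = 0" for u v by (simp only: bev_simps bev_bdisc bvar.case)
   have "bdisc * bU = 0" by (intro bipoly_eqI) (simp only: bev_simps bev_bdisc bvar.case z)
   hence "bU = (0 :: 'a bipoly)" using bipoly_mult_eq_0 bdisc_nz by blast
   hence "bev 0 0 1 0 bU = (0 :: 'a)" by simp
   thus False by simp
  qed
  ultimately show "f \<in> st_prime" using prime_st_prime unfolding prime_ideal_def by blast
 qed
 ultimately have "st_prime = {h. h * g \<in> J}" by blast
 thus ?thesis using prime_st_prime unfolding associated_primes_def by blast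
qed

lemma st_prime_psubset:
 assumes "nz a b"
 shows "st_prime \<subset> point_prime a (b :: 'a)"
proof -
 have "st_prime \<subseteq> point_prime a b" by (auto simp: st_prime_def point_prime_def)
 moreover have "blf (vector [b, - a]) \<in> point_prime a b" by (simp add: point_prime_def lf_def)
 moreover have "blf (vector [b, - a]) \<notin> st_prime"
 proof
  assume "blf (vector [b, - a]) \<in> st_prime"
  hence "lf (vector [b, - a]) u v = 0" for u v by (simp add: st_prime_def)
  from this[of 1 0] this[of 0 1] show False using assms by (simp add: lf_def)
 qed
 ultimately show ?thesis by blast
qed

text \<open>The witness is dlt' om, where dlt' is the other factor of the discriminant and om = w1 y
  + w2 z has (w1, w2) outside the row space of the matrix of linear forms at (a, b). Its products
  with s and t are of bidegree (3,1), and its product with b u - a v is disc om. An f outside the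
  prime would put (w1, w2) into the row space.\<close>

theorem simple_root_embedded:
 assumes D: "lmul l1 l4 - lmul l2 l3 = lmul (vector [b, - a]) (vector [b', - a'])"
  and simple: "a * b' - b * a' ~= 0"
 shows "point_prime a b \<in> embedded_primes J"
proof -
 have disc: "disc u v = (b * u - a * v) * (b' * u - a' * v)" for u v
 proof -
  have "qf (lmul l1 l4 - lmul l2 l3) u v = disc u v" by (simp add: disc_def)
  thus ?thesis unfolding D by (simp add: lf_def)
 qed
 have ab: "nz a b" using simple by auto
 \<comment> \<open>If all four entries vanished at the root, its linear form would divide the
   discriminant twice.\<close>
 have nz: "\<exists>l\<in>{l1, l2, l3, l4}. lf l a b ~= 0"
 proof (rule ccontr)
  assume "\<not> ?thesis"
  hence z: "lf l a b = 0" if "l \<in> {l1, l2, l3, l4}" for l using that by blast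
  have "\<exists>c. l = c *s vector [b, - a]" if "l \<in> {l1, l2, l3, l4}" for l
  proof (rule linear_form_root_multiple[of "vector [b, - a]" l])
   show "(vector [b, - a] :: 'a^2) ~= 0" using ab by (auto simp: vec_eq_iff forall_2)
   show "(vector [b, - a] :: 'a^2) $ 1 * l $ 2 = (vector [b, - a] :: 'a^2) $ 2 * l $ 1"
    using z[OF that] by (simp add: lf_def eq_neg_iff_add_eq_0 mult.commute add.commute)
  qed blast
  then obtain c1 c2 c3 c4 where c: "l1 = c1 *s vector [b, - a]" "l2 = c2 *s vector [b, - a]"
   "l3 = c3 *s vector [b, - a]" "l4 = c4 *s vector [b, - a]" by (meson insertCI)
  have d: "disc u v = (c1 * c4 - c2 * c3) * ((b * u - a * v) * (b * u - a * v))" for u v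
  proof -
   have "lf l1 u v * lf l4 u v - lf l2 u v * lf l3 u v = (c1 * c4 - c2 * c3) * ((b * u - a * v) * (b * u - a * v))"
    unfolding c by (simp add: lf_def algebra_simps)
   thus ?thesis by (simp add: disc_def)
  qed
  have "b * a' - a * b' ~= 0" using simple by (simp add: algebra_simps)
  hence "c1 * c4 - c2 * c3 = 0" using d[of a' b'] disc[of a' b'] by simp
  hence "bdisc = 0" using d by (intro bipoly_eqI) simp
  thus False using bdisc_nz by simp
 qed
 obtain w1 w2 where w: "w1 * lf l4 a b - w2 * lf l3 a b ~= 0 | w2 * lf l1 a b - w1 * lf l2 a b ~= 0"
 proof (cases "lf l4 a b = 0 & lf l2 a b = 0")
  case True
  thus ?thesis using nz that[of 0 1] by auto
 next
  case False
  thus ?thesis using that[of 1 0] by auto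
 qed
 define dlt' where "dlt' = blf (vector [b', - a'] :: 'a^2)"
 define om where "om = w1 *s y + w2 *s z"
 define g where "g = dlt' * bqf om"
 have g: "bev s t u v g = (b' * u - a' * v) * qf om s t" for s t u v
  by (simp add: g_def dlt'_def lf_def)
 have om: "qf om s t = w1 * qf y s t + w2 * qf z s t" for s t by (simp add: om_def)
 have K: "ideal.subspace {h. h * g \<in> J}" by (rule ideal_colon_subspace[OF form_ideal_subspace])
 have "bS * g \<in> J" by (rule cubics[of _ "vector [b' * om $ 1, b' * om $ 2, b' * om $ 3, 0]"
     "vector [- a' * om $ 1, - a' * om $ 2, - a' * om $ 3, 0]"], simp add: g qf_def, algebra)
 moreover have "bT * g \<in> J" by (rule cubics[of _ "vector [0, b' * om $ 1, b' * om $ 2, b' * om $ 3]"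
     "vector [0, - a' * om $ 1, - a' * om $ 2, - a' * om $ 3]"], simp add: g qf_def, algebra)
 moreover have "blf (vector [b, - a]) * g \<in> J"
 proof -
  have "bconst w1 * (bqf y * bdisc) + bconst w2 * (bqf z * bdisc) \<in> J" by (intro J_add J_mult disc_mult)
  moreover have "bconst w1 * (bqf y * bdisc) + bconst w2 * (bqf z * bdisc) = blf (vector [b, - a]) * g"
   by (rule bipoly_eqI, simp add: g om disc lf_def, algebra)
  ultimately show ?thesis by simp
 qed
 ultimately have "point_prime a b \<subseteq> {h. h * g \<in> J}" by (intro point_prime_subset[OF K _ _ _ ab]) simp_all
 moreover have "{h. h * g \<in> J} \<subseteq> point_prime a b"
 proof
  fix f assume "f \<in> {h. h * g \<in> J}"
  hence "f * g \<in> J" by simp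
  moreover have "bev (r * s) (r * t) u v g = r * r * bev s t u v g" for r s t u v by (simp add: g qf_homogeneous)
  ultimately obtain h :: "4 => 'a bipoly" where
   h: "!!s t u v. bev 0 0 u v f * bev s t u v g = (\<Sum>i\<in>UNIV. bev 0 0 u v (h i) * Phi (s, t, u, v) $ i)"
   using J_leading by blast
  have eq: "bev 0 0 u v f * (b' * u - a' * v) * w1 * qf y s t + bev 0 0 u v f * (b' * u - a' * v) * w2 * qf z s t =
    (\<Sum>i\<in>UNIV. bev 0 0 u v (h i) * Phi (s, t, u, v) $ i)" for s t u v
   unfolding h[symmetric] g om by algebra
  obtain P where P: "\<forall>r. bev 0 0 (r * a) (r * b) f = poly P r" using point_prime_poly by blast
  have "poly P r = 0" if "r \<notin> {0}" for r
  proof -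
   let ?f = "bev 0 0 (r * a) (r * b) f" and ?d = "b' * (r * a) - a' * (r * b)"
   note c = coordinates[OF eq[of "r * a" "r * b"]]
   have lr: "lf l (r * a) (r * b) = r * lf l a b" for l by (simp add: lf_def algebra_simps)
   have d0: "lf l1 a b * lf l4 a b - lf l2 a b * lf l3 a b = 0" using disc[of a b] by (simp add: disc_def)
   have "?f * ?d * (w1 * lf l4 a b - w2 * lf l3 a b) = 0" "?f * ?d * (w2 * lf l1 a b - w1 * lf l2 a b) = 0"
    using c d0 unfolding lr by algebra+
   hence "?f * ?d = 0" using w by auto
   moreover have "?d ~= 0"
   proof -
    have "?d = r * (a * b' - b * a')" by (simp add: algebra_simps)
    thus ?thesis using simple that by simp
   qed
   ultimately show ?thesis using P by simp
  qed
  hence "P = 0" by (rule poly_zeroI[of "{0}"]) simp_all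
  thus "f \<in> point_prime a b" using P by (simp add: point_prime_def)
 qed
 ultimately have "point_prime a b = {h. h * g \<in> J}" by blast
 hence "point_prime a b \<in> associated_primes J"
  using prime_point_prime unfolding associated_primes_def by blast
 thus ?thesis unfolding embedded_primes_def using st_prime_associated st_prime_psubset[OF ab] by blast
qed

section \<open>Embedded primes over a double root\<close>

lemma st_or_uv:
 assumes Q: "prime_ideal Q" "J \<subseteq> Q"
 shows "(bS \<in> Q & bT \<in> Q) | (bU \<in> Q & bV \<in> Q)"
proof -
 have pr: "x * y \<in> Q ==> x \<in> Q | y \<in> Q" for x y using Q(1) unfolding prime_ideal_def by blast
 have "bS * bS * bS * bU \<in> Q" "bS * bS * bS * bV \<in> Q" "bT * bT * bT * bU \<in> Q" "bT * bT * bT * bV \<in> Q"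
  using st_cubes Q(2) by auto
 thus ?thesis using pr by metis
qed

text \<open>
 An embedded prime contains \<open>s\<close> and \<open>t\<close>: otherwise a suitable multiple of the annihilated
 element is congruent to a polynomial in \<open>s, t\<close>, and the prime is \<open>\<langle>u, v\<rangle>\<close>.
\<close>

lemma embedded_contains_st:
 assumes P: "prime_ideal P" "P = {g. g * f \<in> J}" and Q: "prime_ideal Q" "J \<subseteq> Q" "Q \<subset> P"
 shows "bS \<in> P" "bT \<in> P"
proof -
 have X: False if X: "X \<notin> P" "X = bS | X = bT" for X
 proof -
  have Qs: "ideal.subspace Q" using Q(1) unfolding prime_ideal_def by blast
  have uv: "bU \<in> Q" "bV \<in> Q" using st_or_uv[OF Q(1,2)] X Q(3) by auto
  define c where "c = X * X * X"
  have cform: "\<exists>a :: 'a^4. \<forall>s t u v. bev s t u v c =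
   a $ 1 * (s * s * s) + a $ 2 * (s * s * t) + a $ 3 * (s * t * t) + a $ 4 * (t * t * t)" using X(2)
  proof
   assume "X = bS"
   thus ?thesis by (intro exI[of _ "vector [1, 0, 0, 0]"]) (simp add: c_def)
  next
   assume "X = bT"
   thus ?thesis by (intro exI[of _ "vector [0, 0, 0, 1]"]) (simp add: c_def)
  qed
  then obtain a :: "'a^4" where a: "!!s t u v. bev s t u v c =
   a $ 1 * (s * s * s) + a $ 2 * (s * s * t) + a $ 3 * (s * t * t) + a $ 4 * (t * t * t)" by blast
  have "(f - subst bS bT 0 0 f) * c \<in> J" by (rule cubic_mod[OF a])
  moreover have "c * f \<notin> J"
  proof
   assume "c * f \<in> J"
   hence "c \<in> P" unfolding P(2) by simp
   thus False using P(1) X(1) unfolding c_def prime_ideal_def by blast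
  qed
  ultimately have f0: "subst bS bT 0 0 f ~= 0" by (auto simp: mult.commute)
  have "P \<subseteq> Q"
  proof
   fix g assume "g \<in> P"
   hence "g * f \<in> J" using P(2) by blast
   hence "bev s t 0 0 (g * f) = 0" for s t by (rule J_vanish_uv)
   hence "subst bS bT 0 0 g * subst bS bT 0 0 f = 0" by (intro bipoly_eqI) simp
   hence "subst bS bT 0 0 g = 0" using bipoly_mult_eq_0 f0 by blast
   moreover have "g - subst bS bT 0 0 g \<in> Q"
    by (rule subst_mod[OF Qs]) (simp_all add: uv ideal.subspace_0[OF Qs])
   ultimately show "g \<in> Q" by simp
  qed
  thus False using Q(3) by blast
 qed
 show "bS \<in> P" "bT \<in> P" using X by blast+
qed

text \<open>
 Modulo \<open>J\<close>, an element annihilated by \<open>s\<close>, \<open>t\<close> and some \<open>h(u, v) ~= 0\<close> has degree 2 in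
 \<open>s, t\<close>, because \<open>J\<close> contains no element of smaller degree and all of larger degree that vanish
 for \<open>u = v = 0\<close>.
\<close>

lemma annihilated_normal_form:
 assumes f: "bS * f \<in> J" "bT * f \<in> J" and h: "h * f \<in> J" "h \<notin> st_prime"
 obtains B C where "f - (bqf y * B + bqf z * C) \<in> J" "subst 0 0 bU bV B = B" "subst 0 0 bU bV C = C"
proof -
 let ?tha = "subst 0 0 bU bV :: 'a bipoly => 'a bipoly"
 obtain A0 A1 A2 B1 B2 B3 g1 g2 g3 g4 where f_eq:
  "f = ?tha A0 + (bS * ?tha A1 + bT * ?tha A2) + (bS * bS * ?tha B1 + bS * bT * ?tha B2 + bT * bT * ?tha B3) +
   (bS * bS * bS * g1 + bS * bS * bT * g2 + bS * bT * bT * g3 + bT * bT * bT * g4)"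
  by (rule st_expansion3)
 have J0: "ideal.subspace J" by (rule form_ideal_subspace)
 define h0 where "h0 = ?tha h"
 have h0: "h0 ~= 0" using h(2) by (simp add: h0_def st_prime_iff)
 define C3 where "C3 = bS * bS * bS * g1 + bS * bS * bT * g2 + bS * bT * bT * g3 + bT * bT * bT * g4"
 have C3: "\<exists>W. \<forall>r. bev (r * s) (r * t) u v C3 = r * r * r * poly W r" for s t u v
 proof -
  have "\<forall>g. \<exists>P. \<forall>r. bev (r * s) (r * t) u v g = poly P r"
  proof
   fix g show "\<exists>P. \<forall>r. bev (r * s) (r * t) u v g = poly P r"
    using bev_poly[of "[:0, s:]" "[:0, t:]" "[:u:]" "[:v:]" g] by simp
  qed
  then obtain P where P: "!!g r. bev (r * s) (r * t) u v g = poly (P g) r" by metis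
  have "bev (r * s) (r * t) u v C3 = r * r * r * poly (smult (s * s * s) (P g1) + smult (s * s * t) (P g2) +
    smult (s * t * t) (P g3) + smult (t * t * t) (P g4)) r" for r
   unfolding C3_def bev_simps bvar.case P poly_add poly_smult by algebra
  thus ?thesis by blast
 qed
 have fval: "bev (r * s) (r * t) u v f = bev 0 0 u v A0 + r * (s * bev 0 0 u v A1 + t * bev 0 0 u v A2) +
   r * r * (s * s * bev 0 0 u v B1 + s * t * bev 0 0 u v B2 + t * t * bev 0 0 u v B3) +
   bev (r * s) (r * t) u v C3" for r s t u v
 proof -
  have "f = ?tha A0 + (bS * ?tha A1 + bT * ?tha A2) + (bS * bS * ?tha B1 + bS * bT * ?tha B2 + bT * bT * ?tha B3) + C3"
   unfolding C3_def by (rule f_eq)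
  thus ?thesis by (simp add: distrib_left mult_ac)
 qed
 have K: "ideal.subspace {g. g * f \<in> J}" by (rule ideal_colon_subspace[OF J0])
 have "h - h0 \<in> {g. g * f \<in> J}"
  unfolding h0_def by (rule subst_mod[OF K]) (use f ideal.subspace_0[OF J0] in simp_all)
 hence "h * f - (h - h0) * f \<in> J" using h(1) by (intro J_diff) simp_all
 hence "h0 * f \<in> J" by (simp add: algebra_simps)
 then obtain et :: "4 => 'a bipoly" where et: "!!s t u v a b c W.
  (!!r. bev (r * s) (r * t) u v (h0 * f) = a + r * b + r * r * c + r * r * r * poly W r) ==>
  a = 0 & b = 0 & c = (\<Sum>i\<in>UNIV. bev 0 0 u v (et i) * Phi (s, t, u, v) $ i)"
  by (rule J_coefficients) blast
 \<comment> \<open>\<open>h0\<close> depends on u and v alone, so comparing orders in r for the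
   element h0 f of \<open>J\<close> kills the parts of f of degree 0 and 1 in s, t.\<close>
 have low: "bev 0 0 u v h * bev 0 0 u v A0 = 0 & bev 0 0 u v h * (s * bev 0 0 u v A1 + t * bev 0 0 u v A2) = 0"
  for s t u v
 proof -
  obtain W where W: "\<forall>r. bev (r * s) (r * t) u v C3 = r * r * r * poly W r" using C3 by blast
  let ?h = "bev 0 0 u v h"
  have "bev (r * s) (r * t) u v (h0 * f) = ?h * bev 0 0 u v A0 + r * (?h * (s * bev 0 0 u v A1 + t * bev 0 0 u v A2)) +
   r * r * (?h * (s * s * bev 0 0 u v B1 + s * t * bev 0 0 u v B2 + t * t * bev 0 0 u v B3)) +
   r * r * r * poly (smult ?h W) r" for r
  proof -
   have "bev (r * s) (r * t) u v (h0 * f) = ?h * bev (r * s) (r * t) u v f" by (simp add: h0_def)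
   thus ?thesis unfolding fval using W by (simp add: distrib_left mult_ac)
  qed
  from et[OF this] show ?thesis by blast
 qed
 have "h0 * ?tha A0 = 0" "h0 * ?tha A1 = 0" "h0 * ?tha A2 = 0"
 proof -
  show "h0 * ?tha A0 = 0" by (rule bipoly_eqI) (use low in \<open>simp add: h0_def\<close>)
  have "bev 0 0 u v h * bev 0 0 u v A1 = 0" for u v using low[of u v 1 0] by simp
  thus "h0 * ?tha A1 = 0" by (intro bipoly_eqI) (simp add: h0_def)
  have "bev 0 0 u v h * bev 0 0 u v A2 = 0" for u v using low[of u v 0 1] by simp
  thus "h0 * ?tha A2 = 0" by (intro bipoly_eqI) (simp add: h0_def)
 qed
 hence A0: "?tha A0 = 0" "?tha A1 = 0" "?tha A2 = 0" using bipoly_mult_eq_0 h0 by blast+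
 have A: "bev 0 0 u v A0 = 0" "bev 0 0 u v A1 = 0" "bev 0 0 u v A2 = 0" for u v
  using A0 st_prime_iff[of A0] st_prime_iff[of A1] st_prime_iff[of A2] by (simp_all add: st_prime_def)
 \<comment> \<open>\<open>J\<close> vanishes at u = v = 0, so s f does, and hence f itself.\<close>
 have "bS * subst bS bT 0 0 f = 0" by (rule bipoly_eqI) (use J_vanish_uv[OF f(1)] in simp)
 moreover have "bS ~= (0 :: 'a bipoly)"
 proof
  assume "bS = (0 :: 'a bipoly)"
  hence "bev 1 0 0 0 bS = (0 :: 'a)" by simp
  thus False by simp
 qed
 ultimately have fz: "subst bS bT 0 0 f = 0" using bipoly_mult_eq_0 by blast
 have f00: "bev s t 0 0 f = 0" for s t
 proof -
  have "bev s t 0 0 (subst bS bT 0 0 f) = 0" unfolding fz by simp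
  thus ?thesis by simp
 qed
 have top: "s * s * bev 0 0 0 0 B1 + s * t * bev 0 0 0 0 B2 + t * t * bev 0 0 0 0 B3 = 0 & bev s t 0 0 C3 = 0" for s t
 proof -
  obtain W where W: "\<forall>r. bev (r * s) (r * t) 0 0 C3 = r * r * r * poly W r" using C3 by blast
  let ?b = "s * s * bev 0 0 0 0 B1 + s * t * bev 0 0 0 0 B2 + t * t * bev 0 0 0 0 B3"
  have "poly (pCons 0 (pCons 0 (pCons ?b W))) r = poly 0 r" for r
  proof -
   have "r * r * ?b + r * r * r * poly W r = 0"
    using fval[of r s t 0 0] f00[of "r * s" "r * t"] W A by simp
   thus ?thesis by (simp only: poly_pCons poly_0) algebra
  qed
  hence "pCons 0 (pCons 0 (pCons ?b W)) = 0" by (rule poly_fun_eqI)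
  hence "?b = 0" "W = 0" by auto
  thus ?thesis using W[rule_format, of 1] by simp
 qed
 have "vector [bev 0 0 0 0 B1, bev 0 0 0 0 B2, bev 0 0 0 0 B3] = (0 :: 'a^3)"
 proof (rule qf_eqI)
  fix s t show "qf (vector [bev 0 0 0 0 B1, bev 0 0 0 0 B2, bev 0 0 0 0 B3]) s t = qf 0 s t"
   using top[of s t] by (simp add: qf_def mult.commute)
 qed
 hence B0: "bev 0 0 0 0 B1 = 0" "bev 0 0 0 0 B2 = 0" "bev 0 0 0 0 B3 = 0" by (simp_all add: vec3_eq_iff)
 let ?mu = "subst bS bT 0 0 :: 'a bipoly => 'a bipoly"
 \<comment> \<open>Subtracting from each coefficient its value at u = v = 0 leaves the sum
   unchanged, as these values add up to zero. Each difference lies in the ideal of u and v, and its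
   product with a cubic monomial in s, t lies in \<open>J\<close>.\<close>
 have "(g1 - ?mu g1) * (bS * bS * bS) + (g2 - ?mu g2) * (bS * bS * bT) + (g3 - ?mu g3) * (bS * bT * bT) +
   (g4 - ?mu g4) * (bT * bT * bT) \<in> J"
  by (intro J_add) (rule cubic_mod[of _ "vector [1, 0, 0, 0]"], simp, rule cubic_mod[of _ "vector [0, 1, 0, 0]"], simp,
    rule cubic_mod[of _ "vector [0, 0, 1, 0]"], simp, rule cubic_mod[of _ "vector [0, 0, 0, 1]"], simp)
 moreover have "(g1 - ?mu g1) * (bS * bS * bS) + (g2 - ?mu g2) * (bS * bS * bT) + (g3 - ?mu g3) * (bS * bT * bT) +
   (g4 - ?mu g4) * (bT * bT * bT) = C3"
 proof (rule bipoly_eqI)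
  fix s t u v
  have "bev s t 0 0 C3 = 0" using top by blast
  hence "s * s * s * bev s t 0 0 g1 + s * s * t * bev s t 0 0 g2 + s * t * t * bev s t 0 0 g3 + t * t * t * bev s t 0 0 g4 = 0"
   by (simp add: C3_def)
  hence "(bev s t u v g1 - bev s t 0 0 g1) * (s * s * s) + (bev s t u v g2 - bev s t 0 0 g2) * (s * s * t) +
    (bev s t u v g3 - bev s t 0 0 g3) * (s * t * t) + (bev s t u v g4 - bev s t 0 0 g4) * (t * t * t) =
    s * s * s * bev s t u v g1 + s * s * t * bev s t u v g2 + s * t * t * bev s t u v g3 + t * t * t * bev s t u v g4"
   by algebra
  thus "bev s t u v ((g1 - ?mu g1) * (bS * bS * bS) + (g2 - ?mu g2) * (bS * bS * bT) + (g3 - ?mu g3) * (bS * bT * bT) +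
   (g4 - ?mu g4) * (bT * bT * bT)) = bev s t u v C3" by (simp add: C3_def)
 qed
 ultimately have C3J: "C3 \<in> J" by simp
 obtain a1 a2 a3 where e1: "vector [1, 0, 0] = a1 *s q + a2 *s y + a3 *s z" using indep3_span[OF qyz] by blast
 obtain b1 b2 b3 where e2: "vector [0, 1, 0] = b1 *s q + b2 *s y + b3 *s z" using indep3_span[OF qyz] by blast
 obtain c1 c2 c3 where e3: "vector [0, 0, 1] = c1 *s q + c2 *s y + c3 *s z" using indep3_span[OF qyz] by blast
 define D where "D x1 x2 x3 = bconst x1 * ?tha B1 + bconst x2 * ?tha B2 + bconst x3 * ?tha B3" for x1 x2 x3
 have Dinv: "?tha (D x1 x2 x3) = D x1 x2 x3" for x1 x2 x3 by (rule bipoly_eqI) (simp add: D_def)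
 \<comment> \<open>\<open>D\<close> vanishes at u = v = 0, so its product with q is a combination of
   q u and q v.\<close>
 have Dq: "D x1 x2 x3 * bqf q \<in> J" for x1 x2 x3
 proof -
  have Kq: "ideal.subspace {g. g * bqf q \<in> J}" by (rule ideal_colon_subspace[OF J0])
  have "D x1 x2 x3 - ?mu (D x1 x2 x3) \<in> {g. g * bqf q \<in> J}"
   by (rule subst_mod[OF Kq]) (use generators(1,2) ideal.subspace_0[OF J0] in \<open>simp_all add: mult.commute\<close>)
  moreover have "?mu (D x1 x2 x3) = 0" by (rule bipoly_eqI) (simp add: D_def B0)
  ultimately show ?thesis by simp
 qed
 have "f - (bqf y * D a2 b2 c2 + bqf z * D a3 b3 c3) = D a1 b1 c1 * bqf q + C3"
 proof (rule bipoly_eqI)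
  fix s t u v
  let ?q = "qf q s t" and ?y = "qf y s t" and ?z = "qf z s t"
  have st: "s * s = a1 * ?q + a2 * ?y + a3 * ?z" "s * t = b1 * ?q + b2 * ?y + b3 * ?z" "t * t = c1 * ?q + c2 * ?y + c3 * ?z"
   using arg_cong[OF e1, of "%x. qf x s t"] arg_cong[OF e2, of "%x. qf x s t"] arg_cong[OF e3, of "%x. qf x s t"]
   by (simp_all add: qf_def[of "vector _"])
  have fv: "bev s t u v f = s * s * bev 0 0 u v B1 + s * t * bev 0 0 u v B2 + t * t * bev 0 0 u v B3 + bev s t u v C3"
   using fval[of 1 s t u v] A by simp
  show "bev s t u v (f - (bqf y * D a2 b2 c2 + bqf z * D a3 b3 c3)) = bev s t u v (D a1 b1 c1 * bqf q + C3)"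
   unfolding bev_simps fv st by (simp add: D_def) algebra
 qed
 hence "f - (bqf y * D a2 b2 c2 + bqf z * D a3 b3 c3) \<in> J" using J_add[OF Dq C3J] by simp
 thus ?thesis by (rule that[OF _ Dinv Dinv])
qed

text \<open>For an embedded prime the annihilated element may be taken as y B + z C with B, C in u,
  v. The discriminant, here a square, annihilates it, so the prime contains s, t and the linear
  form. An element beyond these would force (B, C) into the row module of the matrix of linear
  forms, hence the annihilated element into \<open>J\<close>.\<close>

theorem double_root_embedded:
 assumes D: "lmul l1 l4 - lmul l2 l3 = lmul (vector [b, - a]) (vector [b, - a])"
 shows "embedded_primes J \<subseteq> {point_prime a b}"
proof
 fix P assume "P \<in> embedded_primes J"
 then obtain f f' Q where P: "prime_ideal P" "P = {g. g * f \<in> J}" and Q: "prime_ideal Q" "Q = {g. g * f' \<in> J}" "Q \<subset> P"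
  unfolding embedded_primes_def associated_primes_def by blast
 have JQ: "J \<subseteq> Q" unfolding Q(2) using J_mult' by blast
 have Ps: "ideal.subspace P" using P(1) unfolding prime_ideal_def by blast
 have Qs: "ideal.subspace Q" using Q(1) unfolding prime_ideal_def by blast
 have st: "bS \<in> P" "bT \<in> P" using embedded_contains_st[OF P Q(1) JQ Q(3)] by blast+
 have ab: "nz a b"
 proof (rule ccontr)
  assume "\<not> ?thesis"
  hence "lmul (vector [b, - a]) (vector [b, - a]) = (0 :: 'a^3)" by (simp add: lmul_def vec3_eq_iff)
  thus False using D disc_nz by simp
 qed
 let ?l = "blf (vector [b, - a]) :: 'a bipoly"
 have disc: "bdisc = ?l * ?l"
 proof (rule bipoly_eqI)
  fix s t u v
  have "qf (lmul l1 l4 - lmul l2 l3) u v = disc u v" by (simp add: disc_def)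
  thus "bev s t u v bdisc = bev s t u v (?l * ?l)" unfolding D by simp
 qed
 \<comment> \<open>Either \<open>Q\<close> contains s and t, and then \<open>P\<close> is strictly
   larger than \<open>st_prime\<close>; or \<open>Q\<close> contains u, which is outside
   \<open>st_prime\<close>.\<close>
 obtain h where h: "h \<in> P" "h \<notin> st_prime"
 proof (cases "bS \<in> Q & bT \<in> Q")
  case True
  hence "st_prime \<subseteq> Q" using st_prime_subset[OF Qs] by blast
  thus ?thesis using that Q(3) by blast
 next
  case False
  hence "bU \<in> P" using st_or_uv[OF Q(1) JQ] Q(3) by blast
  moreover have "bU \<notin> (st_prime :: 'a bipoly set)" by (auto simp: st_prime_def intro: exI[of _ 1])
  ultimately show ?thesis by (rule that)
 qed
 have "bS * f \<in> J" "bT * f \<in> J" "h * f \<in> J" using st h(1) unfolding P(2) by blast+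
 then obtain B C where BC: "f - (bqf y * B + bqf z * C) \<in> J" "subst 0 0 bU bV B = B" "subst 0 0 bU bV C = C"
  using annihilated_normal_form h(2) by blast
 let ?f = "bqf y * B + bqf z * C"
 have PP: "g * ?f \<in> J" if "g \<in> P" for g
 proof -
  have "g * f \<in> J" using that P(2) by blast
  hence "g * f - g * (f - ?f) \<in> J" by (rule J_diff[OF _ J_mult[OF BC(1)]])
  thus ?thesis by (simp add: algebra_simps)
 qed
 have PP': "g \<in> P" if "g * ?f \<in> J" for g
 proof -
  have "g * ?f + g * (f - ?f) \<in> J" by (rule J_add[OF that J_mult[OF BC(1)]])
  hence "g * f \<in> J" by (simp add: algebra_simps)
  thus ?thesis using P(2) by blast
 qed
 have "bdisc \<in> P"
 proof (rule PP')
  have "B * (bqf y * bdisc) + C * (bqf z * bdisc) \<in> J" by (intro J_add J_mult disc_mult)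
  thus "bdisc * ?f \<in> J" by (simp add: algebra_simps)
 qed
 hence "?l \<in> P" using P(1) unfolding disc prime_ideal_def by blast
 hence sub: "point_prime a b \<subseteq> P" by (rule point_prime_subset[OF Ps st _ ab])
 have "P \<subseteq> point_prime a b"
 proof (rule ccontr)
  assume "\<not> P \<subseteq> point_prime a b"
  then obtain g where g: "g \<in> P" "g \<notin> point_prime a b" by blast
  define G where "G = subst 0 0 bU bV g"
  have G: "G \<notin> point_prime a b" using g(2) by (simp add: G_def point_prime_def)
  have Binv: "bev s t u v B = bev 0 0 u v B" "bev s t u v C = bev 0 0 u v C" for s t u v
  proof -
   have "bev s t u v (subst 0 0 bU bV B) = bev 0 0 u v B" "bev s t u v (subst 0 0 bU bV C) = bev 0 0 u v C" by simp_all
   thus "bev s t u v B = bev 0 0 u v B" "bev s t u v C = bev 0 0 u v C" unfolding BC(2,3) .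
  qed
  have "bev (r * s) (r * t) u v ?f = r * r * bev s t u v ?f" for r s t u v
   using Binv[of s t u v] Binv[of "r * s" "r * t" u v] by (simp add: qf_homogeneous distrib_left mult.assoc)
  then obtain et :: "4 => 'a bipoly" where
   et: "!!s t u v. bev 0 0 u v g * bev s t u v ?f = (\<Sum>i\<in>UNIV. bev 0 0 u v (et i) * Phi (s, t, u, v) $ i)"
   using J_leading[OF PP[OF g(1)]] by blast
  have eq: "bev 0 0 u v g * bev 0 0 u v B * qf y s t + bev 0 0 u v g * bev 0 0 u v C * qf z s t =
    (\<Sum>i\<in>UNIV. bev 0 0 u v (et i) * Phi (s, t, u, v) $ i)" for s t u v
   unfolding et[symmetric] using Binv[of s t u v] by (simp add: distrib_left mult_ac)
  define b3 where "b3 = subst 0 0 bU bV (et 3)"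
  define b4 where "b4 = subst 0 0 bU bV (et 4)"
  have GB: "G * B = b3 * blf l1 + b4 * blf l3" "G * C = b3 * blf l2 + b4 * blf l4"
  proof -
   have "bev s t u v (G * B) = bev s t u v (b3 * blf l1 + b4 * blf l3)"
    "bev s t u v (G * C) = bev s t u v (b3 * blf l2 + b4 * blf l4)" for s t u v
    using coordinates[OF eq[of u v]] Binv[of s t u v] by (simp_all add: G_def b3_def b4_def)
   thus "G * B = b3 * blf l1 + b4 * blf l3" "G * C = b3 * blf l2 + b4 * blf l4"
    by (blast intro: bipoly_eqI)+
  qed
  \<comment> \<open>Cramer's rule for (B, C) as a combination of the rows. Dividing both numerators
    by the square of the linear form gives polynomial coefficients.\<close>
  let ?N3 = "B * blf l4 - C * blf l3" and ?N4 = "C * blf l1 - B * blf l2"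
  have "G * ?N3 = G * B * blf l4 - G * C * blf l3" "G * ?N4 = G * C * blf l1 - G * B * blf l2"
   by (simp_all add: algebra_simps)
  hence N: "G * ?N3 = b3 * (?l * ?l)" "G * ?N4 = b4 * (?l * ?l)"
   unfolding GB disc[symmetric] bdisc_def by (simp_all add: algebra_simps)
  have inv: "subst 0 0 bU bV ?N3 = ?N3" "subst 0 0 bU bV ?N4 = ?N4"
  proof -
   have "bev s t u v (subst 0 0 bU bV ?N3) = bev s t u v ?N3"
    "bev s t u v (subst 0 0 bU bV ?N4) = bev s t u v ?N4" for s t u v
    using Binv[of s t u v] by simp_all
   thus "subst 0 0 bU bV ?N3 = ?N3" "subst 0 0 bU bV ?N4 = ?N4" by (blast intro: bipoly_eqI)+
  qed
  obtain n3 where n3: "?N3 = ?l * ?l * n3" by (rule divide_root_twice[OF inv(1) N(1) G ab])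
  obtain n4 where n4: "?N4 = ?l * ?l * n4" by (rule divide_root_twice[OF inv(2) N(2) G ab])
  have "bdisc * B = blf l1 * ?N3 + blf l3 * ?N4" "bdisc * C = blf l2 * ?N3 + blf l4 * ?N4"
   unfolding bdisc_def by (simp_all add: algebra_simps)
  hence "bdisc * (B - (n3 * blf l1 + n4 * blf l3)) = 0" "bdisc * (C - (n3 * blf l2 + n4 * blf l4)) = 0"
   unfolding n3 n4 disc by (simp_all add: algebra_simps)
  hence "B - (n3 * blf l1 + n4 * blf l3) = 0" "C - (n3 * blf l2 + n4 * blf l4) = 0"
   using bipoly_mult_eq_0 bdisc_nz by blast+
  hence "B = n3 * blf l1 + n4 * blf l3" "C = n3 * blf l2 + n4 * blf l4" by simp_all
  hence "?f = n3 * (bqf y * blf l1 + bqf z * blf l2) + n4 * (bqf y * blf l3 + bqf z * blf l4)"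
   by (simp add: algebra_simps)
  hence "?f \<in> J" using J_add[OF J_mult[OF generators(3)] J_mult[OF generators(4)]] by simp
  hence "1 \<in> P" by (intro PP') simp
  thus False using P(1) unfolding prime_ideal_def by blast
 qed
 thus "P \<in> {point_prime a b}" using sub by blast
qed

end

section \<open>Syzygies read off from a minimal free resolution\<close>

lemma bidegree_add: "bidegree (m + n) = bidegree m + bidegree n"
 by (simp add: bidegree_def lookup_add)

lemma bidegree_eq_0: "bidegree m = (0, 0) ==> m = 0"
 by (rule bvar_mon_eqI) (simp_all add: bidegree_def)

lemma bigraded_single: "bidegree m = (a, b) ==> single m c \<in> bigraded_piece a b"
 by (simp add: bigraded_piece_def)

lemma bigraded_add: "f \<in> bigraded_piece a b ==> g \<in> bigraded_piece a b ==> f + g \<in> bigraded_piece a b"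
 unfolding bigraded_piece_def using Poly_Mapping.keys_add[of f g] by blast

lemma bigraded_uminus: "f \<in> bigraded_piece a b ==> - f \<in> bigraded_piece a b"
 by (simp add: bigraded_piece_def in_keys_iff)

lemma bigraded_sum: "(!!i. i \<in> A ==> f i \<in> bigraded_piece a b) ==> (\<Sum>i\<in>A. f i) \<in> bigraded_piece a b"
 by (induction A rule: infinite_finite_induct) (simp_all add: bigraded_add, simp_all add: bigraded_piece_def)

lemma bigraded_bconst:
 assumes "f \<in> bigraded_piece a b"
 shows "f * bconst c \<in> bigraded_piece a b"
proof -
 have "keys (f * bconst c) \<subseteq> {k + l | k l. k \<in> keys f & l \<in> keys (bconst c)}"
  using Poly_Mapping.keys_mult[of f "bconst c"] by blast
 moreover have "l = 0" if "l \<in> keys (bconst c)" for l :: "bvar \<Rightarrow>\<^sub>0 nat"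
  using that by (auto simp: bconst_def split: if_splits)
 ultimately show ?thesis using assms unfolding bigraded_piece_def by fastforce
qed

text \<open>Compare components of bidegree (a, b). The hypothesis on \<open>gam\<close> excludes
  columns of smaller bidegree, and a column of the exact bidegree contributes through the constant
  term of its multiplier. The shift (d1, d2) is the bidegree of the row.\<close>

lemma degree_part:
 fixes f :: "'k::field bipoly"
 assumes C: "finite C" and f: "f \<in> bigraded_piece a b" "f = (\<Sum>c\<in>C. D c * x c)"
  and D: "!!c m. c \<in> C ==> m \<in> keys (D c) ==> bidegree m + (d1, d2) = gam c"
  and gam: "!!c. c \<in> C ==> fst (gam c) \<le> a + d1 ==> snd (gam c) \<le> b + d2 ==>
    gam c = (a + d1, b + d2)"
 shows "f = (\<Sum>c\<in>{c \<in> C. gam c = (a + d1, b + d2)}. D c * bconst (lookup (x c) 0))"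
proof -
 define y where "y c = (if gam c = (a + d1, b + d2) then bconst (lookup (x c) 0) else 0)" for c
 define E where "E = (\<Sum>c\<in>C. D c * (x c - y c))"
 have E: "f - (\<Sum>c\<in>C. D c * y c) = E"
  unfolding f(2) E_def by (simp add: sum_subtractf[symmetric] right_diff_distrib)
 have "E \<in> bigraded_piece a b"
 proof -
  have "(\<Sum>c\<in>C. D c * y c) \<in> bigraded_piece a b"
  proof (rule bigraded_sum)
   fix c assume c: "c \<in> C"
   show "D c * y c \<in> bigraded_piece a b"
   proof (cases "gam c = (a + d1, b + d2)")
    case True
    hence "D c \<in> bigraded_piece a b" using D[OF c] by (auto simp: bigraded_piece_def plus_prod_def prod_eq_iff)
    thus ?thesis using True by (simp add: y_def bigraded_bconst)
   qed (simp add: y_def bigraded_piece_def)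
  qed
  thus ?thesis unfolding E[symmetric] using bigraded_add[OF f(1) bigraded_uminus] by fastforce
 qed
 moreover have "bidegree m ~= (a, b)" if mE: "m \<in> keys E" for m
 proof
  assume m: "bidegree m = (a, b)"
  obtain c where c: "c \<in> C" "m \<in> keys (D c * (x c - y c))"
   using mE Poly_Mapping.keys_sum[of "%c. D c * (x c - y c)" C] unfolding E_def by blast
  then obtain k l where kl: "m = k + l" "k \<in> keys (D c)" "l \<in> keys (x c - y c)"
   using Poly_Mapping.keys_mult[of "D c" "x c - y c"] by blast
  have "(a, b) + (d1, d2) = gam c + bidegree l" unfolding D[OF c(1) kl(2), symmetric] m[symmetric] kl(1) bidegree_add by (simp add: add_ac)
  hence ab: "a + d1 = fst (gam c) + fst (bidegree l)" "b + d2 = snd (gam c) + snd (bidegree l)"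
   by (simp_all add: plus_prod_def)
  hence gamc: "gam c = (a + d1, b + d2)" using gam[OF c(1)] by simp
  hence "l = 0" using ab by (intro bidegree_eq_0) (simp add: prod_eq_iff)
  hence "lookup (x c - y c) 0 ~= 0" using kl(3) by (simp add: in_keys_iff)
  thus False using gamc by (simp add: y_def bconst_def lookup_minus)
 qed
 ultimately have "keys E = {}" unfolding bigraded_piece_def by blast
 hence "E = 0" by simp
 hence "f = (\<Sum>c\<in>C. D c * y c)" using E by simp
 also have "\<dots> = (\<Sum>c\<in>{c \<in> C. gam c = (a + d1, b + d2)}. D c * bconst (lookup (x c) 0))"
  unfolding y_def by (rule sum.mono_neutral_cong_right) (use C in auto)
 finally show ?thesis .
qed

definition nat_of_4 :: "4 => nat" where
 "nat_of_4 i = (if i = 1 then 0 else if i = 2 then 1 else if i = 3 then 2 else 3)"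

definition vec_of_4 :: "(4 => 'a::zero) => nat => 'a" where
 "vec_of_4 h n = (if n = 0 then h 1 else if n = 1 then h 2 else if n = 2 then h 3 else if n = 3 then h 4 else 0)"

lemma sum_less_4: "(\<Sum>j<4. f j) = (\<Sum>i\<in>UNIV. f (nat_of_4 i))"
 by (simp add: sum_4 nat_of_4_def numeral_eq_Suc)

lemma nat_of_4_less: "nat_of_4 i < 4" by (simp add: nat_of_4_def)

lemma vec_of_4_nat [simp]: "vec_of_4 h (nat_of_4 i) = h i"
 using exhaust_4[of i] by (auto simp: vec_of_4_def nat_of_4_def)

lemma nat_of_4_surj: "n < 4 ==> \<exists>i. n = nat_of_4 i"
proof -
 assume "n < 4"
 hence "n = nat_of_4 1 | n = nat_of_4 2 | n = nat_of_4 3 | n = nat_of_4 4"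
  by (simp add: nat_of_4_def) linarith
 thus ?thesis by blast
qed

text \<open>The portion of a minimal resolution that determines small syzygies: the generators in
  bidegree (2,1), the columns \<open>D\<close> with their bidegrees, generation of all syzygies by
  these columns, and their independence over the field.\<close>

definition presentation ::
 "'k::field bipoly set => (nat \<times> nat) list => (4 => 'k bipoly) => (4 => nat => 'k bipoly) => bool" where
 "presentation I L e D \<longleftrightarrow>
  (\<forall>i. e i \<in> bigraded_piece 2 1) & I = {\<Sum>i\<in>UNIV. e i * h i | h. True} &
  (\<forall>r c m. c < length L --> m \<in> keys (D r c) --> bidegree m + (2, 1) = L ! c) &
  (\<forall>h. (\<Sum>i\<in>UNIV. e i * h i) = 0 --> (\<exists>x. \<forall>r. h r = (\<Sum>c<length L. D r c * x c))) &
  (\<forall>c<length L. (\<Sum>i\<in>UNIV. e i * D i c) = 0) &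
  (\<forall>a c. (\<forall>r. (\<Sum>c<length L. D r c * bconst (a c)) = 0) --> c < length L --> a c = 0)"

lemma resolution_presentation:
 fixes I :: "'k::field bipoly set"
 assumes res: "is_minimal_free_resolution I (replicate 4 (2, 1) # L # M) d"
 shows "\<exists>e D. presentation I L e D"
proof -
 let ?F = "replicate 4 (2, 1) # L # M"
 let ?n3 = "res_rank ?F 3"
 have r0: "res_rank ?F 0 = 1" and r1: "res_rank ?F 1 = 4" and r2: "res_rank ?F 2 = length L"
  by (simp_all add: res_rank_def res_module_def numeral_2_eq_2)
 have m0: "res_module ?F 0 = [(0, 0)]" and m1: "res_module ?F 1 = replicate 4 (2, 1)" and m2: "res_module ?F 2 = L"
  by (simp_all add: res_module_def numeral_2_eq_2)
 note r = res[unfolded is_minimal_free_resolution_def]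
 have deg: "!!i a b m. a < res_rank ?F i ==> b < res_rank ?F (Suc i) ==> m \<in> keys (d i a b) ==>
   bidegree m + res_module ?F i ! a = res_module ?F (Suc i) ! b" using r by blast
 have img: "(%x. mat_apply (res_rank ?F 0) (res_rank ?F 1) (d 0) x 0) ` free_vecs (res_rank ?F 1) = I"
  using r by blast
 have ex: "!!i. {x \<in> free_vecs (res_rank ?F (Suc i)). mat_apply (res_rank ?F i) (res_rank ?F (Suc i)) (d i) x = (%_. 0)} =
   mat_apply (res_rank ?F (Suc i)) (res_rank ?F (Suc (Suc i))) (d (Suc i)) ` free_vecs (res_rank ?F (Suc (Suc i)))"
  using r by blast
 have min: "!!i a b. 1 \<le> i ==> a < res_rank ?F i ==> b < res_rank ?F (Suc i) ==> lookup (d i a b) 0 = 0"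
  using r by blast
 have ex0: "{x \<in> free_vecs 4. mat_apply 1 4 (d 0) x = (%_. 0)} = mat_apply 4 (length L) (d 1) ` free_vecs (length L)"
  using ex[of 0] r0 r1 r2 by (simp add: numeral_2_eq_2)
 have ex1: "{x \<in> free_vecs (length L). mat_apply 4 (length L) (d 1) x = (%_. 0)} = mat_apply (length L) ?n3 (d 2) ` free_vecs ?n3"
  using ex[of 1] r0 r1 r2 by (simp add: numeral_2_eq_2 numeral_3_eq_3)
 define e where "e i = d 0 0 (nat_of_4 i)" for i
 define D where "D i c = d 1 (nat_of_4 i) c" for i c
 have app0: "mat_apply 1 4 (d 0) x = (%_. 0) \<longleftrightarrow> (\<Sum>i\<in>UNIV. e i * x (nat_of_4 i)) = 0" for x
 proof -
  have "mat_apply 1 4 (d 0) x = (%_. 0) \<longleftrightarrow> mat_apply 1 4 (d 0) x 0 = 0"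
   by (auto simp: mat_apply_def fun_eq_iff)
  thus ?thesis by (simp add: mat_apply_def sum_less_4 e_def)
 qed
 have app0': "mat_apply 1 4 (d 0) x 0 = (\<Sum>i\<in>UNIV. e i * x (nat_of_4 i))" for x
  by (simp add: mat_apply_def sum_less_4 e_def)
 have vf: "vec_of_4 h \<in> free_vecs 4" for h :: "4 => 'k bipoly"
  by (simp add: free_vecs_def vec_of_4_def)
 have "presentation I L e D" unfolding presentation_def
 proof (intro conjI allI impI)
  show "e i \<in> bigraded_piece 2 1" for i unfolding bigraded_piece_def e_def
  proof (intro CollectI ballI)
   fix m assume "m \<in> keys (d 0 0 (nat_of_4 i))"
   thus "bidegree m = (2, 1)"
    using deg[of 0 0 "nat_of_4 i" m, folded One_nat_def] nat_of_4_less[of i]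
    unfolding r0 r1 m0 m1 by (simp add: zero_prod_def[symmetric] del: One_nat_def)
  qed
  show "I = {\<Sum>i\<in>UNIV. e i * h i | h. True}"
  proof (intro equalityI subsetI)
   fix x assume "x \<in> I"
   then obtain y where "x = mat_apply 1 4 (d 0) y 0" using img r0 r1 by auto
   thus "x \<in> {\<Sum>i\<in>UNIV. e i * h i | h. True}"
    unfolding app0' by (intro CollectI exI[of _ "%i. y (nat_of_4 i)"]) simp
  next
   fix x assume "x \<in> {\<Sum>i\<in>UNIV. e i * h i | h. True}"
   then obtain h where "x = (\<Sum>i\<in>UNIV. e i * h i)" by blast
   hence "x = mat_apply 1 4 (d 0) (vec_of_4 h) 0" unfolding app0' by simp
   thus "x \<in> I" using img r0 r1 vf by auto
  qed
  show "bidegree m + (2, 1) = L ! c" if "c < length L" "m \<in> keys (D r c)" for r c m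
   using deg[of "nat_of_4 r" 1 c m] that nat_of_4_less[of r] r1 r2 m1 m2 unfolding D_def
   by (simp add: numeral_2_eq_2)
  show "\<exists>x. \<forall>r. h r = (\<Sum>c<length L. D r c * x c)" if "(\<Sum>i\<in>UNIV. e i * h i) = 0" for h
  proof -
   have "vec_of_4 h \<in> {x \<in> free_vecs 4. mat_apply 1 4 (d 0) x = (%_. 0)}" using vf that app0[of "vec_of_4 h"] by simp
   then obtain x where "vec_of_4 h = mat_apply 4 (length L) (d 1) x" unfolding ex0 by blast
   hence "vec_of_4 h (nat_of_4 r) = mat_apply 4 (length L) (d 1) x (nat_of_4 r)" for r by simp
   hence "h r = (\<Sum>c<length L. D r c * x c)" for r by (simp add: mat_apply_def nat_of_4_less D_def)
   thus ?thesis by blast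
  qed
  show "(\<Sum>i\<in>UNIV. e i * D i c) = 0" if c: "c < length L" for c
  proof -
   define x :: "nat => 'k bipoly" where "x = (%i. if i = c then 1 else 0)"
   have "x \<in> free_vecs (length L)" using c by (auto simp: free_vecs_def x_def)
   hence "mat_apply 4 (length L) (d 1) x \<in> {x \<in> free_vecs 4. mat_apply 1 4 (d 0) x = (%_. 0)}"
    unfolding ex0 by blast
   hence "(\<Sum>i\<in>UNIV. e i * mat_apply 4 (length L) (d 1) x (nat_of_4 i)) = 0"
    unfolding app0[symmetric] by blast
   moreover have "mat_apply 4 (length L) (d 1) x (nat_of_4 i) = D i c" for i
    using c by (simp add: mat_apply_def nat_of_4_less D_def x_def if_distrib sum.delta cong: if_cong)
   ultimately show ?thesis by simp
  qed
  \<comment> \<open>A constant relation between the columns is a kernel vector with constant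
    entries, hence in the image of the next differential; minimality says that such an image has no
    constant terms.\<close>
  show "a c = 0" if z: "\<forall>r. (\<Sum>c<length L. D r c * bconst (a c)) = 0" and c: "c < length L" for a c
  proof -
   define x where "x = (%i. if i < length L then bconst (a i) else 0)"
   have "mat_apply 4 (length L) (d 1) x n = 0" for n
   proof (cases "n < 4")
    case True
    then obtain r where "n = nat_of_4 r" using nat_of_4_surj by blast
    moreover have "(\<Sum>c<length L. D r c * x c) = (\<Sum>c<length L. D r c * bconst (a c))"
     by (rule sum.cong) (simp_all add: x_def)
    ultimately show ?thesis using z True by (simp add: mat_apply_def D_def)
   qed (simp add: mat_apply_def)
   hence "x \<in> {x \<in> free_vecs (length L). mat_apply 4 (length L) (d 1) x = (%_. 0)}"
    by (auto simp: free_vecs_def x_def)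
   then obtain w where "x = mat_apply (length L) ?n3 (d 2) w" unfolding ex1 by blast
   hence "bconst (a c) = (\<Sum>j<?n3. d 2 c j * w j)" using c by (simp add: x_def mat_apply_def fun_eq_iff) metis
   hence "a c = lookup (\<Sum>j<?n3. d 2 c j * w j) 0" by (metis bconst_def lookup_single_eq)
   also have "\<dots> = (\<Sum>j<?n3. lookup (d 2 c j * w j) 0)" by (rule lookup_sum)
   also have "\<dots> = 0"
   proof (rule sum.neutral, rule ballI)
    fix j assume "j \<in> {..<?n3}"
    hence z: "lookup (d 2 c j) 0 = 0" using min[of 2 c j] c r2 by (simp add: numeral_3_eq_3)
    show "lookup (d 2 c j * w j) 0 = 0"
    proof (rule ccontr)
     assume "\<not> ?thesis"
     hence "0 \<in> keys (d 2 c j * w j)" by (simp add: in_keys_iff)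
     then obtain k l where "0 = k + l" "k \<in> keys (d 2 c j)"
      using Poly_Mapping.keys_mult[of "d 2 c j" "w j"] by blast
     moreover from this have "bidegree k + bidegree l = bidegree 0" by (metis bidegree_add)
     hence "bidegree k = (0, 0)" by (simp add: bidegree_def)
     ultimately have "0 \<in> keys (d 2 c j)" using bidegree_eq_0 by blast
     thus False using z by (simp add: in_keys_iff)
    qed
   qed
   finally show ?thesis .
  qed
 qed
 thus ?thesis by blast
qed

section \<open>Syzygies as vectors of forms of small bidegree\<close>

definition h01 :: "'k::field^4 => 'k^4 => 4 => 'k bipoly" where
 "h01 c d i = single (single Var_u 1) (c $ i) +
  single (single Var_v 1) (d $ i)"

definition h10 :: "'k::field^4 => 'k^4 => 4 => 'k bipoly" where
 "h10 c d i = single (single Var_s 1) (c $ i) +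
  single (single Var_t 1) (d $ i)"

definition h02 :: "'k::field^4 => 'k^4 => 'k^4 => 4 => 'k bipoly" where
 "h02 c d e i = single (single Var_u 2) (c $ i) +
  single (single Var_u 1 + single Var_v 1) (d $ i) +
  single (single Var_v 2) (e $ i)"

lemma bev_h [simp]:
 "bev s t u v (h01 c d i) = c $ i * u + d $ i * v"
 "bev s t u v (h10 c d i) = c $ i * s + d $ i * t"
 "bev s t u v (h02 c d e i) = c $ i * (u * u) + d $ i * (u * v) + e $ i * (v * v)"
 by (simp_all add: h01_def h10_def h02_def bev_single lookup_single lookup_add power2_eq_square)

lemma bigraded_h:
 "h01 c d i \<in> bigraded_piece 0 1" "h10 c d i \<in> bigraded_piece 1 0" "h02 c d e i \<in> bigraded_piece 0 2"
 unfolding h01_def h10_def h02_def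
 by (intro bigraded_add bigraded_single; simp add: bidegree_def lookup_single lookup_add)+

lemma bigraded_01_cases:
 fixes h :: "4 => 'k::alg_closed_field bipoly"
 assumes "!!i. h i \<in> bigraded_piece 0 1"
 obtains c d where "h = h01 c d"
proof -
 have "\<exists>a b. \<forall>s t u v. bev s t u v (h i) = a * u + b * v" for i
  by (rule bform_01[OF bform_bev[OF assms[of i]]]) auto
 then obtain a b where ab: "!!i s t u v. bev s t u v (h i) = a i * u + b i * v" by metis
 have "h i = h01 (\<chi> i. a i) (\<chi> i. b i) i" for i by (rule bipoly_eqI) (simp add: ab)
 hence "h = h01 (\<chi> i. a i) (\<chi> i. b i)" by (rule ext)
 thus ?thesis by (rule that)
qed

lemma bigraded_10_cases:
 fixes h :: "4 => 'k::alg_closed_field bipoly"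
 assumes "!!i. h i \<in> bigraded_piece 1 0"
 obtains c d where "h = h10 c d"
proof -
 have "\<exists>a b. \<forall>s t u v. bev s t u v (h i) = a * s + b * t" for i
  by (rule bform_10[OF bform_bev[OF assms[of i]]]) auto
 then obtain a b where ab: "!!i s t u v. bev s t u v (h i) = a i * s + b i * t" by metis
 have "h i = h10 (\<chi> i. a i) (\<chi> i. b i) i" for i by (rule bipoly_eqI) (simp add: ab)
 hence "h = h10 (\<chi> i. a i) (\<chi> i. b i)" by (rule ext)
 thus ?thesis by (rule that)
qed

lemma bigraded_02_cases:
 fixes h :: "4 => 'k::alg_closed_field bipoly"
 assumes "!!i. h i \<in> bigraded_piece 0 2"
 obtains c d e where "h = h02 c d e"
proof -
 have "\<exists>a b c. \<forall>s t u v. bev s t u v (h i) = a * (u * u) + b * (u * v) + c * (v * v)" for i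
  by (rule bform_02[OF bform_bev[OF assms[of i]]]) auto
 then obtain a b c where ab: "!!i s t u v. bev s t u v (h i) = a i * (u * u) + b i * (u * v) + c i * (v * v)" by metis
 have "h i = h02 (\<chi> i. a i) (\<chi> i. b i) (\<chi> i. c i) i" for i by (rule bipoly_eqI) (simp add: ab)
 hence "h = h02 (\<chi> i. a i) (\<chi> i. b i) (\<chi> i. c i)" by (rule ext)
 thus ?thesis by (rule that)
qed

lemma bipoly_zero_iff: "f = 0 \<longleftrightarrow> (\<forall>s t u v. bev s t u v f = 0)" for f :: "'k::alg_closed_field bipoly"
 using bipoly_zeroI by auto

lemma quadratic_form_zero:
 fixes a b c :: "'k::alg_closed_field"
 assumes "!!u v. a * (u * u) + b * (u * v) + c * (v * v) = 0"
 shows "a = 0" "b = 0" "c = 0" using assms[of 1 0] assms[of 0 1] assms[of 1 1] by auto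

lemma cubic_form_zero:
 fixes a b c d :: "'k::alg_closed_field"
 assumes "!!s t. a * (s * s * s) + b * (s * s * t) + c * (s * t * t) + d * (t * t * t) = 0"
 shows "a = 0" "b = 0" "c = 0" "d = 0"
proof -
 have "[:d, c, b, a:] = 0"
 proof (rule poly_fun_eqI)
  fix r show "poly [:d, c, b, a:] r = poly 0 r" using assms[of r 1] by (simp add: algebra_simps)
 qed
 thus "a = 0" "b = 0" "c = 0" "d = 0" by auto
qed

context form_space
begin

lemma syz01_iff: "syz01 c d \<longleftrightarrow> (\<forall>s t u v. u * vdot c (Phi (s, t, u, v)) + v * vdot d (Phi (s, t, u, v)) = 0)"
proof
 assume "syz01 c d"
 then obtain q where q: "is_coord c 0 q" "is_coord d (- q) 0" unfolding syz01_def by blast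
 show "\<forall>s t u v. u * vdot c (Phi (s, t, u, v)) + v * vdot d (Phi (s, t, u, v)) = 0"
  unfolding vdot_Phi[OF q(1)] vdot_Phi[OF q(2)] by (simp add: algebra_simps)
next
 assume z: "\<forall>s t u v. u * vdot c (Phi (s, t, u, v)) + v * vdot d (Phi (s, t, u, v)) = 0"
 define a where "a = c v* A" define b where "b = c v* B"
 define a' where "a' = d v* A" define b' where "b' = d v* B"
 have "qf a s t * (u * u) + qf (b + a') s t * (u * v) + qf b' s t * (v * v) = 0" for s t u v
  using z[rule_format, of u s t v] unfolding vdot_Phi[OF is_coord_self] a_def b_def a'_def b'_def
  by (simp add: algebra_simps)
 from quadratic_form_zero[OF this] have "qf a s t = qf 0 s t" "qf (b + a') s t = qf 0 s t" "qf b' s t = qf 0 s t" for s t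
  by simp_all
 hence "a = 0" "b + a' = 0" "b' = 0" by (blast intro: qf_eqI)+
 hence "is_coord c 0 b" "is_coord d (- b) 0"
  unfolding is_coord_def a_def b_def a'_def b'_def by (simp_all add: eq_neg_iff_add_eq_0 add.commute)
 thus "syz01 c d" unfolding syz01_def by blast
qed

lemma syz02_iff: "syz02 c d e \<longleftrightarrow> (\<forall>s t u v. (u * u) * vdot c (Phi (s, t, u, v)) + (u * v) * vdot d (Phi (s, t, u, v)) +
  (v * v) * vdot e (Phi (s, t, u, v)) = 0)"
proof
 assume "syz02 c d e"
 then obtain a b where q: "is_coord c 0 a" "is_coord d (- a) (- b)" "is_coord e b 0" unfolding syz02_def by blast
 show "\<forall>s t u v. (u * u) * vdot c (Phi (s, t, u, v)) + (u * v) * vdot d (Phi (s, t, u, v)) +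
  (v * v) * vdot e (Phi (s, t, u, v)) = 0"
  unfolding vdot_Phi[OF q(1)] vdot_Phi[OF q(2)] vdot_Phi[OF q(3)] by (simp add: algebra_simps)
next
 assume z: "\<forall>s t u v. (u * u) * vdot c (Phi (s, t, u, v)) + (u * v) * vdot d (Phi (s, t, u, v)) +
  (v * v) * vdot e (Phi (s, t, u, v)) = 0"
 define a1 where "a1 = c v* A" define b1 where "b1 = c v* B"
 define a2 where "a2 = d v* A" define b2 where "b2 = d v* B"
 define a3 where "a3 = e v* A" define b3 where "b3 = e v* B"
 have "qf a1 s t * (u * u * u) + qf (b1 + a2) s t * (u * u * v) + qf (b2 + a3) s t * (u * v * v) + qf b3 s t * (v * v * v) = 0"
  for s t u v
  using z[rule_format, of u s t v] unfolding vdot_Phi[OF is_coord_self] a1_def b1_def a2_def b2_def a3_def b3_def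
  by (simp add: algebra_simps)
 from cubic_form_zero[OF this] have "qf a1 s t = qf 0 s t" "qf (b1 + a2) s t = qf 0 s t" "qf (b2 + a3) s t = qf 0 s t"
  "qf b3 s t = qf 0 s t" for s t by simp_all
 hence "a1 = 0" "b1 + a2 = 0" "b2 + a3 = 0" "b3 = 0" by (blast intro: qf_eqI)+
 hence "is_coord c 0 b1" "is_coord d (- b1) (- a3)" "is_coord e a3 0"
  unfolding is_coord_def a1_def b1_def a2_def b2_def a3_def b3_def by (simp_all add: eq_neg_iff_add_eq_0 add.commute)
 thus "syz02 c d e" unfolding syz02_def by blast
qed

lemma syz10_iff: "syz10 c d \<longleftrightarrow> (\<forall>s t u v. s * vdot c (Phi (s, t, u, v)) + t * vdot d (Phi (s, t, u, v)) = 0)"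
proof
 assume "syz10 c d"
 then obtain g h :: "'k^2" where q: "is_coord c (vector [0, g $ 1, g $ 2]) (vector [0, h $ 1, h $ 2])"
  "is_coord d (- vector [g $ 1, g $ 2, 0]) (- vector [h $ 1, h $ 2, 0])"
  unfolding syz10_def by blast
 show "\<forall>s t u v. s * vdot c (Phi (s, t, u, v)) + t * vdot d (Phi (s, t, u, v)) = 0"
  unfolding vdot_Phi[OF q(1)] vdot_Phi[OF q(2)] by (intro allI, simp add: qf_def, algebra)
next
 assume z: "\<forall>s t u v. s * vdot c (Phi (s, t, u, v)) + t * vdot d (Phi (s, t, u, v)) = 0"
 have form: "p = vector [0, - r $ 1, - r $ 2] & r = - vector [- r $ 1, - r $ 2, 0]"
  if "!!s t. s * qf p s t + t * qf r s t = 0" for p r :: "'k^3"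
 proof -
  have "p $ 1 * (s * s * s) + (p $ 2 + r $ 1) * (s * s * t) + (p $ 3 + r $ 2) * (s * t * t) + r $ 3 * (t * t * t) = 0" for s t
   using that[of s t] by (simp add: qf_def algebra_simps)
  from cubic_form_zero[OF this] show ?thesis by (simp add: vec3_eq_iff eq_neg_iff_add_eq_0)
 qed
 have "s * qf (c v* A) s t + t * qf (d v* A) s t = 0" "s * qf (c v* B) s t + t * qf (d v* B) s t = 0" for s t
  using z[rule_format, of s t 1 0] z[rule_format, of s t 0 1] unfolding vdot_Phi[OF is_coord_self] by simp_all
 note f = form[OF this(1)] form[OF this(2)]
 define g :: "'k^2" where "g = vector [- (d v* A) $ 1, - (d v* A) $ 2]"
 define h :: "'k^2" where "h = vector [- (d v* B) $ 1, - (d v* B) $ 2]"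
 have "c v* A = vector [0, g $ 1, g $ 2]" "d v* A = - vector [g $ 1, g $ 2, 0]"
  "c v* B = vector [0, h $ 1, h $ 2]" "d v* B = - vector [h $ 1, h $ 2, 0]"
  using f by (simp_all add: g_def h_def)
 thus "syz10 c d" unfolding syz10_def is_coord_def by blast
qed

end

text \<open>
 The \<open>e i\<close> form another basis of \<open>U\<close>, and \<open>D\<close> is the matrix of \<open>F\<^sub>2 \<rightarrow> F\<^sub>1\<close>, with \<open>F\<^sub>2\<close> generated in
 the bidegrees \<open>L\<close>.
\<close>

locale form_resolution = form_space +
 fixes e :: "4 => 'a bipoly" and D :: "4 => nat => 'a bipoly" and L :: "(nat \<times> nat) list" and N M :: "'a^4^4"
 assumes NM: "inverse_pair N M" and e: "!!s t u v i. bev s t u v (e i) = (M *v Phi (s, t, u, v)) $ i"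
  and D_degree: "!!r c m. c < length L ==> m \<in> keys (D r c) ==> bidegree m + (2, 1) = L ! c"
  and syzygies: "!!h. (\<Sum>i\<in>UNIV. e i * h i) = 0 ==> \<exists>x. \<forall>r. h r = (\<Sum>c<length L. D r c * x c)"
  and columns: "!!c. c < length L ==> (\<Sum>i\<in>UNIV. e i * D i c) = 0"
  and minimal: "!!a c. (!!r. (\<Sum>c<length L. D r c * bconst (a c)) = 0) ==> c < length L ==> a c = 0"
begin

text \<open>The condition on \<open>L\<close> rules out columns of strictly smaller bidegree, which
  could otherwise be multiplied up by forms of positive degree. The shift by (2, 1) accounts for the
  generators.\<close>

lemma syzygies_of_degree:
 assumes h: "!!r. h r \<in> bigraded_piece a b" "(\<Sum>i\<in>UNIV. e i * h i) = 0"
  and L: "!!c. c < length L ==> fst (L ! c) \<le> a + 2 ==> snd (L ! c) \<le> b + 1 ==> L ! c = (a + 2, b + 1)"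
 obtains x where "!!r. h r = (\<Sum>c\<in>{c. c < length L & L ! c = (a + 2, b + 1)}. D r c * bconst (x c))"
proof -
 obtain x where x: "!!r. h r = (\<Sum>c<length L. D r c * x c)" using syzygies[OF h(2)] by blast
 have "h r = (\<Sum>c\<in>{c \<in> {..<length L}. L ! c = (a + 2, b + 1)}. D r c * bconst (lookup (x c) 0))" for r
  by (rule degree_part[OF _ h(1) x]) (use D_degree L in auto)
 thus ?thesis using that by simp
qed

lemma sum_e: "bev s t u v (\<Sum>i\<in>UNIV. e i * h i) = (\<Sum>i\<in>UNIV. (M *v Phi (s, t, u, v)) $ i * bev s t u v (h i))"
 by (simp add: e)

lemma vdot_matrix: "vdot (c v* M) w = (\<Sum>i\<in>UNIV. (M *v w) $ i * c $ i)"
 by (simp add: vdot_def vector_matrix_mult_def matrix_vector_mult_def sum_4 algebra_simps)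

lemma sum_e_h01: "(\<Sum>i\<in>UNIV. e i * h01 c d i) = 0 \<longleftrightarrow> syz01 (c v* M) (d v* M)"
proof -
 have "bev s t u v (\<Sum>i\<in>UNIV. e i * h01 c d i) =
   u * vdot (c v* M) (Phi (s, t, u, v)) + v * vdot (d v* M) (Phi (s, t, u, v))" for s t u v
  unfolding sum_e vdot_matrix by (simp add: sum_4 algebra_simps)
 thus ?thesis unfolding syz01_iff bipoly_zero_iff by (simp only:)
qed

lemma sum_e_h10: "(\<Sum>i\<in>UNIV. e i * h10 c d i) = 0 \<longleftrightarrow> syz10 (c v* M) (d v* M)"
proof -
 have "bev s t u v (\<Sum>i\<in>UNIV. e i * h10 c d i) =
   s * vdot (c v* M) (Phi (s, t, u, v)) + t * vdot (d v* M) (Phi (s, t, u, v))" for s t u v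
  unfolding sum_e vdot_matrix by (simp add: sum_4 algebra_simps)
 thus ?thesis unfolding syz10_iff bipoly_zero_iff by (simp only:)
qed

lemma sum_e_h02: "(\<Sum>i\<in>UNIV. e i * h02 c d f i) = 0 \<longleftrightarrow> syz02 (c v* M) (d v* M) (f v* M)"
proof -
 have "bev s t u v (\<Sum>i\<in>UNIV. e i * h02 c d f i) = (u * u) * vdot (c v* M) (Phi (s, t, u, v)) +
   (u * v) * vdot (d v* M) (Phi (s, t, u, v)) + (v * v) * vdot (f v* M) (Phi (s, t, u, v))" for s t u v
  unfolding sum_e vdot_matrix by (simp add: sum_4 algebra_simps)
 thus ?thesis unfolding syz02_iff bipoly_zero_iff by (simp only:)
qed

lemma vM: "(c v* N) v* M = c" "(c v* M) v* N = c"
 using NM by (simp_all add: vector_matrix_mul_assoc inverse_pair_def)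

lemma vM_eq_0: "c v* N = 0 ==> c = 0" "c v* M = 0 ==> c = 0"
 using vM[of c] by (metis vector_matrix_mult_0)+

text \<open>Such a syzygy would be a scalar combination of the columns of bidegree exactly (2,2),
  and the hypothesis on \<open>L\<close> leaves none.\<close>

lemma no_syz01:
 assumes L: "!!c. c < length L ==> \<not> (fst (L ! c) \<le> 2 & snd (L ! c) \<le> 2)" and syz: "syz01 c d"
 shows "c = 0 & d = 0"
proof -
 have z: "(\<Sum>i\<in>UNIV. e i * h01 (c v* N) (d v* N) i) = 0" unfolding sum_e_h01 vM by (rule syz)
 obtain x where x: "!!r. h01 (c v* N) (d v* N) r = (\<Sum>c\<in>{c. c < length L & L ! c = (0 + 2, 1 + 1)}. D r c * bconst (x c))"
  by (rule syzygies_of_degree[OF bigraded_h(1) z]) (use L in force)+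
 have J: "{c. c < length L & L ! c = (0 + 2, 1 + 1)} = {}" using L by fastforce
 have "h01 (c v* N) (d v* N) r = 0" for r unfolding x J by simp
 hence "bev s t u v (h01 (c v* N) (d v* N) r) = 0" for r s t u v by simp
 from this[of 0 0 1 0] this[of 0 0 0 1] have "c v* N = 0" "d v* N = 0" by (simp_all add: vec_eq_iff)
 thus ?thesis using vM_eq_0 by blast
qed

lemma no_syz10:
 assumes L: "!!c. c < length L ==> \<not> (fst (L ! c) \<le> 3 & snd (L ! c) \<le> 1)" and syz: "syz10 c d"
 shows "c = 0 & d = 0"
proof -
 have z: "(\<Sum>i\<in>UNIV. e i * h10 (c v* N) (d v* N) i) = 0" unfolding sum_e_h10 vM by (rule syz)
 obtain x where x: "!!r. h10 (c v* N) (d v* N) r = (\<Sum>c\<in>{c. c < length L & L ! c = (1 + 2, 0 + 1)}. D r c * bconst (x c))"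
  by (rule syzygies_of_degree[OF bigraded_h(2) z]) (use L in force)+
 have J: "{c. c < length L & L ! c = (1 + 2, 0 + 1)} = {}" using L by fastforce
 have "h10 (c v* N) (d v* N) r = 0" for r unfolding x J by simp
 hence "bev s t u v (h10 (c v* N) (d v* N) r) = 0" for r s t u v by simp
 from this[of 1 0 0 0] this[of 0 1 0 0] have "c v* N = 0" "d v* N = 0" by (simp_all add: vec_eq_iff)
 thus ?thesis using vM_eq_0 by blast
qed

lemma no_syz02_of_degrees:
 assumes L: "!!c. c < length L ==> \<not> (fst (L ! c) \<le> 2 & snd (L ! c) \<le> 3)" and syz: "syz02 c d f"
 shows "c = 0 & d = 0 & f = 0"
proof -
 have z: "(\<Sum>i\<in>UNIV. e i * h02 (c v* N) (d v* N) (f v* N) i) = 0" unfolding sum_e_h02 vM by (rule syz)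
 obtain x where x: "!!r. h02 (c v* N) (d v* N) (f v* N) r = (\<Sum>c\<in>{c. c < length L & L ! c = (0 + 2, 2 + 1)}. D r c * bconst (x c))"
  by (rule syzygies_of_degree[OF bigraded_h(3) z]) (use L in force)+
 have J: "{c. c < length L & L ! c = (0 + 2, 2 + 1)} = {}" using L by fastforce
 have "h02 (c v* N) (d v* N) (f v* N) r = 0" for r unfolding x J by simp
 hence b: "bev s t u v (h02 (c v* N) (d v* N) (f v* N) r) = 0" for r s t u v by simp
 have "(c v* N) $ r * (u * u) + (d v* N) $ r * (u * v) + (f v* N) $ r * (v * v) = 0" for r u v
  using b[of 0 0 u v r] by simp
 from quadratic_form_zero[OF this] have "c v* N = 0" "d v* N = 0" "f v* N = 0" by (simp_all add: vec_eq_iff)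
 thus ?thesis using vM_eq_0 by blast
qed

lemma column_nonzero: "c < length L ==> \<exists>r. D r c ~= 0"
proof (rule ccontr)
 assume c: "c < length L" and "\<nexists>r. D r c ~= 0"
 hence z: "D r c = 0" for r by blast
 define a where "a i = (if i = c then 1 else 0 :: 'a)" for i
 have "(\<Sum>i<length L. D r i * bconst (a i)) = 0" for r
  by (rule sum.neutral) (auto simp: a_def z bconst_def)
 hence "a c = 0" using minimal c by blast
 thus False by (simp add: a_def)
qed

lemma column_degree:
 assumes "c < length L" "L ! c = (a + 2, b + 1)"
 shows "D r c \<in> bigraded_piece a b"
 using D_degree[OF assms(1)] unfolding bigraded_piece_def assms(2)
 by (auto simp: plus_prod_def prod_eq_iff)

lemma exists_syz10:
 assumes c: "c < length L" "L ! c = (3, 1)"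
 obtains a b where "syz10 a b" "nz a b"
proof -
 have "D r c \<in> bigraded_piece 1 0" for r by (rule column_degree[OF c(1)]) (simp add: c(2))
 then obtain a b where ab: "(%r. D r c) = h10 a b" by (rule bigraded_10_cases)
 have "syz10 (a v* M) (b v* M)" unfolding sum_e_h10[symmetric] ab[symmetric] by (rule columns[OF c(1)])
 moreover have "a v* M ~= 0 | b v* M ~= 0"
 proof (rule ccontr)
  assume "\<not> ?thesis"
  hence "a = 0" "b = 0" using vM_eq_0 by blast+
  hence "D r c = 0" for r using fun_cong[OF ab, of r] by (simp add: h10_def)
  thus False using column_nonzero[OF c(1)] by blast
 qed
 ultimately show ?thesis by (rule that)
qed

lemma exists_syz02:
 assumes c: "c < length L" "L ! c = (2, 3)"
 obtains a b f where "syz02 a b f" "a ~= 0 | b ~= 0 | f ~= 0"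
proof -
 have "D r c \<in> bigraded_piece 0 2" for r by (rule column_degree[OF c(1)]) (simp add: c(2))
 then obtain a b f where ab: "(%r. D r c) = h02 a b f" by (rule bigraded_02_cases)
 have "syz02 (a v* M) (b v* M) (f v* M)" unfolding sum_e_h02[symmetric] ab[symmetric] by (rule columns[OF c(1)])
 moreover have "a v* M ~= 0 | b v* M ~= 0 | f v* M ~= 0"
 proof (rule ccontr)
  assume "\<not> ?thesis"
  hence "a = 0" "b = 0" "f = 0" using vM_eq_0 by blast+
  hence "D r c = 0" for r using fun_cong[OF ab, of r] by (simp add: h02_def)
  thus False using column_nonzero[OF c(1)] by blast
 qed
 ultimately show ?thesis by (rule that)
qed

lemma column_01:
 assumes c: "c < length L" "L ! c = (2, 2)"
 obtains a b where "(%r. D r c) = h01 a b" "syz01 (a v* M) (b v* M)" "a v* M ~= 0 | b v* M ~= 0"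
proof -
 have "D r c \<in> bigraded_piece 0 1" for r by (rule column_degree[OF c(1)]) (simp add: c(2))
 then obtain a b where ab: "(%r. D r c) = h01 a b" by (rule bigraded_01_cases)
 have "syz01 (a v* M) (b v* M)" unfolding sum_e_h01[symmetric] ab[symmetric] by (rule columns[OF c(1)])
 moreover have "a v* M ~= 0 | b v* M ~= 0"
 proof (rule ccontr)
  assume "\<not> ?thesis"
  hence "a = 0" "b = 0" using vM_eq_0 by blast+
  hence "D r c = 0" for r using fun_cong[OF ab, of r] by (simp add: h01_def)
  thus False using column_nonzero[OF c(1)] by blast
 qed
 ultimately show ?thesis by (rule that[OF ab])
qed

lemma v_scale: "(r *s c) v* (X :: 'a^4^4) = r *s (c v* X)"
 by (simp add: vector_matrix_mult_def vec_eq_iff sum_4 algebra_simps)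

text \<open>Column 0 is the only one of bidegree (2,2), so every (0,1) syzygy is a scalar multiple
  of it.\<close>

lemma unique_syz01:
 assumes L: "0 < length L" "L ! 0 = (2, 2)" "!!c. c < length L ==> c ~= 0 ==> \<not> (fst (L ! c) \<le> 2 & snd (L ! c) \<le> 2)"
 obtains c d where "syz01 c d" "nz c d" "!!c' d'. syz01 c' d' ==> \<exists>a. c' = a *s c"
proof -
 obtain a b where ab: "(%r. D r 0) = h01 a b" "syz01 (a v* M) (b v* M)" "a v* M ~= 0 | b v* M ~= 0"
  by (rule column_01[OF L(1,2)])
 have "\<exists>r. c = r *s (a v* M)" if syz: "syz01 c d" for c d
 proof -
  have z: "(\<Sum>i\<in>UNIV. e i * h01 (c v* N) (d v* N) i) = 0" unfolding sum_e_h01 vM by (rule syz)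
  have L22: "L ! c = (0 + 2, 1 + 1)" if c: "c < length L" "fst (L ! c) \<le> 0 + 2" "snd (L ! c) \<le> 1 + 1" for c
   using L(3)[OF c(1)] L(2) c(2,3) by (cases "c = 0") auto
  obtain x where x: "!!r. h01 (c v* N) (d v* N) r = (\<Sum>c\<in>{c. c < length L & L ! c = (0 + 2, 1 + 1)}. D r c * bconst (x c))"
   by (rule syzygies_of_degree[OF bigraded_h(1) z L22]) blast+
  have "{c. c < length L & L ! c = (0 + 2, 1 + 1)} = {0}" using L by fastforce
  hence hx: "h01 (c v* N) (d v* N) r = h01 a b r * bconst (x 0)" for r using x[of r] fun_cong[OF ab(1), of r] by simp
  have "(c v* N) $ r = a $ r * x 0" for r using arg_cong[OF hx[of r], of "bev 0 0 1 0"] by simp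
  hence "c v* N = x 0 *s a" by (simp add: vec_eq_iff mult.commute)
  hence "c = x 0 *s (a v* M)" using vM(1)[of c] v_scale by metis
  thus ?thesis by blast
 qed
 thus ?thesis using that[OF ab(2,3)] by blast
qed

lemma two_syz01_of_degrees:
 assumes L: "1 < length L" "L ! 0 = (2, 2)" "L ! 1 = (2, 2)"
 obtains c d c' d' where "syz01 c d" "syz01 c' d'"
  "!!a b. a *s c + b *s c' = 0 ==> a *s d + b *s d' = 0 ==> a = 0 & b = 0"
proof -
 have L0: "0 < length L" using L(1) by linarith
 obtain a b where ab: "(%r. D r 0) = h01 a b" "syz01 (a v* M) (b v* M)"
  by (rule column_01[OF L0 L(2)])
 obtain a' b' where ab': "(%r. D r 1) = h01 a' b'" "syz01 (a' v* M) (b' v* M)"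
  by (rule column_01[OF L(1,3)])
 have "x = 0 & y = 0" if z: "x *s (a v* M) + y *s (a' v* M) = 0" "x *s (b v* M) + y *s (b' v* M) = 0" for x y
 proof -
  have "(x *s a + y *s a') v* M = 0" "(x *s b + y *s b') v* M = 0"
   using z by (simp_all add: vector_matrix_left_distrib v_scale)
  hence "x *s a + y *s a' = 0" "x *s b + y *s b' = 0" using vM_eq_0 by blast+
  hence xy: "x * a $ r + y * a' $ r = 0" "x * b $ r + y * b' $ r = 0" for r by (simp_all add: vec_eq_iff)
  define f where "f i = (if i = 0 then x else if i = 1 then y else 0)" for i :: nat
  have "(\<Sum>c<length L. D r c * bconst (f c)) = 0" for r
  proof -
   have "(\<Sum>c<length L. D r c * bconst (f c)) = (\<Sum>c\<in>{0, 1}. D r c * bconst (f c))"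
    by (rule sum.mono_neutral_right) (use L in \<open>auto simp: f_def bconst_def\<close>)
   also have "\<dots> = h01 a b r * bconst x + h01 a' b' r * bconst y"
    using fun_cong[OF ab(1), of r] fun_cong[OF ab'(1), of r] by (simp add: f_def)
   also have "\<dots> = 0"
   proof (rule bipoly_zeroI)
    fix s t u v
    have "bev s t u v (h01 a b r * bconst x + h01 a' b' r * bconst y) =
      (x * a $ r + y * a' $ r) * u + (x * b $ r + y * b' $ r) * v" by (simp add: algebra_simps)
    thus "bev s t u v (h01 a b r * bconst x + h01 a' b' r * bconst y) = 0" unfolding xy by simp
   qed
   finally show ?thesis .
  qed
  hence "f 0 = 0" "f 1 = 0" using minimal L0 L(1) by blast+
  thus ?thesis by (simp add: f_def)
 qed
 thus ?thesis using that[OF ab(2) ab'(2)] by blast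
qed

end

section \<open>The classification\<close>

definition two_lines :: "('k::field^4) set => bool" where
 "two_lines Z \<longleftrightarrow> (\<exists>A B. is_line A & is_line B & A ~= B & Z = A \<union> B)"

definition three_lines :: "('k::field^4) set => bool" where
 "three_lines Z \<longleftrightarrow> (\<exists>A B C. is_line A & is_line B & is_line C &
  A ~= B & A ~= C & B ~= C & Z = A \<union> B \<union> C)"

lemma lines_image:
 assumes "inverse_pair N M"
 shows "two_lines Z ==> two_lines ((*v) N ` Z)" "three_lines Z ==> three_lines ((*v) N ` Z)"
proof -
 have "(*v) N ` A ~= (*v) N ` B" if "A ~= B" for A B
  using that inj_image_eq_iff[OF inverse_pair_inj[OF assms]] by blast
 thus "two_lines Z ==> two_lines ((*v) N ` Z)" "three_lines Z ==> three_lines ((*v) N ` Z)"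
  unfolding two_lines_def three_lines_def using is_line_image[OF assms] by (metis image_Un)+
qed

context pencil_ideal
begin

lemma discriminant_roots:
 obtains a b a' b' where "lmul l1 l4 - lmul l2 l3 = lmul (vector [b, - a]) (vector [b', - a'])"
  "nz a b" "nz a' b'" "!!u v. disc u v = (b * u - a * v) * (b' * u - a' * v)"
proof -
 define E where "E = lmul l1 l4 - lmul l2 l3"
 have E: "E ~= 0" using disc_nz by (simp add: E_def)
 obtain a b where ab: "nz a b" "qf E a b = 0" using qf_root by blast
 obtain m where m: "E = lmul (vector [b, - a]) m" using qf_factor[OF ab(2,1)] .
 have m_eq: "m = vector [m $ 1, - (- m $ 2)]" by (simp add: vec_eq_iff forall_2)
 have "m ~= 0" using E m by auto
 hence nz: "- m $ 2 ~= 0 | m $ 1 ~= 0" by (auto simp: vec_eq_iff forall_2)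
 have "disc u v = (b * u - a * v) * (m $ 1 * u - (- m $ 2) * v)" for u v
 proof -
  have "qf E u v = disc u v" by (simp add: E_def disc_def)
  thus ?thesis unfolding m by (simp add: lf_def)
 qed
 thus ?thesis using that[of b a "m $ 1" "- m $ 2"] m m_eq ab(1) nz unfolding E_def by simp
qed

text \<open>Each root contributes one line besides \<open>L0\<close>. Two simple roots give two
  different embedded primes, hence not exactly one; a double root leaves at most one, hence not two.
  These one-sided bounds already decide between the two subtypes of Type 5.\<close>

theorem lines_and_embedded_primes:
 "three_lines (codim1_singular_locus (surf Phi)) & card (embedded_primes J) ~= 1 |
 two_lines (codim1_singular_locus (surf Phi)) &
  card (embedded_primes J) ~= 2"
proof -
 obtain a b a' b' where D: "lmul l1 l4 - lmul l2 l3 = lmul (vector [b, - a]) (vector [b', - a'])"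
  and ab: "nz a b" and ab': "nz a' b'"
  and disc: "!!u v. disc u v = (b * u - a * v) * (b' * u - a' * v)"
  by (rule discriminant_roots) blast
 have "lmul l1 l4 - lmul l2 l3 ~= 0" using disc_nz by simp
 then obtain u0 v0 where "qf (lmul l1 l4 - lmul l2 l3) u0 v0 ~= 0" by (rule qf_nonzero)
 hence d0: "disc u0 v0 ~= 0" by (simp add: disc_def)
 have roots: "disc a b = 0" "disc a' b' = 0" unfolding disc by (simp_all add: mult.commute)
 show ?thesis
 proof (cases "a * b' = b * a'")
  case False
  have locus: "codim1_singular_locus (surf Phi) = L0 \<union> \<Union> (Lr ` {(a, b), (a', b')})"
  proof (rule codim1[OF _ _ _ d0])
   show "disc u v = 0 \<longleftrightarrow> (\<exists>(a, b)\<in>{(a, b), (a', b')}. b * u = a * v)" for u v unfolding disc by simp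
  qed (use ab ab' in auto)
  have "is_line L0" "is_line (Lr (a, b))" "is_line (Lr (a', b'))"
   using line_L0(1) line_Lr(1)[OF ab roots(1)] line_Lr(1)[OF ab' roots(2)] by blast+
  moreover have "L0 ~= Lr (a, b)" "L0 ~= Lr (a', b')" "Lr (a, b) ~= Lr (a', b')"
   using L0_neq_Lr[OF ab roots(1)] L0_neq_Lr[OF ab' roots(2)] Lr_neq_Lr[OF ab roots(1), of a' b'] False by auto
  moreover have "codim1_singular_locus (surf Phi) = L0 \<union> Lr (a, b) \<union> Lr (a', b')" unfolding locus by auto
  moreover have "card (embedded_primes J) ~= 1"
  proof
   assume "card (embedded_primes J) = 1"
   then obtain X where X: "embedded_primes J = {X}" by (rule card_1_singletonE)
   have "point_prime a b \<in> embedded_primes J"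
    by (rule simple_root_embedded[OF D]) (use False in simp)
   moreover have "point_prime a' b' \<in> embedded_primes J"
    by (rule simple_root_embedded[OF D[unfolded lmul_commute[of "vector [b, - a]"]]])
     (use False in \<open>metis mult.commute right_minus_eq\<close>)
   ultimately have eq: "point_prime a b = point_prime a' b'" using X by simp
   have "blf (vector [b, - a]) \<in> point_prime a b" by (simp add: point_prime_def lf_def)
   hence "blf (vector [b, - a]) \<in> point_prime a' b'" unfolding eq .
   hence "bev 0 0 (1 * a') (1 * b') (blf (vector [b, - a])) = 0" unfolding point_prime_def by blast
   thus False using False by (simp add: lf_def mult.commute)
  qed
  ultimately show ?thesis unfolding three_lines_def by blast
 next
  case True
  have "(vector [b, - a] :: 'a^2) ~= 0" using ab by (auto simp: vec_eq_iff forall_2)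
  moreover have "(vector [b, - a] :: 'a^2) $ 1 * (vector [b', - a'] :: 'a^2) $ 2 =
    (vector [b, - a] :: 'a^2) $ 2 * (vector [b', - a'] :: 'a^2) $ 1"
   using True by (simp add: mult.commute)
  ultimately obtain r where r: "vector [b', - a'] = r *s (vector [b, - a] :: 'a^2)"
   by (rule linear_form_root_multiple)
  hence r': "b' = r * b" "a' = r * a" by (simp_all add: vec_eq_iff forall_2)
  have rnz: "r ~= 0" using r' ab' by auto
  \<comment> \<open>Rescaling the root by a square root of \<open>r\<close> turns the discriminant
    into the exact square that \<open>double_root_embedded\<close> expects.\<close>
  obtain rho where rho: "rho ^ 2 = r" using nth_root_exists[of 2 r] by auto
  have D2: "lmul l1 l4 - lmul l2 l3 = lmul (vector [rho * b, - (rho * a)]) (vector [rho * b, - (rho * a)])"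
   unfolding D r' rho[symmetric] by (simp add: lmul_def vec3_eq_iff power2_eq_square algebra_simps)
  have "embedded_primes J \<subseteq> {point_prime (rho * a) (rho * b)}" by (rule double_root_embedded[OF D2])
  hence "card (embedded_primes J) \<le> card {point_prime (rho * a) (rho * b)}" by (intro card_mono) simp_all
  hence card: "card (embedded_primes J) ~= 2" by simp
  have locus: "codim1_singular_locus (surf Phi) = L0 \<union> \<Union> (Lr ` {(a, b)})"
  proof (rule codim1[OF _ _ _ d0])
   fix u v
   have "disc u v = r * ((b * u - a * v) * (b * u - a * v))" unfolding disc r' by (simp add: algebra_simps)
   thus "disc u v = 0 \<longleftrightarrow> (\<exists>(a, b)\<in>{(a, b)}. b * u = a * v)" using rnz by simp
  qed (use ab in auto)
  have "is_line L0" "is_line (Lr (a, b))" using line_L0(1) line_Lr(1)[OF ab roots(1)] by blast+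
  moreover have "L0 ~= Lr (a, b)" by (rule L0_neq_Lr[OF ab roots(1)])
  moreover have "codim1_singular_locus (surf Phi) = L0 \<union> Lr (a, b)" unfolding locus by auto
  ultimately show ?thesis using card unfolding two_lines_def by blast
 qed
qed

end

theorem (in form_space) unique_syz01_locus:
 assumes syz: "syz01 c d" "nz c d" "!!c' d'. syz01 c' d' ==> \<exists>a. c' = a *s c"
  and no10: "!!c d. syz10 c d ==> c = 0"
 shows "three_lines (codim1_singular_locus (surf Phi)) & card (embedded_primes (form_ideal Phi)) ~= 1 |
 two_lines (codim1_singular_locus (surf Phi)) &
  card (embedded_primes (form_ideal Phi)) ~= 2"
proof -
 obtain q y z l1 l2 l3 l4 k N M where qyz: "indep3 q y z" and pf: "pencil_form q y z l1 l2 l3 l4 k"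
  and NM: "inverse_pair N M" and eq: "!!p. pencil_form.Phi q y z l1 l2 l3 l4 p = M *v Phi p"
  and surf: "surf Phi = (*v) N ` surf (pencil_form.Phi q y z l1 l2 l3 l4)"
  and nz: "lmul l1 l4 ~= lmul l2 l3"
  by (rule one_syz01[OF syz(1,2)], erule syz(3), rule that; assumption)
 interpret Q: pencil_form q y z l1 l2 l3 l4 k by (rule pf)
 have ideal: "form_ideal Q.Phi = form_ideal Phi" by (rule form_ideal_matrix[OF NM eq])
 interpret Q: pencil_ideal q y z l1 l2 l3 l4 k
  by unfold_locales (use qyz nz cubics_in_ideal[OF no10] in \<open>auto simp: ideal\<close>)
 have img: "codim1_singular_locus (surf Phi) = (*v) N ` codim1_singular_locus (surf Q.Phi)"
  unfolding surf by (rule codim1_singular_locus_image[OF NM])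
 show ?thesis using Q.lines_and_embedded_primes lines_image[OF NM] unfolding ideal img by blast
qed

section \<open>From generators of \<open>U\<close> to coefficient matrices\<close>

lemma bform_coords_21:
 fixes p :: "4 => 'k::field bipoly"
 assumes "!!i. p i \<in> bigraded_piece 2 1"
 shows "\<exists>A B :: 'k^3^4. \<forall>i s t u v. bev s t u v (p i) = qf (A $ i) s t * u + qf (B $ i) s t * v"
proof -
 have "\<exists>a b. \<forall>s t u v. bev s t u v (p i) = qf a s t * u + qf b s t * v" for i
  by (rule bform_21[OF bform_bev[OF assms[of i]]]) auto
 then obtain a b where ab: "!!i s t u v. bev s t u v (p i) = qf (a i) s t * u + qf (b i) s t * v" by metis
 show ?thesis by (intro exI[of _ "\<chi> i. a i"] exI[of _ "\<chi> i. b i"]) (simp add: ab)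
qed

text \<open>A relation with a nonzero coefficient at \<open>k\<close> expresses \<open>p k\<close>
  through the other three, which cannot span dimension four.\<close>

lemma generators_independent:
 fixes p :: "4 => 'k::alg_closed_field bipoly" and c :: "'k^4"
 assumes dim: "mp.dim (mp.span (range p)) = 4" and zero: "(\<Sum>i\<in>UNIV. bconst (c $ i) * p i) = 0"
 shows "c = 0"
proof (rule ccontr)
 assume "c ~= 0"
 then obtain k where k: "c $ k ~= 0" by (auto simp: vec_eq_iff)
 let ?S = "p ` (UNIV - {k})"
 have scale: "scale_mpoly r f = bconst r * f" for r and f :: "'k bipoly" by (simp add: scale_mpoly_def bconst_def)
 have "(\<Sum>i\<in>UNIV. bconst (c $ i) * p i) = bconst (c $ k) * p k + (\<Sum>i\<in>UNIV - {k}. bconst (c $ i) * p i)"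
  by (rule sum.remove) simp_all
 hence "bconst (c $ k) * p k = - (\<Sum>i\<in>UNIV - {k}. bconst (c $ i) * p i)"
  using zero by (simp add: eq_neg_iff_add_eq_0)
 hence "bconst (1 / c $ k) * (bconst (c $ k) * p k) = bconst (1 / c $ k) * - (\<Sum>i\<in>UNIV - {k}. bconst (c $ i) * p i)"
  by simp
 moreover have "bconst (1 / c $ k) * (bconst (c $ k) * p k) = p k"
  by (rule bipoly_eqI) (simp add: k)
 moreover have "bconst (1 / c $ k) * - (\<Sum>i\<in>UNIV - {k}. bconst (c $ i) * p i) \<in> mp.span ?S"
  unfolding scale[symmetric]
  by (intro mp.span_scale mp.span_neg mp.span_sum) (auto intro: mp.span_base)
 ultimately have pk: "p k \<in> mp.span ?S" by simp
 have "range p \<subseteq> mp.span ?S"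
 proof
  fix x assume "x \<in> range p"
  then obtain i where "x = p i" by blast
  thus "x \<in> mp.span ?S" using pk by (cases "i = k") (auto intro: mp.span_base)
 qed
 hence "mp.span (range p) \<subseteq> mp.span ?S" by (rule mp.span_minimal) (rule mp.subspace_span)
 hence "mp.dim (mp.span (range p)) \<le> card ?S" by (rule mp.dim_le_card) simp
 also have "\<dots> \<le> card (UNIV - {k})" by (rule card_image_le) simp
 also have "\<dots> = 3" by (simp add: card_Diff_singleton)
 finally show False using dim by simp
qed

lemma form_ideal_generator:
 assumes "!!s t u v. bev s t u v x = Phi (s, t, u, v) $ j"
 shows "x \<in> form_ideal Phi"
proof -
 have "bev s t u v x = (\<Sum>i\<in>UNIV. bev s t u v (if i = j then 1 else 0) * Phi (s, t, u, v) $ i)" for s t u v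
 proof -
  have "(\<Sum>i\<in>UNIV. bev s t u v (if i = j then 1 else 0) * Phi (s, t, u, v) $ i) =
    (\<Sum>i\<in>UNIV. if i = j then Phi (s, t, u, v) $ i else 0)" by (rule sum.cong) auto
  thus ?thesis using assms by simp
 qed
 thus ?thesis unfolding form_ideal_def by (intro CollectI exI[of _ "%i. if i = j then 1 else 0"] allI)
qed

text \<open>The generators \<open>e\<close> of the resolution and the basis \<open>p\<close> both
  span the part of the ideal in bidegree (2,1). The constant terms of the coefficients expressing
  one in the other form matrices \<open>S\<close> and \<open>T\<close>, which are mutually inverse
  because \<open>p\<close> is independent.\<close>

lemma resolution_of_generators:
 fixes p :: "4 => 'k::alg_closed_field bipoly"
 assumes fs: "form_space A B" and p: "!!i s t u v. bev s t u v (p i) = form_space.Phi A B (s, t, u, v) $ i"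
  and deg: "!!i. p i \<in> bigraded_piece 2 1" and dim: "mp.dim (mp.span (range p)) = 4"
  and I: "form_ideal (form_space.Phi A B) = I"
  and res: "is_minimal_free_resolution I (replicate 4 (2, 1) # L # M) d"
 obtains e D S T where "form_resolution A B e D L S T"
proof -
 interpret form_space A B by (rule fs)
 obtain e D where P: "presentation I L e D" using resolution_presentation[OF res] by blast
 note P = P[unfolded presentation_def]
 have e: "!!i. e i \<in> bigraded_piece 2 1" "I = {\<Sum>i\<in>UNIV. e i * h i | h :: 4 => 'k bipoly. True}"
  by (rule P[THEN conjunct1, rule_format], rule P[THEN conjunct2, THEN conjunct1])
 have D: "!!r c m. c < length L ==> m \<in> keys (D r c) ==> bidegree m + (2, 1) = L ! c"
   "!!h. (\<Sum>i\<in>UNIV. e i * h i) = 0 ==> \<exists>x. \<forall>r. h r = (\<Sum>c<length L. D r c * x c)"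
   "!!c. c < length L ==> (\<Sum>i\<in>UNIV. e i * D i c) = 0"
   "!!a c. (!!r. (\<Sum>c<length L. D r c * bconst (a c)) = 0) ==> c < length L ==> a c = 0"
  using P[THEN conjunct2, THEN conjunct2] by simp_all
 have combination: "f = (\<Sum>i\<in>UNIV. g i * bconst (lookup (h i) 0))"
  if "f \<in> bigraded_piece 2 1" "!!i. g i \<in> bigraded_piece 2 1" "f = (\<Sum>i\<in>UNIV. g i * h i)"
  for f :: "'k bipoly" and g h :: "4 => 'k bipoly"
 proof -
  have "bidegree m + (0, 0) = (2, 1)" if "m \<in> keys (g i)" for i m
   using \<open>!!i. g i \<in> bigraded_piece 2 1\<close>[of i] that by (simp add: bigraded_piece_def plus_prod_def)
  hence "f = (\<Sum>i\<in>{i \<in> UNIV. (%_ :: 4. (2 :: nat, 1 :: nat)) i = (2 + 0, 1 + 0)}. g i * bconst (lookup (h i) 0))"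
   by (intro degree_part[OF _ that(1,3), where gam = "%_. (2, 1)"]) simp_all
  thus ?thesis by simp
 qed
 have "\<exists>h. e j = (\<Sum>i\<in>UNIV. p i * h i)" for j
 proof -
  have "e j = (\<Sum>i\<in>UNIV. e i * (if i = j then 1 else 0))" by (simp add: if_distrib sum.delta cong: if_cong)
  hence "e j \<in> I" unfolding e(2) by (intro CollectI exI[of _ "%i. if i = j then 1 else 0"]) simp
  hence "e j \<in> form_ideal Phi" using I by simp
  then obtain h :: "4 => 'k bipoly" where h: "\<forall>s t u v. bev s t u v (e j) = (\<Sum>i\<in>UNIV. bev s t u v (h i) * Phi (s, t, u, v) $ i)"
   unfolding form_ideal_def by blast
  have "e j = (\<Sum>i\<in>UNIV. p i * h i)" by (rule bipoly_eqI) (simp add: h p mult.commute)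
  thus ?thesis by blast
 qed
 then obtain h1 where h1: "!!j. e j = (\<Sum>i\<in>UNIV. p i * h1 j i)" by metis
 define s0 where "s0 j i = lookup (h1 j i) 0" for j i
 have s0: "e j = (\<Sum>i\<in>UNIV. p i * bconst (s0 j i))" for j
  unfolding s0_def by (rule combination[OF e(1) deg h1])
 have "\<exists>h. p j = (\<Sum>i\<in>UNIV. e i * h i)" for j
 proof -
  have "p j \<in> form_ideal Phi" by (rule form_ideal_generator[OF p])
  thus ?thesis using I e(2) by blast
 qed
 then obtain h2 where h2: "!!j. p j = (\<Sum>i\<in>UNIV. e i * h2 j i)" by metis
 define t0 where "t0 j i = lookup (h2 j i) 0" for j i
 have t0: "p j = (\<Sum>i\<in>UNIV. e i * bconst (t0 j i))" for j
  unfolding t0_def by (rule combination[OF deg e(1) h2])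
 define S :: "'k^4^4" where "S = (\<chi> j i. s0 j i)"
 define T :: "'k^4^4" where "T = (\<chi> j i. t0 j i)"
 have eS: "bev s t u v (e j) = (S *v Phi (s, t, u, v)) $ j" for s t u v j
  unfolding s0[of j] by (simp add: S_def matrix_vector_mult_def p mult.commute)
 have pT: "Phi (s, t, u, v) = T *v (S *v Phi (s, t, u, v))" for s t u v
 proof -
  have "Phi (s, t, u, v) $ j = (T *v (S *v Phi (s, t, u, v))) $ j" for j
  proof -
   have "Phi (s, t, u, v) $ j = (\<Sum>i\<in>UNIV. bev s t u v (e i) * t0 j i)" unfolding p[symmetric] t0[of j] by simp
   also have "\<dots> = (T *v (S *v Phi (s, t, u, v))) $ j"
    unfolding eS by (subst matrix_vector_mult_def) (simp add: T_def mult.commute)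
   finally show ?thesis .
  qed
  thus ?thesis by (simp add: vec_eq_iff)
 qed
 have "T ** S = mat 1"
 proof -
  have "(T ** S - mat 1) $ i = 0" for i
  proof (rule generators_independent[OF dim], rule bipoly_zeroI)
   fix s t u v :: 'k
   have "((T ** S - mat 1) *v Phi (s, t, u, v)) $ i = 0"
    using pT[of s t u v] by (simp add: matrix_vector_mul_assoc matrix_vector_mult_diff_rdistrib)
   thus "bev s t u v (\<Sum>ia\<in>UNIV. bconst ((T ** S - mat 1) $ i $ ia) * p ia) = 0"
    by (simp add: p matrix_vector_mult_def)
  qed
  hence "T ** S - mat 1 = 0" by (simp add: vec_eq_iff)
  thus ?thesis by simp
 qed
 hence "inverse_pair T S" unfolding inverse_pair_def by (simp add: matrix_left_right_inverse)
 hence "form_resolution A B e D L T S" using eS D by unfold_locales blast+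
 thus ?thesis by (rule that)
qed

lemma form_space_of_generators:
 fixes p :: "4 => 'k::alg_closed_field bipoly"
 assumes deg: "!!i. p i \<in> bigraded_piece 2 1" and dim: "mp.dim (mp.span (range p)) = 4"
  and bpf: "basepoint_free p"
 obtains A B where "form_space A B" "!!i s t u v. bev s t u v (p i) = form_space.Phi A B (s, t, u, v) $ i"
  "form_ideal (form_space.Phi A B) = ideal.span (range p)" "image_surface p = surf (form_space.Phi A B)"
proof -
 obtain A B :: "'k^3^4" where AB: "!!i s t u v. bev s t u v (p i) = qf (A $ i) s t * u + qf (B $ i) s t * v"
  using bform_coords_21[of p, OF deg] by blast
 have fs: "form_space A B"
 proof
  fix c :: "'k^4" assume "c v* A = 0" "c v* B = 0"
  hence c: "qf (c v* A) s t = 0" "qf (c v* B) s t = 0" for s t by simp_all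
  have qv: "qf (c v* X) s t = (\<Sum>i\<in>UNIV. c $ i * qf (X $ i) s t)" for X :: "'k^3^4" and s t
   by (simp add: qf_def vector_matrix_mult_def sum_4 algebra_simps)
  show "c = 0"
  proof (rule generators_independent[OF dim], rule bipoly_zeroI)
   fix s t u v :: 'k
   have "bev s t u v (\<Sum>i\<in>UNIV. bconst (c $ i) * p i) =
     (\<Sum>i\<in>UNIV. c $ i * qf (A $ i) s t) * u + (\<Sum>i\<in>UNIV. c $ i * qf (B $ i) s t) * v"
    by (simp add: AB sum_distrib_right distrib_left sum.distrib mult.assoc)
   thus "bev s t u v (\<Sum>i\<in>UNIV. bconst (c $ i) * p i) = 0" using c unfolding qv by simp
  qed
 next
  fix s t u v assume z: "!!i. qf (A $ i) s t * u + qf (B $ i) s t * v = 0"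
  show "(s = 0 & t = 0) | (u = 0 & v = 0)"
  proof (rule ccontr)
   assume "\<not> ?thesis"
   hence "(vector [s, t] :: 'k^2) ~= 0" "(vector [u, v] :: 'k^2) ~= 0" by (auto simp: vec_eq_iff forall_2)
   then obtain i where "eval_mpoly (bicoords (vector [s, t]) (vector [u, v])) (p i) ~= 0"
    using bpf unfolding basepoint_free_def by blast
   thus False using z[of i] by (simp add: eval_bicoords AB)
  qed
 qed
 interpret form_space A B by (rule fs)
 have p: "bev s t u v (p i) = Phi (s, t, u, v) $ i" for i s t u v by (simp add: AB Phi_def)
 have "form_ideal Phi = ideal.span (range p)"
 proof
  show "form_ideal Phi \<subseteq> ideal.span (range p)"
  proof
   fix x assume "x \<in> form_ideal Phi"
   then obtain h :: "4 => 'k bipoly" where h: "\<forall>s t u v. bev s t u v x = (\<Sum>i\<in>UNIV. bev s t u v (h i) * Phi (s, t, u, v) $ i)"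
    unfolding form_ideal_def by blast
   have "x = (\<Sum>i\<in>UNIV. h i * p i)" by (rule bipoly_eqI) (simp add: h p)
   moreover have "(\<Sum>i\<in>UNIV. h i * p i) \<in> ideal.span (range p)"
    by (intro ideal.span_sum ideal.span_scale ideal.span_base) simp
   ultimately show "x \<in> ideal.span (range p)" by simp
  qed
  have "p j \<in> form_ideal Phi" for j by (rule form_ideal_generator[OF p])
  thus "ideal.span (range p) \<subseteq> form_ideal Phi"
   by (intro ideal.span_minimal form_ideal_subspace) auto
 qed
 moreover have "image_surface p = surf Phi"
 proof -
  have eq: "(\<chi> i. eval_mpoly (bicoords a b) (p i)) = Phi (a $ 1, a $ 2, b $ 1, b $ 2)" for a b
   by (simp add: vec_eq_iff eval_bicoords p)
  have nz: "a ~= 0 \<longleftrightarrow> a $ 1 ~= 0 | a $ 2 ~= 0" for a :: "'k^2" by (simp add: vec_eq_iff forall_2)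
  show ?thesis
  proof (intro equalityI subsetI)
   fix x assume "x \<in> image_surface p"
   then obtain c and a b :: "'k^2" where "c ~= 0" "a ~= 0" "b ~= 0" "x = c *s Phi (a $ 1, a $ 2, b $ 1, b $ 2)"
    unfolding image_surface_def eq by blast
   thus "x \<in> surf Phi" unfolding surf_def param_dom_def nz by blast
  next
   fix x assume "x \<in> surf Phi"
   then obtain c s t u v where x: "c ~= 0" "nz s t" "nz u v" "x = c *s Phi (s, t, u, v)"
    by (rule surfE)
   define a :: "'k^2" where "a = vector [s, t]" define b :: "'k^2" where "b = vector [u, v]"
   have "a ~= 0" "b ~= 0" "x = c *s Phi (a $ 1, a $ 2, b $ 1, b $ 2)" using x by (simp_all add: a_def b_def nz)
   thus "x \<in> image_surface p" unfolding image_surface_def eq using x(1) by blast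
  qed
 qed
 ultimately show ?thesis by (rule that[OF fs p])
qed

theorem theorem7p4:
  fixes U :: "'k::alg_closed_field bipoly set"
    and p :: "4 \<Rightarrow> 'k bipoly"
  defines "I \<equiv> ideal.span (range p)"
    and "\<Sigma> \<equiv> codim1_singular_locus (image_surface p)"
  assumes "mp.subspace U" and "mp.dim U = 4" and "U \<subseteq> bigraded_piece 2 1"
    and "U = mp.span (range p)"
    and "basepoint_free p"
  shows "(has_type I Type1 \<longrightarrow> is_twisted_cubic \<Sigma>) \<and>
    (has_type I Type2 \<longrightarrow>
       (\<exists>C L1. is_smooth_plane_conic C \<and> is_line L1 \<and> \<Sigma> = C \<union> L1)) \<and>
    (has_type I Type3 \<longrightarrow> is_line \<Sigma>) \<and>
    (has_type I Type4 \<longrightarrow> is_line \<Sigma>) \<and>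
    (has_type_5a I \<longrightarrow>
       (\<exists>L1 L2 L3. is_line L1 \<and> is_line L2 \<and> is_line L3 \<and>
          L1 \<noteq> L2 \<and> L1 \<noteq> L3 \<and> L2 \<noteq> L3 \<and> \<Sigma> = L1 \<union> L2 \<union> L3)) \<and>
    (has_type_5b I \<longrightarrow>
       (\<exists>L1 L2. is_line L1 \<and> is_line L2 \<and> L1 \<noteq> L2 \<and> \<Sigma> = L1 \<union> L2)) \<and>
    (has_type I Type6 \<longrightarrow> \<Sigma> = {})"
proof -
 have deg: "p i \<in> bigraded_piece 2 1" for i
  using assms(5,6) mp.span_base[of "p i" "range p"] by auto
 have dim: "mp.dim (mp.span (range p)) = 4" using assms(4,6) by simp
 obtain A B where fs: "form_space A B" and p: "!!i s t u v. bev s t u v (p i) = form_space.Phi A B (s, t, u, v) $ i"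
  and span: "form_ideal (form_space.Phi A B) = ideal.span (range p)" and surf: "image_surface p = surf (form_space.Phi A B)"
  by (rule form_space_of_generators[OF deg dim assms(7)], rule that; assumption)
 have ideal: "form_ideal (form_space.Phi A B) = I" unfolding I_def by (rule span)
 interpret form_space A B by (rule fs)
 have \<Sigma>: "\<Sigma> = codim1_singular_locus (surf Phi)" unfolding \<Sigma>_def surf ..
 have res: "\<exists>e D S T. form_resolution A B e D L S T"
  if "has_type I ty" "resolution_shape ty = replicate 4 (2, 1) # L # M" for ty L M
  using that resolution_of_generators[OF fs p deg dim ideal] unfolding has_type_def by metis
 have below: "\<not> (fst (L ! c) \<le> a & snd (L ! c) \<le> b)"
  if "\<forall>x\<in>set L. \<not> (fst x \<le> a & snd x \<le> b)" "c < length L" for L :: "(nat \<times> nat) list" and a b c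
  using that nth_mem by blast
 have "is_twisted_cubic \<Sigma>" if type: "has_type I Type1"
 proof -
  obtain e D S T where "form_resolution A B e D ([(2,4)] @ replicate 4 (3,2) @ replicate 2 (4,1)) S T"
   using res[OF type] by auto
  then interpret R: form_resolution A B e D "[(2,4)] @ replicate 4 (3,2) @ replicate 2 (4,1)" S T .
  \<comment> \<open>No bidegree of the second module is at most (2,3) or at most (3,1), so there are
    no syzygies of bidegree (0,2) or (1,0).\<close>
  show ?thesis unfolding \<Sigma>
   using R.no_syz02_of_degrees[OF below] R.no_syz10[OF below] by (intro no_syz02) auto
 qed
 moreover have "\<exists>C L1. is_smooth_plane_conic C & is_line L1 & \<Sigma> = C \<union> L1" if type: "has_type I Type2"
 proof -
  obtain e D S T where "form_resolution A B e D ([(2,3)] @ replicate 4 (3,2) @ replicate 2 (4,1)) S T"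
   using res[OF type] by auto
  then interpret R: form_resolution A B e D "[(2,3)] @ replicate 4 (3,2) @ replicate 2 (4,1)" S T .
  obtain a b c where abc: "syz02 a b c" "a ~= 0 | b ~= 0 | c ~= 0"
   by (rule R.exists_syz02[of 0]) simp_all
  show ?thesis unfolding \<Sigma>
   using R.no_syz01[OF below] R.no_syz10[OF below] by (intro one_syz02[OF abc]) auto
 qed
 moreover have "is_line \<Sigma>" if type: "has_type I Type3"
 proof -
  obtain e D S T where "form_resolution A B e D ([(2,4), (3,1)] @ replicate 2 (3,2) @ [(3,3), (4,2), (5,1)]) S T"
   using res[OF type] by auto
  then interpret R: form_resolution A B e D "[(2,4), (3,1)] @ replicate 2 (3,2) @ [(3,3), (4,2), (5,1)]" S T .
  obtain a b where "syz10 a b" "nz a b" by (rule R.exists_syz10[of 1]) simp_all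
  thus ?thesis unfolding \<Sigma> by (rule one_syz10)
 qed
 moreover have "is_line \<Sigma>" if type: "has_type I Type4"
 proof -
  obtain e D S T where "form_resolution A B e D ([(2,3), (3,1)] @ replicate 2 (3,2) @ [(4,2), (5,1)]) S T"
   using res[OF type] by auto
  then interpret R: form_resolution A B e D "[(2,3), (3,1)] @ replicate 2 (3,2) @ [(4,2), (5,1)]" S T .
  obtain a b where "syz10 a b" "nz a b" by (rule R.exists_syz10[of 1]) simp_all
  thus ?thesis unfolding \<Sigma> by (rule one_syz10)
 qed
 moreover have type5: "three_lines \<Sigma> & card (embedded_primes I) ~= 1 | two_lines \<Sigma> & card (embedded_primes I) ~= 2"
  if type: "has_type I Type5"
 proof -
  obtain e D S T where "form_resolution A B e D ([(2,2)] @ replicate 2 (3,2) @ replicate 2 (4,1)) S T"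
   using res[OF type] by auto
  then interpret R: form_resolution A B e D "[(2,2)] @ replicate 2 (3,2) @ replicate 2 (4,1)" S T .
  have L: "\<not> (fst (([(2,2)] @ replicate 2 (3,2) @ replicate 2 (4,1) :: (nat \<times> nat) list) ! c) \<le> 2 &
    snd (([(2,2)] @ replicate 2 (3,2) @ replicate 2 (4,1) :: (nat \<times> nat) list) ! c) \<le> 2)"
   if "c < length ([(2,2)] @ replicate 2 (3,2) @ replicate 2 (4,1) :: (nat \<times> nat) list)" "c ~= 0" for c
   using that below[of "replicate 2 (3,2) @ replicate 2 (4,1)" 2 2 "c - 1"] by (cases c) auto
  obtain c d where cd: "syz01 c d" "nz c d" "!!c' d'. syz01 c' d' ==> \<exists>a. c' = a *s c"
   by (rule R.unique_syz01, simp, simp, erule (1) L, rule that; assumption)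
  show ?thesis unfolding \<Sigma> ideal[symmetric]
   using cd R.no_syz10[OF below] by (intro unique_syz01_locus[of c d]) auto
 qed
 moreover have "\<Sigma> = {}" if type: "has_type I Type6"
 proof -
  obtain e D S T where "form_resolution A B e D (replicate 2 (2,2) @ replicate 2 (4,1)) S T"
   using res[OF type] by auto
  then interpret R: form_resolution A B e D "replicate 2 (2,2) @ replicate 2 (4,1)" S T .
  obtain c d c' d' where "syz01 c d" "syz01 c' d'"
   "\<forall>a b. a *s c + b *s c' = 0 --> a *s d + b *s d' = 0 --> a = 0 & b = 0"
   by (rule R.two_syz01_of_degrees) (auto simp: numeral_2_eq_2)
  thus ?thesis unfolding \<Sigma> by (intro two_syz01[of c d c' d']) auto
 qed
 ultimately show ?thesis unfolding has_type_5a_def has_type_5b_def three_lines_def two_lines_def by auto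
qed


end
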